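(* For any $g\in \vec{F}_+$, the oriented link $\vec{\mathcal{L}}(g)$ admits a positive diagram, i.e. it is isotopic to an oriented link having a diagram all of whose crossings are positive.
   Context: Thompson's group. A binary (ternary) tree means a finite rooted planar tree in which each internal vertex has exactly 2 (3) ordered children; the one-leaf tree is allowed. A caret is an internal vertex together with its child edges. A binary tree diagram is a pair $(T_+,T_-)$ of binary trees with the same number of leaves (top tree and bottom tree). Adding a pair of opposing carets means attaching, for some $i$, a caret to the $i$-th leaf of both trees; two diagrams are equivalent if they differ by finitely many additions/deletions of pairs of opposing carets. Thompson's group $F$ is the set of equivalence classes, with product $(T_+,T)\cdot(T,T_-)=(T_+,T_-)$ and inverse $(T_+,T_-)^{-1}=(T_-,T_+)$. The right vine with $n$ leaves is the binary tree in which the left child of each internal vertex is a leaf. The generator $x_0$ is the class of $(T_+,T_-)$ with $T_-$ the right vine with 3 leaves and $T_+$ the other binary tree with 3 leaves (the left child of the root is internal); $x_{i+1}=\varphi(x_i)$, where $\varphi(T_+,T_-)=(T_+^*,T_-^* )$ and $T^*$ is the tree whose root has a leaf as left child and $T$ as right subtree. One has $F=\langle x_0,x_1,\dots\mid x_nx_k=x_kx_{n+1},\ k<n\rangle$. $F_+$ is the submonoid generated by $x_0,x_1,x_2,\dots$; equivalently, the elements of $F$ represented by some $(T_+,T_-)$ with $T_-$ a right vine. The graph $\Gamma(T_+,T_-)$. Let the trees have $n$ leaves, numbered $0,\dots,n-1$ from left to right. $\Gamma(T_+,T_-)$ is the plane graph with vertices $(0,0),\dots,(n-1,0)$ and the following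 edges. For each internal vertex $v$ of $T_+$, if the leaves below its left child are those numbered $a,\dots,c$, there is an edge joining $(a,0)$ and $(c+1,0)$, drawn in the upper half plane; these form $\Gamma_+$. For each internal vertex of $T_-$ there is, by the same rule, an edge drawn in the lower half plane; these form $\Gamma_-$. The edges are drawn without crossings, as $x$-monotone arcs with interiors in the open half plane. (If $T_-$ is a right vine, $\Gamma_-$ is the path joining $(j,0)$ to $(j+1,0)$ for all $j$.) The link. The unoriented diagram $\mathcal{L}(T_+,T_-)$ is obtained from the medial graph of $\Gamma(T_+,T_-)$ (one 4-valent vertex at the midpoint of each edge of $\Gamma$; for $n=1$ it is a simple closed curve around the single vertex) by turning each 4-valent vertex into a crossing. Drawing the edge of $\Gamma$ as horizontal near its midpoint, with the shaded regions (those containing the vertices of $\Gamma$) to the left and right of the crossing, the strand of positive slope passes over at edges of $\Gamma_+$, and the strand of negative slope passes over at edges of $\Gamma_-$. Orientation. $\vec F=\{(T_+,T_-)\in F \mid \Gamma(T_+,T_-)\text{ is bipartite}\}$ is a subgroup of $F$ (bipartiteness does not depend on the representative), and $\vec F_+=\vec F\cap F_+$. If $(T_+,T_-)\in\vec F$, colour the vertices of $\Gamma(T_+,T_-)$ by $\{+,-\}$ so that adjacent vertices have different colours and the leftmost vertex has colour $+$. The oriented link $\vec{\mathcal L}(T_+,T_-)$ is $\mathcal L(T_+,T_-)$ oriented so that the boundary of the region around each $+$ vertex runs counterclockwise and that around each $-$ vertex runs clockwise. For $g\in\vec F_+$, $\vec{\mathcal L}(g)$ denotes $\vec{\mathcal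 L}(T_+,T_-)$, where $(T_+,T_-)$ is a tree diagram representing $g$ with $T_-$ a right vine; changing the representative only changes the link by adding or deleting distant (split) unknot components. Signs. A crossing of an oriented diagram is positive if, when both strands are drawn pointing upwards, the strand going from lower left to upper right passes over; otherwise it is negative. *)

theory Defs
  imports "HOL-Analysis.Analysis"
begin

section \<open>Thompson's group\<close>

datatype btree = Leaf | Node btree btree

fun leaves :: "btree \<Rightarrow> nat" where
  "leaves Leaf = 1"
| "leaves (Node l r) = leaves l + leaves r"

text \<open>Leaves are numbered from 0; \<open>add_caret i t\<close> is only used for \<open>i < leaves t\<close>.\<close>

fun add_caret :: "nat \<Rightarrow> btree \<Rightarrow> btree" where
  "add_caret i Leaf = Node Leaf Leaf"
| "add_caret i (Node l r) =
     (if i < leaves l then Node (add_caret i l) r else Node l (add_caret (i - leaves l) r))"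

type_synonym diagram = "btree \<times> btree"

definition tree_diagrams :: "diagram set" where
  "tree_diagrams = {(T, B). leaves T = leaves B}"

definition opposing_carets :: "diagram \<Rightarrow> diagram \<Rightarrow> bool" where
  "opposing_carets d d' \<longleftrightarrow>
     d \<in> tree_diagrams \<and>
     (\<exists>i < leaves (fst d). d' = (add_caret i (fst d), add_caret i (snd d)))"

definition diagram_equiv :: "(diagram \<times> diagram) set" where
  "diagram_equiv =
     {(d, d'). d \<in> tree_diagrams \<and> d' \<in> tree_diagrams \<and> equivclp opposing_carets d d'}"

definition thompson_F :: "diagram set set" where
  "thompson_F = tree_diagrams // diagram_equiv"

definition diagram_class :: "diagram \<Rightarrow> diagram set" where
  "diagram_class d = diagram_equiv `` {d}"

definition F_mult :: "diagram set \<Rightarrow> diagram set \<Rightarrow> diagram set" where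
  "F_mult g h = \<Union> {diagram_class (T, B) | T S B. (T, S) \<in> g \<and> (S, B) \<in> h}"

definition x_gen :: "nat \<Rightarrow> diagram set" where
  "x_gen i = diagram_class
     (((\<lambda>(T, B). (Node Leaf T, Node Leaf B)) ^^ i)
        (Node (Node Leaf Leaf) Leaf, Node Leaf (Node Leaf Leaf)))"

inductive_set F_plus :: "diagram set set" where
  one: "diagram_class (Leaf, Leaf) \<in> F_plus"
| mult: "g \<in> F_plus \<Longrightarrow> F_mult g (x_gen i) \<in> F_plus"

fun right_vine :: "btree \<Rightarrow> bool" where
  "right_vine Leaf \<longleftrightarrow> True"
| "right_vine (Node l r) \<longleftrightarrow> l = Leaf \<and> right_vine r"


section \<open>The graph and its colourings\<close>

text \<open>\<open>half_graph a T\<close> is the half of the graph that comes from a tree \<open>T\<close> whose leaves are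
  numbered \<open>a, a + 1, \<dots>\<close>; an edge is written with its left end first.\<close>

fun half_graph :: "nat \<Rightarrow> btree \<Rightarrow> (nat \<times> nat) set" where
  "half_graph a Leaf = {}"
| "half_graph a (Node l r) =
     insert (a, a + leaves l) (half_graph a l \<union> half_graph (a + leaves l) r)"

text \<open>\<open>c j\<close> says that vertex \<open>j\<close> has colour \<open>+\<close>; the values of \<open>c\<close> at numbers that are
  not vertices are irrelevant.\<close>

definition proper_colouring :: "(nat \<Rightarrow> bool) \<Rightarrow> diagram \<Rightarrow> bool" where
  "proper_colouring c d \<longleftrightarrow>
     (\<forall>(a, b) \<in> half_graph 0 (fst d) \<union> half_graph 0 (snd d). c a \<noteq> c b)"

definition oriented_F :: "diagram set set" where
  "oriented_F = {g \<in> thompson_F. \<exists>d \<in> g. \<exists>c. proper_colouring c d}"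


section \<open>Oriented polygonal links in space\<close>

text \<open>A point of space is a pair of a point of the plane and a height, so that \<^const>\<open>fst\<close> is the
  projection along which diagrams are drawn; they are looked at from above.  A link diagram is
  not a separate object but a link whose projection is regular.\<close>

type_synonym plane = "real \<times> real"
type_synonym space = "plane \<times> real"

fun polygonal_path :: "space \<Rightarrow> space list \<Rightarrow> real \<Rightarrow> space" where
  "polygonal_path p [] = linepath p p"
| "polygonal_path p [q] = linepath p q"
| "polygonal_path p (q # r # qs) = linepath p q +++ polygonal_path q (r # qs)"

definition polygon :: "space list \<Rightarrow> real \<Rightarrow> space" where
  "polygon ps = polygonal_path (hd ps) (tl ps @ [hd ps])"

definition polygonal_link :: "space list set \<Rightarrow> bool" where
  "polygonal_link Ps \<longleftrightarrow>
     finite Ps \<and> (\<forall>ps \<in> Ps. ps \<noteq> [] \<and> simple_path (polygon ps)) \<and>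
     pairwise (\<lambda>ps qs. disjnt (path_image (polygon ps)) (path_image (polygon qs))) Ps"

text \<open>An oriented polygonal link is determined by the set of its directed edges.\<close>

type_synonym arrow = "space \<times> space"

definition arrows :: "space list set \<Rightarrow> arrow set" where
  "arrows Ps = (\<Union>ps \<in> Ps. set (zip ps (rotate1 ps)))"

definition ambient_isotopy :: "(real \<Rightarrow> space \<Rightarrow> space) \<Rightarrow> bool" where
  "ambient_isotopy H \<longleftrightarrow>
     continuous_on ({0..1} \<times> UNIV) (\<lambda>(t, x). H t x) \<and> (\<forall>x. H 0 x = x) \<and>
     (\<forall>t \<in> {0..1}. \<exists>g. homeomorphism UNIV UNIV (H t) g)"

text \<open>Equality of closed curves up to an orientation-preserving reparametrisation of the circle.\<close>

definition same_oriented_loop :: "(real \<Rightarrow> space) \<Rightarrow> (real \<Rightarrow> space) \<Rightarrow> bool" where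
  "same_oriented_loop p q \<longleftrightarrow>
     (\<exists>s \<in> {0..1}. \<exists>\<phi>. continuous_on {0..1} \<phi> \<and> strict_mono_on {0..1} \<phi> \<and>
        \<phi> ` {0..1} = {0..1} \<and> (\<forall>t \<in> {0..1}. q t = shiftpath s p (\<phi> t)))"

text \<open>In particular, both arguments of \<open>isotopic\<close> have to be links.\<close>

definition isotopic :: "arrow set \<Rightarrow> arrow set \<Rightarrow> bool" where
  "isotopic E E' \<longleftrightarrow>
     (\<exists>Ps Ps'. polygonal_link Ps \<and> arrows Ps = E \<and> polygonal_link Ps' \<and> arrows Ps' = E' \<and>
        (\<exists>H f. ambient_isotopy H \<and> bij_betw f Ps Ps' \<and>
           (\<forall>ps \<in> Ps. same_oriented_loop (H 1 \<circ> polygon ps) (polygon (f ps)))))"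


section \<open>Positive diagrams\<close>

text \<open>No edge is vertical, no vertex is projected onto an edge that it does not belong to, and
  there are no triple points.  It follows that the double points are finitely many transverse
  crossings of the interiors of two edges.\<close>

definition regular_projection :: "arrow set \<Rightarrow> bool" where
  "regular_projection E \<longleftrightarrow>
     (\<forall>(p, q) \<in> E. fst p \<noteq> fst q) \<and>
     (\<forall>v \<in> fst ` E \<union> snd ` E. \<forall>(p, q) \<in> E.
        fst v \<in> closed_segment (fst p) (fst q) \<longrightarrow> v = p \<or> v = q) \<and>
     (\<forall>e \<in> E. \<forall>f \<in> E. \<forall>g \<in> E. distinct [e, f, g] \<longrightarrow>
        fst ` open_segment (fst e) (snd e) \<inter> fst ` open_segment (fst f) (snd f)
          \<inter> fst ` open_segment (fst g) (snd g) = {})"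

definition passes_over :: "arrow \<Rightarrow> arrow \<Rightarrow> bool" where
  "passes_over e f \<longleftrightarrow>
     (\<exists>x \<in> open_segment (fst e) (snd e). \<exists>y \<in> open_segment (fst f) (snd f).
        fst x = fst y \<and> snd x > snd y)"

definition cross :: "plane \<Rightarrow> plane \<Rightarrow> real" where
  "cross u v = fst u * snd v - snd u * fst v"

definition direction :: "arrow \<Rightarrow> plane" where
  "direction e = fst (snd e) - fst (fst e)"

text \<open>If both strands point upwards and the one from lower left to upper right is over, then it
  has to be turned counterclockwise to get the direction of the other one.\<close>

definition positive_diagram :: "arrow set \<Rightarrow> bool" where
  "positive_diagram E \<longleftrightarrow>
     regular_projection E \<and>
     (\<forall>e \<in> E. \<forall>f \<in> E. passes_over e f \<longrightarrow> cross (direction e) (direction f) > 0)"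


section \<open>The oriented link of a tree diagram\<close>

text \<open>An edge \<open>(a, b)\<close> in the upper half plane is thought of as drawn from \<open>(a, 0)\<close> straight to
  \<open>((a + b) / 2, (b - a)\<^sup>2 / 2)\<close> and from there straight to \<open>(b, 0)\<close>; these edges do not cross each
  other.  Near its highest point, the 4-valent vertex of the medial graph is replaced by two
  crossing diagonals of a small square.  \<open>corner e s t\<close> is a corner of that square, \<open>s\<close> and \<open>t\<close>
  being the signs of its horizontal and vertical offset.  The diagonal of positive slope is the
  upper one.\<close>

definition corner :: "nat \<times> nat \<Rightarrow> int \<Rightarrow> int \<Rightarrow> space" where
  "corner e s t =
     (case e of (a, b) \<Rightarrow>
        (((real a + real b) / 2 + of_int s / 8, (real b - real a)\<^sup>2 / 2 + of_int t / 8),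
         if s = t then 1 else 0))"

text \<open>The corners at the edges that end in the vertex \<open>j\<close>, counterclockwise around \<open>j\<close>:
  first those of the edges to the right, then those of the edges to the left, in each case only
  the two corners on the side of \<open>j\<close>.\<close>

definition corners_around :: "(nat \<times> nat) set \<Rightarrow> nat \<Rightarrow> space list" where
  "corners_around G j =
     concat (map (\<lambda>b. [corner (j, b) (-1) (-1), corner (j, b) (-1) 1])
       (sorted_list_of_set {b. (j, b) \<in> G})) @
     concat (map (\<lambda>a. [corner (a, j) 1 1, corner (a, j) 1 (-1)])
       (sorted_list_of_set {a. (a, j) \<in> G}))"

fun pair_up :: "'a list \<Rightarrow> ('a \<times> 'a) set" where
  "pair_up (p # q # ps) = insert (p, q) (pair_up ps)"
| "pair_up _ = {}"

text \<open>The arcs of the medial graph around \<open>j\<close> in the upper half plane, directed counterclockwise.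
  They start and end on the axis, at \<open>j + 1/4\<close> and \<open>j - 1/4\<close>.  A vertex without edges only occurs
  for the tree with one leaf; it gets an additional point, as a straight arc would run along the
  axis.\<close>

definition medial_arcs :: "(nat \<times> nat) set \<Rightarrow> nat \<Rightarrow> arrow set" where
  "medial_arcs G j =
     (let cs = corners_around G j; apex = ((real j, 1/4), 0)
      in pair_up ([((real j + 1/4, 0), 0)] @ (if cs = [] then [apex, apex] else cs)
           @ [((real j - 1/4, 0), 0)]))"

text \<open>The directions of the strands at an edge \<open>(a, b)\<close> are the continuations of those of the
  adjacent arcs: if \<open>a\<close> has colour \<open>+\<close> and \<open>b\<close> has colour \<open>-\<close>, then both strands go upwards.\<close>

definition strands :: "nat \<times> nat \<Rightarrow> arrow set" where
  "strands e = {(corner e (-1) (-1), corner e 1 1), (corner e 1 (-1), corner e (-1) 1)}"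

definition orient :: "bool \<Rightarrow> arrow set \<Rightarrow> arrow set" where
  "orient s A = (if s then A else prod.swap ` A)"

definition half_link :: "(nat \<Rightarrow> bool) \<Rightarrow> btree \<Rightarrow> arrow set" where
  "half_link c T =
     (let G = half_graph 0 T
      in (\<Union>j < leaves T. orient (c j) (medial_arcs G j)) \<union>
         (\<Union>e \<in> G. orient (c (fst e)) (strands e)))"

definition reflect :: "space \<Rightarrow> space" where
  "reflect = (\<lambda>((x, y), z). ((x, - y), z))"

text \<open>The part in the lower half plane is a mirror image: the reflection turns a diagonal of
  positive slope into one of negative slope, which stays the upper one.  As it also exchanges
  clockwise and counterclockwise, the colours have to be exchanged before.  Only proper colourings
  \<open>c\<close> of \<open>d\<close> with \<open>c 0\<close> are meaningful.\<close>

definition thompson_link :: "(nat \<Rightarrow> bool) \<Rightarrow> diagram \<Rightarrow> arrow set" where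
  "thompson_link c d =
     half_link c (fst d) \<union>
     map_prod reflect reflect ` half_link (\<lambda>j. \<not> c j) (snd d)"

end

(* The lower crossings of the diagram, those at the edges of the vine, are the negative ones.  At an
   edge (a, b) of the upper tree and at the edge (b - 1, b) of the vine, the lower strands, together
   with the arcs of the disc of b between them, form one arc that never passes over anything.  Such
   an arc may be replaced by any other arc with the same ends that stays below the rest of the link.
   The new arc drops from the upper left corner of the edge (a, b) to the disc of a, leaves that disc
   across its lower boundary, and runs below the discs of a + 1, ..., b - 1 to its end, without meeting
   anything else.  So each edge of the upper tree contributes one crossing, between the new arc and
   the boundary of the disc of a; as the directions of both depend on the colour of a only, the
   crossing is positive for both colours. *)
theory Submission
  imports Defs "HOL-Combinatorics.Cycles"
begin

section \<open>Ambient isotopies and loops\<close>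

text \<open>Isotopy is meant literally, as an ambient isotopy carrying oriented closed curves to
  oriented closed curves, so exchanging one low arc for another has to be realised by homeomorphisms
  of space. Both arcs project injectively and have the rest of the link above them. Joined to a
  point far enough below, each spans triangles that avoid the rest of the link, and is turned into
  the same two edges by moves that exchange one side of a free triangle for the other two sides;
  such a move is a push along a median of the triangle. The second obstacle is that the crossings of
  every intermediate diagram have to be known for all trees at once. All vertices have explicit
  coordinates, and segments are kept apart by lines of the plane. The corner \<open>VQ a b\<close>
  of the new arc of the edge \<open>(a, b)\<close> lies on the line \<open>x - y = b\<close> through
  the lower end of that arc, so the last pieces of the new arcs are on parallel lines; its descent
  is \<open>1 / (16 * (b - a))\<close> to the right of \<open>a\<close>, so of two edges with the
  same left end the longer one descends further to the left and the arcs are nested.\<close>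

text \<open>\<open>\<Phi>\<close> is a lift to the line of an orientation-preserving homeomorphism
  of the circle. Such lifts can be composed and inverted, which gives transitivity and symmetry
  without moving base points; their continuity follows from monotonicity and surjectivity. Only the
  values of the curves on \<open>[0, 1)\<close> enter, so closedness at \<open>1\<close> is a
  separate assumption where it matters.\<close>

definition same_loop :: "(real \<Rightarrow> 'a) \<Rightarrow> (real \<Rightarrow> 'a) \<Rightarrow> bool" where
  "same_loop p q \<longleftrightarrow> (\<exists>\<Phi> :: real \<Rightarrow> real. strict_mono \<Phi> \<and> surj \<Phi> \<and> (\<forall>t. \<Phi> (t + 1) = \<Phi> t + 1) \<and>
     (\<forall>t. q (frac t) = p (frac (\<Phi> t))))"

lemma same_loopI:
  assumes "strict_mono (\<Phi> :: real \<Rightarrow> real)" "surj \<Phi>" "\<And>t. \<Phi> (t + 1) = \<Phi> t + 1"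
    and "\<And>t. q (frac t) = p (frac (\<Phi> t))"
  shows "same_loop p q"
  unfolding same_loop_def using assms by blast

lemma same_loop_cong:
  assumes "\<And>t. t \<in> {0..1} \<Longrightarrow> q t = p t"
  shows "same_loop p q"
  using assms by (intro same_loopI[of id]) (auto simp: strict_mono_def frac_ge_0 less_imp_le[OF frac_lt_1])

lemma same_loop_trans:
  assumes "same_loop p q" "same_loop q r"
  shows "same_loop p r"
proof -
  obtain \<Phi> where \<Phi>: "strict_mono \<Phi>" "surj \<Phi>" "\<forall>t. \<Phi> (t + 1) = \<Phi> t + 1" "\<forall>t. q (frac t) = p (frac (\<Phi> t))"
    using assms(1) unfolding same_loop_def by blast
  obtain \<Psi> where \<Psi>: "strict_mono \<Psi>" "surj \<Psi>" "\<forall>t. \<Psi> (t + 1) = \<Psi> t + 1" "\<forall>t. r (frac t) = q (frac (\<Psi> t))"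
    using assms(2) unfolding same_loop_def by blast
  show ?thesis
  proof (rule same_loopI[of "\<Phi> \<circ> \<Psi>"])
    show "surj (\<Phi> \<circ> \<Psi>)" using \<Phi>(2) \<Psi>(2) by (rule comp_surj[rotated])
  qed (use \<Phi> \<Psi> in \<open>auto simp: strict_mono_def\<close>)
qed

lemma same_loop_sym:
  assumes "same_loop p q"
  shows "same_loop q p"
proof -
  obtain \<Phi> where \<Phi>: "strict_mono \<Phi>" "surj \<Phi>" "\<forall>t. \<Phi> (t + 1) = \<Phi> t + 1" "\<forall>t. q (frac t) = p (frac (\<Phi> t))"
    using assms unfolding same_loop_def by blast
  have inj: "inj \<Phi>" using \<Phi>(1) strict_mono_imp_inj_on by blast
  show ?thesis
  proof (rule same_loopI[of "inv \<Phi>"])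
    show "strict_mono (inv \<Phi>)"
      by (rule strict_mono_inv[OF \<Phi>(1,2)]) (simp add: inj)
    show "surj (inv \<Phi>)" using inj by (rule inj_imp_surj_inv)
    fix t
    show "inv \<Phi> (t + 1) = inv \<Phi> t + 1"
      using \<Phi>(2,3) inj by (metis inv_f_eq surj_f_inv_f)
    show "p (frac t) = q (frac (inv \<Phi> t))"
      using \<Phi>(2,4) by (simp add: surj_f_inv_f)
  qed
qed

lemma same_loop_comp:
  assumes "same_loop p q"
  shows "same_loop (h \<circ> p) (h \<circ> q)"
proof -
  obtain \<Phi> where \<Phi>: "strict_mono \<Phi>" "surj \<Phi>" "\<forall>t. \<Phi> (t + 1) = \<Phi> t + 1" "\<forall>t. q (frac t) = p (frac (\<Phi> t))"
    using assms(1) unfolding same_loop_def by blast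
  then show ?thesis by (intro same_loopI[of \<Phi>]) auto
qed

text \<open>The base point moves to \<open>frac (\<Phi> 0)\<close>, and the reparametrisation is
  \<open>\<Phi> - \<Phi> 0\<close>, which maps the unit interval onto itself because
  \<open>\<Phi>\<close> has degree one.\<close>

lemma same_loop_imp_same_oriented_loop:
  assumes pq: "same_loop p q" and p: "p 1 = p 0" and q: "q 1 = q 0"
  shows "same_oriented_loop p q"
proof -
  obtain \<Phi> where \<Phi>: "strict_mono \<Phi>" "surj \<Phi>" "\<forall>t. \<Phi> (t + 1) = \<Phi> t + 1" "\<forall>t. q (frac t) = p (frac (\<Phi> t))"
    using pq unfolding same_loop_def by blast
  define \<phi> where "\<phi> t = \<Phi> t - \<Phi> 0" for t
  have cont: "continuous_on UNIV \<Phi>"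
    by (rule continuous_onI_mono) (use \<Phi>(1,2) in \<open>auto simp: strict_mono_less_eq\<close>)
  have \<phi>1: "\<Phi> 1 = \<Phi> 0 + 1" using \<Phi>(3)[rule_format, of 0] by simp
  have le: "\<Phi> s \<le> \<Phi> t \<longleftrightarrow> s \<le> t" for s t using \<Phi>(1) by (simp add: strict_mono_less_eq)
  have img: "\<phi> ` {0..1} = {0..1}"
  proof (intro equalityI subsetI)
    fix y assume "y \<in> \<phi> ` {0..1}"
    then obtain t where "0 \<le> t" "t \<le> 1" "y = \<phi> t" by auto
    then show "y \<in> {0..1}" using le[of 0 t] le[of t 1] \<phi>1 by (auto simp: \<phi>_def)
  next
    fix y :: real assume y: "y \<in> {0..1}"
    obtain t where t: "\<Phi> t = y + \<Phi> 0" using \<Phi>(2) by (metis surjD)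
    then have "0 \<le> t" "t \<le> 1" using le[of 0 t] le[of t 1] \<phi>1 y by auto
    then show "y \<in> \<phi> ` {0..1}" using t by (intro image_eqI[of _ _ t]) (auto simp: \<phi>_def)
  qed
  have eq: "q t = shiftpath (frac (\<Phi> 0)) p (\<phi> t)" if t: "t \<in> {0..1}" for t
  proof -
    have "q t = q (frac t)"
      using t q by (cases "t = 1") (auto simp: frac_eq)
    also have "\<dots> = p (frac (\<Phi> 0 + \<phi> t))" using \<Phi>(4) by (simp add: \<phi>_def)
    also have "\<dots> = shiftpath (frac (\<Phi> 0)) p (\<phi> t)"
    proof -
      have r: "\<phi> t \<in> {0..1}" using img t by blast
      define s where "s = frac (\<Phi> 0)"
      have f: "frac (\<Phi> 0 + \<phi> t) = frac (s + \<phi> t)"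
        unfolding s_def by (simp add: frac_def algebra_simps)
      have s: "0 \<le> s" "s < 1" by (auto simp: s_def frac_lt_1)
      \<comment> \<open>At the sum \<open>1\<close> the shifted path takes the value
        \<open>p 1\<close> while \<open>frac\<close> leads to \<open>p 0\<close>; here
        \<open>p\<close> has to be closed.\<close>
      consider "s + \<phi> t < 1" | "s + \<phi> t = 1" | "s + \<phi> t > 1" "s + \<phi> t < 2" using r s by fastforce
      then have "p (frac (s + \<phi> t)) = shiftpath s p (\<phi> t)"
      proof cases
        case 1
        then have "frac (s + \<phi> t) = s + \<phi> t" using r s by (simp add: frac_eq)
        then show ?thesis using 1 by (simp add: shiftpath_def)
      next
        case 2
        then show ?thesis using p by (simp add: shiftpath_def)
      next
        case 3
        have "frac (s + \<phi> t) = s + \<phi> t - 1" using 3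
          by (simp add: frac_unique_iff)
        then show ?thesis using 3 by (simp add: shiftpath_def)
      qed
      then show ?thesis unfolding f s_def .
    qed
    finally show ?thesis .
  qed
  show ?thesis
    unfolding same_oriented_loop_def
  proof (intro bexI exI conjI ballI)
    show "frac (\<Phi> 0) \<in> {0..1}" by (simp add: less_imp_le[OF frac_lt_1])
    show "continuous_on {0..1} \<phi>" unfolding \<phi>_def
      by (intro continuous_intros continuous_on_subset[OF cont]) auto
    show "strict_mono_on {0..1} \<phi>" using \<Phi>(1) by (auto simp: strict_mono_on_def strict_mono_def \<phi>_def)
    show "\<phi> ` {0..1} = {0..1}" by (fact img)
    fix t :: real assume "t \<in> {0..1}"
    then show "q t = shiftpath (frac (\<Phi> 0)) p (\<phi> t)" by (rule eq)
  qed
qed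

section \<open>Reparametrisations with fixed ends, and rotation of closed polygons\<close>

text \<open>Joining paths is associative only up to a change of speed, and
  \<open>polygonal_path\<close> nests its joins to the right. This relation absorbs the changes of
  speed that occur when a vertex is inserted or a list is rotated.\<close>

definition reparam :: "(real \<Rightarrow> 'a) \<Rightarrow> (real \<Rightarrow> 'a) \<Rightarrow> bool" where
  "reparam p q \<longleftrightarrow> (\<exists>\<phi> :: real \<Rightarrow> real. strict_mono_on {0..1} \<phi> \<and> \<phi> ` {0..1} = {0..1} \<and> \<phi> 0 = 0 \<and> \<phi> 1 = 1 \<and>
     (\<forall>t \<in> {0..1}. q t = p (\<phi> t)))"

lemma reparamI:
  assumes "\<phi> 0 = 0" "\<phi> 1 = 1" "\<And>s t. 0 \<le> s \<Longrightarrow> s < t \<Longrightarrow> t \<le> 1 \<Longrightarrow> \<phi> s < \<phi> t"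
    and "\<And>y. 0 \<le> y \<Longrightarrow> y \<le> 1 \<Longrightarrow> \<exists>t. 0 \<le> t \<and> t \<le> 1 \<and> \<phi> t = y"
    and "\<And>t. 0 \<le> t \<Longrightarrow> t \<le> 1 \<Longrightarrow> q t = p (\<phi> t)"
  shows "reparam p q"
  unfolding reparam_def
proof (intro exI[of _ \<phi>] conjI)
  show "strict_mono_on {0..1} \<phi>" using assms(3) by (auto simp: strict_mono_on_def)
  have b: "0 \<le> \<phi> t \<and> \<phi> t \<le> 1" if "0 \<le> t" "t \<le> 1" for t
    using assms(3)[of 0 t] assms(3)[of t 1] that assms(1,2)
    by (cases "t = 0"; cases "t = 1") auto
  show "\<phi> ` {0..1} = {0..1}"
  proof (intro equalityI subsetI)
    fix y assume "y \<in> \<phi> ` {0..1}"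
    then show "y \<in> {0..1}" using b by auto
  next
    fix y :: real assume "y \<in> {0..1}"
    then obtain t where "0 \<le> t" "t \<le> 1" "\<phi> t = y" using assms(4)[of y] by auto
    then show "y \<in> \<phi> ` {0..1}" by (intro image_eqI[of _ _ t]) auto
  qed
  show "\<forall>t\<in>{0..1}. q t = p (\<phi> t)" using assms(5) by simp
qed (rule assms(1,2))+

lemma reparamE:
  assumes "reparam p q"
  obtains \<phi> :: "real \<Rightarrow> real" where "strict_mono_on {0..1} \<phi>" "\<phi> ` {0..1} = {0..1}" "\<phi> 0 = 0" "\<phi> 1 = 1"
    "\<forall>t \<in> {0..1}. q t = p (\<phi> t)"
proof -
  from assms[unfolded reparam_def] show thesis
    by (elim exE conjE) (rule that; assumption)
qed

lemma reparam_refl: "reparam p p"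
  by (rule reparamI[of "\<lambda>t. t"]) auto

lemma reparam_trans:
  assumes "reparam p q" "reparam q r"
  shows "reparam p r"
proof -
  obtain \<phi> where \<phi>: "strict_mono_on {0..1} \<phi>" "\<phi> ` {0..1} = {0..1}" "\<phi> 0 = 0" "\<phi> 1 = 1"
    "\<forall>t \<in> {0..1}. q t = p (\<phi> t)"
    using assms(1) by (rule reparamE)
  obtain \<psi> where \<psi>: "strict_mono_on {0..1} \<psi>" "\<psi> ` {0..1} = {0..1}" "\<psi> 0 = 0" "\<psi> 1 = 1"
    "\<forall>t \<in> {0..1}. r t = q (\<psi> t)"
    using assms(2) by (rule reparamE)
  have \<psi>b: "\<psi> t \<in> {0..1}" if "t \<in> {0..1}" for t
    using imageI[OF that, of \<psi>] unfolding \<psi>(2) .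
  show ?thesis
    unfolding reparam_def
  proof (intro exI[of _ "\<phi> \<circ> \<psi>"] conjI ballI)
    show "strict_mono_on {0..1} (\<phi> \<circ> \<psi>)"
      unfolding o_def
      by (intro strict_mono_onI strict_mono_onD[OF \<phi>(1)] \<psi>b strict_mono_onD[OF \<psi>(1)])
    show "(\<phi> \<circ> \<psi>) ` {0..1} = {0..1}" by (simp only: image_comp[symmetric] \<phi>(2) \<psi>(2))
    show "(\<phi> \<circ> \<psi>) 0 = 0" "(\<phi> \<circ> \<psi>) 1 = 1" by (simp_all add: \<phi>(3,4) \<psi>(3,4))
    fix t :: real assume "t \<in> {0..1}"
    then show "r t = p ((\<phi> \<circ> \<psi>) t)" using \<phi>(5)[rule_format, OF \<psi>b] \<psi>(5) by simp
  qed
qed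

text \<open>The reparametrisation is continued periodically along the line; since it fixes both
  ends, the continuation is strictly increasing across the integers.\<close>

lemma reparam_imp_same_loop:
  assumes "reparam p q"
  shows "same_loop p q"
proof -
  obtain \<phi> where \<phi>: "strict_mono_on {0..1} \<phi>" "\<phi> ` {0..1} = {0..1}" "\<phi> 0 = 0" "\<phi> 1 = 1"
    "\<forall>t \<in> {0..1}. q t = p (\<phi> t)"
    using assms by (rule reparamE)
  define \<Phi> where "\<Phi> t = of_int \<lfloor>t\<rfloor> + \<phi> (frac t)" for t
  have f: "0 \<le> frac t" "frac t < 1" for t :: real by (auto simp: frac_lt_1)
  have \<phi>b: "0 \<le> \<phi> t" "\<phi> t < 1" if "0 \<le> t" "t < 1" for t
  proof -
    show "0 \<le> \<phi> t" using \<phi>(2) that by (metis atLeastAtMost_iff imageI less_imp_le)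
    have "\<phi> t < \<phi> 1" using \<phi>(1) that by (auto simp: strict_mono_on_def)
    then show "\<phi> t < 1" using \<phi>(4) by simp
  qed
  have fr: "frac (\<Phi> t) = \<phi> (frac t)" for t
    using \<phi>b[OF f] by (simp add: \<Phi>_def frac_unique_iff)
  show ?thesis
  proof (rule same_loopI[of \<Phi>])
    show "strict_mono \<Phi>"
    proof (rule strict_monoI)
      fix s t :: real assume st: "s < t"
      show "\<Phi> s < \<Phi> t"
      proof (cases "\<lfloor>s\<rfloor> = \<lfloor>t\<rfloor>")
        case True
        then have "frac s < frac t" using st by (simp add: frac_def)
        then have "\<phi> (frac s) < \<phi> (frac t)" using \<phi>(1) f[of s] f[of t] by (auto simp: strict_mono_on_def)
        then show ?thesis using True by (simp add: \<Phi>_def)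
      next
        case False
        then have "\<lfloor>s\<rfloor> + 1 \<le> \<lfloor>t\<rfloor>" using st by linarith
        then have "of_int \<lfloor>s\<rfloor> + 1 \<le> (of_int \<lfloor>t\<rfloor> :: real)" by linarith
        then show ?thesis using \<phi>b[OF f, of s] \<phi>b[OF f, of t] by (simp add: \<Phi>_def)
      qed
    qed
    show "surj \<Phi>"
    proof (unfold surj_def, intro allI)
      fix y :: real
      have "frac y \<in> \<phi> ` {0..1}" using \<phi>(2) f[of y] by auto
      then obtain x where x: "0 \<le> x" "x \<le> 1" "\<phi> x = frac y" by auto
      then have "x < 1" using \<phi>(4) f[of y] by (cases "x = 1") auto
      then have "frac x = x" using x by (simp add: frac_eq)
      then have "frac (of_int \<lfloor>y\<rfloor> + x) = x" "\<lfloor>of_int \<lfloor>y\<rfloor> + x\<rfloor> = \<lfloor>y\<rfloor>" using x \<open>x < 1\<close>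
        by (auto simp: frac_unique_iff floor_eq_iff)
      then have "\<Phi> (of_int \<lfloor>y\<rfloor> + x) = y" using x by (simp add: \<Phi>_def frac_def)
      then show "\<exists>x. y = \<Phi> x" by metis
    qed
    fix t :: real
    show "\<Phi> (t + 1) = \<Phi> t + 1" by (simp add: \<Phi>_def frac_1_eq)
    show "q (frac t) = p (frac (\<Phi> t))"
      using \<phi>(5) f[of t] by (simp add: fr)
  qed
qed

lemma reparam_join:
  assumes "reparam p q"
  shows "reparam (g +++ p) (g +++ q)"
proof -
  obtain \<phi> where \<phi>: "strict_mono_on {0..1} \<phi>" "\<phi> ` {0..1} = {0..1}" "\<phi> 0 = 0" "\<phi> 1 = 1"
    "\<forall>t \<in> {0..1}. q t = p (\<phi> t)"
    using assms by (rule reparamE)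
  have m: "\<phi> s < \<phi> t" if "0 \<le> s" "s < t" "t \<le> 1" for s t
    using \<phi>(1) that by (auto simp: strict_mono_on_def)
  have pos: "0 < \<phi> t" if "0 < t" "t \<le> 1" for t using m[of 0 t] that \<phi>(3) by simp
  show ?thesis
  proof (rule reparamI[of "\<lambda>t. if t \<le> 1/2 then t else 1/2 + \<phi> (2 * t - 1) / 2"], goal_cases)
    case (3 s t)
    then show ?case using m[of "2 * s - 1" "2 * t - 1"] pos[of "2 * t - 1"] by auto
  next
    case (4 y)
    show ?case
    proof (cases "y \<le> 1/2")
      case True then show ?thesis using 4 by (intro exI[of _ y]) auto
    next
      case False
      then have "2 * y - 1 \<in> \<phi> ` {0..1}" using \<phi>(2) 4 by auto
      then obtain x where x: "0 \<le> x" "x \<le> 1" "\<phi> x = 2 * y - 1" by auto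
      then have "x \<noteq> 0" using False \<phi>(3) by auto
      then show ?thesis using x False by (intro exI[of _ "(x + 1) / 2"]) (auto simp: field_simps)
    qed
  next
    case (5 t)
    then show ?case using \<phi>(5) pos[of "2 * t - 1"] by (auto simp: joinpaths_def)
  qed (use \<phi>(3,4) in auto)
qed

lemma reparam_assoc:
  assumes "pathfinish a = pathstart b" "pathfinish b = pathstart c"
  shows "reparam ((a +++ b) +++ c) (a +++ (b +++ c))"
\<comment> \<open>The pieces of the first path occupy \<open>[0, 1/4]\<close>,
  \<open>[1/4, 1/2]\<close>, \<open>[1/2, 1]\<close>, those of the second path
  \<open>[0, 1/2]\<close>, \<open>[1/2, 3/4]\<close>, \<open>[3/4, 1]\<close>; the map matches them
  linearly.\<close>
proof (rule reparamI[of "\<lambda>t. if t \<le> 1/2 then t / 2 else if t \<le> 3/4 then t - 1/4 else 2 * t - 1"], goal_cases)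
  case (4 y)
  then show ?case
    by (intro exI[of _ "if y \<le> 1/4 then 2 * y else if y \<le> 1/2 then y + 1/4 else (y + 1) / 2"]) (auto simp: field_simps)
next
  case (5 t)
  then show ?case by (auto simp: joinpaths_def algebra_simps)
qed auto

lemma polygonal_path_0 [simp]: "polygonal_path p qs 0 = p"
  by (induction p qs rule: polygonal_path.induct) (auto simp: linepath_def joinpaths_def)

lemma polygonal_path_1 [simp]: "polygonal_path p qs 1 = last (p # qs)"
  by (induction p qs rule: polygonal_path.induct) (auto simp: linepath_def joinpaths_def)

lemma polygonal_path_start [simp]: "pathstart (polygonal_path p qs) = p"
  by (simp add: pathstart_def)

lemma polygonal_path_finish [simp]: "pathfinish (polygonal_path p qs) = last (p # qs)"
  by (simp add: pathfinish_def)

text \<open>An edge added at the end is joined outside all other joins and has to be carried inwards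
  through each of them.\<close>

lemma reparam_snoc:
  assumes "qs \<noteq> []"
  shows "reparam (polygonal_path p qs +++ linepath (last qs) r) (polygonal_path p (qs @ [r]))"
  using assms
proof (induction p qs rule: polygonal_path.induct)
  case (3 p q r' qs)
  have a: "reparam ((linepath p q +++ polygonal_path q (r' # qs)) +++ linepath (last (r' # qs)) r)
     (linepath p q +++ (polygonal_path q (r' # qs) +++ linepath (last (r' # qs)) r))"
    by (rule reparam_assoc) auto
  show ?case
    using reparam_trans[OF a reparam_join[OF 3(1)]] by simp
qed (auto simp: reparam_refl)

text \<open>Both closed paths change from one piece to the other at the parameter
  \<open>1/2\<close>, so the lift is the translation by \<open>1/2\<close>.\<close>

lemma same_loop_swap:
  assumes "pathfinish a = pathstart b" "pathfinish b = pathstart a"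
  shows "same_loop (a +++ b) (b +++ a)"
proof (rule same_loopI[of "\<lambda>t. t + 1/2"])
  show "surj (\<lambda>t::real. t + 1/2)" by (rule surjI[of _ "\<lambda>t. t - 1/2"]) simp
  fix t :: real
  have f: "0 \<le> frac t" "frac t < 1" by (auto simp: frac_lt_1)
  have "frac (t + 1/2) = (if frac t < 1/2 then frac t + 1/2 else frac t - 1/2)"
  proof (cases "frac t < 1/2")
    case True
    then show ?thesis using f by (simp add: frac_unique_iff) (simp add: frac_def)
  next
    case False
    have "t - frac t = of_int \<lfloor>t\<rfloor>" by (simp add: frac_def)
    then have "t + 1/2 - (frac t - 1/2) = of_int (\<lfloor>t\<rfloor> + 1)" by simp
    then show ?thesis using False f by (simp add: frac_unique_iff)
  qed
  moreover have "(b +++ a) u = (a +++ b) (if u < 1/2 then u + 1/2 else u - 1/2)" if "0 \<le> u" "u < 1" for u :: real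
    using assms that
    by (cases "u = 0") (auto simp: joinpaths_def pathstart_def pathfinish_def algebra_simps)
  ultimately show "(b +++ a) (frac t) = (a +++ b) (frac (t + 1/2))"
    using f by simp
qed (auto simp: strict_mono_def)

lemma same_loop_rotate1:
  assumes "2 \<le> length ps"
  shows "same_loop (polygon ps) (polygon (rotate1 ps))"
proof -
  obtain x y zs where ps: "ps = x # y # zs" using assms by (auto simp: numeral_2_eq_2 Suc_le_length_iff)
  have 1: "polygon ps = linepath x y +++ polygonal_path y (zs @ [x])"
    by (cases zs) (auto simp: ps polygon_def)
  have 2: "polygon (rotate1 ps) = polygonal_path y ((zs @ [x]) @ [y])"
    by (auto simp: ps polygon_def)
  have 3: "same_loop (linepath x y +++ polygonal_path y (zs @ [x])) (polygonal_path y (zs @ [x]) +++ linepath x y)"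
    by (rule same_loop_swap) auto
  have 4: "reparam (polygonal_path y (zs @ [x]) +++ linepath x y) (polygonal_path y ((zs @ [x]) @ [y]))"
    using reparam_snoc[of "zs @ [x]" y y] by simp
  show ?thesis
    unfolding 1 2 by (rule same_loop_trans[OF 3 reparam_imp_same_loop[OF 4]])
qed

lemma same_loop_rotate:
  assumes "2 \<le> length ps"
  shows "same_loop (polygon ps) (polygon (rotate k ps))"
proof (induction k)
  case 0
  show ?case by (rule same_loop_cong) simp
next
  case (Suc k)
  have "rotate (Suc k) ps = rotate1 (rotate k ps)" by simp
  then show ?case using same_loop_trans[OF Suc same_loop_rotate1[of "rotate k ps"]] assms by simp
qed

section \<open>Final maps of ambient isotopies\<close>

definition isoend :: "(space \<Rightarrow> space) \<Rightarrow> bool" where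
  "isoend h \<longleftrightarrow> (\<exists>H. ambient_isotopy H \<and> H 1 = h)"

lemma isoend_id: "isoend (\<lambda>x. x)"
  unfolding isoend_def ambient_isotopy_def
  by (rule exI[of _ "\<lambda>t x. x"])
    (auto intro!: continuous_intros exI[of _ "\<lambda>x. x"] simp: homeomorphism_def case_prod_beta continuous_on_snd)

lemma isoend_comp:
  assumes "isoend h" "isoend k"
  shows "isoend (k \<circ> h)"
proof -
  obtain H :: "real \<Rightarrow> space \<Rightarrow> space" where H: "continuous_on ({0..1} \<times> UNIV) (\<lambda>(t, x). H t x)" "\<forall>x. H 0 x = x"
     "\<forall>t \<in> {0..1}. \<exists>g. homeomorphism UNIV UNIV (H t) g" "H 1 = h"
    using assms(1) unfolding isoend_def ambient_isotopy_def by blast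
  obtain K :: "real \<Rightarrow> space \<Rightarrow> space" where K: "continuous_on ({0..1} \<times> UNIV) (\<lambda>(t, x). K t x)" "\<forall>x. K 0 x = x"
     "\<forall>t \<in> {0..1}. \<exists>g. homeomorphism UNIV UNIV (K t) g" "K 1 = k"
    using assms(2) unfolding isoend_def ambient_isotopy_def by blast
  have "continuous_on ({0..1} \<times> UNIV) ((\<lambda>(t, x). K t x) \<circ> (\<lambda>z. (fst z, (\<lambda>(t, x). H t x) z)))"
    by (intro continuous_on_compose continuous_intros continuous_on_subset[OF K(1)] H(1)) auto
  then have "continuous_on ({0..1} \<times> UNIV) (\<lambda>(t, x). (K t \<circ> H t) x)"
    by (simp add: case_prod_beta o_def)
  moreover have "\<exists>g. homeomorphism UNIV UNIV (K t \<circ> H t) g" if "t \<in> {0..1}" for t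
    using H(3) K(3) that homeomorphism_compose by (metis (no_types))
  ultimately show ?thesis
    unfolding isoend_def ambient_isotopy_def
    by (intro exI[of _ "\<lambda>t. K t \<circ> H t"] conjI ballI allI)
      (simp_all only: o_def H(2)[rule_format] K(2)[rule_format] H(4) K(4))
qed

text \<open>The isotopy is run backwards: \<open>H (1 - t)\<close> composed with the inverse of
  \<open>h\<close> starts at the identity and ends at that inverse.\<close>

lemma isoend_inverse:
  assumes "isoend h"
  obtains g where "isoend g" "\<And>x. g (h x) = x"
proof -
  obtain H :: "real \<Rightarrow> space \<Rightarrow> space" where H: "continuous_on ({0..1} \<times> UNIV) (\<lambda>(t, x). H t x)" "\<forall>x. H 0 x = x"
     "\<forall>t \<in> {0..1}. \<exists>g. homeomorphism UNIV UNIV (H t) g" "H 1 = h"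
    using assms(1) unfolding isoend_def ambient_isotopy_def by blast
  obtain g where g: "homeomorphism UNIV UNIV h g" using H(3)[rule_format, of 1] H(4) by auto
  have gc: "continuous_on UNIV g" and gh: "\<And>x. g (h x) = x" and hg: "\<And>x. h (g x) = x"
    using g by (auto simp: homeomorphism_def)
  have g': "homeomorphism UNIV UNIV g h" using g by (rule homeomorphism_symD)
  have "continuous_on ({0..1} \<times> UNIV) ((\<lambda>(t, x). H t x) \<circ> (\<lambda>z. (1 - fst z, g (snd z))))"
    by (intro continuous_on_compose continuous_intros continuous_on_subset[OF H(1)]
        continuous_on_compose2[OF gc]) auto
  then have "continuous_on ({0..1} \<times> UNIV) (\<lambda>(t, x). (H (1 - t) \<circ> g) x)"
    by (simp add: case_prod_beta o_def)
  moreover have "\<exists>g'. homeomorphism UNIV UNIV (H (1 - t) \<circ> g) g'" if "t \<in> {0..1}" for t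
    using H(3)[rule_format, of "1 - t"] that homeomorphism_compose[OF g'] by auto
  moreover have "H (1 - 1) \<circ> g = g" by (simp only: o_def diff_self H(2)[rule_format])
  ultimately have "isoend g"
    unfolding isoend_def ambient_isotopy_def
    by (intro exI[of _ "\<lambda>t. H (1 - t) \<circ> g"] conjI ballI allI)
      (simp_all only: o_def diff_zero H(4) hg)
  then show ?thesis using gh that by blast
qed

section \<open>Polygons and links as sets of directed edges\<close>

definition seg :: "arrow \<Rightarrow> space set" where
  "seg e = closed_segment (fst e) (snd e)"

definition edges :: "'a list \<Rightarrow> ('a \<times> 'a) set" where
  "edges xs = set (zip xs (tl xs))"

lemma edges_simps [simp]: "edges [] = {}" "edges [x] = {}"
  "edges (x # y # zs) = insert (x, y) (edges (y # zs))"
  by (auto simp: edges_def)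

lemma edges_subset: "(x, y) \<in> edges xs \<Longrightarrow> x \<in> set xs \<and> y \<in> set (tl xs)"
  unfolding edges_def by (auto dest: set_zip_leftD set_zip_rightD)

lemma edges_in: "e \<in> edges xs \<Longrightarrow> fst e \<in> set xs \<and> snd e \<in> set xs"
  unfolding edges_def by (cases e; cases xs) (auto dest: set_zip_leftD set_zip_rightD)

definition cyc :: "'a list \<Rightarrow> ('a \<times> 'a) set" where
  "cyc xs = set (zip xs (rotate1 xs))"

lemma cyc_Cons: "cyc (x # xs) = edges (x # xs @ [x])"
proof -
  have "zip ((x # xs) @ [x]) (xs @ [x]) = zip (x # xs) (xs @ [x])"
    by (subst zip_append1) simp
  then show ?thesis by (simp add: cyc_def edges_def)
qed

lemma edges_snoc: "edges (us @ [a, b]) = insert (a, b) (edges (us @ [a]))"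
  by (induction us rule: induct_list012) auto

lemma cyc_rotate1: "cyc (rotate1 xs) = cyc xs"
proof (cases xs)
  case (Cons x ys)
  show ?thesis
  proof (cases ys)
    case Nil then show ?thesis by (simp add: Cons cyc_def)
  next
    case (Cons y zs)
    have "cyc (rotate1 xs) = edges ((y # zs) @ [x, y])"
      using cyc_Cons[of y "zs @ [x]"] by (simp add: \<open>xs = x # ys\<close> Cons)
    moreover have "cyc xs = insert (x, y) (edges ((y # zs) @ [x]))"
      using cyc_Cons[of x "y # zs"] by (simp add: \<open>xs = x # ys\<close> Cons)
    ultimately show ?thesis by (simp only: edges_snoc)
  qed
qed (simp add: cyc_def)

lemma cyc_rotate [simp]: "cyc (rotate k xs) = cyc xs"
  by (induction k) (auto simp: cyc_rotate1)

lemma cyc_in: "(p, q) \<in> cyc xs \<Longrightarrow> p \<in> set xs \<and> q \<in> set xs"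
  unfolding cyc_def by (auto dest: set_zip_leftD set_zip_rightD)

lemma cyc_fst: "fst ` cyc xs = set xs"
proof -
  have "map fst (zip xs (rotate1 xs)) = xs" by (rule map_fst_zip) simp
  then have "set (map fst (zip xs (rotate1 xs))) = set xs" by (rule arg_cong)
  then show ?thesis by (simp only: cyc_def set_map)
qed

lemma cyc_rotate_to:
  assumes "(p, q) \<in> cyc xs" "2 \<le> length xs"
  obtains k rest where "rotate k xs = p # q # rest"
proof -
  obtain i where i: "i < length xs" "xs ! i = p" "rotate1 xs ! i = q"
    using assms(1) unfolding cyc_def by (auto simp: in_set_zip)
  have 0: "rotate i xs ! 0 = p" using i assms(2) by (subst nth_rotate) auto
  have 1: "rotate i xs ! 1 = q" using i assms(2) by (subst nth_rotate) (auto simp: nth_rotate1 add.commute)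
  have "length (rotate i xs) \<ge> 2" using assms(2) by simp
  then obtain a b rest where "rotate i xs = a # b # rest"
    by (cases "rotate i xs"; cases "tl (rotate i xs)") auto
  then show ?thesis using 0 1 that[of i rest] by simp
qed

text \<open>A condition on the arrows alone, which can be checked without knowing the components:
  every vertex has exactly one outgoing and one incoming arrow, and distinct arrows meet only in
  common ends.\<close>

definition link :: "arrow set \<Rightarrow> bool" where
  "link E \<longleftrightarrow> finite E \<and> (\<forall>(p, q) \<in> E. p \<noteq> q) \<and> inj_on fst E \<and> inj_on snd E \<and> fst ` E = snd ` E \<and>
     (\<forall>e \<in> E. \<forall>f \<in> E. e \<noteq> f \<longrightarrow> seg e \<inter> seg f \<subseteq> {fst e, snd e} \<inter> {fst f, snd f})"

lemma linkD:
  assumes "link E"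
  shows "finite E" "inj_on fst E" "inj_on snd E" "fst ` E = snd ` E"
    and "(p, q) \<in> E \<Longrightarrow> p \<noteq> q"
    and "e \<in> E \<Longrightarrow> f \<in> E \<Longrightarrow> e \<noteq> f \<Longrightarrow> seg e \<inter> seg f \<subseteq> {fst e, snd e} \<inter> {fst f, snd f}"
proof -
  have *: "\<forall>(p, q) \<in> E. p \<noteq> q"
    "\<forall>e \<in> E. \<forall>f \<in> E. e \<noteq> f \<longrightarrow> seg e \<inter> seg f \<subseteq> {fst e, snd e} \<inter> {fst f, snd f}"
    using assms unfolding link_def by - (elim conjE, assumption)+
  show "finite E" "inj_on fst E" "inj_on snd E" "fst ` E = snd ` E"
    using assms unfolding link_def by - (elim conjE, assumption)+
  show "(p, q) \<in> E \<Longrightarrow> p \<noteq> q" using *(1) by blast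
  show "e \<in> E \<Longrightarrow> f \<in> E \<Longrightarrow> e \<noteq> f \<Longrightarrow> seg e \<inter> seg f \<subseteq> {fst e, snd e} \<inter> {fst f, snd f}"
    by (rule *(2)[rule_format])
qed

text \<open>Speaks of vertex lists and arrows in place of traced curves, so that inserting or
  removing a vertex is an operation on lists.\<close>

definition plink :: "space list set \<Rightarrow> bool" where
  "plink Ps \<longleftrightarrow> finite Ps \<and> (\<forall>ps \<in> Ps. distinct ps \<and> 3 \<le> length ps) \<and>
     pairwise (\<lambda>ps qs. disjnt (set ps) (set qs)) Ps \<and> link (arrows Ps)"

lemma arrows_cyc: "arrows Ps = (\<Union>ps \<in> Ps. cyc ps)"
  by (simp add: arrows_def cyc_def)

lemma path_image_polygonal_path:
  assumes "qs \<noteq> []"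
  shows "path_image (polygonal_path p qs) = (\<Union>e \<in> edges (p # qs). seg e)"
  using assms
proof (induction p qs rule: polygonal_path.induct)
  case (3 p q r qs)
  then show ?case
    by (subst polygonal_path.simps, subst path_image_join) (auto simp: seg_def)
qed (auto simp: seg_def)

lemma path_image_polygon:
  assumes "ps \<noteq> []"
  shows "path_image (polygon ps) = (\<Union>e \<in> cyc ps. seg e)"
  using assms cyc_Cons[of "hd ps" "tl ps"] path_image_polygonal_path[of "tl ps @ [hd ps]" "hd ps"]
  by (simp add: polygon_def)

text \<open>A point common to the first edge and a later one would be an end of both, and as the
  vertices are distinct only \<open>q\<close> is left.\<close>

lemma arc_polygonal_path:
  assumes "qs \<noteq> []" "distinct (p # qs)"
    and "\<And>e f. e \<in> edges (p # qs) \<Longrightarrow> f \<in> edges (p # qs) \<Longrightarrow> e \<noteq> f \<Longrightarrow>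
      seg e \<inter> seg f \<subseteq> {fst e, snd e} \<inter> {fst f, snd f}"
  shows "arc (polygonal_path p qs)"
  using assms
proof (induction p qs rule: polygonal_path.induct)
  case (3 p q r qs)
  have I: "arc (polygonal_path q (r # qs))" using 3 by auto
  have "path_image (linepath p q) \<inter> path_image (polygonal_path q (r # qs)) \<subseteq> {q}"
  proof
    fix x assume x: "x \<in> path_image (linepath p q) \<inter> path_image (polygonal_path q (r # qs))"
    then obtain f where f: "f \<in> edges (q # r # qs)" "x \<in> seg f"
      unfolding path_image_polygonal_path[OF list.distinct(2)] by blast
    have s: "fst f \<in> set (q # r # qs)" "snd f \<in> set (q # r # qs)"
      using edges_in[OF f(1)] by auto
    then have "f \<noteq> (p, q)" using 3(3) by auto
    moreover have "x \<in> seg (p, q)" using x by (simp add: seg_def)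
    ultimately have "x \<in> {p, q} \<inter> {fst f, snd f}" using 3(4)[of "(p, q)" f] f by auto
    then show "x \<in> {q}" using s 3(3) by auto
  qed
  then show ?case using 3(3) I by (auto intro!: arc_join arc_linepath)
qed auto

text \<open>The polygon is cut into its first edge and the remaining arc, which meet only in their
  two common ends.\<close>

lemma simple_path_polygon:
  assumes "distinct ps" "3 \<le> length ps" "link E" "cyc ps \<subseteq> E"
  shows "simple_path (polygon ps)"
proof -
  obtain x y z zs where ps: "ps = x # y # z # zs"
    using assms(2) by (auto simp: numeral_3_eq_3 Suc_le_length_iff)
  have cy: "cyc ps = insert (x, y) (edges (y # (z # zs) @ [x]))"
    using cyc_Cons[of x "y # z # zs"] by (simp add: ps)
  have L: "seg e \<inter> seg f \<subseteq> {fst e, snd e} \<inter> {fst f, snd f}" if "e \<in> cyc ps" "f \<in> cyc ps" "e \<noteq> f" for e f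
    by (rule linkD(6)[OF assms(3)]) (use that assms(4) in auto)
  have A: "arc (polygonal_path y ((z # zs) @ [x]))"
    by (rule arc_polygonal_path) (use assms(1) L cy in \<open>auto simp: ps\<close>)
  have D: "(x, y) \<notin> edges (y # (z # zs) @ [x])"
  proof
    assume "(x, y) \<in> edges (y # (z # zs) @ [x])"
    then have "y \<in> set ((z # zs) @ [x])" using edges_subset by fastforce
    then show False using assms(1) by (auto simp: ps)
  qed
  have "path_image (linepath x y) \<inter> path_image (polygonal_path y ((z # zs) @ [x])) \<subseteq> {x, y}"
  proof
    fix u assume u: "u \<in> path_image (linepath x y) \<inter> path_image (polygonal_path y ((z # zs) @ [x]))"
    have "(z # zs) @ [x] \<noteq> []" by simp
    from u have "u \<in> (\<Union>e \<in> edges (y # (z # zs) @ [x]). seg e)"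
      unfolding path_image_polygonal_path[OF \<open>(z # zs) @ [x] \<noteq> []\<close>] by (rule IntD2)
    then obtain f where f: "f \<in> edges (y # (z # zs) @ [x])" "u \<in> seg f" by blast
    then show "u \<in> {x, y}" using L[of "(x, y)" f] cy D u by (auto simp: seg_def)
  qed
  then have "simple_path (linepath x y +++ polygonal_path y ((z # zs) @ [x]))"
    using assms(1) A by (intro simple_path_join_loop arc_linepath) (auto simp: ps)
  then show ?thesis by (simp add: polygon_def ps)
qed

lemma plink_imp_polygonal_link:
  assumes "plink Ps"
  shows "polygonal_link Ps"
  unfolding polygonal_link_def
proof (intro conjI ballI)
  have fin: "finite Ps" and d: "\<And>ps. ps \<in> Ps \<Longrightarrow> distinct ps \<and> 3 \<le> length ps"
    and pw: "pairwise (\<lambda>ps qs. disjnt (set ps) (set qs)) Ps" and L: "link (arrows Ps)"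
    using assms by (auto simp: plink_def)
  show "finite Ps" by fact
  fix ps assume ps: "ps \<in> Ps"
  show "ps \<noteq> []" using d[OF ps] by auto
  show "simple_path (polygon ps)"
    by (rule simple_path_polygon[of _ "arrows Ps"]) (use ps d L in \<open>auto simp: arrows_cyc\<close>)
next
  have d: "\<And>ps. ps \<in> Ps \<Longrightarrow> distinct ps \<and> 3 \<le> length ps"
    and pw: "pairwise (\<lambda>ps qs. disjnt (set ps) (set qs)) Ps" and L: "link (arrows Ps)"
    using assms by (auto simp: plink_def)
  show "pairwise (\<lambda>ps qs. disjnt (path_image (polygon ps)) (path_image (polygon qs))) Ps"
  proof (rule pairwiseI)
    fix ps qs assume *: "ps \<in> Ps" "qs \<in> Ps" "ps \<noteq> qs"
    then have dj: "set ps \<inter> set qs = {}" using pw by (auto simp: pairwise_def disjnt_def)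
    have ne: "ps \<noteq> []" "qs \<noteq> []" using d[OF *(1)] d[OF *(2)] by auto
    have "seg e \<inter> seg f = {}" if ef: "e \<in> cyc ps" "f \<in> cyc qs" for e f
    proof -
      have v: "fst e \<in> set ps" "snd e \<in> set ps" "fst f \<in> set qs" "snd f \<in> set qs"
        using cyc_in[of "fst e" "snd e" ps] cyc_in[of "fst f" "snd f" qs] ef by auto
      then have "e \<noteq> f" using dj by auto
      moreover have "e \<in> arrows Ps" "f \<in> arrows Ps" using ef * by (auto simp: arrows_cyc)
      ultimately have "seg e \<inter> seg f \<subseteq> {fst e, snd e} \<inter> {fst f, snd f}"
        by (intro linkD(6)[OF L])
      moreover have "{fst e, snd e} \<inter> {fst f, snd f} = {}" using v dj by auto
      ultimately show ?thesis by simp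
    qed
    then show "disjnt (path_image (polygon ps)) (path_image (polygon qs))"
      unfolding path_image_polygon[OF ne(1)] path_image_polygon[OF ne(2)] disjnt_def
      by (simp add: Int_UN_distrib2)
  qed
qed

section \<open>Deformation of one link into another\<close>

text \<open>Quantifying over all decompositions of \<open>E\<close> makes the relation transitive:
  the decomposition produced by one deformation is the input of the next. If \<open>E\<close> has no
  decomposition the relation says nothing, so one has to be supplied before isotopy can be
  concluded.\<close>

definition deforms :: "arrow set \<Rightarrow> arrow set \<Rightarrow> bool" where
  "deforms E E' \<longleftrightarrow> (\<forall>Ps. plink Ps \<and> arrows Ps = E \<longrightarrow>
     (\<exists>Ps' h f. plink Ps' \<and> arrows Ps' = E' \<and> isoend h \<and> bij_betw f Ps Ps' \<and>
        (\<forall>ps \<in> Ps. same_loop (h \<circ> polygon ps) (polygon (f ps)))))"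

lemma deforms_refl: "deforms E E"
  unfolding deforms_def
proof (intro allI impI, elim conjE)
  fix Ps assume "plink Ps" "arrows Ps = E"
  then show "\<exists>Ps' h f. plink Ps' \<and> arrows Ps' = E \<and> isoend h \<and> bij_betw f Ps Ps' \<and>
        (\<forall>ps \<in> Ps. same_loop (h \<circ> polygon ps) (polygon (f ps)))"
    by (intro exI[of _ Ps] exI[of _ "\<lambda>x. x"] conjI isoend_id) (auto intro: same_loop_cong simp: bij_betw_def)
qed

lemma deforms_trans:
  assumes "deforms E F" "deforms F G"
  shows "deforms E G"
  unfolding deforms_def
proof (intro allI impI, elim conjE)
  fix Ps assume "plink Ps" "arrows Ps = E"
  then obtain Qs h f where 1: "plink Qs" "arrows Qs = F" "isoend h" "bij_betw f Ps Qs"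
     "\<forall>ps \<in> Ps. same_loop (h \<circ> polygon ps) (polygon (f ps))"
    using assms(1) unfolding deforms_def by blast
  obtain Rs k g where 2: "plink Rs" "arrows Rs = G" "isoend k" "bij_betw g Qs Rs"
     "\<forall>qs \<in> Qs. same_loop (k \<circ> polygon qs) (polygon (g qs))"
    using assms(2) 1(1,2) unfolding deforms_def by blast
  have "same_loop ((k \<circ> h) \<circ> polygon ps) (polygon ((g \<circ> f) ps))" if "ps \<in> Ps" for ps
  proof -
    have "f ps \<in> Qs" using 1(4) that by (auto simp: bij_betw_def)
    then show ?thesis
      using same_loop_trans[OF same_loop_comp[OF 1(5)[rule_format, OF that], of k] 2(5)[rule_format]]
      by (simp add: o_assoc)
  qed
  then show "\<exists>Ps' h f. plink Ps' \<and> arrows Ps' = G \<and> isoend h \<and> bij_betw f Ps Ps' \<and>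
        (\<forall>ps \<in> Ps. same_loop (h \<circ> polygon ps) (polygon (f ps)))"
    using 2(1,2) isoend_comp[OF 1(3) 2(3)] bij_betw_trans[OF 1(4) 2(4)] by blast
qed

lemma deforms_imp_isotopic:
  assumes "deforms E E'" "plink Ps" "arrows Ps = E"
  shows "isotopic E E'"
proof -
  obtain Ps' h f where *: "plink Ps'" "arrows Ps' = E'" "isoend h" "bij_betw f Ps Ps'"
     "\<forall>ps \<in> Ps. same_loop (h \<circ> polygon ps) (polygon (f ps))"
    using assms unfolding deforms_def by blast
  obtain H where H: "ambient_isotopy H" "H 1 = h" using *(3) unfolding isoend_def by blast
  have loop: "polygon ps 1 = polygon ps 0" for ps
    by (simp add: polygon_def)
  have "same_oriented_loop (H 1 \<circ> polygon ps) (polygon (f ps))" if "ps \<in> Ps" for ps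
    using *(5) that H(2) by (intro same_loop_imp_same_oriented_loop) (auto simp: loop)
  then show ?thesis
    unfolding isotopic_def using assms(2,3) * H(1) plink_imp_polygonal_link by blast
qed

text \<open>The image of the old polygon runs through both edges \<open>p v\<close> and
  \<open>v q\<close> in the first half of the parameter interval, whereas the new polygon spends
  this half on \<open>p v\<close> alone. The two differ by one reassociation of joins.\<close>

lemma polygon_apex:
  assumes "rest \<noteq> []"
    and fixed: "\<And>e x. e \<in> edges (q # rest @ [p]) \<Longrightarrow> x \<in> seg e \<Longrightarrow> h x = x"
    and mv: "\<And>s. s \<in> {0..1} \<Longrightarrow> h (linepath p q s) = (linepath p v +++ linepath v q) s"
  shows "same_loop (h \<circ> polygon (p # q # rest)) (polygon (p # v # q # rest))"
proof -
  have 1: "polygon (p # q # rest) = linepath p q +++ polygonal_path q (rest @ [p])"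
    using assms(1) by (cases rest) (auto simp: polygon_def)
  have 2: "polygon (p # v # q # rest) = linepath p v +++ (linepath v q +++ polygonal_path q (rest @ [p]))"
    using assms(1) by (cases rest) (auto simp: polygon_def)
  have f: "h (polygonal_path q (rest @ [p]) s) = polygonal_path q (rest @ [p]) s" if "s \<in> {0..1}" for s
  proof -
    have "polygonal_path q (rest @ [p]) s \<in> path_image (polygonal_path q (rest @ [p]))"
      using that by (simp add: path_image_def)
    then obtain e where "e \<in> edges (q # rest @ [p])" "polygonal_path q (rest @ [p]) s \<in> seg e"
      using path_image_polygonal_path[of "rest @ [p]" q] by blast
    then show ?thesis by (rule fixed)
  qed
  have "same_loop (h \<circ> polygon (p # q # rest)) ((linepath p v +++ linepath v q) +++ polygonal_path q (rest @ [p]))"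
  proof (rule same_loop_cong)
    fix t :: real assume "t \<in> {0..1}"
    then show "((linepath p v +++ linepath v q) +++ polygonal_path q (rest @ [p])) t = (h \<circ> polygon (p # q # rest)) t"
      using mv[of "2 * t"] f[of "2 * t - 1"] unfolding 1 by (auto simp: joinpaths_def[of _ "polygonal_path q (rest @ [p])"])
  qed
  moreover have "same_loop ((linepath p v +++ linepath v q) +++ polygonal_path q (rest @ [p])) (polygon (p # v # q # rest))"
    unfolding 2 by (intro reparam_imp_same_loop reparam_assoc) auto
  ultimately show ?thesis by (rule same_loop_trans)
qed

lemma arrows_insert_remove:
  assumes "ps \<in> Ps"
  shows "arrows Ps = cyc ps \<union> arrows (Ps - {ps})"
  using assms by (auto simp: arrows_cyc)

text \<open>Only one component changes, after a rotation that brings the edge in question to the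
  front; the others are fixed pointwise by \<open>h\<close> and keep their lists.\<close>

lemma deforms_replace:
  assumes Ps: "plink Ps" "ps \<in> Ps" and xs: "rotate k ps = xs"
    and ys: "distinct ys" "3 \<le> length ys" "set ys \<inter> \<Union> (set ` (Ps - {ps})) = {}"
    and E': "link E'" "cyc ys \<union> arrows (Ps - {ps}) = E'"
    and h: "isoend h" "\<And>e x. e \<in> arrows (Ps - {ps}) \<Longrightarrow> x \<in> seg e \<Longrightarrow> h x = x"
    and loop: "same_loop (h \<circ> polygon xs) (polygon ys)"
  shows "\<exists>Ps' h f. plink Ps' \<and> arrows Ps' = E' \<and> isoend h \<and> bij_betw f Ps Ps' \<and>
        (\<forall>ps \<in> Ps. same_loop (h \<circ> polygon ps) (polygon (f ps)))"
proof -
  define Ps' where "Ps' = insert ys (Ps - {ps})"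
  have ysn: "ys \<notin> Ps - {ps}"
  proof
    assume "ys \<in> Ps - {ps}"
    then have "set ys \<subseteq> \<Union> (set ` (Ps - {ps}))" by (rule UN_upper)
    then have "set ys = {}" using ys(3) by (simp add: Int_absorb2)
    then show False using ys(2) by simp
  qed
  have ar: "arrows Ps' = E'" using E'(2) by (auto simp: Ps'_def arrows_cyc)
  have pl: "plink Ps'"
    unfolding plink_def ar
  proof (intro conjI)
    show "finite Ps'" "\<forall>ps\<in>Ps'. distinct ps \<and> 3 \<le> length ps" using Ps ys by (auto simp: plink_def Ps'_def)
    show "pairwise (\<lambda>ps qs. disjnt (set ps) (set qs)) Ps'"
      unfolding Ps'_def pairwise_insert
    proof (intro conjI)
      show "pairwise (\<lambda>ps qs. disjnt (set ps) (set qs)) (Ps - {ps})"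
        using Ps(1) unfolding plink_def pairwise_def by blast
      show "\<forall>y. y \<in> Ps - {ps} \<and> y \<noteq> ys \<longrightarrow> disjnt (set ys) (set y) \<and> disjnt (set y) (set ys)"
        using ys(3) unfolding disjnt_def by blast
    qed
    show "link E'" by (fact E')
  qed
  define f where "f x = (if x = ps then ys else x)" for x
  have "bij_betw f Ps Ps'"
    unfolding bij_betw_def
  proof
    show "inj_on f Ps" using ysn by (auto simp: inj_on_def f_def)
    show "f ` Ps = Ps'" using Ps(2) by (auto simp: f_def Ps'_def)
  qed
  moreover have "same_loop (h \<circ> polygon x) (polygon (f x))" if x: "x \<in> Ps" for x
  proof (cases "x = ps")
    case True
    have "2 \<le> length ps" using Ps by (auto simp: plink_def)
    then have "same_loop (h \<circ> polygon ps) (h \<circ> polygon xs)"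
      unfolding xs[symmetric] by (intro same_loop_comp same_loop_rotate)
    then show ?thesis using loop True by (auto simp: f_def intro: same_loop_trans)
  next
    case False
    have ne: "x \<noteq> []" using Ps(1) x by (auto simp: plink_def)
    have "h (polygon x t) = polygon x t" if "t \<in> {0..1}" for t
    proof -
      have "polygon x t \<in> path_image (polygon x)" using that by (simp add: path_image_def)
      then obtain e where "e \<in> cyc x" "polygon x t \<in> seg e" unfolding path_image_polygon[OF ne] by blast
      moreover have "e \<in> arrows (Ps - {ps})" using \<open>e \<in> cyc x\<close> x False by (auto simp: arrows_cyc)
      ultimately show ?thesis using h(2) by blast
    qed
    then show ?thesis using False by (auto simp: f_def intro!: same_loop_cong)
  qed
  ultimately show ?thesis using ar pl h(1) by blast
qed

section \<open>Pushing an edge across a free triangle\<close>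

text \<open>Every line of direction \<open>w\<close> is mapped to itself at all times. Along it
  \<open>\<phi>\<close> decreases at a rate of at most \<open>k < 1\<close>, so no point overtakes
  another and the map is injective; the intermediate value theorem gives surjectivity, and
  invariance of domain the continuity of the inverse.\<close>

lemma isoend_push:
  fixes w :: space and \<phi> :: "space \<Rightarrow> real"
  assumes cont: "continuous_on UNIV \<phi>" and \<phi>: "\<And>x. 0 \<le> \<phi> x" "\<And>x. \<phi> x \<le> 1"
    and lip: "\<And>x s. 0 \<le> s \<Longrightarrow> \<phi> x - \<phi> (x + s *\<^sub>R w) \<le> k * s" and k: "0 \<le> k" "k < 1" and w: "w \<noteq> 0"
  shows "isoend (\<lambda>x. x + \<phi> x *\<^sub>R w)"
proof -
  define H where "H t x = x + (t * \<phi> x) *\<^sub>R w" for t x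
  have c1: "continuous_on ({0..1} \<times> UNIV) (\<lambda>(t, x). H t x)"
    unfolding H_def case_prod_beta by (intro continuous_intros continuous_on_compose2[OF cont]) auto
  have "\<exists>g. homeomorphism UNIV UNIV (H t) g" if t: "t \<in> {0..1}" for t
  proof -
    have c: "continuous_on UNIV (H t)"
      unfolding H_def by (intro continuous_intros cont)
    have aux: False if eq: "H t x = H t (x + s *\<^sub>R w)" and s: "0 < s" for x s
    proof -
      have "(t * \<phi> x) *\<^sub>R w = (s + t * \<phi> (x + s *\<^sub>R w)) *\<^sub>R w"
        using eq by (simp add: H_def algebra_simps)
      then have "t * \<phi> x = s + t * \<phi> (x + s *\<^sub>R w)" using w unfolding scaleR_cancel_right by blast
      then have "s = t * (\<phi> x - \<phi> (x + s *\<^sub>R w))" by (simp add: right_diff_distrib)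
      also have "\<dots> \<le> t * (k * s)" using lip[of s x] s t by (intro mult_left_mono) auto
      also have "\<dots> \<le> 1 * (k * s)" using t s k by (intro mult_right_mono) auto
      also have "\<dots> < s" using s k by simp
      finally show False by simp
    qed
    have inj: "inj (H t)"
    proof (rule injI)
      fix x y assume eq: "H t x = H t y"
      define s where "s = t * \<phi> x - t * \<phi> y"
      have y: "y = x + s *\<^sub>R w" using eq by (simp add: H_def s_def algebra_simps)
      then have x: "x = y + (- s) *\<^sub>R w" by simp
      have "\<not> 0 < s" using aux[of x s] eq y by blast
      moreover have "\<not> 0 < - s" using aux[of y "- s"] eq x by metis
      ultimately show "x = y" using y by simp
    qed
    have surj: "range (H t) = UNIV"
    proof (intro equalityI subsetI)
      fix y :: space
      \<comment> \<open>A zero \<open>s\<close> of \<open>G\<close> yields the preimage of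
        \<open>y\<close> at \<open>y + s w\<close>; it is found in \<open>[-1, 0]\<close> because no
        point moves by more than \<open>w\<close>.\<close>
      define G where "G s = s + t * \<phi> (y + s *\<^sub>R w)" for s
      have "continuous_on {-1..0} G"
        unfolding G_def by (intro continuous_intros continuous_on_compose2[OF cont]) auto
      moreover have "G (-1) \<le> 0"
        using mult_mono[of t 1 "\<phi> (y + (-1) *\<^sub>R w)" 1] \<phi> t by (simp add: G_def)
      moreover have "0 \<le> G 0" using \<phi> t by (simp add: G_def)
      ultimately obtain s where "G s = 0" using IVT'[of G "-1" 0 0] by auto
      then have "H t (y + s *\<^sub>R w) = y"
        unfolding H_def G_def by (metis add.assoc add.right_neutral scaleR_left_distrib scaleR_zero_left)
      then show "y \<in> range (H t)" by (metis rangeI)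
    qed auto
    show ?thesis
      using invariance_of_domain_homeomorphism[OF open_UNIV c order_refl inj] unfolding surj by blast
  qed
  then have "ambient_isotopy H" using c1 by (auto simp: ambient_isotopy_def H_def[of 0])
  moreover have "H 1 = (\<lambda>x. x + \<phi> x *\<^sub>R w)" by (simp add: H_def fun_eq_iff)
  ultimately show ?thesis unfolding isoend_def by blast
qed

text \<open>\<open>D\<close> is the Gram determinant of \<open>u\<close> and \<open>w\<close>; it
  vanishes only in the case of equality in the Cauchy-Schwarz inequality. Scalar products with
  \<open>a\<close> and \<open>b\<close> are the coordinates with respect to \<open>u\<close> and
  \<open>w\<close> in the plane that these span.\<close>

lemma dual_coordinates:
  fixes u w :: "'a :: real_inner"
  assumes "\<not> collinear {0, u, w}"
  obtains a b where "a \<bullet> u = 1" "a \<bullet> w = 0" "b \<bullet> u = 0" "b \<bullet> w = 1"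
proof -
  define D where "D = (u \<bullet> u) * (w \<bullet> w) - (u \<bullet> w)\<^sup>2"
  have "D \<noteq> 0"
  proof
    assume "D = 0"
    then have "(u \<bullet> w)\<^sup>2 = (norm u * norm w)\<^sup>2"
      by (simp add: D_def power_mult_distrib power2_norm_eq_inner)
    then have "\<bar>u \<bullet> w\<bar> = norm u * norm w"
      by (metis abs_mult abs_norm_cancel power2_eq_iff abs_minus)
    then show False using assms by (simp add: norm_cauchy_schwarz_equal)
  qed
  have 1: "(inverse D *\<^sub>R (x *\<^sub>R u - y *\<^sub>R w)) \<bullet> z = (x * (u \<bullet> z) - y * (w \<bullet> z)) / D" for x y z
    by (simp add: inner_diff_left divide_inverse)
  have 2: "(inverse D *\<^sub>R (x *\<^sub>R w - y *\<^sub>R u)) \<bullet> z = (x * (w \<bullet> z) - y * (u \<bullet> z)) / D" for x y z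
    by (simp add: inner_diff_left divide_inverse)
  show ?thesis
    by (rule that[of "inverse D *\<^sub>R ((w \<bullet> w) *\<^sub>R u - (u \<bullet> w) *\<^sub>R w)" "inverse D *\<^sub>R ((u \<bullet> u) *\<^sub>R w - (u \<bullet> w) *\<^sub>R u)"];
        unfold 1 2; use \<open>D \<noteq> 0\<close> in \<open>simp add: D_def inner_commute[of w u] power2_eq_square mult.commute\<close>)
qed

abbreviation tri :: "'a \<Rightarrow> 'a \<Rightarrow> 'a \<Rightarrow> 'a :: real_vector set" where
  "tri p q v \<equiv> convex hull {p, q, v}"

text \<open>The edge is pushed parallel to the median \<open>w\<close> from its midpoint
  \<open>m\<close> to \<open>v\<close>, by the multiple \<open>1 - 2 * \<bar>s - 1/2\<bar>\<close>
  of \<open>w\<close>; this carries it onto the other two sides. The tent is extended to space as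
  the positive part of \<open>\<psi> K\<close>. For growing \<open>K\<close> the set where
  \<open>\<psi> K\<close> is positive shrinks towards the triangle, so finitely many segments that
  touch the triangle at most in a common end are fixed for some \<open>K\<close>; and for every
  \<open>K\<close> the tent decreases along \<open>w\<close> at a rate below one, so the push stays
  injective.\<close>

lemma apex_isotopy:
  fixes p q v :: space
  assumes nc: "\<not> collinear {p, q, v}" and fin: "finite E"
    and nd: "\<And>e. e \<in> E \<Longrightarrow> fst e \<noteq> snd e"
    and E: "\<And>e. e \<in> E \<Longrightarrow> tri p q v \<inter> seg e \<subseteq> {p, q} \<inter> {fst e, snd e}"
  obtains h where "isoend h" "\<And>e x. e \<in> E \<Longrightarrow> x \<in> seg e \<Longrightarrow> h x = x"
    "\<And>s. s \<in> {0..1} \<Longrightarrow> h (linepath p q s) = (linepath p v +++ linepath v q) s"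
proof -
  define u where "u = q - p"
  define m where "m = (1/2) *\<^sub>R (p + q)"
  define w where "w = v - m"
  have "\<not> collinear {0, u, w}"
  proof
    assume c: "collinear {0, u, w}"
    have v: "v - p = w + (1/2) *\<^sub>R u" by (simp add: w_def m_def u_def prod_eq_iff field_simps)
    have "collinear {0, u, v - p}"
      using c unfolding collinear_lemma v
    proof (elim disjE exE)
      assume "w = 0"
      then show "u = 0 \<or> w + (1/2) *\<^sub>R u = 0 \<or> (\<exists>c. w + (1/2) *\<^sub>R u = c *\<^sub>R u)"
        by (intro disjI2 exI[of _ "1/2"]) simp
    next
      fix c assume "w = c *\<^sub>R u"
      then have "w + (1/2) *\<^sub>R u = (c + 1/2) *\<^sub>R u" by (simp add: scaleR_left_distrib)
      then show "u = 0 \<or> w + (1/2) *\<^sub>R u = 0 \<or> (\<exists>c. w + (1/2) *\<^sub>R u = c *\<^sub>R u)" by blast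
    qed auto
    then have "collinear {q, p, v}" using collinear_3[of q p v] unfolding u_def by simp
    then show False using nc by (simp add: insert_commute)
  qed
  then obtain a b where ab: "a \<bullet> u = 1" "a \<bullet> w = 0" "b \<bullet> u = 0" "b \<bullet> w = 1"
    using dual_coordinates by blast
  have w0: "w \<noteq> 0" using ab by auto
  define N where "N y = y - (a \<bullet> y) *\<^sub>R u - (b \<bullet> y) *\<^sub>R w" for y
  \<comment> \<open>With the coordinates \<open>a\<close> and \<open>b\<close> along the edge and
    the median, and the remainder \<open>N\<close> outside the plane, the triangle is given by
    \<open>N = 0\<close> and \<open>0 \<le> b \<le> 1 - 2 * \<bar>a\<bar>\<close>. The terms with
    \<open>K\<close> penalise leaving it. The factor \<open>K / (K + 1)\<close> tends to one but
    stays below it; it is the greatest rate of decrease along \<open>w\<close>.\<close>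
  define \<psi> where "\<psi> K x = 1 - 2 * \<bar>a \<bullet> (x - m)\<bar>
      - max (K / (K + 1) * (b \<bullet> (x - m))) (- K * (b \<bullet> (x - m))) - K * norm (N (x - m))" for K x
  have max0: "0 \<le> max (K / (K + 1) * s) (- K * s)" if "0 < K" for K s :: real
  proof (cases "0 \<le> s")
    case True
    then have "0 \<le> K / (K + 1) * s" using that by (intro mult_nonneg_nonneg divide_nonneg_nonneg) auto
    then show ?thesis by (rule max.coboundedI1)
  next
    case False
    then have "0 \<le> - K * s" using that by (simp add: mult_le_0_iff)
    then show ?thesis by (rule max.coboundedI2)
  qed
  have cont: "continuous_on S (\<psi> K)" for S K
    unfolding \<psi>_def N_def by (intro continuous_intros)
  have anti: "\<psi> K' x \<le> \<psi> K x" if "0 < K" "K \<le> K'" for K K' x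
  proof -
    have "max (K / (K + 1) * s) (- K * s) \<le> max (K' / (K' + 1) * s) (- K' * s)" for s
    proof (cases "0 \<le> s")
      case True
      have "K / (K + 1) \<le> K' / (K' + 1)" using that by (simp add: field_simps)
      then have "K / (K + 1) * s \<le> K' / (K' + 1) * s" using True by (rule mult_right_mono)
      moreover have "- K * s \<le> 0" "0 \<le> K' / (K' + 1) * s" using True that by auto
      ultimately show ?thesis by linarith
    next
      case False
      have "- K * s \<le> - K' * s" using False that by (simp add: mult_le_cancel_right)
      moreover have "K / (K + 1) * s \<le> 0" "0 \<le> - K' * s" using False that
        by (auto simp: mult_le_0_iff zero_le_mult_iff divide_le_0_iff)
      ultimately show ?thesis by linarith
    qed
    moreover have "K * norm (N (x - m)) \<le> K' * norm (N (x - m))" using that by (intro mult_right_mono) auto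
    ultimately show ?thesis unfolding \<psi>_def by (smt (verit))
  qed
  \<comment> \<open>Off the plane or beyond the edge a penalty grows without bound. At a point of
    the plane beyond the other two sides, \<open>K / (K + 1) * b\<close> tends to \<open>b\<close>,
    which is greater than \<open>1 - 2 * \<bar>a\<bar>\<close>.\<close>
  have out: "\<exists>K>0. \<psi> K x < 0" if x: "x \<notin> tri p q v" for x
  proof -
    define y where "y = x - m"
    have M: "\<psi> K x \<le> 1 - K * norm (N y)" if "0 < K" for K
      using max0[OF that, of "b \<bullet> y"] by (simp add: \<psi>_def y_def)
    consider "N y \<noteq> 0" | "b \<bullet> y < 0" | "N y = 0" "0 \<le> b \<bullet> y" by linarith
    then show ?thesis
    proof cases
      case 1
      then have n: "0 < norm (N y)" by simp
      define K where "K = 2 / norm (N y)"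
      have "0 < K" "K * norm (N y) = 2" using n by (auto simp: K_def)
      then show ?thesis using M[of K] by (intro exI[of _ K]) auto
    next
      case 2
      define K where "K = 2 / (- (b \<bullet> y))"
      have K: "0 < K" "- K * (b \<bullet> y) = 2" using 2 by (auto simp: K_def field_simps)
      have "max (K / (K + 1) * (b \<bullet> y)) (- K * (b \<bullet> y)) \<ge> 2" using K by simp
      moreover have "0 \<le> K * norm (N y)" using K by simp
      ultimately have "\<psi> K x < 0" unfolding \<psi>_def y_def[symmetric] by linarith
      then show ?thesis using K by blast
    next
      case 3
      define \<tau> where "\<tau> = 1 - 2 * \<bar>a \<bullet> y\<bar>"
      have "y = (a \<bullet> y) *\<^sub>R u + (b \<bullet> y) *\<^sub>R w"
        using 3(1) unfolding N_def by (metis diff_diff_eq eq_iff_diff_eq_0)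
      then have xm: "x = m + ((a \<bullet> y) *\<^sub>R u + (b \<bullet> y) *\<^sub>R w)" by (metis y_def add.commute diff_add_cancel)
      have bary: "m + (\<alpha> *\<^sub>R u + \<beta> *\<^sub>R w) = ((1 - \<beta>) / 2 - \<alpha>) *\<^sub>R p + ((1 - \<beta>) / 2 + \<alpha>) *\<^sub>R q + \<beta> *\<^sub>R v" for \<alpha> \<beta>
        by (simp add: m_def u_def w_def prod_eq_iff field_simps)
      have "\<not> b \<bullet> y \<le> \<tau>"
      proof
        assume le: "b \<bullet> y \<le> \<tau>"
        have "x = ((1 - b \<bullet> y) / 2 - a \<bullet> y) *\<^sub>R p + ((1 - b \<bullet> y) / 2 + a \<bullet> y) *\<^sub>R q + (b \<bullet> y) *\<^sub>R v"
          unfolding bary[symmetric] by (rule xm)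
        moreover have "0 \<le> (1 - b \<bullet> y) / 2 - a \<bullet> y" "0 \<le> (1 - b \<bullet> y) / 2 + a \<bullet> y"
          using le abs_ge_self[of "a \<bullet> y"] abs_ge_minus_self[of "a \<bullet> y"]
          unfolding \<tau>_def by (simp_all add: field_simps)
        ultimately have "x \<in> tri p q v" unfolding convex_hull_3 using 3 by force
        then show False using x by blast
      qed
      then have lt: "\<tau> < b \<bullet> y" by simp
      obtain K where K: "0 < K" "\<tau> < K / (K + 1) * (b \<bullet> y)"
      proof (cases "\<tau> < 0")
        case True
        show ?thesis by (rule that[of 1]) (use True 3 in auto)
      next
        case False
        \<comment> \<open>The required inequality amounts to
          \<open>K > \<tau> / (b \<bullet> y - \<tau>)\<close>.\<close>
        define K where "K = \<tau> / (b \<bullet> y - \<tau>) + 1"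
        have "0 < K" using False lt by (simp add: K_def add_nonneg_pos)
        moreover have "K * (b \<bullet> y - \<tau>) = \<tau> + (b \<bullet> y - \<tau>)" using lt by (simp add: K_def distrib_right)
        then have "K * (b \<bullet> y) > \<tau> * (K + 1)" using lt by (simp add: algebra_simps)
        ultimately show ?thesis by (intro that[of K]) (auto simp: field_simps)
      qed
      then have "\<psi> K x < 0" using 3 unfolding \<psi>_def y_def[symmetric] \<tau>_def by simp
      then show ?thesis using K by blast
    qed
  qed
  have mp: "a \<bullet> (p - m) = - 1/2" "b \<bullet> (p - m) = 0" "N (p - m) = 0"
     "a \<bullet> (q - m) = 1/2" "b \<bullet> (q - m) = 0" "N (q - m) = 0"
  proof -
    have 1: "p - m = (- 1/2) *\<^sub>R u" "q - m = (1/2) *\<^sub>R u"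
      by (auto simp: m_def u_def prod_eq_iff field_simps)
    show "a \<bullet> (p - m) = - 1/2" "b \<bullet> (p - m) = 0" "N (p - m) = 0"
     "a \<bullet> (q - m) = 1/2" "b \<bullet> (q - m) = 0" "N (q - m) = 0"
      unfolding 1 N_def by (simp_all add: ab)
  qed
  \<comment> \<open>A covering argument fails for a segment that starts in an end \<open>P\<close>
    of the edge, since \<open>\<psi> K\<close> vanishes at \<open>P\<close> for every
    \<open>K\<close>. But along the ray from \<open>P\<close> it is bounded by the linear function
    \<open>s * lin K\<close>, with equality for small \<open>s\<close>, so its sign at one point
    near \<open>P\<close> outside the triangle settles the whole segment.\<close>
  have ray: "\<exists>K>0. \<forall>x \<in> closed_segment P d. \<psi> K x \<le> 0"
    if P: "P \<in> {p, q}" and d: "tri p q v \<inter> closed_segment P d \<subseteq> {P}" "d \<noteq> P" for P d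
  proof -
    obtain \<sigma> where \<sigma>: "a \<bullet> (P - m) = \<sigma> / 2" "\<sigma> = 1 \<or> \<sigma> = -1" "b \<bullet> (P - m) = 0" "N (P - m) = 0"
    proof (cases "P = p")
      case True
      then show ?thesis using mp by (intro that[of "- 1"]) simp_all
    next
      case False
      then have "P = q" using P by simp
      then show ?thesis using mp by (intro that[of 1]) simp_all
    qed
    define r where "r = d - P"
    define lin where "lin K = - 2 * \<sigma> * (a \<bullet> r) - max (K / (K + 1) * (b \<bullet> r)) (- K * (b \<bullet> r)) - K * norm (N r)" for K
    have decomp: "\<psi> K (P + s *\<^sub>R r) = 1 - 2 * \<bar>\<sigma> / 2 + s * (a \<bullet> r)\<bar>
        - s * max (K / (K + 1) * (b \<bullet> r)) (- K * (b \<bullet> r)) - s * (K * norm (N r))" if "0 \<le> s" for K s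
    proof -
      have e: "P + s *\<^sub>R r - m = (P - m) + s *\<^sub>R r" by simp
      have a: "a \<bullet> (P + s *\<^sub>R r - m) = \<sigma> / 2 + s * (a \<bullet> r)" unfolding e inner_add_right \<sigma>(1) by simp
      have b: "b \<bullet> (P + s *\<^sub>R r - m) = s * (b \<bullet> r)" unfolding e inner_add_right \<sigma>(3) by simp
      have "N (P + s *\<^sub>R r - m) = N (P - m) + s *\<^sub>R N r"
        unfolding e N_def by (simp add: inner_add_right algebra_simps)
      then have n: "norm (N (P + s *\<^sub>R r - m)) = s * norm (N r)" using \<sigma>(4) that by simp
      show ?thesis unfolding \<psi>_def a b n using that by (simp add: max_mult_distrib_left algebra_simps)
    qed
    \<comment> \<open>So small that the coordinate along the edge does not change its sign before
      \<open>s0\<close>; up to there the absolute value is linear.\<close>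
    define s0 where "s0 = 1 / (2 * \<bar>a \<bullet> r\<bar> + 1)"
    have s0: "0 < s0" "s0 \<le> 1" "s0 * \<bar>a \<bullet> r\<bar> \<le> 1/2" by (auto simp: s0_def field_simps)
    have "P + s0 *\<^sub>R r \<in> closed_segment P d" unfolding in_segment
      using s0 by (intro exI[of _ s0]) (auto simp: r_def algebra_simps)
    moreover have "P + s0 *\<^sub>R r \<noteq> P" using s0 d(2) by (auto simp: r_def)
    ultimately have "P + s0 *\<^sub>R r \<notin> tri p q v" using d(1) by blast
    then obtain K where K: "0 < K" "\<psi> K (P + s0 *\<^sub>R r) < 0" using out by blast
    have "\<bar>s0 * (a \<bullet> r)\<bar> \<le> 1/2" using s0 by (simp add: abs_mult)
    then have "2 * \<bar>\<sigma> / 2 + s0 * (a \<bullet> r)\<bar> = 1 + 2 * \<sigma> * (s0 * (a \<bullet> r))" using \<sigma>(2) by auto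
    then have "\<psi> K (P + s0 *\<^sub>R r) = s0 * lin K"
      unfolding decomp[OF less_imp_le[OF s0(1)]] lin_def by (simp add: algebra_simps)
    then have lin: "lin K < 0" using K s0 by (simp add: mult_less_0_iff)
    have "\<psi> K x \<le> 0" if xin: "x \<in> closed_segment P d" for x
    proof -
      obtain s where s: "0 \<le> s" "s \<le> 1" "x = (1 - s) *\<^sub>R P + s *\<^sub>R d"
        using xin unfolding in_segment by blast
      have "x = P + s *\<^sub>R r" unfolding s(3) by (simp add: r_def algebra_simps)
      note s = s(1,2) this
      have "2 * \<bar>\<sigma> / 2 + s * (a \<bullet> r)\<bar> \<ge> 1 + 2 * \<sigma> * (s * (a \<bullet> r))"
        using \<sigma>(2) abs_ge_self[of "1/2 + s * (a \<bullet> r)"] abs_ge_minus_self[of "s * (a \<bullet> r) - 1/2"] by auto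
      then have "\<psi> K x \<le> s * lin K" unfolding s(3) decomp[OF s(1)] lin_def by (simp add: algebra_simps)
      also have "\<dots> \<le> 0" using lin s by (simp add: mult_le_0_iff)
      finally show ?thesis .
    qed
    then show ?thesis using K by blast
  qed
  have ex1: "\<exists>K>0. \<forall>x \<in> seg e. \<psi> K x \<le> 0" if e: "e \<in> E" for e
  proof (cases "tri p q v \<inter> seg e = {}")
    case True
    \<comment> \<open>The open sets where \<open>\<psi> K\<close> is negative increase with
      \<open>K\<close> and cover the compact segment.\<close>
    have "seg e \<subseteq> (\<Union>n. {x. \<psi> (real (Suc n)) x < 0})"
    proof
      fix x assume "x \<in> seg e"
      then obtain K where K: "0 < K" "\<psi> K x < 0" using out True by blast
      obtain n where "K \<le> real n" using real_arch_simple by blast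
      then have "\<psi> (real (Suc n)) x < 0" using anti[OF K(1), of "real (Suc n)" x] K by auto
      then show "x \<in> (\<Union>n. {x. \<psi> (real (Suc n)) x < 0})" by blast
    qed
    moreover have "open {x. \<psi> (real (Suc n)) x < 0}" for n
      by (intro open_Collect_less cont continuous_intros)
    moreover have "compact (seg e)" by (simp add: seg_def)
    ultimately obtain I where I: "finite I" "seg e \<subseteq> (\<Union>n\<in>I. {x. \<psi> (real (Suc n)) x < 0})"
      by (metis (no_types, lifting) compactE_image UNIV_I)
    define K where "K = real (Suc (Max (insert 0 I)))"
    have "\<psi> K x \<le> 0" if xin: "x \<in> seg e" for x
    proof -
      obtain n where n: "n \<in> I" "\<psi> (real (Suc n)) x < 0" using I(2) xin by blast
      have "n \<le> Max (insert 0 I)" using I(1) n(1) by simp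
      then show ?thesis using anti[of "real (Suc n)" K x] n by (simp add: K_def)
    qed
    then show ?thesis by (intro exI[of _ K]) (auto simp: K_def)
  next
    case False
    then obtain P where P: "P \<in> tri p q v" "P \<in> seg e" by blast
    then have P': "P \<in> {p, q}" "P = fst e \<or> P = snd e" using E[OF e] by auto
    define d where "d = (if P = fst e then snd e else fst e)"
    have sg: "seg e = closed_segment P d" using P' by (auto simp: d_def seg_def closed_segment_commute)
    have ne: "p \<noteq> q" using ab(1) by (auto simp: u_def)
    \<comment> \<open>A segment through both \<open>p\<close> and \<open>q\<close> would contain the
      midpoint of the edge, a point of the triangle other than \<open>p\<close> and
      \<open>q\<close>.\<close>
    have "tri p q v \<inter> seg e \<subseteq> {P}"
    proof (rule ccontr)
      assume "\<not> ?thesis"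
      then have "p \<in> seg e" "q \<in> seg e" using E[OF e] P P' by auto
      then have "closed_segment p q \<subseteq> seg e" by (simp add: seg_def closed_segment_subset)
      moreover have "closed_segment p q \<subseteq> tri p q v"
        by (simp add: closed_segment_subset hull_inc)
      ultimately have "midpoint p q \<in> {p, q}" using E[OF e] midpoint_in_closed_segment[of p q] by blast
      then show False using ne by auto
    qed
    moreover have "d \<noteq> P" using nd[OF e] P'(2) by (auto simp: d_def)
    ultimately show ?thesis using ray[OF P'(1), of d] sg by simp
  qed
  obtain K where K: "0 < K" "\<And>e x. e \<in> E \<Longrightarrow> x \<in> seg e \<Longrightarrow> \<psi> K x \<le> 0"
  proof -
    obtain k where k: "\<And>e. e \<in> E \<Longrightarrow> 0 < k e \<and> (\<forall>x \<in> seg e. \<psi> (k e) x \<le> 0)" using ex1 by metis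
    define K where "K = Max (insert 1 (k ` E))"
    have "\<psi> K x \<le> 0" if "e \<in> E" "x \<in> seg e" for e x
    proof -
      have "k e \<le> K" using fin that by (simp add: K_def)
      then show ?thesis using anti[of "k e" K x] k[OF that(1)] that(2) by fastforce
    qed
    moreover have "1 \<le> K" using fin by (simp add: K_def)
    ultimately show ?thesis by (intro that[of K]) auto
  qed
  define \<phi> where "\<phi> x = max 0 (\<psi> K x)" for x
  define h where "h x = x + \<phi> x *\<^sub>R w" for x
  show ?thesis
  proof (rule that[of h])
    show "isoend h"
      unfolding h_def
    proof (rule isoend_push)
      show "continuous_on UNIV \<phi>" unfolding \<phi>_def by (intro continuous_intros cont)
      show "0 \<le> \<phi> x" for x by (simp add: \<phi>_def)
      have "\<psi> K x \<le> 1" for x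
        using max0[OF K(1), of "b \<bullet> (x - m)"] K(1) mult_nonneg_nonneg[of K "norm (N (x - m))"]
        unfolding \<psi>_def by (smt (verit) norm_ge_zero)
      then show "\<phi> x \<le> 1" for x by (simp add: \<phi>_def)
      show "\<phi> x - \<phi> (x + s *\<^sub>R w) \<le> K / (K + 1) * s" if "0 \<le> s" for x s
      proof -
        have e: "x + s *\<^sub>R w - m = (x - m) + s *\<^sub>R w" by simp
        have a: "a \<bullet> (x + s *\<^sub>R w - m) = a \<bullet> (x - m)" unfolding e inner_add_right using ab by simp
        have b: "b \<bullet> (x + s *\<^sub>R w - m) = b \<bullet> (x - m) + s" unfolding e inner_add_right using ab by simp
        have n: "N (x + s *\<^sub>R w - m) = N (x - m)"
          unfolding N_def a b by (simp add: algebra_simps)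
        have mx: "max (K / (K + 1) * (r + s)) (- K * (r + s)) \<le> max (K / (K + 1) * r) (- K * r) + K / (K + 1) * s" for r
        proof -
          have "- K * (r + s) \<le> - K * r + K / (K + 1) * s" using K(1) that
            by (simp add: algebra_simps) (smt (verit) divide_nonneg_nonneg mult_nonneg_nonneg)
          moreover have "K / (K + 1) * (r + s) = K / (K + 1) * r + K / (K + 1) * s" by (simp add: distrib_left)
          ultimately show ?thesis by linarith
        qed
        have "\<psi> K x - \<psi> K (x + s *\<^sub>R w) \<le> K / (K + 1) * s"
          unfolding \<psi>_def a b n using mx[of "b \<bullet> (x - m)"] by linarith
        moreover have "0 \<le> K / (K + 1) * s" using K(1) that by simp
        ultimately show ?thesis unfolding \<phi>_def by linarith
      qed
      show "0 \<le> K / (K + 1)" "K / (K + 1) < 1" using K(1) by auto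
      show "w \<noteq> 0" by (fact w0)
    qed
    show "h x = x" if "e \<in> E" "x \<in> seg e" for e x
      using K(2)[OF that] by (simp add: h_def \<phi>_def)
    show "h (linepath p q s) = (linepath p v +++ linepath v q) s" if s: "s \<in> {0..1}" for s
    proof -
      have lp: "linepath p q s - m = (s - 1/2) *\<^sub>R u"
        by (simp add: linepath_def m_def u_def prod_eq_iff field_simps)
      have "N (linepath p q s - m) = 0" unfolding lp N_def by (simp add: ab)
      then have "\<psi> K (linepath p q s) = 1 - 2 * \<bar>s - 1/2\<bar>"
        unfolding \<psi>_def by (simp add: lp ab)
      then have ph: "\<phi> (linepath p q s) = 1 - 2 * \<bar>s - 1/2\<bar>" 
        using s abs_le_iff[of "s - 1/2" "1/2"] unfolding \<phi>_def by (auto simp: max_def)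
      have v: "v = m + w" by (simp add: w_def)
      show ?thesis
      proof (cases "s \<le> 1/2")
        case True
        have f: "\<phi> (linepath p q s) = 2 * s" using ph True by simp
        show ?thesis unfolding h_def f using True
          by (simp add: joinpaths_def linepath_def v m_def prod_eq_iff field_simps)
      next
        case False
        have f: "\<phi> (linepath p q s) = 2 - 2 * s" using ph False by simp
        show ?thesis unfolding h_def f using False
          by (simp add: joinpaths_def linepath_def v m_def prod_eq_iff field_simps)
      qed
    qed
  qed
qed

section \<open>Triangle moves\<close>

text \<open>\<open>E\<close> stands for the rest of the link. That it does not contain the base
  \<open>p q\<close> follows, because the midpoint of the base lies in the triangle.\<close>

definition delta :: "arrow set \<Rightarrow> space \<Rightarrow> space \<Rightarrow> space \<Rightarrow> bool" where
  "delta E p q v \<longleftrightarrow> finite E \<and> (\<forall>e \<in> E. fst e \<noteq> snd e) \<and> \<not> collinear {p, q, v} \<and>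
     (\<forall>e \<in> E. tri p q v \<inter> seg e \<subseteq> {p, q} \<inter> {fst e, snd e})"

lemma triangle_sides:
  fixes p q v :: space
  assumes "\<not> collinear {p, q, v}"
  shows "closed_segment p v \<inter> closed_segment v q = {v}" "q \<notin> closed_segment p v" "p \<notin> closed_segment v q"
    "p \<noteq> q" "p \<noteq> v" "q \<noteq> v"
    "closed_segment p q \<subseteq> tri p q v" "closed_segment p v \<subseteq> tri p q v" "closed_segment v q \<subseteq> tri p q v"
proof -
  have "\<not> collinear {p, v, q}" using assms by (simp add: insert_commute)
  then show "closed_segment p v \<inter> closed_segment v q = {v}" by (intro Int_closed_segment disjI2)
  show "q \<notin> closed_segment p v"
  proof
    assume "q \<in> closed_segment p v"
    then have "{p, q, v} \<subseteq> closed_segment p v" by simp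
    then have "collinear {p, q, v}" by (rule collinear_subset[OF collinear_closed_segment])
    then show False using assms by blast
  qed
  show "p \<notin> closed_segment v q"
  proof
    assume "p \<in> closed_segment v q"
    then have "{p, q, v} \<subseteq> closed_segment v q" by simp
    then have "collinear {p, q, v}" by (rule collinear_subset[OF collinear_closed_segment])
    then show False using assms by blast
  qed
  show "p \<noteq> q" "p \<noteq> v" "q \<noteq> v" using assms by (auto simp: insert_commute)
  show "closed_segment p q \<subseteq> tri p q v" "closed_segment p v \<subseteq> tri p q v" "closed_segment v q \<subseteq> tri p q v"
    by (rule closed_segment_subset; simp add: hull_inc)+
qed

lemma delta_apex_new:
  assumes "delta E p q v" "e \<in> E"
  shows "fst e \<noteq> v" "snd e \<noteq> v"
proof -
  have *: "tri p q v \<inter> seg e \<subseteq> {p, q}" "\<not> collinear {p, q, v}" using assms by (auto simp: delta_def)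
  have "v \<in> tri p q v" by (simp add: hull_inc)
  then show "fst e \<noteq> v" "snd e \<noteq> v" using * triangle_sides(5,6)[OF *(2)] by (auto simp: seg_def)
qed

lemma delta_base_new:
  assumes "delta E p q v" 
  shows "(p, q) \<notin> E" "(q, p) \<notin> E"
proof -
  have nc: "\<not> collinear {p, q, v}" using assms by (simp add: delta_def)
  have "midpoint p q \<in> closed_segment p q" "midpoint p q \<in> closed_segment q p"
    by (auto simp: closed_segment_commute)
  moreover have "midpoint p q \<noteq> p" "midpoint p q \<noteq> q" using triangle_sides(4)[OF nc] by auto
  ultimately show "(p, q) \<notin> E" "(q, p) \<notin> E"
    using assms triangle_sides(7)[OF nc] unfolding delta_def seg_def by fastforce+
qed

text \<open>Segments of \<open>E\<close> meet the three sides only in \<open>p\<close> or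
  \<open>q\<close>, and the apex is a new vertex with one arrow in and one arrow out, so the
  conditions on a link agree on both sides. Moves are made in both directions, hence the
  equivalence.\<close>

lemma delta_link:
  assumes d: "delta E p q v"
  shows "link (insert (p, q) E) \<longleftrightarrow> link (insert (p, v) (insert (v, q) E))" (is "link ?L \<longleftrightarrow> link ?R")
proof -
  have nc: "\<not> collinear {p, q, v}" and fin: "finite E"
    and t: "\<And>e. e \<in> E \<Longrightarrow> tri p q v \<inter> seg e \<subseteq> {p, q} \<inter> {fst e, snd e}" using d by (auto simp: delta_def)
  note ts = triangle_sides[OF nc]
  have v: "v \<notin> fst ` E" "v \<notin> snd ` E" using delta_apex_new[OF d] by blast+
  note new = delta_base_new[OF d]
  have new': "(p, v) \<notin> E" "(v, q) \<notin> E" using v by force+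
  have 1: "inj_on fst ?L \<longleftrightarrow> inj_on fst E \<and> p \<notin> fst ` E" using new by (simp add: insert_absorb)
  have 2: "inj_on snd ?L \<longleftrightarrow> inj_on snd E \<and> q \<notin> snd ` E" using new by (simp add: insert_absorb)
  have 3: "inj_on fst ?R \<longleftrightarrow> inj_on fst E \<and> p \<notin> fst ` E" using new' v ts(4-6) by (auto simp: inj_on_insert)
  have 4: "inj_on snd ?R \<longleftrightarrow> inj_on snd E \<and> q \<notin> snd ` E" using new' v ts(4-6) by (auto simp: inj_on_insert)
  have 5: "fst ` ?L = snd ` ?L \<longleftrightarrow> fst ` ?R = snd ` ?R"
  proof -
    have im: "fst ` ?L = insert p (fst ` E)" "snd ` ?L = insert q (snd ` E)"
      "fst ` ?R = insert v (insert p (fst ` E))" "snd ` ?R = insert v (insert q (snd ` E))" by auto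
    have "v \<notin> insert p (fst ` E)" "v \<notin> insert q (snd ` E)" using v ts(5,6) by auto
    from insert_ident[OF this] show ?thesis unfolding im by (rule sym)
  qed
  define pw where "pw F \<longleftrightarrow> (\<forall>e \<in> F. \<forall>f \<in> F. e \<noteq> f \<longrightarrow> seg e \<inter> seg f \<subseteq> {fst e, snd e} \<inter> {fst f, snd f})" for F
  have ins: "pw (insert e F) \<longleftrightarrow> pw F" if "\<And>f. f \<in> F \<Longrightarrow> seg e \<inter> seg f \<subseteq> {fst e, snd e} \<inter> {fst f, snd f}" for e F
  proof -
    have "seg f \<inter> seg e \<subseteq> {fst f, snd f} \<inter> {fst e, snd e}" if "f \<in> F" for f
      using \<open>\<And>f. f \<in> F \<Longrightarrow> seg e \<inter> seg f \<subseteq> {fst e, snd e} \<inter> {fst f, snd f}\<close>[OF that] by (simp add: Int_commute)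
    then show ?thesis unfolding pw_def using that by (simp only: ball_simps) blast
  qed
  have 6: "pw ?L \<longleftrightarrow> pw E"
  proof (rule ins)
    fix f assume f: "f \<in> E"
    have "seg (p, q) \<subseteq> tri p q v" using ts(7) by (simp add: seg_def)
    then show "seg (p, q) \<inter> seg f \<subseteq> {fst (p, q), snd (p, q)} \<inter> {fst f, snd f}" using t[OF f] by (simp only: fst_conv snd_conv) blast
  qed
  have 7: "pw ?R \<longleftrightarrow> pw (insert (v, q) E)"
  proof (rule ins)
    fix f assume f: "f \<in> insert (v, q) E"
    show "seg (p, v) \<inter> seg f \<subseteq> {fst (p, v), snd (p, v)} \<inter> {fst f, snd f}"
    proof (cases "f = (v, q)")
      case True
      then show ?thesis using ts(1) by (simp add: seg_def)
    next
      case False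
      then have "f \<in> E" using f by simp
      moreover have "seg (p, v) \<subseteq> tri p q v" "q \<notin> seg (p, v)" using ts by (simp_all add: seg_def)
      ultimately show ?thesis using t by (simp only: fst_conv snd_conv) blast
    qed
  qed
  have 8: "pw (insert (v, q) E) \<longleftrightarrow> pw E"
  proof (rule ins)
    fix f assume f: "f \<in> E"
    have "seg (v, q) \<subseteq> tri p q v" "p \<notin> seg (v, q)" using ts by (simp_all add: seg_def)
    then show "seg (v, q) \<inter> seg f \<subseteq> {fst (v, q), snd (v, q)} \<inter> {fst f, snd f}" using t[OF f] by (simp only: fst_conv snd_conv) blast
  qed
  have 9: "(\<forall>(p, q) \<in> ?L. p \<noteq> q) \<longleftrightarrow> (\<forall>(p, q) \<in> ?R. p \<noteq> q)" using ts(4-6) by auto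
  show ?thesis
    unfolding link_def pw_def[symmetric] 1 2 3 4 5 6 7 8 9 by (simp add: fin)
qed

lemma plink_component:
  assumes "plink Ps" "(p, q) \<in> arrows Ps"
  obtains ps k rest where "ps \<in> Ps" "rotate k ps = p # q # rest" "rest \<noteq> []"
proof -
  obtain ps where ps: "ps \<in> Ps" "(p, q) \<in> cyc ps" using assms(2) by (auto simp: arrows_cyc)
  have l: "3 \<le> length ps" using assms(1) ps(1) by (auto simp: plink_def)
  obtain k rest where r: "rotate k ps = p # q # rest" using cyc_rotate_to[OF ps(2)] l by auto
  have "length (rotate k ps) = length ps" by simp
  then have "rest \<noteq> []" unfolding r using l by auto
  then show ?thesis using that[OF ps(1) r] by blast
qed

lemma plink_others:
  assumes "plink Ps" "ps \<in> Ps" "x \<in> set ps"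
  shows "(x, y) \<notin> arrows (Ps - {ps})"
proof
  assume "(x, y) \<in> arrows (Ps - {ps})"
  then obtain qs where qs: "qs \<in> Ps - {ps}" "(x, y) \<in> cyc qs" unfolding arrows_cyc by blast
  note qs = qs(1) cyc_in[OF qs(2), THEN conjunct1]
  have "pairwise (\<lambda>ps qs. disjnt (set ps) (set qs)) Ps" using assms(1) by (simp add: plink_def)
  then have "disjnt (set ps) (set qs)" by (rule pairwiseD) (use assms(2) qs(1) in auto)
  then show False using assms(3) qs(2) by (auto simp: disjnt_def)
qed

lemma plink_vertices_disjoint:
  assumes "plink Ps" "ps \<in> Ps"
  shows "set ps \<inter> \<Union> (set ` (Ps - {ps})) = {}"
proof -
  have pw: "pairwise (\<lambda>ps qs. disjnt (set ps) (set qs)) Ps" using assms(1) by (simp add: plink_def)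
  have "disjnt (set ps) (set qs)" if "qs \<in> Ps - {ps}" for qs
    by (rule pairwiseD[OF pw]) (use assms(2) that in auto)
  then show ?thesis by (auto simp: disjnt_def)
qed

text \<open>The passage to two sides is the push across the triangle; the passage back uses the
  isotopy whose final map \<open>g\<close> undoes \<open>h\<close>.\<close>

lemma delta_deforms:
  assumes d: "delta E p q v" and L: "link (insert (p, q) E)"
  shows "deforms (insert (p, q) E) (insert (p, v) (insert (v, q) E))"
    and "deforms (insert (p, v) (insert (v, q) E)) (insert (p, q) E)"
proof -
  let ?L = "insert (p, q) E" and ?R = "insert (p, v) (insert (v, q) E)"
  have R: "link ?R" using delta_link[OF d] L by blast
  have nc: "\<not> collinear {p, q, v}" and fin: "finite E" and nd: "\<And>e. e \<in> E \<Longrightarrow> fst e \<noteq> snd e"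
    and t: "\<And>e. e \<in> E \<Longrightarrow> tri p q v \<inter> seg e \<subseteq> {p, q} \<inter> {fst e, snd e}" using d by (auto simp: delta_def)
  note ts = triangle_sides[OF nc]
  have v: "v \<notin> fst ` E" "v \<notin> snd ` E" using delta_apex_new[OF d] by blast+
  note new = delta_base_new[OF d]
  have new': "(p, v) \<notin> E" "(v, q) \<notin> E" using v by force+
  obtain h where h: "isoend h" "\<And>e x. e \<in> E \<Longrightarrow> x \<in> seg e \<Longrightarrow> h x = x"
    "\<And>s. s \<in> {0..1} \<Longrightarrow> h (linepath p q s) = (linepath p v +++ linepath v q) s"
    using apex_isotopy[OF nc fin nd t] by blast
  obtain g where g: "isoend g" "\<And>x. g (h x) = x" using isoend_inverse[OF h(1)] by blast
  have g2: "g x = x" if "e \<in> E" "x \<in> seg e" for e x using g(2)[of x] h(2)[OF that] by simp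
  have verts: "fst ` arrows Qs = \<Union> (set ` Qs)" for Qs
    unfolding arrows_cyc image_UN cyc_fst by (rule refl)
  show "deforms ?L ?R"
    unfolding deforms_def
  proof (intro allI impI, elim conjE)
    fix Ps assume Ps: "plink Ps" "arrows Ps = ?L"
    obtain ps k rest where ps: "ps \<in> Ps" "rotate k ps = p # q # rest" "rest \<noteq> []"
      using plink_component[OF Ps(1), of p q] Ps(2) by auto
    have dist: "distinct (p # q # rest)" and setps: "set ps = set (p # q # rest)"
      unfolding ps(2)[symmetric] using Ps(1) ps(1) by (auto simp: plink_def)
    have cyl: "cyc ps = insert (p, q) (edges (q # rest @ [p]))"
      using cyc_Cons[of p "q # rest"] cyc_rotate[of k ps] by (simp add: ps(2))
    have ne: "(p, q) \<notin> edges (q # rest @ [p])"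
      using edges_subset[of p q "q # rest @ [p]"] dist by auto
    have E0: "E = edges (q # rest @ [p]) \<union> arrows (Ps - {ps})"
    proof -
      have "?L = insert (p, q) (edges (q # rest @ [p])) \<union> arrows (Ps - {ps})"
        using Ps(2) arrows_insert_remove[OF ps(1)] cyl by simp
      moreover have "(p, q) \<notin> edges (q # rest @ [p]) \<union> arrows (Ps - {ps})"
        using ne plink_others[OF Ps(1) ps(1), of p q] setps by simp
      ultimately show ?thesis using new(1) by (simp add: insert_ident)
    qed
    have vn: "v \<notin> set ps" "v \<notin> \<Union> (set ` (Ps - {ps}))"
    proof -
      have "v \<notin> fst ` ?L" using v ts(5) by simp
      then have "v \<notin> \<Union> (set ` Ps)" unfolding verts[of Ps, symmetric] Ps(2) .
      then show "v \<notin> set ps" "v \<notin> \<Union> (set ` (Ps - {ps}))" using ps(1) by blast+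
    qed
    show "\<exists>Ps' h f. plink Ps' \<and> arrows Ps' = ?R \<and> isoend h \<and> bij_betw f Ps Ps' \<and>
        (\<forall>ps \<in> Ps. same_loop (h \<circ> polygon ps) (polygon (f ps)))"
    proof (rule deforms_replace[OF Ps(1) ps(1,2), where ys = "p # v # q # rest"])
      show "distinct (p # v # q # rest)" using dist vn(1) setps by auto
      show "3 \<le> length (p # v # q # rest)" by simp
      have "set (p # v # q # rest) = insert v (set ps)" using setps by auto
      then show "set (p # v # q # rest) \<inter> \<Union> (set ` (Ps - {ps})) = {}"
        using plink_vertices_disjoint[OF Ps(1) ps(1)] vn(2) by simp
      show "link ?R" by fact
      show "cyc (p # v # q # rest) \<union> arrows (Ps - {ps}) = ?R"
        unfolding cyc_Cons E0 by auto
      show "isoend h" by fact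
      show "h x = x" if "e \<in> arrows (Ps - {ps})" "x \<in> seg e" for e x using h(2)[of e x] that E0 by simp
      show "same_loop (h \<circ> polygon (p # q # rest)) (polygon (p # v # q # rest))"
      proof (rule polygon_apex[OF ps(3)])
        show "h x = x" if "e \<in> edges (q # rest @ [p])" "x \<in> seg e" for e x
          using h(2)[of e x] that E0 by simp
      qed (fact h(3))
    qed
  qed
  show "deforms ?R ?L"
    unfolding deforms_def
  proof (intro allI impI, elim conjE)
    fix Ps assume Ps: "plink Ps" "arrows Ps = ?R"
    obtain ps k rest' where ps: "ps \<in> Ps" "rotate k ps = p # v # rest'" "rest' \<noteq> []"
      using plink_component[OF Ps(1), of p v] Ps(2) by auto
    obtain q' rest where rest': "rest' = q' # rest" using ps(3) by (cases rest') auto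
    have cyl0: "cyc ps = edges (p # v # q' # rest @ [p])"
      using cyc_Cons[of p "v # q' # rest"] cyc_rotate[of k ps] by (simp add: ps(2) rest')
    have sub: "cyc ps \<subseteq> ?R" using Ps(2) ps(1) by (auto simp: arrows_cyc)
    \<comment> \<open>No arrow of \<open>E\<close> starts in \<open>v\<close>, so \<open>v\<close>
      can only be followed by \<open>q\<close>.\<close>
    have "(v, q') \<in> ?R" using cyl0 sub by auto
    then have q': "q' = q" using v(1) ts(5) by force
    \<comment> \<open>If the component were the triangle itself, \<open>E\<close> would contain the
      base in the direction from \<open>q\<close> to \<open>p\<close>.\<close>
    have "rest \<noteq> []"
    proof
      assume "rest = []"
      then have "(q, p) \<in> ?R" using cyl0 q' sub by auto
      then show False using new(2) ts(4-6) by auto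
    qed
    note ps = ps(1) ps(2)[unfolded rest' q'] this
    have dist: "distinct (p # v # q # rest)" and setps: "set ps = set (p # v # q # rest)"
      unfolding ps(2)[symmetric] using Ps(1) ps(1) by (auto simp: plink_def)
    have cyl: "cyc ps = insert (p, v) (insert (v, q) (edges (q # rest @ [p])))"
      unfolding cyl0 q' by simp
    have ne: "(p, v) \<notin> edges (q # rest @ [p])" "(v, q) \<notin> edges (q # rest @ [p])"
      using edges_subset[of p v "q # rest @ [p]"] edges_subset[of v q "q # rest @ [p]"] dist by auto
    have E0: "E = edges (q # rest @ [p]) \<union> arrows (Ps - {ps})"
    proof -
      have "?R = insert (p, v) (insert (v, q) (edges (q # rest @ [p]) \<union> arrows (Ps - {ps})))"
        using Ps(2) arrows_insert_remove[OF ps(1)] cyl by simp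
      moreover have "(p, v) \<notin> edges (q # rest @ [p]) \<union> arrows (Ps - {ps})" "(v, q) \<notin> edges (q # rest @ [p]) \<union> arrows (Ps - {ps})"
        using ne plink_others[OF Ps(1) ps(1), of p v] plink_others[OF Ps(1) ps(1), of v q] setps by simp_all
      moreover have "(p, v) \<notin> insert (v, q) E" "(p, v) \<noteq> (v, q)" using new' ts(5) by auto
      ultimately show ?thesis using new' by (simp add: insert_ident)
    qed
    show "\<exists>Ps' h f. plink Ps' \<and> arrows Ps' = ?L \<and> isoend h \<and> bij_betw f Ps Ps' \<and>
        (\<forall>ps \<in> Ps. same_loop (h \<circ> polygon ps) (polygon (f ps)))"
    proof (rule deforms_replace[OF Ps(1) ps(1,2), where ys = "p # q # rest"])
      show "distinct (p # q # rest)" using dist by auto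
      show "3 \<le> length (p # q # rest)" using ps(3) by (cases rest) auto
      have "set (p # q # rest) \<subseteq> set ps" using setps by auto
      then show "set (p # q # rest) \<inter> \<Union> (set ` (Ps - {ps})) = {}"
        using plink_vertices_disjoint[OF Ps(1) ps(1)] by blast
      show "link ?L" by fact
      show "cyc (p # q # rest) \<union> arrows (Ps - {ps}) = ?L"
        unfolding cyc_Cons E0 by auto
      show "isoend g" by fact
      show "g x = x" if "e \<in> arrows (Ps - {ps})" "x \<in> seg e" for e x using g2[of e x] that E0 by simp
      have "same_loop (h \<circ> polygon (p # q # rest)) (polygon (p # v # q # rest))"
      proof (rule polygon_apex[OF ps(3)])
        show "h x = x" if "e \<in> edges (q # rest @ [p])" "x \<in> seg e" for e x
          using h(2)[of e x] that E0 by simp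
      qed (fact h(3))
      then have "same_loop (g \<circ> (h \<circ> polygon (p # q # rest))) (g \<circ> polygon (p # v # q # rest))"
        by (rule same_loop_comp)
      moreover have "g \<circ> (h \<circ> polygon (p # q # rest)) = polygon (p # q # rest)" by (simp only: o_def g(2))
      ultimately show "same_loop (g \<circ> polygon (p # v # q # rest)) (polygon (p # q # rest))"
        by (simp only: same_loop_sym)
    qed
  qed
qed

definition drel :: "arrow set \<Rightarrow> arrow set \<Rightarrow> bool" where
  "drel L R \<longleftrightarrow> (\<exists>E p q v. delta E p q v \<and> L = insert (p, q) E \<and> R = insert (p, v) (insert (v, q) E))"

text \<open>With the equivalence closure two links can be compared by moving both of them to a third
  one.\<close>

lemma equivclp_drel_deforms:
  assumes "equivclp drel L R"
  shows "link L \<Longrightarrow> link R \<and> deforms L R"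
  using assms unfolding equivclp_def
proof (induction rule: rtranclp_induct)
  case base
  then show ?case by (simp add: deforms_refl)
next
  case (step y z)
  then have y: "link y" "deforms L y" by auto
  consider "drel y z" | "drel z y" using step(2) by (auto simp: symclp_def)
  then have "link z \<and> deforms y z"
  proof cases
    case 1
    then show ?thesis using y(1) delta_link delta_deforms(1) unfolding drel_def by metis
  next
    case 2
    then show ?thesis using y(1) delta_link delta_deforms(2) unfolding drel_def by metis
  qed
  then show ?case using y deforms_trans by blast
qed

section \<open>Cones whose apex is far below the link\<close>

text \<open>At a forbidden coincidence \<open>x\<close> is not above \<open>y\<close>, so by
  compactness the projections of \<open>x\<close> and \<open>y\<close> are at least
  \<open>\<epsilon>\<close> apart. The horizontal displacement is at most \<open>2 * C * l\<close>,
  which bounds \<open>l\<close> from below, and then the drop \<open>l * (N + snd z)\<close> is too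
  large for the bounded sets. The direction is taken from a point \<open>z\<close> that may differ
  from the start \<open>y\<close> of the ray, so that the lemma serves cones with the apex
  (\<open>z = y\<close>) as well as parallel rays.\<close>

lemma deep_avoid:
  fixes K A B :: "space set" and c :: plane
  assumes "compact K" "compact A" "compact B"
    and above: "\<And>x y. x \<in> K \<Longrightarrow> y \<in> A \<Longrightarrow> fst x = fst y \<Longrightarrow> snd y < snd x"
  shows "\<forall>\<^sub>F N in at_top. \<forall>x \<in> K. \<forall>y \<in> A. \<forall>z \<in> B. \<forall>l \<ge> 0. x \<noteq> y + l *\<^sub>R ((c, - N) - z)"
proof -
  define Z where "Z = (K \<times> A) \<inter> {w. snd (fst w) \<le> snd (snd w)}"
  have "compact Z"
    unfolding Z_def by (intro compact_Int_closed compact_Times assms closed_Collect_le continuous_intros)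
  obtain \<epsilon> where \<epsilon>: "\<epsilon> > 0" "\<And>x y. x \<in> K \<Longrightarrow> y \<in> A \<Longrightarrow> snd x \<le> snd y \<Longrightarrow> \<epsilon> \<le> dist (fst x) (fst y)"
  proof (cases "Z = {}")
    case True
    then show ?thesis by (intro that[of 1]) (auto simp: Z_def)
  next
    case False
    have "continuous_on Z (\<lambda>w. dist (fst (fst w)) (fst (snd w)))" by (intro continuous_intros)
    then obtain w where w: "w \<in> Z" "\<And>u. u \<in> Z \<Longrightarrow> dist (fst (fst w)) (fst (snd w)) \<le> dist (fst (fst u)) (fst (snd u))"
      using continuous_attains_inf[OF \<open>compact Z\<close> False] by blast
    have "fst w \<in> K" "snd w \<in> A" "snd (fst w) \<le> snd (snd w)" using w(1) by (auto simp: Z_def)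
    then have "0 < dist (fst (fst w)) (fst (snd w))" using above[of "fst w" "snd w"] by fastforce
    moreover have "dist (fst (fst w)) (fst (snd w)) \<le> dist (fst x) (fst y)" if "x \<in> K" "y \<in> A" "snd x \<le> snd y" for x y
      using w(2)[of "(x, y)"] that by (simp add: Z_def)
    ultimately show ?thesis using that by blast
  qed
  have "bounded (K \<union> A \<union> B \<union> {(c, 0)})" using assms by (simp add: compact_imp_bounded)
  then obtain C where C: "C > 0" "\<And>x. x \<in> K \<union> A \<union> B \<union> {(c, 0)} \<Longrightarrow> norm x \<le> C"
    unfolding bounded_pos by blast
  have sC: "\<bar>snd x\<bar> \<le> C" "norm (fst x) \<le> C" if "x \<in> K \<union> A \<union> B \<union> {(c, 0)}" for x
    using C(2)[OF that] norm_snd_le[of "snd x" "fst x"] norm_fst_le[of "fst x" "snd x"] by auto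
  show ?thesis
    unfolding eventually_at_top_linorder
  \<comment> \<open>The bound makes the drop exceed \<open>2 * C\<close>, the greatest possible
    difference of heights.\<close>
  proof (intro exI[of _ "C + 4 * C * C / \<epsilon> + 1"] allI impI ballI notI)
    fix N x y z l assume N: "C + 4 * C * C / \<epsilon> + 1 \<le> N" and mem: "x \<in> K" "y \<in> A" "z \<in> B" and l: "0 \<le> (l::real)"
      and eq: "x = y + l *\<^sub>R ((c, - N) - z)"
    have b: "\<bar>snd x\<bar> \<le> C" "\<bar>snd y\<bar> \<le> C" "\<bar>snd z\<bar> \<le> C" "norm (fst z) \<le> C" "norm c \<le> C"
      using sC[of x] sC[of y] sC[of z] sC[of "(c, 0)"] mem by auto
    have s: "snd y - snd x = l * (N + snd z)" unfolding eq by (simp add: algebra_simps)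
    have q: "0 \<le> 4 * C * C / \<epsilon>" using C \<epsilon> by simp
    have "0 \<le> N - C" "0 \<le> N + snd z" "N - C \<le> N + snd z" using N b q by auto
    then have "snd x \<le> snd y" using s l mult_nonneg_nonneg[of l "N + snd z"] by linarith
    then have "\<epsilon> \<le> dist (fst x) (fst y)" using \<epsilon>(2) mem by blast
    also have "\<dots> = l * norm (c - fst z)" unfolding eq dist_norm using l by simp
    also have "\<dots> \<le> l * (2 * C)" using b l norm_triangle_ineq4[of c "fst z"] by (intro mult_left_mono) auto
    finally have l2: "\<epsilon> / (2 * C) \<le> l" using C(1) by (simp add: field_simps)
    have "\<epsilon> / (2 * C) * (4 * C * C / \<epsilon> + 1) \<le> l * (N + snd z)"
      using l l2 N b q \<epsilon>(1) C(1) by (intro mult_mono) auto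
    also have "\<dots> \<le> 2 * C" using s b by linarith
    finally have "\<epsilon> / (2 * C) * (4 * C * C / \<epsilon> + 1) \<le> 2 * C" .
    moreover have "\<epsilon> / (2 * C) * (4 * C * C / \<epsilon> + 1) = 2 * C + \<epsilon> / (2 * C)"
      using \<epsilon>(1) C(1) by (simp add: field_simps)
    moreover have "0 < \<epsilon> / (2 * C)" using \<epsilon>(1) C(1) by simp
    ultimately show False by linarith
  qed
qed

lemma in_tri: "x \<in> tri v p q \<longleftrightarrow> (\<exists>a b d. 0 \<le> a \<and> 0 \<le> b \<and> 0 \<le> d \<and> a + b + d = 1 \<and> x = a *\<^sub>R v + b *\<^sub>R p + d *\<^sub>R q)"
  unfolding convex_hull_3 by blast

lemma in_tri_cone:
  fixes v p r :: "'a :: real_vector"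
  assumes "x \<in> tri v p r"
  obtains y l where "y \<in> closed_segment p r" "0 \<le> l" "l \<le> 1" "x = y + l *\<^sub>R (v - y)"
proof -
  obtain a b d where *: "0 \<le> a" "0 \<le> b" "0 \<le> d" "a + b + d = 1" "x = a *\<^sub>R v + b *\<^sub>R p + d *\<^sub>R r"
    using assms unfolding in_tri by blast
  show ?thesis
  proof (cases "b + d = 0")
    case True
    then have "b = 0" "d = 0" "a = 1" using * by linarith+
    then show ?thesis using *(5) by (intro that[of p 1]) auto
  next
    case False
    define t where "t = d / (b + d)"
    have t: "0 \<le> t" "t \<le> 1" "(b + d) * t = d" "(b + d) * (1 - t) = b" using * False by (auto simp: t_def field_simps)
    have "x = a *\<^sub>R v + (b + d) *\<^sub>R ((1 - t) *\<^sub>R p + t *\<^sub>R r)"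
      unfolding *(5) scaleR_add_right scaleR_scaleR t by (simp add: add.assoc)
    moreover have "b + d = 1 - a" using * by simp
    ultimately have "x = ((1 - t) *\<^sub>R p + t *\<^sub>R r) + a *\<^sub>R (v - ((1 - t) *\<^sub>R p + t *\<^sub>R r))"
      by (simp add: algebra_simps)
    moreover have "(1 - t) *\<^sub>R p + t *\<^sub>R r \<in> closed_segment p r" using t unfolding in_segment by blast
    ultimately show ?thesis using * by (intro that) auto
  qed
qed

lemma deep_avoid_disjoint:
  fixes K :: "space set" and p r :: space
  assumes "compact K"
    and "\<And>x y. x \<in> K \<Longrightarrow> y \<in> closed_segment p r \<Longrightarrow> fst x = fst y \<Longrightarrow> snd y < snd x"
  shows "\<forall>\<^sub>F N in at_top. tri (c, - N) p r \<inter> K = {}"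
proof -
  have "\<forall>\<^sub>F N in at_top. \<forall>x \<in> K. \<forall>y \<in> closed_segment p r. \<forall>z \<in> closed_segment p r. \<forall>l \<ge> 0. x \<noteq> y + l *\<^sub>R ((c, - N) - z)"
    by (rule deep_avoid) (use assms in auto)
  then show ?thesis
  proof eventually_elim
    case (elim N)
    then show ?case using in_tri_cone by (metis disjoint_iff)
  qed
qed

lemma cone_shift:
  fixes v :: "'a :: real_vector"
  assumes "x - v = k *\<^sub>R (b - v)"
  shows "x = b + (1 - k) *\<^sub>R (v - b)"
proof -
  have "x = v + k *\<^sub>R (b - v)" using assms by (metis add.commute diff_add_cancel)
  then show ?thesis by (simp add: algebra_simps)
qed

text \<open>Strict order of heights fails at the common end \<open>p\<close>. A homothety with
  centre \<open>p\<close> enlarges a common point of triangle and segment until it reaches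
  \<open>q\<close> on the segment, or until its foot on the base reaches \<open>r\<close>. In each
  case one of the two compared sets is a single point away from \<open>p\<close>, and the rays are
  parallel to \<open>v - p\<close>.\<close>

lemma deep_avoid_shared:
  fixes p q r :: space
  assumes ne: "q \<noteq> p" "r \<noteq> p"
    and above: "\<And>x y. x \<in> closed_segment p q \<Longrightarrow> y \<in> closed_segment p r \<Longrightarrow> fst x = fst y \<Longrightarrow>
      x = p \<and> y = p \<or> snd y < snd x"
  shows "\<forall>\<^sub>F N in at_top. tri (c, - N) p r \<inter> closed_segment p q \<subseteq> {p}"
proof -
  have 1: "\<forall>\<^sub>F N in at_top. \<forall>x \<in> {q}. \<forall>y \<in> closed_segment p r. \<forall>z \<in> {p}. \<forall>l \<ge> 0. x \<noteq> y + l *\<^sub>R ((c, - N) - z)"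
  proof (rule deep_avoid)
    fix x y assume "x \<in> {q}" "y \<in> closed_segment p r" "fst x = fst y"
    then show "snd y < snd x" using above[of q y] ne(1) by (simp only: singleton_iff ends_in_segment) blast
  qed auto
  have 2: "\<forall>\<^sub>F N in at_top. \<forall>x \<in> closed_segment p q. \<forall>y \<in> {r}. \<forall>z \<in> {p}. \<forall>l \<ge> 0. x \<noteq> y + l *\<^sub>R ((c, - N) - z)"
  proof (rule deep_avoid)
    fix x y assume "x \<in> closed_segment p q" "y \<in> {r}" "fst x = fst y"
    then show "snd y < snd x" using above[of x r] ne(2) by (simp only: singleton_iff ends_in_segment) blast
  qed auto
  from 1 2 show ?thesis
  proof eventually_elim
    case (elim N)
    define v where "v = (c, - N)"
    note elim = elim[folded v_def]
    show ?case unfolding v_def[symmetric]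
    proof (rule subsetI, rule ccontr)
      fix x assume x: "x \<in> tri v p r \<inter> closed_segment p q" "x \<notin> {p}"
      obtain \<mu> where \<mu>: "0 \<le> \<mu>" "\<mu> \<le> 1" "x = (1 - \<mu>) *\<^sub>R p + \<mu> *\<^sub>R q" using x(1) unfolding Int_iff in_segment by blast
      have xm: "x - p = \<mu> *\<^sub>R (q - p)" unfolding \<mu>(3) by (simp add: algebra_simps)
      have "\<mu> \<noteq> 0" using xm x(2) by auto
      then have \<mu>0: "0 < \<mu>" using \<mu> by simp
      obtain a b d where *: "0 \<le> a" "0 \<le> b" "0 \<le> d" "a + b + d = 1" "x = a *\<^sub>R v + b *\<^sub>R p + d *\<^sub>R r"
        using x(1) unfolding Int_iff in_tri by blast
      have b: "b = 1 - a - d" using * by simp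
      have xa: "x - p = a *\<^sub>R (v - p) + d *\<^sub>R (r - p)" unfolding *(5) b by (simp add: algebra_simps)
      show False
      proof (cases "d \<le> \<mu>")
        case True
        have "q - p = (1 / \<mu>) *\<^sub>R (x - p)" unfolding xm using \<mu>0 by simp
        also have "\<dots> = (a / \<mu>) *\<^sub>R (v - p) + (d / \<mu>) *\<^sub>R (r - p)" unfolding xa scaleR_add_right scaleR_scaleR by simp
        finally have "q = (p + (d / \<mu>) *\<^sub>R (r - p)) + (a / \<mu>) *\<^sub>R (v - p)" by (simp add: algebra_simps)
        moreover have "p + (d / \<mu>) *\<^sub>R (r - p) \<in> closed_segment p r"
          unfolding in_segment using True * \<mu>0 by (intro exI[of _ "d / \<mu>"]) (simp add: algebra_simps)
        moreover have "0 \<le> a / \<mu>" using * \<mu>0 by simp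
        ultimately show False using elim(1) by blast
      next
        case False
        then have d: "0 < d" using \<mu> by simp
        have "(\<mu> / d) *\<^sub>R (q - p) = (1 / d) *\<^sub>R (x - p)" unfolding xm by simp
        also have "\<dots> = (a / d) *\<^sub>R (v - p) + (r - p)" unfolding xa scaleR_add_right scaleR_scaleR using d by simp
        finally have "p + (\<mu> / d) *\<^sub>R (q - p) = r + (a / d) *\<^sub>R (v - p)" by (simp add: algebra_simps)
        moreover have "p + (\<mu> / d) *\<^sub>R (q - p) \<in> closed_segment p q"
          unfolding in_segment using False d \<mu>0 by (intro exI[of _ "\<mu> / d"]) (simp add: algebra_simps)
        moreover have "0 \<le> a / d" using * d by simp
        ultimately show False using elim(2) by blast
      qed
    qed
  qed
qed

text \<open>The projections determine the absolute value of the ratio \<open>k\<close>, and this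
  bounds the height of the third point independently of \<open>N\<close>.\<close>

lemma deep_not_collinear:
  fixes x y :: space
  assumes "fst x \<noteq> fst y"
  shows "\<forall>\<^sub>F N in at_top. \<not> collinear {(c, - N), x, y}"
proof -
  define n where "n = norm (fst y - fst x)"
  have n: "0 < n" using assms by (simp add: n_def)
  define M where "M = \<bar>snd x\<bar> + norm (c - fst x) / n * \<bar>snd y - snd x\<bar> + 1"
  show ?thesis
    unfolding eventually_at_top_linorder
  proof (intro exI[of _ M] allI impI notI)
    fix N assume N: "M \<le> N" and col: "collinear {(c, - N), x, y}"
    have "collinear {0, (c, - N) - x, y - x}" using col collinear_3[of "(c, - N)" x y] by simp
    then have "collinear {0, y - x, (c, - N) - x}" by (simp add: insert_commute)
    moreover have "y - x \<noteq> 0" using assms by auto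
    ultimately obtain k where k: "(c, - N) - x = k *\<^sub>R (y - x)"
      unfolding collinear_lemma by (metis scaleR_zero_left)
    have 1: "c - fst x = k *\<^sub>R (fst y - fst x)" using arg_cong[OF k, of fst] by simp
    have 2: "- N - snd x = k * (snd y - snd x)" using arg_cong[OF k, of snd] by simp
    have "norm (c - fst x) = \<bar>k\<bar> * n" unfolding 1 n_def by simp
    then have k': "\<bar>k\<bar> = norm (c - fst x) / n" using n by (simp add: field_simps)
    have "N \<le> \<bar>snd x\<bar> + \<bar>k * (snd y - snd x)\<bar>" using 2 by linarith
    also have "\<dots> = M - 1" unfolding abs_mult k' M_def by simp
    finally show False using N by simp
  qed
qed

text \<open>Scaling from the apex turns a second common point into one of two coincidences:
  \<open>x0\<close> lies on a segment from the base to the apex, or a point of the base lies on the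
  segment from \<open>x0\<close> to the apex. A deep apex excludes both, as the projections of
  \<open>x0\<close> and of the base are disjoint.\<close>

lemma deep_apex_side:
  fixes x0 x y :: space
  assumes "\<And>b. b \<in> closed_segment x y \<Longrightarrow> fst x0 \<noteq> fst b"
  shows "\<forall>\<^sub>F N in at_top. tri (c, - N) x y \<inter> closed_segment x0 (c, - N) \<subseteq> {(c, - N)}"
proof -
  have 1: "\<forall>\<^sub>F N in at_top. \<forall>u \<in> {x0}. \<forall>w \<in> closed_segment x y. \<forall>z \<in> closed_segment x y. \<forall>l \<ge> 0. u \<noteq> w + l *\<^sub>R ((c, - N) - z)"
    by (rule deep_avoid) (use assms in auto)
  have 2: "\<forall>\<^sub>F N in at_top. \<forall>u \<in> closed_segment x y. \<forall>w \<in> {x0}. \<forall>z \<in> {x0}. \<forall>l \<ge> 0. u \<noteq> w + l *\<^sub>R ((c, - N) - z)"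
    by (rule deep_avoid) (use assms in fastforce)+
  from 1 2 show ?thesis
  proof eventually_elim
    case (elim N)
    define v where "v = (c, - N)"
    note elim = elim[folded v_def]
    show ?case unfolding v_def[symmetric]
    proof (rule subsetI, rule ccontr)
      fix z assume z: "z \<in> tri v x y \<inter> closed_segment x0 v" "z \<notin> {v}"
      obtain b l where b: "b \<in> closed_segment x y" "0 \<le> l" "l \<le> 1" "z = b + l *\<^sub>R (v - b)"
        using z(1) in_tri_cone by blast
      obtain m where m: "0 \<le> m" "m \<le> 1" "z = (1 - m) *\<^sub>R x0 + m *\<^sub>R v" using z(1) unfolding Int_iff in_segment by blast
      have zb: "z - v = (1 - l) *\<^sub>R (b - v)" unfolding b(4) by (simp add: algebra_simps)
      have zm: "z - v = (1 - m) *\<^sub>R (x0 - v)" unfolding m(3) by (simp add: algebra_simps)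
      have l1: "0 < 1 - l" using zb z(2) b(3) by (cases "l = 1") auto
      have m1: "0 < 1 - m" using zm z(2) m(2) by (cases "m = 1") auto
      have eq: "(1 - l) *\<^sub>R (b - v) = (1 - m) *\<^sub>R (x0 - v)" using zb zm by simp
      show False
      proof (cases "1 - l \<le> 1 - m")
        case True
        define k where "k = (1 - l) / (1 - m)"
        have k: "0 \<le> k" "k \<le> 1" using True l1 m1 by (auto simp: k_def)
        have "x0 - v = (1 / (1 - m)) *\<^sub>R ((1 - m) *\<^sub>R (x0 - v))" using m1 by simp
        also have "\<dots> = k *\<^sub>R (b - v)" unfolding eq[symmetric] by (simp add: k_def)
        finally have "x0 = b + (1 - k) *\<^sub>R (v - b)" by (rule cone_shift)
        then show False using elim(1) b(1) k by (metis diff_ge_0_iff_ge singletonI)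
      next
        case False
        define k where "k = (1 - m) / (1 - l)"
        have k: "0 \<le> k" "k \<le> 1" using False l1 m1 by (auto simp: k_def)
        have "b - v = (1 / (1 - l)) *\<^sub>R ((1 - l) *\<^sub>R (b - v))" using l1 by simp
        also have "\<dots> = k *\<^sub>R (x0 - v)" unfolding eq by (simp add: k_def)
        finally have "b = x0 + (1 - k) *\<^sub>R (v - x0)" by (rule cone_shift)
        then show False using elim(2) b(1) k by (metis diff_ge_0_iff_ge singletonI)
      qed
    qed
  qed
qed

section \<open>Replacing a flat arc by two edges through a deep point\<close>

text \<open>Says that the arc projects to an embedded polygonal arc of the plane.\<close>

fun flat :: "space list \<Rightarrow> bool" where
  "flat (x # y # zs) \<longleftrightarrow> fst x \<noteq> fst y \<and>
     (\<forall>f \<in> edges (y # zs). \<forall>a \<in> closed_segment x y. \<forall>b \<in> seg f. fst a = fst b \<longrightarrow> a = y \<and> b = y) \<and> flat (y # zs)"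
| "flat _ \<longleftrightarrow> True"

text \<open>A triangle has to avoid the later edges of the arc only: when it is used, the earlier
  ones have already been replaced.\<close>

fun fanok :: "space \<Rightarrow> space list \<Rightarrow> bool" where
  "fanok v (x # y # zs) \<longleftrightarrow> (\<forall>f \<in> edges (y # zs). tri v x y \<inter> seg f \<subseteq> {y} \<inter> {fst f, snd f}) \<and> fanok v (y # zs)"
| "fanok v _ \<longleftrightarrow> True"

lemma edges_fst_not_last:
  assumes "distinct xs" "(a, b) \<in> edges xs"
  shows "a \<noteq> last xs"
  using assms
proof (induction xs rule: induct_list012)
  case (3 x y zs)
  then show ?case using last_in_set[of "y # zs"] by (cases "a = x") auto
qed auto

lemma drelI: "delta E p q v \<Longrightarrow> drel (insert (p, q) E) (insert (p, v) (insert (v, q) E))"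
  unfolding drel_def by (rule exI[of _ E], rule exI[of _ p], rule exI[of _ q], rule exI[of _ v]) simp

text \<open>Each step removes the vertex \<open>x\<close> between \<open>v\<close> and its successor
  \<open>y\<close>, by crossing the triangle with base \<open>v y\<close> and apex \<open>x\<close>
  from the two sides to the base. The obstacles are the edge from \<open>x0\<close> to
  \<open>v\<close>, the rest \<open>R\<close> and the edges not yet absorbed.\<close>

lemma fan_tail:
  assumes R: "finite R" "\<And>e. e \<in> R \<Longrightarrow> fst e \<noteq> snd e"
    and Rv: "\<And>e a b. e \<in> R \<Longrightarrow> (a, b) \<in> edges (x # zs) \<Longrightarrow> tri v a b \<inter> seg e \<subseteq> {b} \<inter> {fst e, snd e}"
    and nc: "\<And>a b. (a, b) \<in> edges (x # zs) \<Longrightarrow> \<not> collinear {v, a, b}"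
    and side: "\<And>a b. (a, b) \<in> edges (x # zs) \<Longrightarrow> tri v a b \<inter> closed_segment x0 v \<subseteq> {v}"
    and ok: "fanok v (x # zs)" and x0: "x0 \<noteq> v"
  shows "equivclp drel (insert (x0, v) (insert (v, x) (R \<union> edges (x # zs)))) (insert (x0, v) (insert (v, last (x # zs)) R))"
  using Rv nc side ok
proof (induction zs arbitrary: x)
  case Nil
  then show ?case by simp
next
  case (Cons y ws)
  let ?E = "insert (x0, v) (R \<union> edges (y # ws))"
  have fin: "finite (edges xs)" for xs :: "space list" by (simp add: edges_def)
  have nc: "\<not> collinear {v, y, x}" using Cons.prems(2)[of x y] by (simp add: insert_commute)
  have "delta ?E v y x"
    unfolding delta_def
  proof (intro conjI ballI nc)
    show "finite ?E" using R fin by simp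
    fix e assume e: "e \<in> ?E"
    have t: "tri v y x = tri v x y" by (simp add: insert_commute)
    consider "e = (x0, v)" | "e \<in> R" | "e \<in> edges (y # ws)" using e by blast
    then have "fst e \<noteq> snd e \<and> tri v y x \<inter> seg e \<subseteq> {v, y} \<inter> {fst e, snd e}"
    proof cases
      case 1
      then show ?thesis using Cons.prems(3)[of x y] x0 unfolding t seg_def by auto
    next
      case 2
      then show ?thesis using Cons.prems(1)[of e x y] R(2) unfolding t by auto
    next
      case 3
      have "\<not> collinear {v, fst e, snd e}" using Cons.prems(2)[of "fst e" "snd e"] 3 by simp
      then have "fst e \<noteq> snd e" by auto
      moreover have "tri v x y \<inter> seg e \<subseteq> {y} \<inter> {fst e, snd e}" using Cons.prems(4) 3 by simp
      ultimately show ?thesis unfolding t by auto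
    qed
    then show "fst e \<noteq> snd e" "tri v y x \<inter> seg e \<subseteq> {v, y} \<inter> {fst e, snd e}" by blast+
  qed
  then have "drel (insert (v, y) ?E) (insert (v, x) (insert (x, y) ?E))" by (rule drelI)
  then have 1: "equivclp drel (insert (v, x) (insert (x, y) ?E)) (insert (v, y) ?E)"
    by (rule equivclp_sym[OF r_into_equivclp])
  have 2: "equivclp drel (insert (x0, v) (insert (v, y) (R \<union> edges (y # ws)))) (insert (x0, v) (insert (v, last (y # ws)) R))"
  proof (rule Cons.IH)
    show "tri v a b \<inter> seg e \<subseteq> {b} \<inter> {fst e, snd e}" if "e \<in> R" "(a, b) \<in> edges (y # ws)" for e a b
      by (rule Cons.prems(1)[OF that(1)]) (simp add: that(2))
    show "\<not> collinear {v, a, b}" if "(a, b) \<in> edges (y # ws)" for a b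
      by (rule Cons.prems(2)) (simp add: that)
    show "tri v a b \<inter> closed_segment x0 v \<subseteq> {v}" if "(a, b) \<in> edges (y # ws)" for a b
      by (rule Cons.prems(3)) (simp add: that)
    show "fanok v (y # ws)" using Cons.prems(4) by simp
  qed
  have e1: "insert (v, x) (insert (x, y) ?E) = insert (x0, v) (insert (v, x) (R \<union> edges (x # y # ws)))" by auto
  have e2: "insert (v, y) ?E = insert (x0, v) (insert (v, y) (R \<union> edges (y # ws)))" by auto
  show ?case using equivclp_trans[OF 1[unfolded e1 e2] 2] by simp
qed

text \<open>The first edge is opened towards the apex \<open>v\<close>; after that the edges are
  absorbed one by one into the edge that leaves \<open>v\<close>.\<close>

lemma fan:
  assumes R: "finite R" "\<And>e. e \<in> R \<Longrightarrow> fst e \<noteq> snd e" and d: "distinct xs" and len: "3 \<le> length xs"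
    and Rv: "\<And>e a b. e \<in> R \<Longrightarrow> (a, b) \<in> edges xs \<Longrightarrow> tri v a b \<inter> seg e \<subseteq> {hd xs, last xs} \<inter> {a, b} \<inter> {fst e, snd e}"
    and nc: "\<And>a b. (a, b) \<in> edges xs \<Longrightarrow> \<not> collinear {v, a, b}"
    and side: "\<And>a b. (a, b) \<in> edges (tl xs) \<Longrightarrow> tri v a b \<inter> closed_segment (hd xs) v \<subseteq> {v}"
    and ok: "fanok v xs"
  shows "equivclp drel (R \<union> edges xs) (insert (hd xs, v) (insert (v, last xs) R))"
proof -
  obtain x0 x1 zs where xs: "xs = x0 # x1 # zs" using len by (cases xs; cases "tl xs") auto
  have fin: "finite (edges xs)" for xs :: "space list" by (simp add: edges_def)
  have nc0: "\<not> collinear {x0, x1, v}" using nc[of x0 x1] by (simp add: xs insert_commute)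
  have "delta (R \<union> edges (x1 # zs)) x0 x1 v"
    unfolding delta_def
  proof (intro conjI ballI nc0)
    show "finite (R \<union> edges (x1 # zs))" using R fin by simp
    fix e assume e: "e \<in> R \<union> edges (x1 # zs)"
    have t: "tri x0 x1 v = tri v x0 x1" by (simp add: insert_commute)
    consider "e \<in> R" | "e \<in> edges (x1 # zs)" using e by blast
    then have "fst e \<noteq> snd e \<and> tri x0 x1 v \<inter> seg e \<subseteq> {x0, x1} \<inter> {fst e, snd e}"
    proof cases
      case 1
      then show ?thesis using Rv[of e x0 x1] R(2) unfolding t by (auto simp: xs)
    next
      case 2
      have "\<not> collinear {v, fst e, snd e}" using nc[of "fst e" "snd e"] 2 by (simp add: xs)
      then have "fst e \<noteq> snd e" by auto
      moreover have "tri v x0 x1 \<inter> seg e \<subseteq> {x1} \<inter> {fst e, snd e}" using ok 2 by (simp add: xs)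
      ultimately show ?thesis unfolding t by auto
    qed
    then show "fst e \<noteq> snd e" "tri x0 x1 v \<inter> seg e \<subseteq> {x0, x1} \<inter> {fst e, snd e}" by blast+
  qed
  then have "drel (insert (x0, x1) (R \<union> edges (x1 # zs))) (insert (x0, v) (insert (v, x1) (R \<union> edges (x1 # zs))))"
    by (rule drelI)
  then have 1: "equivclp drel (R \<union> edges xs) (insert (x0, v) (insert (v, x1) (R \<union> edges (x1 # zs))))"
    by (simp add: xs r_into_equivclp)
  have 2: "equivclp drel (insert (x0, v) (insert (v, x1) (R \<union> edges (x1 # zs)))) (insert (x0, v) (insert (v, last (x1 # zs)) R))"
  proof (rule fan_tail[OF R])
    \<comment> \<open>The start of an edge after the first is neither end of the arc, so the
      triangle can be touched at \<open>b\<close> only.\<close>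
    show "tri v a b \<inter> seg e \<subseteq> {b} \<inter> {fst e, snd e}" if "e \<in> R" "(a, b) \<in> edges (x1 # zs)" for e a b
    proof -
      have ab: "a \<in> set (x1 # zs)" "b \<in> set zs" using edges_subset[OF that(2)] by auto
      have "a \<noteq> last (x1 # zs)" by (rule edges_fst_not_last[OF _ that(2)]) (use d in \<open>simp add: xs\<close>)
      moreover have "a \<noteq> x0" "b \<noteq> x0" using ab d by (auto simp: xs)
      ultimately show ?thesis using Rv[OF that(1), of a b] that(2) by (auto simp: xs)
    qed
    show "x0 \<noteq> v" using nc0 by (auto simp: insert_commute)
    show "\<not> collinear {v, a, b}" if "(a, b) \<in> edges (x1 # zs)" for a b
      by (rule nc) (simp add: xs that)
    show "tri v a b \<inter> closed_segment x0 v \<subseteq> {v}" if "(a, b) \<in> edges (x1 # zs)" for a b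
      using side[of a b] that by (simp add: xs)
    show "fanok v (x1 # zs)" using ok by (simp add: xs)
  qed
  show ?thesis using equivclp_trans[OF 1 2] by (simp add: xs)
qed

section \<open>Passing an arc below a link\<close>

text \<open>The exception covers the two ends at which the arc is attached to the rest of the
  link.\<close>

definition under :: "arrow set \<Rightarrow> space list \<Rightarrow> bool" where
  "under R xs \<longleftrightarrow> (\<forall>e \<in> R. \<forall>f \<in> edges xs. \<forall>x \<in> seg e. \<forall>y \<in> seg f. fst x = fst y \<longrightarrow>
     snd y < snd x \<or> x = y \<and> x \<in> {fst e, snd e} \<and> x \<in> {hd xs, last xs})"

lemma edges_last: "2 \<le> length xs \<Longrightarrow> \<exists>f \<in> edges xs. snd f = last xs"
proof (induction xs rule: induct_list012)
  case (3 x y zs)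
  then show ?case by (cases zs) auto
qed auto

lemma last_in_edges_seg: "2 \<le> length xs \<Longrightarrow> \<exists>f \<in> edges xs. last xs \<in> seg f"
  using edges_last[of xs] unfolding seg_def by force

text \<open>An end of the arc belongs to an edge of its own, and in a flat arc it cannot also lie in
  the interior of another edge.\<close>

lemma edge_contains_end:
  assumes "flat xs" "(x, y) \<in> edges xs" "P \<in> closed_segment x y" "P \<in> {hd xs, last xs}"
  shows "P \<in> {x, y}"
proof (cases "P = hd xs")
  case True
  obtain x0 x1 zs where xs: "xs = x0 # x1 # zs" using assms(2) by (cases xs; cases "tl xs") auto
  show ?thesis
  proof (cases "(x, y) = (x0, x1)")
    case True
    then show ?thesis using \<open>P = hd xs\<close> xs by simp
  next
    case False
    then have "(x, y) \<in> edges (x1 # zs)" using assms(2) xs by auto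
    moreover have "P \<in> seg (x, y)" "P = x0" using assms(3) True xs by (auto simp: seg_def)
    moreover have "x0 \<in> closed_segment x0 x1" by simp
    ultimately have "x0 = x1" using assms(1) unfolding xs flat.simps by blast
    then show ?thesis using assms(1) xs by simp
  qed
next
  case False
  then have "P = last xs" using assms(4) by simp
  then show ?thesis using assms(1-3)
  proof (induction xs rule: flat.induct)
    case (1 x0 x1 zs)
    show ?case
    proof (cases "(x, y) = (x0, x1)")
      case True
      show ?thesis
      proof (cases zs)
        case Nil
        then show ?thesis using True 1(2) by simp
      next
        case (Cons z ws)
        then have "2 \<le> length (x1 # zs)" by simp
        from last_in_edges_seg[OF this] obtain f where "f \<in> edges (x1 # zs)" "last (x1 # zs) \<in> seg f" by blast
        moreover have "P = last (x1 # zs)" "P \<in> closed_segment x0 x1" using 1 True by simp_all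
        ultimately have "P = x1" using 1(3) unfolding flat.simps by blast
        then show ?thesis using True by simp
      qed
    next
      case False
      then have "(x, y) \<in> edges (x1 # zs)" "flat (x1 # zs)" "P = last (x1 # zs)" using 1(2-4) by auto
      then show ?thesis using 1(1)[OF _ _ _ 1(5)] by blast
    qed
  qed auto
qed

text \<open>Here an arc of a single edge is excluded: an edge of the arc has at most one end where
  contact with the link is allowed, so a contact point is unique.\<close>

lemma edge_not_both_ends:
  assumes "distinct xs" "3 \<le> length xs" "(x, y) \<in> edges xs" "x \<noteq> y"
  shows "\<not> {x, y} \<subseteq> {hd xs, last xs}"
proof -
  obtain x0 x1 x2 zs where xs: "xs = x0 # x1 # x2 # zs"
    using assms(2) by (cases xs; cases "tl xs"; cases "tl (tl xs)") auto
  have l: "last xs \<in> set (x2 # zs)" unfolding xs by (simp add: last_in_set del: last.simps) (metis last.simps last_in_set list.distinct(1) list.set_intros(1) set_ConsD)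
  show ?thesis
  proof (cases "(x, y) = (x0, x1)")
    case True
    then have "y \<noteq> hd xs" "y \<noteq> last xs" using l assms(1) by (auto simp: xs)
    then show ?thesis by blast
  next
    case False
    then have "(x, y) \<in> edges (x1 # x2 # zs)" using assms(3) by (auto simp: xs)
    then have "x \<in> set (x1 # x2 # zs)" "y \<in> set (x1 # x2 # zs)" using edges_in by fastforce+
    then have "x \<noteq> hd xs" "y \<noteq> hd xs" using assms(1) by (auto simp: xs)
    then show ?thesis using assms(4) by blast
  qed
qed

text \<open>An edge of the link either misses the base of the triangle or meets it in exactly one
  point, which is an end of both. In both situations the cone with a deep apex is free.\<close>

lemma eventually_under:
  assumes u: "under R xs" and f: "flat xs" and d: "distinct xs" "3 \<le> length xs"
    and e: "e \<in> R" "fst e \<noteq> snd e" and ab: "(a, b) \<in> edges xs"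
  shows "\<forall>\<^sub>F N in at_top. tri (c, - N) a b \<inter> seg e \<subseteq> {hd xs, last xs} \<inter> {a, b} \<inter> {fst e, snd e}"
proof -
  have U: "snd y < snd x \<or> x = y \<and> x \<in> {fst e, snd e} \<and> x \<in> {hd xs, last xs}"
    if "x \<in> seg e" "y \<in> closed_segment a b" "fst x = fst y" for x y
    using u e(1) ab that unfolding under_def seg_def by (metis fst_conv snd_conv)
  show ?thesis
  proof (cases "seg e \<inter> closed_segment a b = {}")
    case True
    have "\<forall>\<^sub>F N in at_top. tri (c, - N) a b \<inter> seg e = {}"
    proof (rule deep_avoid_disjoint)
      show "compact (seg e)" by (simp add: seg_def)
      fix x y assume xy: "x \<in> seg e" "y \<in> closed_segment a b" "fst x = fst y"
      show "snd y < snd x" using U[OF xy] True xy by blast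
    qed
    then show ?thesis by eventually_elim simp
  next
    case False
    then obtain P where P: "P \<in> seg e" "P \<in> closed_segment a b" by blast
    have ends: "Q \<in> {fst e, snd e} \<and> Q \<in> {hd xs, last xs} \<and> Q \<in> {a, b}" if "Q \<in> seg e" "Q \<in> closed_segment a b" for Q
      using U[OF that refl] edge_contains_end[OF f ab that(2)] by blast
    have "a \<noteq> b"
      using f ab
    proof (induction xs rule: flat.induct)
      case (1 x y zs) then show ?case by (cases "(a, b) = (x, y)") auto
    qed auto
    have uniq: "Q = P" if "Q \<in> seg e" "Q \<in> closed_segment a b" for Q
      using ends[OF that] ends[OF P] edge_not_both_ends[OF d ab \<open>a \<noteq> b\<close>]
      by (simp only: insert_iff empty_iff insert_subset empty_subsetI) metis
    define q where "q = (if P = fst e then snd e else fst e)"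
    define r where "r = (if P = a then b else a)"
    have se: "seg e = closed_segment P q" using ends[OF P] by (auto simp: q_def seg_def closed_segment_commute)
    have sr: "closed_segment a b = closed_segment P r" "{a, b} = {P, r}"
      using ends[OF P] by (auto simp: r_def closed_segment_commute)
    have "\<forall>\<^sub>F N in at_top. tri (c, - N) P r \<inter> closed_segment P q \<subseteq> {P}"
    proof (rule deep_avoid_shared)
      show "q \<noteq> P" using e(2) ends[OF P] by (auto simp: q_def)
      show "r \<noteq> P" using \<open>a \<noteq> b\<close> ends[OF P] by (auto simp: r_def)
      fix x y assume xy: "x \<in> closed_segment P q" "y \<in> closed_segment P r" "fst x = fst y"
      show "x = P \<and> y = P \<or> snd y < snd x"
        using U[of x y] xy uniq[of x] unfolding se sr by blast
    qed
    then show ?thesis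
    proof eventually_elim
      case (elim N)
      have "tri (c, - N) a b = tri (c, - N) P r" using sr(2) by metis
      then show ?case using elim ends[OF P] unfolding se by blast
    qed
  qed
qed

lemma eventually_not_collinear:
  assumes "flat xs" "(a, b) \<in> edges xs"
  shows "\<forall>\<^sub>F N in at_top. \<not> collinear {(c, - N), a, b}"
  using assms
proof (induction xs rule: flat.induct)
  case (1 x y zs)
  then show ?case using deep_not_collinear[of a b c] by (cases "(a, b) = (x, y)") auto
qed auto

lemma eventually_apex_side:
  assumes "flat xs" "(a, b) \<in> edges (tl xs)"
  shows "\<forall>\<^sub>F N in at_top. tri (c, - N) a b \<inter> closed_segment (hd xs) (c, - N) \<subseteq> {(c, - N)}"
proof (rule deep_apex_side)
  fix w assume w: "w \<in> closed_segment a b"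
  obtain x0 x1 zs where xs: "xs = x0 # x1 # zs" using assms(2) by (cases xs; cases "tl xs") auto
  show "fst (hd xs) \<noteq> fst w"
  proof
    assume eq: "fst (hd xs) = fst w"
    have "(a, b) \<in> edges (x1 # zs)" "w \<in> seg (a, b)" "x0 \<in> closed_segment x0 x1" "fst x0 = fst w"
      using assms(2) w eq by (auto simp: xs seg_def)
    then have "x0 = x1" using assms(1) unfolding xs flat.simps by blast
    then show False using assms(1) xs by simp
  qed
qed

lemma eventually_fanok:
  assumes "flat xs"
  shows "\<forall>\<^sub>F N in at_top. fanok (c, - N) xs"
  using assms
proof (induction xs rule: flat.induct)
  case (1 x y zs)
  have nxy: "fst x \<noteq> fst y" and F: "\<And>f a b. f \<in> edges (y # zs) \<Longrightarrow> a \<in> closed_segment x y \<Longrightarrow> b \<in> seg f \<Longrightarrow> fst a = fst b \<Longrightarrow> a = y \<and> b = y"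
    and fl: "flat (y # zs)"
    using 1(2) by auto
  have "\<forall>\<^sub>F N in at_top. tri (c, - N) x y \<inter> seg f \<subseteq> {y} \<inter> {fst f, snd f}" if f: "f \<in> edges (y # zs)" for f
  proof -
    obtain z ws where zs: "zs = z # ws" using f by (cases zs) auto
    show ?thesis
    proof (cases "f = (y, z)")
      case True
      have "\<forall>\<^sub>F N in at_top. tri (c, - N) y x \<inter> closed_segment y z \<subseteq> {y}"
      proof (rule deep_avoid_shared)
        show "z \<noteq> y" using fl zs by auto
        show "x \<noteq> y" using nxy by auto
        fix a b assume "a \<in> closed_segment y z" "b \<in> closed_segment y x" "fst a = fst b"
        then show "a = y \<and> b = y \<or> snd b < snd a"
          using F[OF f, of b a] True by (simp add: seg_def closed_segment_commute)
      qed
      then show ?thesis by eventually_elim (simp add: True seg_def insert_commute)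
    next
      case False
      \<comment> \<open>Of the following edges only the next one contains \<open>y\<close>; a later
        one would meet the edge from \<open>y\<close> to \<open>z\<close> outside
        \<open>z\<close>.\<close>
      have ny: "y \<notin> seg f"
      proof
        assume "y \<in> seg f"
        moreover have "f \<in> edges (z # ws)" using f False zs by auto
        moreover have "y \<in> closed_segment y z" by simp
        ultimately have "y = z" using fl unfolding zs flat.simps by blast
        then show False using fl zs by simp
      qed
      have "\<forall>\<^sub>F N in at_top. tri (c, - N) x y \<inter> seg f = {}"
      proof (rule deep_avoid_disjoint)
        show "compact (seg f)" by (simp add: seg_def)
        fix a b assume "a \<in> seg f" "b \<in> closed_segment x y" "fst a = fst b"
        then show "snd b < snd a" using F[OF f, of b a] ny by metis
      qed
      then show ?thesis by eventually_elim simp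
    qed
  qed
  then have "\<forall>\<^sub>F N in at_top. \<forall>f \<in> edges (y # zs). tri (c, - N) x y \<inter> seg f \<subseteq> {y} \<inter> {fst f, snd f}"
    by (intro eventually_ball_finite) (auto simp: edges_def)
  then show ?case using 1(1)[OF fl] by eventually_elim simp
qed auto

lemma eventually_fan:
  assumes R: "finite R" "\<And>e. e \<in> R \<Longrightarrow> fst e \<noteq> snd e" and d: "distinct xs" "3 \<le> length xs"
    and f: "flat xs" and u: "under R xs"
  shows "\<forall>\<^sub>F N in at_top. equivclp drel (R \<union> edges xs) (insert (hd xs, (c, - N)) (insert ((c, - N), last xs) R))"
proof -
  have fin: "finite (edges ys)" for ys :: "space list" by (simp add: edges_def)
  have "\<forall>\<^sub>F N in at_top. \<forall>e \<in> R. \<forall>g \<in> edges xs. tri (c, - N) (fst g) (snd g) \<inter> seg e \<subseteq> {hd xs, last xs} \<inter> {fst g, snd g} \<inter> {fst e, snd e}"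
    by (intro eventually_ball_finite R fin ballI eventually_under[OF u f d] R(2)) auto
  moreover have "\<forall>\<^sub>F N in at_top. \<forall>g \<in> edges xs. \<not> collinear {(c, - N), fst g, snd g}"
    by (intro eventually_ball_finite fin ballI eventually_not_collinear[OF f]) auto
  moreover have "\<forall>\<^sub>F N in at_top. \<forall>g \<in> edges (tl xs). tri (c, - N) (fst g) (snd g) \<inter> closed_segment (hd xs) (c, - N) \<subseteq> {(c, - N)}"
    by (intro eventually_ball_finite fin ballI eventually_apex_side[OF f]) auto
  moreover have "\<forall>\<^sub>F N in at_top. fanok (c, - N) xs" by (rule eventually_fanok[OF f])
  ultimately show ?thesis
  proof eventually_elim
    case (elim N)
    show ?case
    proof (rule fan[OF R d])
      show "tri (c, - N) a b \<inter> seg e \<subseteq> {hd xs, last xs} \<inter> {a, b} \<inter> {fst e, snd e}"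
        if "e \<in> R" "(a, b) \<in> edges xs" for e a b
        using elim(1)[rule_format, OF that] by simp
      show "\<not> collinear {(c, - N), a, b}" if "(a, b) \<in> edges xs" for a b
        using elim(2)[rule_format, OF that] by simp
      show "tri (c, - N) a b \<inter> closed_segment (hd xs) (c, - N) \<subseteq> {(c, - N)}" if "(a, b) \<in> edges (tl xs)" for a b
        using elim(3)[rule_format, OF that] by simp
    qed (assumption | fact elim(4))+
  qed
qed

text \<open>Both arcs are equivalent to the same two edges through a deep point, for which any depth
  works that is sufficient for both. The arcs need not be compared with each other and may cross in
  the projection. The point over which the apex is placed is arbitrary; the origin is taken.\<close>

lemma underpass:
  assumes L: "link (R \<union> edges xs)"
    and xs: "distinct xs" "3 \<le> length xs" "flat xs" "under R xs"
    and ys: "distinct ys" "3 \<le> length ys" "flat ys" "under R ys"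
    and eq: "hd xs = hd ys" "last xs = last ys"
  shows "link (R \<union> edges ys) \<and> deforms (R \<union> edges xs) (R \<union> edges ys)"
proof -
  have R: "finite R" "\<And>e. e \<in> R \<Longrightarrow> fst e \<noteq> snd e" using linkD(1)[OF L] linkD(5)[OF L] by auto
  have "\<forall>\<^sub>F N :: real in at_top. equivclp drel (R \<union> edges xs) (insert (hd xs, (0, - N)) (insert ((0, - N), last xs) R)) \<and>
      equivclp drel (R \<union> edges ys) (insert (hd ys, (0, - N)) (insert ((0, - N), last ys) R))"
    by (intro eventually_conj eventually_fan R xs ys)
  then obtain N :: real where "equivclp drel (R \<union> edges xs) (insert (hd xs, (0, - N)) (insert ((0, - N), last xs) R))"
      "equivclp drel (R \<union> edges ys) (insert (hd ys, (0, - N)) (insert ((0, - N), last ys) R))"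
    using eventually_happens by fastforce
  then have "equivclp drel (R \<union> edges xs) (R \<union> edges ys)"
    unfolding eq by (metis equivclp_sym equivclp_trans)
  then show ?thesis using equivclp_drel_deforms L by blast
qed

section \<open>Decomposing a set of arrows into closed polygons\<close>

text \<open>\<open>support \<sigma> x\<close> lists the orbit of \<open>x\<close> in the order of
  iteration, so the closed edges of the list form the graph of \<open>\<sigma>\<close> on the
  orbit.\<close>

lemma cyc_orbit:
  assumes "permutation \<sigma>"
  shows "cyc (support \<sigma> x) = (\<lambda>y. (y, \<sigma> y)) ` set (support \<sigma> x)"
proof -
  define n where "n = least_power \<sigma> x"
  have n: "(\<sigma> ^^ n) x = x" "0 < n" using least_power_of_permutation[OF assms] by (auto simp: n_def)
  let ?xs = "map (\<lambda>i. (\<sigma> ^^ i) x) [0..<n]"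
  have r: "rotate1 ?xs = map \<sigma> ?xs"
  proof (rule nth_equalityI)
    fix i assume "i < length (rotate1 ?xs)"
    then have i: "i < n" by simp
    then have "rotate1 ?xs ! i = ?xs ! (Suc i mod n)" by (simp add: nth_rotate1)
    also have "\<dots> = map \<sigma> ?xs ! i"
    proof (cases "Suc i = n")
      case True
      then show ?thesis using n i funpow.simps(2)[of i \<sigma>] by auto
    next
      case False
      then show ?thesis using i by simp
    qed
    finally show "rotate1 ?xs ! i = map \<sigma> ?xs ! i" .
  qed simp
  have z: "zip ys (map \<sigma> ys) = map (\<lambda>y. (y, \<sigma> y)) ys" for ys by (induction ys) auto
  show ?thesis
    unfolding cyc_def n_def[symmetric] r z set_map ..
qed

text \<open>Sending each vertex to the target of its outgoing arrow permutes the finite set of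
  vertices, and the cycles are the components. One start is chosen for each cycle, because different
  starts give different lists. A cycle of length one would be a degenerate arrow, and in a cycle of
  length two the two arrows would share their midpoint.\<close>

lemma link_imp_plink:
  assumes L: "link E"
  obtains Ps where "plink Ps" "arrows Ps = E"
proof -
  define V where "V = fst ` E"
  \<comment> \<open>The identity outside the vertices makes \<open>\<sigma>\<close> a permutation of
    the whole type.\<close>
  define \<sigma> where "\<sigma> x = (if x \<in> V then snd (SOME e. e \<in> E \<and> fst e = x) else x)" for x
  have s: "\<sigma> x = y" if "(x, y) \<in> E" for x y
  proof -
    have "(SOME e. e \<in> E \<and> fst e = x) = (x, y)"
      by (rule some_equality) (use that inj_onD[OF linkD(2)[OF L]] in auto)
    then show ?thesis using that by (force simp: \<sigma>_def V_def)
  qed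
  have E: "E = (\<lambda>y. (y, \<sigma> y)) ` V" unfolding V_def using s by force
  have fV: "finite V" using linkD(1)[OF L] by (simp add: V_def)
  have "inj_on \<sigma> V"
  proof (rule inj_onI)
    fix x y assume "x \<in> V" "y \<in> V" "\<sigma> x = \<sigma> y"
    moreover from this have "(x, \<sigma> x) \<in> E" "(y, \<sigma> y) \<in> E" by (subst E, blast)+
    ultimately show "x = y" using inj_onD[OF linkD(3)[OF L], of "(x, \<sigma> x)" "(y, \<sigma> y)"] by simp
  qed
  have "snd ` E = \<sigma> ` V" by (subst E) (simp add: image_image)
  then have "\<sigma> ` V = V" using linkD(4)[OF L] unfolding V_def[symmetric] by simp
  with \<open>inj_on \<sigma> V\<close> have "\<sigma> permutes V" by (intro bij_imp_permutes) (auto simp: bij_betw_def \<sigma>_def)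
  then have perm: "permutation \<sigma>" using fV permutation_permutes by blast
  have inV: "set (support \<sigma> x) \<subseteq> V" if "x \<in> V" for x
    unfolding support_set[OF perm]
    using that permutes_in_image[OF permutes_funpow[OF \<open>\<sigma> permutes V\<close>]] by (intro image_subsetI) simp
  have self: "x \<in> set (support \<sigma> x)" for x
    unfolding support_set[OF perm] by (metis funpow_0 rangeI)
  define rep where "rep C = (SOME x. x \<in> V \<and> set (support \<sigma> x) = C)" for C
  define CC where "CC = (\<lambda>x. set (support \<sigma> x)) ` V"
  define Ps where "Ps = (\<lambda>C. support \<sigma> (rep C)) ` CC"
  have rep: "rep C \<in> V \<and> set (support \<sigma> (rep C)) = C" if "C \<in> CC" for C
    unfolding rep_def by (rule someI_ex) (use that in \<open>auto simp: CC_def\<close>)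
  have UC: "\<Union> CC = V" using inV self unfolding CC_def by blast
  have "arrows Ps = (\<Union>C \<in> CC. (\<lambda>y. (y, \<sigma> y)) ` C)"
    unfolding arrows_cyc Ps_def by (simp add: cyc_orbit[OF perm] rep del: set_map)
  also have "\<dots> = E" unfolding E UC[symmetric] by blast
  finally have ar: "arrows Ps = E" .
  have "plink Ps"
    unfolding plink_def ar
  proof (intro conjI ballI L)
    show "finite Ps" using fV by (simp add: Ps_def CC_def)
    fix ps assume ps: "ps \<in> Ps"
    then obtain C where C: "C \<in> CC" "ps = support \<sigma> (rep C)" unfolding Ps_def by blast
    define x where "x = rep C"
    have x: "ps = support \<sigma> x" "x \<in> V" using C rep[of C] by (simp_all only: x_def)
    show dist: "distinct ps" unfolding x by (rule cycle_of_permutation[OF perm])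
    have sub: "cyc ps \<subseteq> E" using ps ar by (auto simp: arrows_cyc)
    have "x \<in> set ps" using self x by simp
    then have "ps \<noteq> []" by auto
    moreover have "length ps \<noteq> 1"
    proof
      assume "length ps = 1"
      then obtain a where "ps = [a]" by (auto simp: length_Suc_conv)
      then have "(a, a) \<in> E" using sub by (simp add: cyc_def)
      then show False using linkD(5)[OF L] by blast
    qed
    moreover have "length ps \<noteq> 2"
    proof
      assume "length ps = 2"
      then obtain a b where ab: "ps = [a, b]" by (auto simp: numeral_2_eq_2 length_Suc_conv)
      then have "(a, b) \<in> E" "(b, a) \<in> E" "a \<noteq> b" using sub dist by (auto simp: cyc_def)
      then have "closed_segment a b \<inter> closed_segment b a \<subseteq> {a, b}"
        using linkD(6)[OF L, of "(a, b)" "(b, a)"] by (auto simp: seg_def)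
      moreover have "midpoint a b \<in> closed_segment a b \<inter> closed_segment b a"
        by (simp add: closed_segment_commute[of b a])
      ultimately have "midpoint a b \<in> {a, b}" by blast
      then show False using \<open>a \<noteq> b\<close> by auto
    qed
    ultimately show "3 \<le> length ps" by (cases ps; cases "tl ps"; cases "tl (tl ps)") auto
  next
    show "pairwise (\<lambda>ps qs. disjnt (set ps) (set qs)) Ps"
    proof (rule pairwiseI)
      fix ps qs assume "ps \<in> Ps" "qs \<in> Ps" "ps \<noteq> qs"
      then obtain C D where "C \<in> CC" "D \<in> CC" "set ps = C" "set qs = D" "C \<noteq> D" using rep unfolding Ps_def by blast
      then show "disjnt (set ps) (set qs)"
        using disjoint_support[OF perm] unfolding CC_def disjnt_def disjoint_def by blast
    qed
  qed
  then show ?thesis using ar that by blast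
qed

section \<open>Separation of segments of the diagram\<close>

text \<open>\<open>AxR j\<close> and \<open>AxL j\<close> are the points \<open>j + 1/4\<close> and \<open>j - 1/4\<close> of the axis; in \<open>Cor u i j a b\<close>,
  \<open>u\<close>, \<open>i\<close> and \<open>j\<close> stand for upper half plane, right and top.  The lowered arc of the edge \<open>(a, b)\<close> runs
  through \<open>VP a b\<close> and \<open>VQ a b\<close>.  \<open>Apx\<close> only occurs for the diagram with one leaf.\<close>

datatype vert = AxR nat | AxL nat | Cor bool bool bool nat nat | VP nat nat | VQ nat nat | Apx bool

abbreviation LL :: "bool \<Rightarrow> nat \<Rightarrow> nat \<Rightarrow> vert" where "LL u \<equiv> Cor u False False"
abbreviation UL :: "bool \<Rightarrow> nat \<Rightarrow> nat \<Rightarrow> vert" where "UL u \<equiv> Cor u False True"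
abbreviation UR :: "bool \<Rightarrow> nat \<Rightarrow> nat \<Rightarrow> vert" where "UR u \<equiv> Cor u True True"
abbreviation LR :: "bool \<Rightarrow> nat \<Rightarrow> nat \<Rightarrow> vert" where "LR u \<equiv> Cor u True False"

text \<open>Corners in the lower half plane are named after their mirror images, so
  \<open>UL False\<close> is the deepest corner on the left. The offset of \<open>VP a b\<close> has
  the constant product \<open>1/16\<close> with \<open>b - a\<close>: this places the point on a
  line of slope \<open>b - a\<close> that has the left subtree of the edge below it.\<close>

fun vx :: "vert \<Rightarrow> real" where
  "vx (AxR j) = real j + 1/4"
| "vx (AxL j) = real j - 1/4"
| "vx (Cor u s t a b) = (real a + real b) / 2 + (if s then 1/8 else - 1/8)"
| "vx (VP a b) = real a + 1 / (16 * (real b - real a))"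
| "vx (VQ a b) = real a + 1 / (16 * (real b - real a))"
| "vx (Apx u) = 0"

text \<open>The coordinate of \<open>VQ a b\<close> puts it on the line \<open>x - y = b\<close>,
  which also contains \<open>UL False (b - 1) b\<close>.\<close>

fun vy :: "vert \<Rightarrow> real" where
  "vy (AxR j) = 0"
| "vy (AxL j) = 0"
| "vy (Cor u s t a b) = (if u then 1 else - 1) * ((real b - real a)\<^sup>2 / 2 + (if t then 1/8 else - 1/8))"
| "vy (VP a b) = 0"
| "vy (VQ a b) = real a + 1 / (16 * (real b - real a)) - real b"
| "vy (Apx u) = (if u then 1/4 else - 1/4)"

text \<open>The given link lies between the heights \<open>0\<close> and \<open>1\<close>, so the
  height \<open>-1\<close> is below all of it.\<close>

fun vz :: "vert \<Rightarrow> real" where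
  "vz (AxR j) = 0"
| "vz (AxL j) = 0"
| "vz (Cor u s t a b) = (if s = t then 1 else 0)"
| "vz (VP a b) = - 1"
| "vz (VQ a b) = - 1"
| "vz (Apx u) = 0"

definition pos :: "vert \<Rightarrow> space" where
  "pos v = ((vx v, vy v), vz v)"

definition parr :: "vert \<times> vert \<Rightarrow> arrow" where
  "parr e = (pos (fst e), pos (snd e))"

text \<open>Stronger than disjointness in space: crossings in the projection are excluded as
  well.\<close>

definition psep :: "arrow \<Rightarrow> arrow \<Rightarrow> bool" where
  "psep e f \<longleftrightarrow> (\<forall>x \<in> seg e. \<forall>y \<in> seg f. fst x = fst y \<longrightarrow>
     x = y \<and> x \<in> {fst e, snd e} \<and> x \<in> {fst f, snd f})"

definition vsep :: "vert \<times> vert \<Rightarrow> vert \<times> vert \<Rightarrow> bool" where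
  "vsep e f \<longleftrightarrow> psep (parr e) (parr f)"

lemma psep_sym: "psep e f \<Longrightarrow> psep f e"
  unfolding psep_def by metis

lemma vsep_sym: "vsep e f \<Longrightarrow> vsep f e"
  unfolding vsep_def by (rule psep_sym)

lemma seg_swap: "seg (q, p) = seg (p, q)"
  by (simp add: seg_def closed_segment_commute)

lemma vsep_swap1: "vsep (q, p) f \<Longrightarrow> vsep (p, q) f"
  unfolding vsep_def psep_def parr_def by (simp add: seg_swap[of "pos q"]) blast

lemma vsep_swap2: "vsep e (q, p) \<Longrightarrow> vsep e (p, q)"
  using vsep_sym vsep_swap1 by blast

lemma seg_parr:
  assumes "x \<in> seg (parr (p, q))"
  obtains t where "0 \<le> t" "t \<le> 1" "x = (1 - t) *\<^sub>R pos p + t *\<^sub>R pos q"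
  using assms unfolding seg_def parr_def by (auto simp: in_segment)

text \<open>A line of the plane separates the projections. Strictness on one side is enough, so the
  line may pass through the second segment.\<close>

lemma vsep_lt:
  fixes A B :: real
  assumes "A * vx p + B * vy p < k" "A * vx q + B * vy q < k"
    and "k \<le> A * vx r + B * vy r" "k \<le> A * vx s + B * vy s"
  shows "vsep (p, q) (r, s)"
  unfolding vsep_def psep_def
proof (intro ballI impI)
  fix x y assume x: "x \<in> seg (parr (p, q))" and y: "y \<in> seg (parr (r, s))" and eq: "fst x = fst y"
  obtain t where t: "0 \<le> t" "t \<le> 1" "x = (1 - t) *\<^sub>R pos p + t *\<^sub>R pos q" using seg_parr[OF x] .
  obtain u where u: "0 \<le> u" "u \<le> 1" "y = (1 - u) *\<^sub>R pos r + u *\<^sub>R pos s" using seg_parr[OF y] .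
  have "A * fst (fst x) + B * snd (fst x) = (1 - t) * (A * vx p + B * vy p) + t * (A * vx q + B * vy q)"
    unfolding t(3) by (simp add: pos_def algebra_simps)
  also have "\<dots> < k" using convex_bound_lt[OF assms(1,2), of "1 - t" t] t by simp
  finally have 1: "A * fst (fst x) + B * snd (fst x) < k" .
  have "A * fst (fst y) + B * snd (fst y) = (1 - u) * (A * vx r + B * vy r) + u * (A * vx s + B * vy s)"
    unfolding u(3) by (simp add: pos_def algebra_simps)
  moreover have "k = (1 - u) * k + u * k" by (simp add: algebra_simps)
  moreover have "(1 - u) * k \<le> (1 - u) * (A * vx r + B * vy r)" "u * k \<le> u * (A * vx s + B * vy s)"
    using assms u by (auto intro: mult_left_mono)
  ultimately have "k \<le> A * fst (fst y) + B * snd (fst y)" by linarith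
  then show "x = y \<and> x \<in> {fst (parr (p, q)), snd (parr (p, q))} \<and> x \<in> {fst (parr (r, s)), snd (parr (r, s))}"
    using 1 eq by simp
qed

text \<open>The line passes through the common vertex \<open>q\<close>. The first segment meets it
  in \<open>q\<close> only, and the second segment stays on the other side or on the line.\<close>

lemma vsep_share:
  fixes A B :: real
  assumes "A * vx p + B * vy p < A * vx q + B * vy q"
    and "A * vx q + B * vy q \<le> A * vx r + B * vy r" "vx q \<noteq> vx r \<or> vy q \<noteq> vy r"
  shows "vsep (p, q) (q, r)"
  unfolding vsep_def psep_def
proof (intro ballI impI)
  fix x y assume x: "x \<in> seg (parr (p, q))" and y: "y \<in> seg (parr (q, r))" and eq: "fst x = fst y"
  let ?L = "\<lambda>v. A * vx v + B * vy v"
  obtain t where t: "0 \<le> t" "t \<le> 1" "x = (1 - t) *\<^sub>R pos p + t *\<^sub>R pos q" using seg_parr[OF x] .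
  obtain u where u: "0 \<le> u" "u \<le> 1" "y = (1 - u) *\<^sub>R pos q + u *\<^sub>R pos r" using seg_parr[OF y] .
  have 1: "A * fst (fst x) + B * snd (fst x) = ?L q - (1 - t) * (?L q - ?L p)"
    unfolding t(3) by (simp add: pos_def algebra_simps)
  have 2: "A * fst (fst y) + B * snd (fst y) = ?L q + u * (?L r - ?L q)"
    unfolding u(3) by (simp add: pos_def algebra_simps)
  have 3: "0 \<le> u * (?L r - ?L q)" using u assms(2) by simp
  have 4: "0 \<le> (1 - t) * (?L q - ?L p)" using t assms(1) by simp
  have "(1 - t) * (?L q - ?L p) = 0" using 1 2 3 4 eq by simp
  then have "t = 1" using assms(1) by simp
  then have xq: "x = pos q" using t by simp
  have f: "fst y = fst (pos q)" using eq xq by simp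
  then have "u * (vx r - vx q) = 0" "u * (vy r - vy q) = 0"
    unfolding u(3) by (simp_all add: pos_def algebra_simps)
  then have "u = 0" using assms(3) by auto
  then have "y = pos q" using u by simp
  then show "x = y \<and> x \<in> {fst (parr (p, q)), snd (parr (p, q))} \<and> x \<in> {fst (parr (q, r)), snd (parr (q, r))}"
    using xq by (simp add: parr_def)
qed

lemmas expand = algebra_simps power2_eq_square add_divide_distrib diff_divide_distrib mult_1_left mult_1_right
  times_divide_eq_right times_divide_eq_left

section \<open>Linear bounds for the vertices of a subtree\<close>

text \<open>Everything that a subtree on the leaves \<open>s, ..., e\<close> can contribute to the
  upper half plane, whatever its shape. \<open>AxL s\<close> is missing because the boundary of the
  disc of \<open>s\<close> leaves the subtree before it returns to the axis.\<close>

definition pts :: "nat \<Rightarrow> nat \<Rightarrow> vert set" where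
  "pts s e = {Cor True i j a b | i j a b. s \<le> a \<and> a < b \<and> b \<le> e} \<union> {AxR j | j. s \<le> j \<and> j \<le> e} \<union>
     {AxL j | j. s < j \<and> j \<le> e} \<union> {VP a b | a b. s \<le> a \<and> a < b \<and> b \<le> e}"

lemma pts_cases:
  assumes "v \<in> pts s e"
  obtains (Cor) i j a b where "v = Cor True i j a b" "s \<le> a" "a < b" "b \<le> e"
  | (AxR) j where "v = AxR j" "s \<le> j" "j \<le> e"
  | (AxL) j where "v = AxL j" "s < j" "j \<le> e"
  | (VP) a b where "v = VP a b" "s \<le> a" "a < b" "b \<le> e"
  using assms unfolding pts_def by blast

lemma pts_mono: "v \<in> pts s e \<Longrightarrow> s' \<le> s \<Longrightarrow> e \<le> e' \<Longrightarrow> v \<in> pts s' e'"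
  unfolding pts_def by (auto intro: le_trans) 

lemma cor_bounds:
  assumes "a < b"
  shows "vx (Cor True i j a b) \<le> (real a + real b) / 2 + 1/8" "(real a + real b) / 2 - 1/8 \<le> vx (Cor True i j a b)"
    "vy (Cor True i j a b) \<le> (real b - real a)\<^sup>2 / 2 + 1/8" "3/8 \<le> vy (Cor True i j a b)"
proof -
  have "1 \<le> (real b - real a)\<^sup>2" using assms by (intro one_le_power) linarith
  then show "vx (Cor True i j a b) \<le> (real a + real b) / 2 + 1/8" "(real a + real b) / 2 - 1/8 \<le> vx (Cor True i j a b)"
    "vy (Cor True i j a b) \<le> (real b - real a)\<^sup>2 / 2 + 1/8" "3/8 \<le> vy (Cor True i j a b)"
    by (auto split: if_splits)
qed

lemma vp_bounds:
  assumes "a < b"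
  shows "0 < 1 / (16 * (real b - real a))" "1 / (16 * (real b - real a)) \<le> 1/16"
    "(real b - real a) * (1 / (16 * (real b - real a))) = 1/16"
  using assms by (auto simp: field_simps)

lemma pts_F0:
  assumes "v \<in> pts s e"
  shows "real s \<le> vx v" "0 \<le> vy v"
proof -
  have "real s \<le> vx v \<and> 0 \<le> vy v"
    using assms
  proof (cases rule: pts_cases)
    case (Cor i j a b)
    then have "real s \<le> real a" "real a + 1 \<le> real b" by auto
    then have "real s \<le> vx v" using cor_bounds(2)[OF Cor(3), of i j] unfolding Cor(1) by (simp only: expand; linarith)
    moreover have "0 \<le> vy v" using cor_bounds(4)[OF Cor(3), of i j] unfolding Cor(1) by linarith
    ultimately show ?thesis by blast
  next
    case (VP a b)
    have "real s \<le> real a" using VP by simp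
    then show ?thesis unfolding VP(1) vx.simps vy.simps using vp_bounds(1)[OF VP(3)] by (intro conjI; linarith)
  qed auto
  then show "real s \<le> vx v" "0 \<le> vy v" by blast+
qed

text \<open>A line of slope \<open>-k\<close> through \<open>AxR e\<close> bounds the subtree on the
  right. For the corners of an edge the decisive term is \<open>(b - a) * (k - (b - a))\<close>,
  which is at least one because \<open>k\<close> exceeds \<open>e - s\<close> by one.\<close>

lemma pts_F1:
  assumes "v \<in> pts s e" and k: "k = real e - real s + 1"
  shows "k * vx v + vy v \<le> k * (real e + 1/4)"
  using assms(1)
proof (cases rule: pts_cases)
  case (Cor i j a b)
  have r: "real s \<le> real a" "real a + 1 \<le> real b" "real b \<le> real e" using Cor by auto
  have k1: "1 \<le> k" using r k by linarith
  have "k * vx v + vy v \<le> k * ((real a + real b) / 2 + 1/8) + ((real b - real a)\<^sup>2 / 2 + 1/8)"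
    using cor_bounds[OF Cor(3), of i j] k1 unfolding Cor(1) by (intro add_mono mult_left_mono) auto
  moreover have "0 \<le> k * (real e - real b)" using k1 r by simp
  moreover have "1 * 1 \<le> (real b - real a) * (k - (real b - real a))" using r k by (intro mult_mono) auto
  ultimately show ?thesis using k1 by (simp only: expand; linarith)
next
  case (VP a b)
  have r: "real a + 1 \<le> real b" "real b \<le> real e" "real s \<le> real a" using VP by auto
  have "vx v \<le> real e + 1/4" unfolding VP(1) vx.simps using r vp_bounds(2)[OF VP(3)] by linarith
  moreover have "0 \<le> k" using r k by linarith
  ultimately have "vx v \<le> real e + 1/4" "0 \<le> k" by auto
  then show ?thesis using VP(1) by (simp add: mult_left_mono)
qed (use k in \<open>auto intro!: mult_left_mono\<close>)

text \<open>The bound is the value of the same functional at \<open>UL True s b\<close>: the right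
  subtree of the edge \<open>(s, b)\<close> lies below the line of slope \<open>m\<close> through
  this corner.\<close>

lemma pts_F2:
  assumes "v \<in> pts b e" "s < b" and m: "m = real e - real s" and D: "D = real b - real s"
  shows "vy v - m * (vx v - real s) < D * (D - m) / 2 + (1 + m) / 8"
proof -
  have D1: "1 \<le> D" using assms(2) D by linarith
  have base: "vy v - m * (vx v - real s) < D * (D - m) / 2 + (1 + m) / 8"
    if "vy v = 0" "D \<le> vx v - real s" "0 \<le> m"
  proof -
    have "m * D \<le> m * (vx v - real s)" using that by (intro mult_left_mono) auto
    moreover have "0 < D * D" "0 \<le> m * D" using D1 that by auto
    ultimately show ?thesis unfolding that(1) using that(3) by (simp only: expand; linarith)
  qed
  show ?thesis
    using assms(1)
  proof (cases rule: pts_cases)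
    case (Cor i j a b')
    have r: "real s + D \<le> real a" "real a + 1 \<le> real b'" "real b' \<le> real e" using Cor D by auto
    have m0: "0 \<le> m" using r m D1 by linarith
    have "m * ((real a + real b') / 2 - 1/8 - real s) \<le> m * (vx v - real s)"
      using cor_bounds[OF Cor(3), of i j] m0 unfolding Cor(1) by (intro mult_left_mono) auto
    then have "vy v - m * (vx v - real s) \<le> (real b' - real a)\<^sup>2 / 2 + 1/8 - m * ((real a + real b') / 2 - 1/8 - real s)"
      using cor_bounds[OF Cor(3), of i j] unfolding Cor(1) by linarith
    moreover have "0 \<le> (real b' - real a) * (m - (real b' - real a))" using r m D1 by (intro mult_nonneg_nonneg) auto
    moreover have "0 \<le> m * (real a - real s - D)" using r m0 by simp
    moreover have "0 < D * D" "0 \<le> m * D" using D1 m0 by auto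
    ultimately show ?thesis by (simp only: expand; linarith)
  next
    case (AxR j)
    then show ?thesis using base D m assms(2) by auto
  next
    case (AxL j)
    have "real b + 1 \<le> real j" "real j \<le> real e" using AxL by auto
    then show ?thesis using base D m assms(2) AxL(1) by auto
  next
    case (VP a b')
    have r: "real b \<le> real a" "real a + 1 \<le> real b'" "real b' \<le> real e" using VP by auto
    show ?thesis
    proof (rule base)
      show "D \<le> vx v - real s" unfolding VP(1) vx.simps D using r vp_bounds(1)[OF VP(3)] by linarith
      show "0 \<le> m" using r m D D1 by linarith
    qed (simp add: VP(1))
  qed
qed

text \<open>Again the bound is the value at \<open>UL True s b\<close>, whose quadratic term
  vanishes for the slope \<open>D\<close>: the left subtree of \<open>(s, b)\<close> lies below the
  line of slope \<open>D\<close> through this corner.\<close>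

lemma pts_F3:
  assumes "v \<in> pts s (b - 1)" "s < b" and D: "D = real b - real s"
  shows "vy v - D * (vx v - real s) < (1 + D) / 8"
proof -
  have D1: "1 \<le> D" using assms(2) D by linarith
  have base: ?thesis if "vy v = 0"
  proof -
    have "0 \<le> D * (vx v - real s)" using pts_F0[OF assms(1)] D1 by simp
    then show ?thesis using that D1 by (simp only: expand; linarith)
  qed
  show ?thesis
    using assms(1)
  proof (cases rule: pts_cases)
    case (Cor i j a b')
    have r: "real s \<le> real a" "real a + 1 \<le> real b'" "real b' + 1 \<le> real b" using Cor assms(2) by auto
    have "D * ((real a + real b') / 2 - 1/8 - real s) \<le> D * (vx v - real s)"
      using cor_bounds[OF Cor(3), of i j] D1 unfolding Cor(1) by (intro mult_left_mono) auto
    then have "vy v - D * (vx v - real s) \<le> (real b' - real a)\<^sup>2 / 2 + 1/8 - D * ((real a + real b') / 2 - 1/8 - real s)"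
      using cor_bounds[OF Cor(3), of i j] unfolding Cor(1) by linarith
    moreover have "1 * 1 \<le> (real b' - real a) * (D - (real b' - real a))" using r D by (intro mult_mono) auto
    moreover have "0 \<le> D * (real a - real s)" using r D1 by simp
    ultimately show ?thesis by (simp only: expand; linarith)
  qed (use base in auto)
qed

text \<open>The points with \<open>D * (x - s) - y = 1/16\<close> form the line of slope
  \<open>D\<close> through \<open>VP s b\<close>. The left subtree is below it, which leaves room
  for the lowered arc on its way to the axis.\<close>

lemma pts_F4:
  assumes "v \<in> pts s (b - 1)" "s < b" and D: "D = real b - real s"
  shows "1 / 16 < D * (vx v - real s) - vy v"
  using assms(1)
proof (cases rule: pts_cases)
  case (Cor i j a b')
  have D1: "1 \<le> D" using assms(2) D by linarith
  have r: "real s \<le> real a" "real a + 1 \<le> real b'" "real b' + 1 \<le> real b" using Cor assms(2) by auto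
  have "D * ((real a + real b') / 2 - 1/8 - real s) \<le> D * (vx v - real s)"
    using cor_bounds[OF Cor(3), of i j] D1 unfolding Cor(1) by (intro mult_left_mono) auto
  then have "D * (vx v - real s) - vy v \<ge> D * ((real a + real b') / 2 - 1/8 - real s) - ((real b' - real a)\<^sup>2 / 2 + 1/8)"
    using cor_bounds[OF Cor(3), of i j] unfolding Cor(1) by linarith
  moreover define d where "d = real b' - real a"
  have "(d + 1) * (d / 2 - 1/8) \<le> D * (d / 2 - 1/8)"
    using r D by (intro mult_right_mono) (auto simp: d_def)
  moreover have "0 \<le> D * (real a - real s)" using r D1 by simp
  moreover have "(real a + real b') / 2 - 1/8 - real s = (d / 2 - 1/8) + (real a - real s)" by (simp add: d_def field_simps)
  ultimately have "D * (vx v - real s) - vy v \<ge> (d + 1) * (d / 2 - 1/8) - (d\<^sup>2 / 2 + 1/8)"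
    unfolding d_def[symmetric] by (simp add: distrib_left)
  moreover have "(d + 1) * (d / 2 - 1/8) - (d\<^sup>2 / 2 + 1/8) = 3 * d / 8 - 1/4" by (simp only: expand; linarith)
  moreover have "1 \<le> d" using r by (simp add: d_def)
  ultimately show ?thesis by linarith
next
  case (AxR j)
  then have "1 * (1/4) \<le> D * (vx v - real s)" using assms(2) D by (intro mult_mono) auto
  then show ?thesis using AxR by simp
next
  case (AxL j)
  then have "1 * (1/4) \<le> D * (vx v - real s)" using assms(2) D by (intro mult_mono) auto
  then show ?thesis using AxL by simp
next
  case (VP a b')
  have r: "real a + 1 \<le> real b'" "real b' + 1 \<le> real b" "real s \<le> real a" using VP assms(2) by auto
  have "(real b' - real a) * (1 / (16 * (real b' - real a))) < D * (1 / (16 * (real b' - real a)))"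
    using r D vp_bounds(1)[OF VP(3)] by (intro mult_strict_right_mono) auto
  moreover have "0 \<le> D * (real a - real s)" using r D by simp
  ultimately show ?thesis unfolding VP(1) vp_bounds(3)[OF VP(3)] by (simp add: distrib_left right_diff_distrib)
qed

section \<open>Separation of the segments in the upper half plane\<close>

text \<open>Going counterclockwise around the leftmost leaf, this is the point from which the
  boundary of its disc leaves the subtree. Where it continues depends on the surrounding
  tree.\<close>

fun ex :: "bool \<Rightarrow> nat \<Rightarrow> btree \<Rightarrow> vert" where
  "ex u s Leaf = AxR s"
| "ex u s (Node l r) = UL u s (s + leaves l)"

text \<open>Segments of the given link and the first segments \<open>(UL, VP)\<close> of the lowered
  arcs are put together, so that one induction separates them all.\<close>

fun up :: "nat \<Rightarrow> btree \<Rightarrow> (vert \<times> vert) set" where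
  "up s Leaf = {}"
| "up s (Node l r) = (let b = s + leaves l in
     {(ex True s l, LL True s b), (LL True s b, UR True s b), (LR True s b, UL True s b),
      (ex True b r, UR True s b), (LR True s b, AxL b), (UL True s b, VP s b)} \<union> up s l \<union> up b r)"

lemma leaves_pos: "1 \<le> leaves t"
  by (induction t) auto

lemma ex_pts: "ex True s t \<in> pts s (s + leaves t - 1)"
proof (cases t)
  case (Node l r)
  then show ?thesis using leaves_pos[of l] leaves_pos[of r] by (auto simp: pts_def)
qed (auto simp: pts_def)

lemma up_pts: "(p, q) \<in> up s t \<Longrightarrow> p \<in> pts s (s + leaves t - 1) \<and> q \<in> pts s (s + leaves t - 1)"
proof (induction t arbitrary: s)
  case (Node l r)
  let ?e = "s + leaves (Node l r) - 1"
  have l1: "1 \<le> leaves l" "1 \<le> leaves r" by (rule leaves_pos)+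
  have ml: "v \<in> pts s ?e" if "v \<in> pts s (s + leaves l - 1)" for v
    by (rule pts_mono[OF that]) (use l1 in auto)
  have mr: "v \<in> pts s ?e" if "v \<in> pts (s + leaves l) (s + leaves l + leaves r - 1)" for v
    by (rule pts_mono[OF that]) (use l1 in auto)
  have c: "Cor True i j s (s + leaves l) \<in> pts s ?e" "AxL (s + leaves l) \<in> pts s ?e" "VP s (s + leaves l) \<in> pts s ?e" for i j
    using l1 by (auto simp: pts_def)
  have e1: "ex True s l \<in> pts s ?e" by (rule ml[OF ex_pts])
  have e2: "ex True (s + leaves l) r \<in> pts s ?e" using mr ex_pts[of "s + leaves l" r] by simp
  consider "(p, q) \<in> up s l" | "(p, q) \<in> up (s + leaves l) r"
    | "(p, q) \<in> {(ex True s l, LL True s (s + leaves l)), (LL True s (s + leaves l), UR True s (s + leaves l)),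
        (LR True s (s + leaves l), UL True s (s + leaves l)), (ex True (s + leaves l) r, UR True s (s + leaves l)),
        (LR True s (s + leaves l), AxL (s + leaves l)), (UL True s (s + leaves l), VP s (s + leaves l))}"
    using Node.prems by (auto simp: Let_def)
  then show ?case
  proof cases
    case 1
    then show ?thesis using Node.IH(1) ml by blast
  next
    case 2
    then show ?thesis using Node.IH(2) mr by fastforce
  next
    case 3
    then show ?thesis using c e1 e2 by blast
  qed
qed simp

text \<open>The height above the line of slope \<open>\<sigma>\<close> through
  \<open>(s, 0)\<close>, measured parallel to the second axis of the plane.\<close>

definition gx :: "real \<Rightarrow> nat \<Rightarrow> vert \<Rightarrow> real" where
  "gx \<sigma> s v = (- \<sigma>) * (vx v - real s) + vy v"

text \<open>\<open>below_exit s t f\<close>: some line through the exit point of \<open>t\<close>, of positive slope, has the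
  segment \<open>f\<close> below it; arcs that leave from the exit point stay above it.\<close>

definition below_exit :: "nat \<Rightarrow> btree \<Rightarrow> vert \<times> vert \<Rightarrow> bool" where
  "below_exit s t f \<longleftrightarrow> (\<exists>\<sigma>. 1 \<le> \<sigma> \<and> \<sigma> \<le> real (leaves t - 1) \<and> gx \<sigma> s (ex True s t) \<le> (1 + \<sigma>) / 8 \<and>
     (gx \<sigma> s (fst f) < gx \<sigma> s (ex True s t) \<or> fst f = ex True s t) \<and>
     (gx \<sigma> s (snd f) < gx \<sigma> s (ex True s t) \<or> snd f = ex True s t) \<and>
     (gx \<sigma> s (fst f) < gx \<sigma> s (ex True s t) \<or> gx \<sigma> s (snd f) < gx \<sigma> s (ex True s t)))"

lemma vsep_gx_lt:
  assumes "gx \<sigma> s p < k" "gx \<sigma> s q < k" "k \<le> gx \<sigma> s r" "k \<le> gx \<sigma> s t"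
  shows "vsep (p, q) (r, t)"
  by (rule vsep_lt[where A = "- \<sigma>" and B = 1 and k = "k - \<sigma> * real s"])
    (use assms in \<open>simp_all add: gx_def algebra_simps\<close>)

lemma vsep_gx_share:
  assumes "gx \<sigma> s p < gx \<sigma> s q" "gx \<sigma> s q \<le> gx \<sigma> s r" "vx q \<noteq> vx r \<or> vy q \<noteq> vy r"
  shows "vsep (p, q) (q, r)"
  by (rule vsep_share[where A = "- \<sigma>" and B = 1])
    (use assms in \<open>simp_all add: gx_def algebra_simps\<close>)

text \<open>The line through the exit point separates \<open>f\<close> from the continuation to
  \<open>r\<close>; if \<open>f\<close> ends in the exit point, the line passes through a shared
  vertex. The slope depends on \<open>f\<close>, so \<open>r\<close> has to lie above all admissible
  lines, for which \<open>(1 + \<sigma>) / 8\<close> is an upper bound.\<close>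

lemma below_exit_vsep:
  assumes "below_exit s t f"
    and "\<And>\<sigma>. 1 \<le> \<sigma> \<Longrightarrow> \<sigma> \<le> real (leaves t - 1) \<Longrightarrow> (1 + \<sigma>) / 8 \<le> gx \<sigma> s r"
    and ne: "vx (ex True s t) \<noteq> vx r \<or> vy (ex True s t) \<noteq> vy r"
  shows "vsep f (ex True s t, r)"
proof -
  let ?x = "ex True s t"
  obtain p q where f: "f = (p, q)" by (cases f)
  obtain \<sigma> where \<sigma>: "1 \<le> \<sigma>" "\<sigma> \<le> real (leaves t - 1)" "gx \<sigma> s ?x \<le> (1 + \<sigma>) / 8"
     "gx \<sigma> s p < gx \<sigma> s ?x \<or> p = ?x" "gx \<sigma> s q < gx \<sigma> s ?x \<or> q = ?x"
     "gx \<sigma> s p < gx \<sigma> s ?x \<or> gx \<sigma> s q < gx \<sigma> s ?x"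
    using assms(1) unfolding below_exit_def f by auto
  have r: "gx \<sigma> s ?x \<le> gx \<sigma> s r" using assms(2)[OF \<sigma>(1,2)] \<sigma>(3) by linarith
  consider "gx \<sigma> s p < gx \<sigma> s ?x" "gx \<sigma> s q < gx \<sigma> s ?x" | "p = ?x" "gx \<sigma> s q < gx \<sigma> s ?x"
    | "q = ?x" "gx \<sigma> s p < gx \<sigma> s ?x" using \<sigma>(4-6) by blast
  then show ?thesis
  proof cases
    case 1
    then show ?thesis unfolding f using r by (intro vsep_gx_lt) auto
  next
    case 2
    then show ?thesis unfolding f using vsep_gx_share[OF 2(2) r ne] by (intro vsep_swap1[of q]) auto
  next
    case 3
    then show ?thesis unfolding f using vsep_gx_share[OF 3(2) r ne] by simp
  qed
qed

text \<open>Together with \<open>gx_UR\<close> and \<open>gx_AxL\<close> this covers the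
  continuations from an exit point: to the parent edge of a left subtree, to the parent edge of a
  right subtree, and to the axis at the root.\<close>

lemma gx_LL:
  assumes "1 \<le> \<sigma>" "\<sigma> + 1 \<le> d" "d = real b - real s"
  shows "(1 + \<sigma>) / 8 \<le> gx \<sigma> s (LL True s b)"
proof -
  have "2 * 1 \<le> d * (d - \<sigma>)" using assms by (intro mult_mono) auto
  moreover have "real b = real s + d" using assms(3) by simp
  then have "gx \<sigma> s (LL True s b) = d * (d - \<sigma>) / 2 + (\<sigma> - 1) / 8"
    by (simp add: gx_def field_simps power2_eq_square)
  ultimately show ?thesis by (simp only: expand; linarith)
qed

lemma gx_UR:
  assumes "1 \<le> \<sigma>" "a < s"
  shows "(1 + \<sigma>) / 8 \<le> gx \<sigma> s (UR True a s)"
proof -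
  define d where "d = real s - real a"
  have d: "1 \<le> d" using assms by (simp add: d_def)
  have "1 * 1 \<le> d * d" "1 * 1 \<le> \<sigma> * d" "\<sigma> * 1 \<le> \<sigma> * d" using assms d by (intro mult_mono mult_left_mono; simp)+
  moreover have "gx \<sigma> s (UR True a s) = d * d / 2 + 1/8 + \<sigma> * d / 2 - \<sigma> / 8"
    by (simp add: gx_def d_def field_simps power2_eq_square)
  ultimately show ?thesis using assms by (simp only: expand; linarith)
qed

lemma gx_AxL:
  assumes "1 \<le> \<sigma>"
  shows "(1 + \<sigma>) / 8 \<le> gx \<sigma> s (AxL s)"
  using assms by (simp add: gx_def field_simps)

lemma ex_bounds:
  "real s < vx (ex True s t)" "vx (ex True s t) < real (s + leaves t)"
  "0 \<le> vy (ex True s t)"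
proof -
  have "real s < vx (ex True s t) \<and> vx (ex True s t) < real (s + leaves t) \<and> 0 \<le> vy (ex True s t)"
  proof (cases t)
    case (Node l r)
    have "1 \<le> real (leaves l)" "1 \<le> real (leaves r)" using leaves_pos[of l] leaves_pos[of r] by linarith+
    then show ?thesis using Node by (auto simp: field_simps)
  qed simp
  then show "real s < vx (ex True s t)" "vx (ex True s t) < real (s + leaves t)" "0 \<le> vy (ex True s t)" by auto
qed

lemma ex_vx: "real s + 1/4 \<le> vx (ex True s t)"
proof (cases t)
  case (Node l r)
  have "1 \<le> real (leaves l)" using leaves_pos[of l] by linarith
  moreover have "vx (ex True s t) = real s + real (leaves l) / 2 - 1/8" by (simp add: Node field_simps)
  ultimately show ?thesis by linarith
qed simp

text \<open>Two slopes suffice: the length \<open>D\<close> of the root edge for the left subtree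
  and most segments at the root edge, and the width \<open>m\<close> of the whole subtree for the
  right subtree and the arc that leaves it.\<close>

lemma below_exit_up: "f \<in> up s t \<Longrightarrow> below_exit s t f"
proof (induction t arbitrary: s f)
  case (Node l r)
  define b where "b = s + leaves l"
  define e where "e = s + leaves (Node l r) - 1"
  have l1: "1 \<le> leaves l" "1 \<le> leaves r" by (rule leaves_pos)+
  define D where "D = real b - real s"
  define m where "m = real e - real s"
  have D1: "1 \<le> D" "D \<le> m" using l1 by (auto simp: D_def m_def b_def e_def)
  have sb: "s < b" using l1 by (simp add: b_def)
  have mr: "real (leaves (Node l r) - 1) = m" using l1 by (simp add: m_def e_def)
  have x: "ex True s (Node l r) = UL True s b" by (simp add: b_def)
  have Dsq: "(real b - real s)\<^sup>2 = D * D" by (simp add: D_def power2_eq_square)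
  have cor: "gx \<sigma> s (Cor True i j s b) = D * (D - \<sigma>) / 2 + (if j then 1 else - 1) / 8 - \<sigma> * (if i then 1 else - 1) / 8" for \<sigma> i j
    by (simp add: gx_def D_def field_simps power2_eq_square)
  have gU: "gx \<sigma> s (UL True s b) = D * (D - \<sigma>) / 2 + (1 + \<sigma>) / 8" for \<sigma> unfolding cor by (simp add: field_simps)
  have F2: "gx m s v < gx m s (UL True s b)" if "v \<in> pts b e" for v
    using pts_F2[OF that sb m_def D_def] unfolding gU unfolding gx_def by simp
  have F3: "gx D s v < gx D s (UL True s b)" if "v \<in> pts s (b - 1)" for v
    using pts_F3[OF that sb D_def] unfolding gU unfolding gx_def by simp
  have useD: "below_exit s (Node l r) (p, q)"
    if "gx D s p < gx D s (UL True s b) \<or> p = UL True s b" "gx D s q < gx D s (UL True s b) \<or> q = UL True s b"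
      "gx D s p < gx D s (UL True s b) \<or> gx D s q < gx D s (UL True s b)" for p q
  proof -
    have "gx D s (UL True s b) \<le> (1 + D) / 8" unfolding gU by simp
    then show ?thesis
      unfolding below_exit_def mr x fst_conv snd_conv by (intro exI[of _ D] conjI that D1)
  qed
  have usem: "below_exit s (Node l r) (p, q)"
    if "gx m s p < gx m s (UL True s b)" "gx m s q < gx m s (UL True s b)" for p q
  proof -
    have "D * (D - m) \<le> 0" using D1 by (simp add: mult_le_0_iff)
    then have "gx m s (UL True s b) \<le> (1 + m) / 8" unfolding gU by linarith
    then show ?thesis
      unfolding below_exit_def mr x fst_conv snd_conv using that D1 by (intro exI[of _ m] conjI) simp_all
  qed
  have lt: "gx \<sigma> s (Cor True i j s b) < gx \<sigma> s (UL True s b)" if "i \<or> \<not> j" "0 < \<sigma>" for \<sigma> i j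
    unfolding cor using that by (cases i; cases j) auto
  obtain p q where f: "f = (p, q)" by (cases f)
  have "(p, q) \<in> {(ex True s l, LL True s b), (LL True s b, UR True s b), (LR True s b, UL True s b),
      (ex True b r, UR True s b), (LR True s b, AxL b), (UL True s b, VP s b)} \<union> up s l \<union> up b r"
    using Node.prems unfolding f by (simp add: b_def Let_def)
  then consider "(p, q) \<in> up s l" | "(p, q) \<in> up b r" | "(p, q) = (ex True s l, LL True s b)" | "(p, q) = (LL True s b, UR True s b)"
    | "(p, q) = (LR True s b, UL True s b)" | "(p, q) = (ex True b r, UR True s b)" | "(p, q) = (LR True s b, AxL b)"
    | "(p, q) = (UL True s b, VP s b)" by blast
  then show ?case unfolding f
  proof cases
    case 1
    then have "p \<in> pts s (b - 1)" "q \<in> pts s (b - 1)" using up_pts[OF 1] by (simp_all add: b_def)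
    then show "below_exit s (Node l r) (p, q)" using F3 by (intro useD) auto
  next
    case 2
    then have "p \<in> pts b e" "q \<in> pts b e" using up_pts[OF 2] by (simp_all add: b_def e_def add.assoc)
    then show "below_exit s (Node l r) (p, q)" using F2 by (intro usem) auto
  next
    case 3
    then show "below_exit s (Node l r) (p, q)" using F3[of "ex True s l"] ex_pts[of s l] lt[of False False D] D1 by (intro useD) (auto simp: b_def)
  next
    case 4
    then show "below_exit s (Node l r) (p, q)" using lt[of False False D] lt[of True True D] D1 by (intro useD) auto
  next
    case 5
    then show "below_exit s (Node l r) (p, q)" using lt[of True False D] D1 by (intro useD) auto
  next
    case 6
    have "ex True b r \<in> pts b e" using ex_pts[of b r] by (simp add: b_def e_def add.assoc)
    then show "below_exit s (Node l r) (p, q)" using 6 F2 lt[of True True m] D1 by (intro usem) auto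
  next
    case 7
    have "gx D s (AxL b) < gx D s (UL True s b)"
    proof -
      have rb: "real b = real s + D" by (simp add: D_def)
      have "gx D s (AxL b) = - (D * D) + D / 4" unfolding gx_def vx.simps vy.simps rb by (simp only: expand; linarith)
      moreover have "1 * D \<le> D * D" using D1 by (intro mult_right_mono) auto
      ultimately show ?thesis unfolding gU using D1 by (simp only: expand; linarith)
    qed
    then show "below_exit s (Node l r) (p, q)" using 7 lt[of True False D] D1 by (intro useD) auto
  next
    case 8
    have "gx D s (VP s b) < gx D s (UL True s b)"
    proof -
      have aux: "(- D) * (real s + y - real s) + 0 = - (D * y)" for y by simp
      have "gx D s (VP s b) = - (D * (1 / (16 * D)))"
        unfolding gx_def vx.simps vy.simps D_def[symmetric] by (rule aux)
      then have "gx D s (VP s b) = - (1/16)" unfolding vp_bounds(3)[OF sb, folded D_def] .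
      then show ?thesis unfolding gU using D1 by (simp only: expand; linarith)
    qed
    then show "below_exit s (Node l r) (p, q)" using 8 by (intro useD) auto
  qed
qed simp

lemmas expand' = expand mult_minus_left mult_minus_right minus_add_distrib minus_diff_eq

text \<open>The two strands of a crossing, the upper one first.\<close>

definition diag :: "bool \<Rightarrow> vert \<times> vert \<Rightarrow> vert \<times> vert \<Rightarrow> bool" where
  "diag u e f \<longleftrightarrow> (\<exists>a b. e = (LL u a b, UR u a b) \<and> f = (LR u a b, UL u a b))"

lemma ex_below_corner:
  assumes "b = s + leaves l" "D = real b - real s"
  shows "vx (ex True s l) < real s + D / 2 - 1/8" "vy (ex True s l) < D * D / 2 - 1/8"
proof -
  have D1: "1 \<le> D" using leaves_pos[of l] assms by auto
  then have DD: "1 * 1 \<le> D * D" by (intro mult_mono) auto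
  have "vx (ex True s l) < real s + D / 2 - 1/8 \<and> vy (ex True s l) < D * D / 2 - 1/8"
  proof (cases l)
    case Leaf
    then show ?thesis using D1 DD by simp
  next
    case (Node l' r')
    define d where "d = real (leaves l')"
    have d: "1 \<le> d" "d + 1 \<le> D" using leaves_pos[of l'] leaves_pos[of r'] assms by (auto simp: d_def Node)
    then have "(d + 1) * (d + 1) \<le> D * D" by (intro mult_mono) auto
    moreover have "vx (ex True s l) = real s + d / 2 - 1/8" "vy (ex True s l) = d * d / 2 + 1/8"
      by (auto simp: Node d_def field_simps power2_eq_square)
    ultimately show ?thesis using d by (simp only: expand'; linarith)
  qed
  then show "vx (ex True s l) < real s + D / 2 - 1/8" "vy (ex True s l) < D * D / 2 - 1/8" by auto
qed

text \<open>The root edge adds six segments, which lines separate from each other and from the two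
  subtrees; the strands \<open>N2\<close> and \<open>N3\<close> are the only crossing among them.
  For an arc that leaves a subtree no single line serves the whole subtree, and
  \<open>below_exit\<close> provides one for each segment.\<close>

lemma up_pairwise: "e \<in> up s t \<Longrightarrow> f \<in> up s t \<Longrightarrow> e \<noteq> f \<Longrightarrow> vsep e f \<or> diag True e f \<or> diag True f e"
proof (induction t arbitrary: s e f)
  case (Node l r)
  define b where "b = s + leaves l"
  have l1: "1 \<le> leaves l" "1 \<le> leaves r" by (rule leaves_pos)+
  define S where "S = real s"
  define D where "D = real b - real s"
  have D1: "1 \<le> D" using l1 by (auto simp: D_def b_def)
  have DD: "D \<le> D * D" using mult_mono[of 1 D D D] D1 by simp
  have sb: "s < b" using l1 by (simp add: b_def)
  have rb: "real b = S + D" by (simp add: S_def D_def)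
  define x where "x = 1 / (16 * D)"
  have x: "0 < x" "x \<le> 1/16" "D * x = 1/16" using vp_bounds[OF sb] by (simp_all add: x_def D_def)
  have co: "vx (LL True s b) = S + D/2 - 1/8" "vx (UL True s b) = S + D/2 - 1/8"
    "vx (LR True s b) = S + D/2 + 1/8" "vx (UR True s b) = S + D/2 + 1/8"
    "vy (LL True s b) = D*D/2 - 1/8" "vy (UL True s b) = D*D/2 + 1/8"
    "vy (LR True s b) = D*D/2 - 1/8" "vy (UR True s b) = D*D/2 + 1/8"
    "vx (AxL b) = S + D - 1/4" "vy (AxL b) = 0" "vx (VP s b) = S + x" "vy (VP s b) = 0"
    by (simp_all add: S_def D_def x_def field_simps power2_eq_square)
  have exl: "vx (ex True s l) < S + D/2 - 1/8" "vy (ex True s l) < D*D/2 - 1/8"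
    using ex_below_corner[OF b_def D_def] by (simp_all add: S_def)
  have exr: "S + D + 1/4 \<le> vx (ex True b r)" "0 \<le> vy (ex True b r)"
    using ex_vx[of b r] ex_bounds(3)[of b r] by (simp_all add: rb)
  have exrD: "D * (S + D + 1/4) \<le> D * vx (ex True b r)" using exr D1 by (intro mult_left_mono) auto
  \<comment> \<open>\<open>\<alpha> / \<beta>\<close> is the slope of the line through
    \<open>VP s b\<close> and \<open>UL True s b\<close>. It is at least \<open>D\<close>, so the
    left subtree, which is below the line of slope \<open>D\<close> through \<open>VP s b\<close>,
    is below this line too.\<close>
  define \<alpha> where "\<alpha> = D*D/2 + 1/8"
  define \<beta> where "\<beta> = D/2 - 1/8 - x"
  have \<alpha>: "0 < \<alpha>" using mult_nonneg_nonneg[of D D] D1 unfolding \<alpha>_def by linarith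
  have \<beta>: "0 < \<beta>" using x D1 by (simp add: \<beta>_def)
  have W: "(- \<alpha>) * vx v + \<beta> * vy v < - \<alpha> * (S + x)" if "v \<in> pts s (b - 1)" for v
  proof -
    have F: "vy v < D * (vx v - S - x)" using pts_F4[OF that sb D_def] x(3) by (simp add: S_def right_diff_distrib)
    have "0 \<le> vy v" using pts_F0[OF that] by blast
    then have "0 < D * (vx v - S - x)" using F by linarith
    then have p: "0 < vx v - S - x" using D1 by (simp add: zero_less_mult_iff)
    have "\<beta> * vy v < \<beta> * (D * (vx v - S - x))" using F \<beta> by (rule mult_strict_left_mono)
    also have "\<dots> = (D * \<beta>) * (vx v - S - x)" by simp
    also have "\<dots> \<le> \<alpha> * (vx v - S - x)"
      using p D1 x(3) by (intro mult_right_mono) (simp_all add: \<alpha>_def \<beta>_def right_diff_distrib)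
    finally show ?thesis by (simp add: algebra_simps)
  qed
  have WUL: "(- \<alpha>) * vx (UL True s b) + \<beta> * vy (UL True s b) = - \<alpha> * (S + x)"
    unfolding co(2,6) \<alpha>_def[symmetric] \<beta>_def by (simp add: algebra_simps add_divide_distrib diff_divide_distrib)
  have WVP: "(- \<alpha>) * vx (VP s b) + \<beta> * vy (VP s b) = - \<alpha> * (S + x)" unfolding co by simp
  have WLL: "(- \<alpha>) * vx (LL True s b) + \<beta> * vy (LL True s b) < - \<alpha> * (S + x)"
    unfolding WUL[symmetric] co using \<beta> by (simp add: right_diff_distrib distrib_left)
  have WUR: "(- \<alpha>) * vx (UR True s b) + \<beta> * vy (UR True s b) < - \<alpha> * (S + x)"
    unfolding WUL[symmetric] co using \<alpha> by (simp add: right_diff_distrib distrib_left)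
  define N1 where "N1 = (ex True s l, LL True s b)"
  define N2 where "N2 = (LL True s b, UR True s b)"
  define N3 where "N3 = (LR True s b, UL True s b)"
  define N4 where "N4 = (ex True b r, UR True s b)"
  define N5 where "N5 = (LR True s b, AxL b)"
  define N6 where "N6 = (UL True s b, VP s b)"
  have exlp: "ex True s l \<in> pts s (b - 1)" using ex_pts[of s l] by (simp add: b_def)
  note D12 = D1 DD
  have ylr: "0 < D*D/2 - 1/8" using D12 by linarith
  have n12: "vsep N1 N2" unfolding N1_def N2_def
    by (rule vsep_share[where A = 1 and B = 0]) (use exl D1 in \<open>simp_all add: co del: vx.simps vy.simps\<close>)
  have n13: "vsep N1 N3" unfolding N1_def N3_def
    by (rule vsep_lt[where A = 1 and B = 1 and k = "S + D/2 + D*D/2"]) (use exl D1 in \<open>simp_all add: co del: vx.simps vy.simps\<close>)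
  have n14: "vsep N1 N4" unfolding N1_def N4_def
    by (rule vsep_lt[where A = 1 and B = 0 and k = "S + D/2"]) (use exl exr D1 in \<open>simp_all add: co del: vx.simps vy.simps\<close>)
  have n15: "vsep N1 N5" unfolding N1_def N5_def
    by (rule vsep_lt[where A = 1 and B = 0 and k = "S + D/2"]) (use exl D1 in \<open>simp_all add: co del: vx.simps vy.simps\<close>)
  have n16: "vsep N1 N6" unfolding N1_def N6_def
    by (rule vsep_lt[where A = "- \<alpha>" and B = \<beta> and k = "- \<alpha> * (S + x)"]) (rule W[OF exlp] WLL WUL[THEN eq_refl, THEN order_trans[OF _ order_refl]] eq_refl[OF WUL[symmetric]] eq_refl[OF WVP[symmetric]])+
  have n23: "diag True N2 N3" unfolding N2_def N3_def diag_def by blast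
  have n24: "vsep N2 N4" unfolding N2_def N4_def
    by (rule vsep_swap2, rule vsep_share[where A = 1 and B = 0]) (use exr D1 in \<open>simp_all add: co del: vx.simps vy.simps\<close>)
  have n25: "vsep N2 N5" unfolding N2_def N5_def
    by (rule vsep_lt[where A = 1 and B = "- 1" and k = "S + D/2 - D*D/2 + 1/8"]; (unfold co)?; use D12 in \<open>simp only: expand' mult_zero_right; linarith\<close>)
  have n26: "vsep N2 N6" unfolding N2_def N6_def
    by (rule vsep_lt[where A = "- \<alpha>" and B = \<beta> and k = "- \<alpha> * (S + x)"]) (rule WLL WUR eq_refl[OF WUL[symmetric]] eq_refl[OF WVP[symmetric]])+
  have n34: "vsep N3 N4" unfolding N3_def N4_def
    by (rule vsep_lt[where A = D and B = 1 and k = "D * S + D * D + D/8 + 1/8"]; (unfold co)?; use exr exrD D1 in \<open>simp only: expand'; linarith\<close>)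
  have n35: "vsep N3 N5" unfolding N3_def N5_def
    by (rule vsep_swap1, rule vsep_share[where A = 0 and B = "- 1"]) (use ylr in \<open>simp_all add: co del: vx.simps vy.simps\<close>)
  have n36: "vsep N3 N6" unfolding N3_def N6_def
    by (rule vsep_sym, rule vsep_swap1, rule vsep_swap2, rule vsep_share[where A = 1 and B = 0]) (use x D1 in \<open>simp_all add: co del: vx.simps vy.simps\<close>)
  have n54: "vsep N5 N4" unfolding N5_def N4_def
    by (rule vsep_lt[where A = D and B = 1 and k = "D * S + D * D + D/8 + 1/8"]; (unfold co)?; use exr exrD D1 in \<open>simp only: expand'; linarith\<close>)
  have n64: "vsep N6 N4" unfolding N6_def N4_def
    by (rule vsep_lt[where A = 1 and B = 0 and k = "S + D/2"]) (use exr x D1 in \<open>simp_all add: co del: vx.simps vy.simps\<close>)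
  have n65: "vsep N6 N5" unfolding N6_def N5_def
    by (rule vsep_lt[where A = 1 and B = 0 and k = "S + D/2"]) (use x D1 in \<open>simp_all add: co del: vx.simps vy.simps\<close>)
  define New where "New = {N1, N2, N3, N4, N5, N6}"
  have nn: "vsep e f \<or> diag True e f \<or> diag True f e" if "e \<in> New" "f \<in> New" "e \<noteq> f" for e f
    using that n12 n13 n14 n15 n16 n23 n24 n25 n26 n34 n35 n36 n54 n64 n65 vsep_sym
    unfolding New_def by blast
  have lp: "p \<in> pts s (b - 1) \<and> q \<in> pts s (b - 1)" if "(p, q) \<in> up s l" for p q
    using up_pts[OF that] by (simp add: b_def)
  \<comment> \<open>The line has slope \<open>-D\<close> and passes through \<open>AxL b\<close>.
    The left subtree is on its left; the right subtree and the segments \<open>N2\<close> to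
    \<open>N5\<close> are not.\<close>
  have lF: "D * vx v + 1 * vy v < D * S + D * D - D / 4" if "v \<in> pts s (b - 1)" for v
  proof -
    have "D * vx v + vy v \<le> D * (real (b - 1) + 1/4)" by (rule pts_F1[OF that]) (use sb in \<open>simp add: D_def of_nat_diff\<close>)
    moreover have "real (b - 1) = S + D - 1" using sb rb by (simp add: of_nat_diff)
    ultimately show ?thesis using D1 by (simp only: expand'; linarith)
  qed
  have rp: "S + D \<le> vx v \<and> 0 \<le> vy v" if "(p, q) \<in> up b r" "v = p \<or> v = q" for p q v
    using up_pts[OF that(1)] pts_F0[of p b "b + leaves r - 1"] pts_F0[of q b "b + leaves r - 1"] that(2)
    unfolding rb by blast
  have lr: "vsep e f" if "e \<in> up s l" "f \<in> up b r" for e f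
  proof -
    obtain p q p' q' where e: "e = (p, q)" "f = (p', q')" by (cases e; cases f)
    have r1: "D * (S + D) \<le> D * vx p'" "D * (S + D) \<le> D * vx q'" "0 \<le> vy p'" "0 \<le> vy q'"
      using rp[of p' q'] that(2) D1 unfolding e by (auto intro: mult_left_mono)
    show ?thesis unfolding e
      by (rule vsep_lt[where A = D and B = 1 and k = "D * S + D * D - D / 4"])
        (use lF lp that(1) r1 D1 in \<open>auto simp: e algebra_simps\<close>)
  qed
  have ln: "vsep e f" if e: "e \<in> up s l" and f: "f \<in> New" for e f
  proof -
    obtain p q where pq: "e = (p, q)" by (cases e)
    have P: "p \<in> pts s (b - 1)" "q \<in> pts s (b - 1)" using lp e pq by auto
    have v: "vsep (p, q) (p', q')" if "D * S + D * D - D / 4 \<le> D * vx p' + 1 * vy p'" "D * S + D * D - D / 4 \<le> D * vx q' + 1 * vy q'" for p' q'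
      using vsep_lt[OF lF[OF P(1)] lF[OF P(2)] that] .
    have 1: "vsep e N1" unfolding N1_def
    proof (rule below_exit_vsep[OF below_exit_up[OF e]])
      fix \<sigma> assume "1 \<le> \<sigma>" "\<sigma> \<le> real (leaves l - 1)"
      then show "(1 + \<sigma>) / 8 \<le> gx \<sigma> s (LL True s b)" using l1 by (intro gx_LL[OF _ _ D_def]) (auto simp: D_def b_def of_nat_diff)
    qed (use exl in \<open>simp add: co del: vx.simps vy.simps\<close>)
    have 2: "vsep e N2" unfolding N2_def pq by (rule v; (unfold co)?; use D1 in \<open>simp only: expand'; linarith\<close>)
    have 3: "vsep e N3" unfolding N3_def pq by (rule v; (unfold co)?; use D1 in \<open>simp only: expand'; linarith\<close>)
    have 4: "vsep e N4" unfolding N4_def pq by (rule v; (unfold co)?; use exr exrD D1 in \<open>simp only: expand'; linarith\<close>)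
    have 5: "vsep e N5" unfolding N5_def pq by (rule v; (unfold co)?; use D1 in \<open>simp only: expand'; linarith\<close>)
    have 6: "vsep e N6" unfolding N6_def pq
      by (rule vsep_lt[OF W[OF P(1)] W[OF P(2)] eq_refl[OF WUL[symmetric]] eq_refl[OF WVP[symmetric]]])
    show ?thesis using f 1 2 3 4 5 6 unfolding New_def by blast
  qed
  have nr: "vsep f e" if e: "e \<in> up b r" and f: "f \<in> New" for e f
  proof -
    obtain p q where pq: "e = (p, q)" by (cases e)
    have P: "S + D \<le> vx p" "S + D \<le> vx q" using rp[of p q] e pq by auto
    have v: "vsep (p', q') (p, q)" if "vx p' < S + D" "vx q' < S + D" for p' q'
      by (rule vsep_lt[where A = 1 and B = 0 and k = "S + D"]) (use P that in simp_all)
    have 4: "vsep e N4" unfolding N4_def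
    proof (rule below_exit_vsep[OF below_exit_up[OF e]])
      fix \<sigma> :: real assume "1 \<le> \<sigma>"
      then show "(1 + \<sigma>) / 8 \<le> gx \<sigma> b (UR True s b)" using sb by (intro gx_UR) auto
    qed (use exr D1 in \<open>simp add: co del: vx.simps vy.simps\<close>)
    have "vsep N1 e" "vsep N2 e" "vsep N3 e" "vsep N5 e" "vsep N6 e"
      unfolding N1_def N2_def N3_def N5_def N6_def pq by (rule v; use exl x D1 in \<open>simp add: co del: vx.simps vy.simps\<close>)+
    then show ?thesis using f 4 vsep_sym unfolding New_def by blast
  qed
  have up: "up s (Node l r) = New \<union> up s l \<union> up b r"
    by (simp add: New_def N1_def N2_def N3_def N4_def N5_def N6_def b_def Let_def)
  show ?case
    using Node.prems Node.IH(1)[of e s f] Node.IH(2)[of e b f] nn lr ln nr vsep_sym unfolding up by blast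
qed simp

section \<open>The arcs of the link\<close>

text \<open>The arcs that start in exit points, labelled by the disc around which they run, since
  its colour decides their direction. The last arc of the disc of a vertex other than
  \<open>0\<close>, from \<open>LR\<close> to the axis, is kept apart in \<open>uarc\<close> because
  it belongs to an arc that will be replaced.\<close>

fun warc :: "bool \<Rightarrow> nat \<Rightarrow> btree \<Rightarrow> (nat \<times> vert \<times> vert) set" where
  "warc u s Leaf = {}"
| "warc u s (Node l r) = {(s, ex u s l, LL u s (s + leaves l)), (s + leaves l, ex u (s + leaves l) r, UR u s (s + leaves l))} \<union>
     warc u s l \<union> warc u (s + leaves l) r"

definition uarc :: "bool \<Rightarrow> (nat \<times> nat) set \<Rightarrow> (nat \<times> vert \<times> vert) set" where
  "uarc u G = (\<lambda>(a, b). (b, LR u a b, AxL b)) ` G"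

definition pstr :: "bool \<Rightarrow> (nat \<times> nat) set \<Rightarrow> (nat \<times> vert \<times> vert) set" where
  "pstr u G = (\<lambda>(a, b). (a, LL u a b, UR u a b)) ` G"

definition nstr :: "bool \<Rightarrow> (nat \<times> nat) set \<Rightarrow> (nat \<times> vert \<times> vert) set" where
  "nstr u G = (\<lambda>(a, b). (a, LR u a b, UL u a b)) ` G"

definition arcs :: "bool \<Rightarrow> nat \<Rightarrow> btree \<Rightarrow> (nat \<times> vert \<times> vert) set" where
  "arcs u s t = warc u s t \<union> uarc u (half_graph s t)"

lemma arcs_simps:
  "arcs u s Leaf = {}"
  "arcs u s (Node l r) = {(s, ex u s l, LL u s (s + leaves l)), (s + leaves l, ex u (s + leaves l) r, UR u s (s + leaves l)),
     (s + leaves l, LR u s (s + leaves l), AxL (s + leaves l))} \<union> arcs u s l \<union> arcs u (s + leaves l) r"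
  by (auto simp: arcs_def uarc_def)

section \<open>Combinatorics of the edges of a tree\<close>

lemma half_graph_range: "(a, b) \<in> half_graph s t \<Longrightarrow> s \<le> a \<and> a < b \<and> b < s + leaves t"
proof (induction t arbitrary: s)
  case (Node l r)
  then show ?case using leaves_pos[of l] leaves_pos[of r] by fastforce
qed simp

lemma finite_half_graph: "finite (half_graph s t)"
  by (induction t arbitrary: s) auto

text \<open>Every vertex but the first has an edge to the left, and only one by
  \<open>half_graph_parent_unique\<close>. So edges are indexed by their right ends, which matches
  the edges of the upper tree with those of the vine.\<close>

lemma half_graph_parent: "s < b \<Longrightarrow> b < s + leaves t \<Longrightarrow> \<exists>a. (a, b) \<in> half_graph s t"
proof (induction t arbitrary: s)
  case (Node l r)
  consider "b < s + leaves l" | "b = s + leaves l" | "s + leaves l < b" by linarith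
  then show ?case
  proof cases
    case 1 then show ?thesis using Node.IH(1)[of s] Node.prems by auto
  next
    case 2 then show ?thesis by auto
  next
    case 3 then show ?thesis using Node.IH(2)[of "s + leaves l"] Node.prems by auto
  qed
qed simp

lemma half_graph_parent_unique: "(a, b) \<in> half_graph s t \<Longrightarrow> (a', b) \<in> half_graph s t \<Longrightarrow> a = a'"
proof (induction t arbitrary: s)
  case (Node l r)
  have "leaves l \<ge> 1" "leaves r \<ge> 1" by (rule leaves_pos)+
  then show ?case
    using Node half_graph_range[of a b s l] half_graph_range[of a b "s + leaves l" r]
      half_graph_range[of a' b s l] half_graph_range[of a' b "s + leaves l" r] by auto
qed simp

lemma half_graph_noncrossing: "(a, b) \<in> half_graph s t \<Longrightarrow> (a', b') \<in> half_graph s t \<Longrightarrow> a' < a \<Longrightarrow> a < b' \<Longrightarrow> b \<le> b'"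
proof (induction t arbitrary: s)
  case (Node l r)
  have "leaves l \<ge> 1" "leaves r \<ge> 1" by (rule leaves_pos)+
  then show ?case
    using Node half_graph_range[of a b s l] half_graph_range[of a b "s + leaves l" r]
      half_graph_range[of a' b' s l] half_graph_range[of a' b' "s + leaves l" r] by fastforce
qed simp

lemma half_graph_vine: "right_vine t \<Longrightarrow> half_graph s t = {(j, Suc j) | j. s \<le> j \<and> Suc j < s + leaves t}"
proof (induction t arbitrary: s)
  case (Node l r)
  then have "half_graph s (Node l r) = insert (s, Suc s) {(j, Suc j) | j. Suc s \<le> j \<and> Suc j < Suc s + leaves r}" by auto
  also have "\<dots> = {(j, Suc j) | j. s \<le> j \<and> Suc j < s + leaves (Node l r)}"
    using Node.prems leaves_pos[of r] by (auto simp: le_Suc_eq)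
  finally show ?case .
qed simp

lemma arcs_label: "(j, e) \<in> arcs u s t \<Longrightarrow> s \<le> j \<and> j < s + leaves t"
proof (induction t arbitrary: s)
  case (Node l r)
  then show ?case using leaves_pos[of l] leaves_pos[of r] by (fastforce simp: arcs_simps)
qed (simp add: arcs_simps)

section \<open>The given link as an image of symbolic arrows\<close>

lemma pos_corner:
  "corner (a, b) (- 1) (- 1) = pos (LL True a b)" "corner (a, b) (- 1) 1 = pos (UL True a b)"
  "corner (a, b) 1 1 = pos (UR True a b)" "corner (a, b) 1 (- 1) = pos (LR True a b)"
  by (auto simp: corner_def pos_def)

lemma pair_up_append: "even (length xs) \<Longrightarrow> pair_up (xs @ ys) = pair_up xs \<union> pair_up ys"
  by (induction xs rule: pair_up.induct) auto

lemma even_corners: "even (length (corners_around G j))"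
proof -
  have "even (length (concat (map (\<lambda>b. [f b, g b]) xs)))" for f g :: "nat \<Rightarrow> space" and xs by (induction xs) auto
  then show ?thesis by (simp add: corners_around_def)
qed

lemma sorted_list_of_set_snoc:
  fixes A :: "nat set"
  assumes "finite A" "\<And>a. a \<in> A \<Longrightarrow> a < b"
  shows "sorted_list_of_set (insert b A) = sorted_list_of_set A @ [b]"
proof -
  have bA: "b \<notin> A" using assms(2) by blast
  have "sorted_wrt (<) (sorted_list_of_set A @ [b])"
    using assms by (auto simp: sorted_wrt_append)
  then show ?thesis
    using assms(1) bA sorted_list_of_set_unique[of "insert b A" "sorted_list_of_set A @ [b]"] by simp
qed

text \<open>The root edge is the longest edge at \<open>s\<close> and the only edge to the left at
  \<open>b\<close>, so its corners come last around both vertices.\<close>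

lemma corners_Node:
  fixes s :: nat and l r :: btree
  defines "b \<equiv> s + leaves l"
  defines "G \<equiv> half_graph s (Node l r)"
  shows "corners_around G s = corners_around (half_graph s l) s @ [pos (LL True s b), pos (UL True s b)]"
    and "corners_around G b = corners_around (half_graph b r) b @ [pos (UR True s b), pos (LR True s b)]"
    and "s < j \<Longrightarrow> j < b \<Longrightarrow> corners_around G j = corners_around (half_graph s l) j"
    and "b < j \<Longrightarrow> corners_around G j = corners_around (half_graph b r) j"
proof -
  have l1: "leaves l \<ge> 1" "leaves r \<ge> 1" by (rule leaves_pos)+
  have sb: "s < b" using l1 by (simp add: b_def)
  have G: "G = insert (s, b) (half_graph s l \<union> half_graph b r)" by (simp add: G_def b_def)
  have rl: "s \<le> x \<and> x < y \<and> y < b" if "(x, y) \<in> half_graph s l" for x y using half_graph_range[OF that] by (simp add: b_def)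
  have rr: "b \<le> x \<and> x < y" if "(x, y) \<in> half_graph b r" for x y using half_graph_range[OF that] by simp
  have k: "{y. (s, y) \<in> G} = insert b {y. (s, y) \<in> half_graph s l}" "{y. (b, y) \<in> G} = {y. (b, y) \<in> half_graph b r}"
    "{x. (x, s) \<in> G} = {}" "{x. (x, s) \<in> half_graph s l} = {}" "{x. (x, b) \<in> G} = {s}" "{x. (x, b) \<in> half_graph b r} = {}"
    unfolding G using rl rr sb by fastforce+
  have "finite {y. (s, y) \<in> half_graph s l}"
    by (rule finite_subset[of _ "snd ` half_graph s l"]) (force, simp add: finite_half_graph)
  then have so: "sorted_list_of_set {y. (s, y) \<in> G} = sorted_list_of_set {y. (s, y) \<in> half_graph s l} @ [b]"
    unfolding k(1) by (rule sorted_list_of_set_snoc) (use rl in auto)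
  show "corners_around G s = corners_around (half_graph s l) s @ [pos (LL True s b), pos (UL True s b)]"
    unfolding corners_around_def so k(3,4) by (simp add: pos_corner)
  show "corners_around G b = corners_around (half_graph b r) b @ [pos (UR True s b), pos (LR True s b)]"
    unfolding corners_around_def k(2,5,6) by (simp add: pos_corner)
  show "corners_around G j = corners_around (half_graph s l) j" if "s < j" "j < b"
  proof -
    have "{y. (j, y) \<in> G} = {y. (j, y) \<in> half_graph s l}" "{x. (x, j) \<in> G} = {x. (x, j) \<in> half_graph s l}"
      unfolding G using rl rr that by fastforce+
    then show ?thesis by (simp add: corners_around_def)
  qed
  show "corners_around G j = corners_around (half_graph b r) j" if "b < j"
  proof -
    have "{y. (j, y) \<in> G} = {y. (j, y) \<in> half_graph b r}" "{x. (x, j) \<in> G} = {x. (x, j) \<in> half_graph b r}"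
      unfolding G using rl rr sb that by fastforce+
    then show ?thesis by (simp add: corners_around_def)
  qed
qed

definition larcs :: "nat \<Rightarrow> nat \<Rightarrow> btree \<Rightarrow> arrow set" where
  "larcs j s t = parr ` {e. (j, e) \<in> arcs True s t}"

text \<open>The end point \<open>z\<close> is left open because the last arc around \<open>s\<close>
  ends outside the subtree. For subtrees \<open>z\<close> becomes \<open>LL\<close> or
  \<open>UR\<close> of the parent edge, for the whole tree it becomes \<open>AxL 0\<close>.\<close>

lemma pair_up_root:
  "pair_up (pos (AxR s) # corners_around (half_graph s t) s @ [z]) = insert (pos (ex True s t), z) (larcs s s t)"
proof (induction t arbitrary: z)
  case Leaf
  then show ?case by (simp add: corners_around_def larcs_def arcs_simps)
next
  case (Node l r)
  let ?b = "s + leaves l"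
  have b: "s < ?b" using leaves_pos[of l] by simp
  let ?c = "corners_around (half_graph s l) s"
  have "pos (AxR s) # corners_around (half_graph s (Node l r)) s @ [z] =
     (pos (AxR s) # ?c @ [pos (LL True s ?b)]) @ [pos (UL True s ?b), z]"
    unfolding corners_Node(1) by simp
  then have "pair_up (pos (AxR s) # corners_around (half_graph s (Node l r)) s @ [z]) =
     pair_up (pos (AxR s) # ?c @ [pos (LL True s ?b)]) \<union> {(pos (UL True s ?b), z)}"
    using pair_up_append[of "pos (AxR s) # ?c @ [pos (LL True s ?b)]" "[pos (UL True s ?b), z]"] even_corners[of "half_graph s l" s]
    by simp
  also have "\<dots> = insert (pos (ex True s l), pos (LL True s ?b)) (larcs s s l) \<union> {(pos (UL True s ?b), z)}"
    unfolding Node.IH(1) ..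
  also have "\<dots> = insert (pos (ex True s (Node l r)), z) (larcs s s (Node l r))"
  proof -
    have "(s, e) \<notin> arcs True ?b r" for e using arcs_label[of s e True ?b r] b by auto
    then have "{e. (s, e) \<in> arcs True s (Node l r)} = insert (ex True s l, LL True s ?b) {e. (s, e) \<in> arcs True s l}"
      using b by (auto simp: arcs_simps)
    then show ?thesis by (auto simp: larcs_def parr_def)
  qed
  finally show ?case .
qed

lemma pair_up_inner:
  assumes "s < j" "j < s + leaves t"
  shows "pair_up (pos (AxR j) # corners_around (half_graph s t) j @ [pos (AxL j)]) = larcs j s t \<and>
    corners_around (half_graph s t) j \<noteq> []"
  using assms
proof (induction t arbitrary: s)
  case (Node l r)
  let ?b = "s + leaves l"
  have b: "s < ?b" using leaves_pos[of l] by simp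
  have nl: "(j, e) \<notin> arcs True s l" if "?b \<le> j" for e using arcs_label[of j e True s l] that by auto
  have nr: "(j, e) \<notin> arcs True ?b r" if "j < ?b" for e using arcs_label[of j e True ?b r] that by auto
  consider "j < ?b" | "j = ?b" | "?b < j" by linarith
  then show ?case
  proof cases
    case 1
    then have "larcs j s (Node l r) = larcs j s l" using nr Node.prems unfolding larcs_def by (auto simp: arcs_simps)
    then show ?thesis using Node.IH(1)[of s] Node.prems 1 corners_Node(3)[of s j l r] by simp
  next
    case 2
    let ?c = "corners_around (half_graph ?b r) ?b"
    have "pos (AxR j) # corners_around (half_graph s (Node l r)) j @ [pos (AxL j)] =
      (pos (AxR ?b) # ?c @ [pos (UR True s ?b)]) @ [pos (LR True s ?b), pos (AxL ?b)]"
      unfolding 2 corners_Node(2) by simp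
    then have "pair_up (pos (AxR j) # corners_around (half_graph s (Node l r)) j @ [pos (AxL j)]) =
      pair_up (pos (AxR ?b) # ?c @ [pos (UR True s ?b)]) \<union> {(pos (LR True s ?b), pos (AxL ?b))}"
      using pair_up_append[of "pos (AxR ?b) # ?c @ [pos (UR True s ?b)]" "[pos (LR True s ?b), pos (AxL ?b)]"] even_corners[of "half_graph ?b r" ?b]
      by simp
    also have "\<dots> = larcs j s (Node l r)"
    proof -
      have "{e. (j, e) \<in> arcs True s (Node l r)} =
        {(ex True ?b r, UR True s ?b), (LR True s ?b, AxL ?b)} \<union> {e. (?b, e) \<in> arcs True ?b r}"
        using nl 2 b by (auto simp: arcs_simps)
      then show ?thesis unfolding pair_up_root by (auto simp: larcs_def parr_def 2)
    qed
    finally show ?thesis unfolding 2 corners_Node(2) by simp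
  next
    case 3
    then have "larcs j s (Node l r) = larcs j ?b r" using nl Node.prems b unfolding larcs_def by (auto simp: arcs_simps)
    then show ?thesis using Node.IH(2)[of ?b] Node.prems 3 corners_Node(4)[of s l j r] by simp
  qed
qed simp

definition orient1 :: "bool \<Rightarrow> 'a \<times> 'a \<Rightarrow> 'a \<times> 'a" where
  "orient1 s e = (if s then e else prod.swap e)"

definition oarr :: "(nat \<Rightarrow> bool) \<Rightarrow> (nat \<times> vert \<times> vert) set \<Rightarrow> (vert \<times> vert) set" where
  "oarr c Z = (\<lambda>(j, e). orient1 (c j) e) ` Z"

definition all_arcs :: "bool \<Rightarrow> btree \<Rightarrow> (nat \<times> vert \<times> vert) set" where
  "all_arcs u t = insert (0, ex u 0 t, AxL 0) (arcs u 0 t)"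

lemma parr_orient1: "parr (orient1 s e) = orient1 s (parr e)"
  by (simp add: orient1_def parr_def prod.swap_def)

lemma orient_image: "orient s A = orient1 s ` A"
  by (auto simp: orient_def orient1_def)

text \<open>From here on the geometry of the link enters only through \<open>pos\<close>, and
  orientation only through the labels.\<close>

lemma half_link_oarr:
  assumes "t \<noteq> Leaf"
  shows "half_link c t = parr ` oarr c (all_arcs True t \<union> pstr True (half_graph 0 t) \<union> nstr True (half_graph 0 t))"
proof -
  let ?G = "half_graph 0 t"
  obtain l r where t: "t = Node l r" using assms by (cases t) auto
  have m0: "medial_arcs ?G 0 = parr ` {e. (0, e) \<in> all_arcs True t}"
  proof -
    have "corners_around ?G 0 \<noteq> []" unfolding t corners_Node(1)[of 0 l r] by simp
    then have "medial_arcs ?G 0 = pair_up (pos (AxR 0) # corners_around ?G 0 @ [pos (AxL 0)])"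
      by (simp add: medial_arcs_def pos_def)
    also have "\<dots> = parr ` {e. (0, e) \<in> all_arcs True t}"
    proof -
      have "{e. (0, e) \<in> all_arcs True t} = insert (ex True 0 t, AxL 0) {e. (0, e) \<in> arcs True 0 t}"
        by (auto simp: all_arcs_def)
      then show ?thesis unfolding pair_up_root larcs_def by (simp add: parr_def)
    qed
    finally show ?thesis .
  qed
  have m1: "medial_arcs ?G j = parr ` {e. (j, e) \<in> all_arcs True t}" if "0 < j" "j < leaves t" for j
  proof -
    have *: "pair_up (pos (AxR j) # corners_around ?G j @ [pos (AxL j)]) = larcs j 0 t" "corners_around ?G j \<noteq> []"
      using pair_up_inner[of 0 j t] that by auto
    then have "medial_arcs ?G j = larcs j 0 t" by (simp add: medial_arcs_def pos_def)
    also have "\<dots> = parr ` {e. (j, e) \<in> all_arcs True t}" using that by (simp add: larcs_def all_arcs_def)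
    finally show ?thesis .
  qed
  have m: "medial_arcs ?G j = parr ` {e. (j, e) \<in> all_arcs True t}" if "j < leaves t" for j
    using m0 m1 that by (cases "j = 0") auto
  have lab: "j < leaves t" if "(j, e) \<in> all_arcs True t" for j e
    using that arcs_label[of j e True 0 t] leaves_pos[of t] by (auto simp: all_arcs_def)
  have "(\<Union>j < leaves t. orient (c j) (medial_arcs ?G j)) = (\<Union>j < leaves t. parr ` orient1 (c j) ` {e. (j, e) \<in> all_arcs True t})"
    using m by (intro SUP_cong refl) (simp add: orient_image image_image parr_orient1)
  also have "\<dots> = parr ` oarr c (all_arcs True t)"
  proof (intro equalityI subsetI)
    fix w assume "w \<in> parr ` oarr c (all_arcs True t)"
    then obtain z where z: "z \<in> all_arcs True t" "w = parr (case z of (j, e) \<Rightarrow> orient1 (c j) e)" unfolding oarr_def by blast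
    obtain j e where "z = (j, e)" by (cases z)
    then have "(j, e) \<in> all_arcs True t" "w = parr (orient1 (c j) e)" using z by simp_all
    then show "w \<in> (\<Union>j < leaves t. parr ` orient1 (c j) ` {e. (j, e) \<in> all_arcs True t})" using lab by blast
  next
    fix w assume "w \<in> (\<Union>j < leaves t. parr ` orient1 (c j) ` {e. (j, e) \<in> all_arcs True t})"
    then obtain j e where "(j, e) \<in> all_arcs True t" "w = parr (orient1 (c j) e)" by blast
    moreover from this have "orient1 (c j) e \<in> oarr c (all_arcs True t)"
      unfolding oarr_def by (intro image_eqI[of _ _ "(j, e)"]) simp_all
    ultimately show "w \<in> parr ` oarr c (all_arcs True t)" by blast
  qed
  finally have 1: "(\<Union>j < leaves t. orient (c j) (medial_arcs ?G j)) = parr ` oarr c (all_arcs True t)" .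
  define f where "f e = parr (orient1 (c (fst e)) (LL True (fst e) (snd e), UR True (fst e) (snd e)))" for e
  define g where "g e = parr (orient1 (c (fst e)) (LR True (fst e) (snd e), UL True (fst e) (snd e)))" for e
  have "orient (c (fst e)) (strands e) = {f e, g e}" for e
    using pos_corner[of "fst e" "snd e"]
    by (simp add: f_def g_def orient_image strands_def parr_orient1) (simp add: parr_def)
  then have "(\<Union>e \<in> ?G. orient (c (fst e)) (strands e)) = (\<Union>e \<in> ?G. {f e, g e})" by simp
  also have "\<dots> = f ` ?G \<union> g ` ?G" by blast
  also have "\<dots> = parr ` oarr c (pstr True ?G \<union> nstr True ?G)"
    unfolding oarr_def pstr_def nstr_def image_Un image_image f_def g_def case_prod_beta fst_conv snd_conv ..
  finally have 2: "(\<Union>e \<in> ?G. orient (c (fst e)) (strands e)) = parr ` oarr c (pstr True ?G \<union> nstr True ?G)" .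
  show ?thesis
    unfolding half_link_def Let_def 1 2 by (simp add: oarr_def image_Un Un_assoc)
qed

fun low :: "vert \<Rightarrow> vert" where
  "low (Cor u i j a b) = Cor False i j a b"
| "low v = v"

lemma low_ex: "low (ex True s t) = ex False s t"
  by (cases t) auto

lemma low_warc: "warc False s t = map_prod id (map_prod low low) ` warc True s t"
  by (induction t arbitrary: s) (auto simp: low_ex image_Un)

lemma reflect_pos: "(\<exists>i j a b. v = Cor True i j a b) \<or> (\<exists>j. v = AxR j \<or> v = AxL j) \<Longrightarrow> reflect (pos v) = pos (low v)"
  by (auto simp: reflect_def pos_def)

lemma ex_kind: "(\<exists>i j a b. ex True s t = Cor True i j a b) \<or> (\<exists>j. ex True s t = AxR j \<or> ex True s t = AxL j)"
  by (cases t) auto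

lemma warc_kind: "(j, p, q) \<in> warc True s t \<Longrightarrow> v = p \<or> v = q \<Longrightarrow>
    (\<exists>i j a b. v = Cor True i j a b) \<or> (\<exists>j. v = AxR j \<or> v = AxL j)"
proof (induction t arbitrary: s)
  case (Node l r)
  let ?b = "s + leaves l"
  consider "(j, p, q) \<in> warc True s l" | "(j, p, q) \<in> warc True ?b r" | "p = ex True s l" "q = LL True s ?b"
    | "p = ex True ?b r" "q = UR True s ?b"
    using Node.prems(1) by auto
  then show ?case
  proof cases
    case 1 then show ?thesis using Node.IH(1) Node.prems(2) by blast
  next
    case 2 then show ?thesis using Node.IH(2) Node.prems(2) by blast
  next
    case 3 then show ?thesis using Node.prems(2) ex_kind[of s l] by auto
  next
    case 4 then show ?thesis using Node.prems(2) ex_kind[of ?b r] by auto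
  qed
qed simp

lemma reflected_half_link:
  assumes "t \<noteq> Leaf"
  shows "map_prod reflect reflect ` half_link c t =
    parr ` oarr c (all_arcs False t \<union> pstr False (half_graph 0 t) \<union> nstr False (half_graph 0 t))"
proof -
  let ?G = "half_graph 0 t"
  let ?Z = "\<lambda>u. all_arcs u t \<union> pstr u ?G \<union> nstr u ?G"
  let ?f = "map_prod (id :: nat \<Rightarrow> nat) (map_prod low low)"
  have Z: "?Z False = ?f ` ?Z True"
    by (simp add: all_arcs_def arcs_def low_warc low_ex uarc_def pstr_def nstr_def image_Un image_image case_prod_beta)
  have kind: "(\<exists>i j a b. v = Cor True i j a b) \<or> (\<exists>j. v = AxR j \<or> v = AxL j)"
    if "(k, p, q) \<in> ?Z True" "v = p \<or> v = q" for k p q v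
    using that warc_kind[of k p q 0 t v] ex_kind[of 0 t]
    by (auto simp: all_arcs_def arcs_def uarc_def pstr_def nstr_def)
  have "map_prod reflect reflect (parr (orient1 (c k) (p, q))) = parr (orient1 (c k) (low p, low q))"
    if "(k, p, q) \<in> ?Z True" for k p q
    using reflect_pos[OF kind[OF that, of p]] reflect_pos[OF kind[OF that, of q]]
    by (simp add: orient1_def parr_def)
  then have "map_prod reflect reflect ` parr ` oarr c (?Z True) = parr ` oarr c (?f ` ?Z True)"
    unfolding oarr_def image_image
  proof (intro image_cong refl)
    fix z assume *: "\<And>k p q. (k, p, q) \<in> ?Z True \<Longrightarrow> map_prod reflect reflect (parr (orient1 (c k) (p, q))) = parr (orient1 (c k) (low p, low q))"
      and z: "z \<in> ?Z True"
    obtain k p q where "z = (k, p, q)" by (cases z)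
    then show "map_prod reflect reflect (parr (case z of (j, e) \<Rightarrow> orient1 (c j) e)) =
      parr (case ?f z of (j, e) \<Rightarrow> orient1 (c j) e)"
      using *[of k p q] z by simp
  qed
  then show ?thesis unfolding half_link_oarr[OF assms] Z by simp
qed

section \<open>Every vertex is entered once and left once\<close>

definition arc_tails :: "bool \<Rightarrow> nat \<Rightarrow> btree \<Rightarrow> vert set" where
  "arc_tails u s t = {AxR j | j. s \<le> j \<and> j < s + leaves t} \<union> (\<lambda>(a, b). UL u a b) ` half_graph s t \<union> (\<lambda>(a, b). LR u a b) ` half_graph s t"

definition arc_heads :: "bool \<Rightarrow> nat \<Rightarrow> btree \<Rightarrow> vert set" where
  "arc_heads u s t = {AxL j | j. s < j \<and> j < s + leaves t} \<union> (\<lambda>(a, b). LL u a b) ` half_graph s t \<union> (\<lambda>(a, b). UR u a b) ` half_graph s t"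

lemma ex_in_tails: "ex u s t \<in> arc_tails u s t"
  using leaves_pos[of t] by (cases t) (auto simp: arc_tails_def)

lemma arc_tails_Node:
  "arc_tails u s (Node l r) = {UL u s (s + leaves l), LR u s (s + leaves l)} \<union> arc_tails u s l \<union> arc_tails u (s + leaves l) r"
  by (auto simp: arc_tails_def)

lemma arc_heads_Node:
  "arc_heads u s (Node l r) = {AxL (s + leaves l), LL u s (s + leaves l), UR u s (s + leaves l)} \<union> arc_heads u s l \<union> arc_heads u (s + leaves l) r"
  using leaves_pos[of l] leaves_pos[of r] by (auto simp: arc_heads_def)

lemma arc_tails_disjoint:
  assumes "b = s + leaves l"
  shows "arc_tails u s l \<inter> arc_tails u b r = {}" "UL u s b \<notin> arc_tails u s l \<union> arc_tails u b r" "LR u s b \<notin> arc_tails u s l \<union> arc_tails u b r"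
    "arc_heads u s l \<inter> arc_heads u b r = {}" "AxL b \<notin> arc_heads u s l \<union> arc_heads u b r"
    "LL u s b \<notin> arc_heads u s l \<union> arc_heads u b r" "UR u s b \<notin> arc_heads u s l \<union> arc_heads u b r"
  using assms half_graph_range[of _ _ s l] half_graph_range[of _ _ b r] leaves_pos[of l]
  by (fastforce simp: arc_tails_def arc_heads_def)+

lemma inj_on_Un_disjoint: "inj_on f A \<Longrightarrow> inj_on f B \<Longrightarrow> f ` A \<inter> f ` B = {} \<Longrightarrow> inj_on f (A \<union> B)"
  unfolding inj_on_Un by blast

text \<open>The exit point is the only start without an arc inside the subtree. The surrounding tree
  attaches the missing arc, or finally \<open>all_arcs\<close> does.\<close>

lemma arcs_bij:
  "inj_on (fst \<circ> snd) (arcs u s t) \<and> inj_on (snd \<circ> snd) (arcs u s t) \<and>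
   (fst \<circ> snd) ` arcs u s t = arc_tails u s t - {ex u s t} \<and> (snd \<circ> snd) ` arcs u s t = arc_heads u s t"
proof (induction t arbitrary: s)
  case Leaf
  then show ?case by (auto simp: arcs_simps arc_tails_def arc_heads_def)
next
  case (Node l r)
  define b where "b = s + leaves l"
  note dj = arc_tails_disjoint[OF b_def, of u r]
  let ?N = "{(s, ex u s l, LL u s b), (b, ex u b r, UR u s b), (b, LR u s b, AxL b)}"
  have A: "arcs u s (Node l r) = ?N \<union> (arcs u s l \<union> arcs u b r)" by (simp add: arcs_simps b_def)
  note l = Node.IH(1)[of s] and r = Node.IH(2)[of b]
  have e: "ex u s l \<in> arc_tails u s l" "ex u b r \<in> arc_tails u b r" by (rule ex_in_tails)+
  have t0: "(fst \<circ> snd) ` (arcs u s l \<union> arcs u b r) = (arc_tails u s l - {ex u s l}) \<union> (arc_tails u b r - {ex u b r})"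
    using l r by (simp only: image_Un)
  have h0: "(snd \<circ> snd) ` (arcs u s l \<union> arcs u b r) = arc_heads u s l \<union> arc_heads u b r"
    using l r by (simp only: image_Un)
  have i1: "inj_on (fst \<circ> snd) (arcs u s l \<union> arcs u b r)"
    unfolding inj_on_Un using l r dj(1) by (simp only: ) blast
  have i2: "inj_on (snd \<circ> snd) (arcs u s l \<union> arcs u b r)"
    unfolding inj_on_Un using l r dj(4) by (simp only: ) blast
  have tN: "(fst \<circ> snd) ` ?N = {ex u s l, ex u b r, LR u s b}" by simp
  have hN: "(snd \<circ> snd) ` ?N = {LL u s b, UR u s b, AxL b}" by simp
  have "ex u s l \<noteq> ex u b r" "ex u s l \<noteq> LR u s b" "ex u b r \<noteq> LR u s b" using e dj(1-3) by auto
  then have j1: "inj_on (fst \<circ> snd) ?N" by auto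
  have j2: "inj_on (snd \<circ> snd) ?N" by auto
  have d1: "(fst \<circ> snd) ` ?N \<inter> (fst \<circ> snd) ` (arcs u s l \<union> arcs u b r) = {}"
    unfolding t0 tN using e dj(1-3) by blast
  have d2: "(snd \<circ> snd) ` ?N \<inter> (snd \<circ> snd) ` (arcs u s l \<union> arcs u b r) = {}"
    unfolding h0 hN using dj(5-7) by blast
  have I1: "inj_on (fst \<circ> snd) (arcs u s (Node l r))" unfolding A by (rule inj_on_Un_disjoint[OF j1 i1 d1])
  have I2: "inj_on (snd \<circ> snd) (arcs u s (Node l r))" unfolding A by (rule inj_on_Un_disjoint[OF j2 i2 d2])
  have X: "ex u s (Node l r) = UL u s b" by (simp add: b_def)
  have T: "(fst \<circ> snd) ` arcs u s (Node l r) = arc_tails u s (Node l r) - {ex u s (Node l r)}"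
    unfolding A image_Un[of _ ?N] tN t0 X arc_tails_Node b_def[symmetric] using e dj(1-3) by (auto simp: b_def)
  have H: "(snd \<circ> snd) ` arcs u s (Node l r) = arc_heads u s (Node l r)"
    unfolding A image_Un[of _ ?N] hN h0 arc_heads_Node b_def[symmetric] by auto
  show ?case by (intro conjI I1 I2 T H)
qed

lemma all_arcs_bij:
  fixes u t
  defines "Z \<equiv> all_arcs u t"
  shows "inj_on (fst \<circ> snd) Z" "inj_on (snd \<circ> snd) Z"
    "(fst \<circ> snd) ` Z = arc_tails u 0 t" "(snd \<circ> snd) ` Z = insert (AxL 0) (arc_heads u 0 t)"
proof -
  note a = arcs_bij[of u 0 t]
  have n: "AxL 0 \<notin> arc_heads u 0 t" by (auto simp: arc_heads_def)
  have i: "(fst \<circ> snd) ` arcs u 0 t = arc_tails u 0 t - {ex u 0 t}" "(snd \<circ> snd) ` arcs u 0 t = arc_heads u 0 t" using a by auto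
  show "inj_on (fst \<circ> snd) Z" "inj_on (snd \<circ> snd) Z"
  proof -
    have "(fst \<circ> snd) (0 :: nat, ex u 0 t, AxL 0) \<notin> (fst \<circ> snd) ` arcs u 0 t" unfolding i by simp
    then show "inj_on (fst \<circ> snd) Z" unfolding Z_def all_arcs_def inj_on_insert using a[THEN conjunct1]
      by (intro conjI) (assumption, blast)
    have "(snd \<circ> snd) (0 :: nat, ex u 0 t, AxL 0) \<notin> (snd \<circ> snd) ` arcs u 0 t" unfolding i using n by simp
    then show "inj_on (snd \<circ> snd) Z" unfolding Z_def all_arcs_def inj_on_insert using a[THEN conjunct2, THEN conjunct1]
      by (intro conjI) (assumption, blast)
  qed
  show "(fst \<circ> snd) ` Z = arc_tails u 0 t" "(snd \<circ> snd) ` Z = insert (AxL 0) (arc_heads u 0 t)"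
    unfolding Z_def all_arcs_def image_insert i using ex_in_tails[of u 0 t] by auto
qed

text \<open>Whether the arc at the vertex points away from it in the orientation given by the
  colours. Counterclockwise, arcs end in \<open>LL\<close> and \<open>UR\<close> and start in
  \<open>UL\<close> and \<open>LR\<close>; the colour that counts is that of the vertex on whose
  side the corner lies.\<close>

fun arc_out :: "(nat \<Rightarrow> bool) \<Rightarrow> vert \<Rightarrow> bool" where
  "arc_out c (AxR j) \<longleftrightarrow> c j"
| "arc_out c (AxL j) \<longleftrightarrow> \<not> c j"
| "arc_out c (Cor u i j a b) \<longleftrightarrow> (if i = j then \<not> (if i then c b else c a) else if i then c b else c a)"
| "arc_out c _ \<longleftrightarrow> False"

lemma arc_label_ends:
  assumes "(j, p, q) \<in> all_arcs u t" 
  shows "arc_out c p = c j" "arc_out c q = (\<not> c j)"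
proof -
  have ex: "arc_out c (ex u s l) = c s" for s l by (cases l) auto
  have "(j, p, q) \<in> arcs u s t \<Longrightarrow> arc_out c p = c j \<and> arc_out c q = (\<not> c j)" for s t
  proof (induction t arbitrary: s)
    case (Node l r)
    then show ?case using ex by (auto simp: arcs_simps)
  qed (simp add: arcs_simps)
  then show "arc_out c p = c j" "arc_out c q = (\<not> c j)"
    using assms ex unfolding all_arcs_def by auto
qed

definition half_verts :: "bool \<Rightarrow> btree \<Rightarrow> vert set" where
  "half_verts u t = {Cor u i j a b | i j a b. (a, b) \<in> half_graph 0 t} \<union> {AxR j | j. j < leaves t} \<union> {AxL j | j. j < leaves t}"

lemma all_arcs_ends: "(fst \<circ> snd) ` all_arcs u t \<union> (snd \<circ> snd) ` all_arcs u t = half_verts u t"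
  unfolding all_arcs_bij
proof (intro equalityI subsetI)
  fix v assume "v \<in> arc_tails u 0 t \<union> insert (AxL 0) (arc_heads u 0 t)"
  then show "v \<in> half_verts u t"
    using leaves_pos[of t] unfolding half_verts_def arc_tails_def arc_heads_def by auto
next
  fix v assume "v \<in> half_verts u t"
  then consider i j a b where "v = Cor u i j a b" "(a, b) \<in> half_graph 0 t" | j where "v = AxR j" "j < leaves t"
    | j where "v = AxL j" "j < leaves t" unfolding half_verts_def by blast
  then show "v \<in> arc_tails u 0 t \<union> insert (AxL 0) (arc_heads u 0 t)"
  proof cases
    case (1 i j a b)
    then show ?thesis by (cases i; cases j) (auto simp: arc_tails_def arc_heads_def intro: rev_image_eqI)
  qed (auto simp: arc_tails_def arc_heads_def)
qed

lemma all_arcs_disjoint_ends: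
  "(fst \<circ> snd) ` all_arcs u t \<inter> (snd \<circ> snd) ` all_arcs u t = {}"
  unfolding all_arcs_bij by (auto simp: arc_tails_def arc_heads_def)

text \<open>An arc leaves a corner if and only if the strand through it enters it, and of the two arcs
  at a point of the axis one leaves it.\<close>

lemma oarr_arcs:
  fixes c u t
  defines "A \<equiv> oarr c (all_arcs u t)"
  shows "inj_on fst A" "inj_on snd A" "fst ` A = {v \<in> half_verts u t. arc_out c v}" "snd ` A = {v \<in> half_verts u t. \<not> arc_out c v}"
proof -
  let ?Z = "all_arcs u t"
  have A: "e \<in> A \<longleftrightarrow> (\<exists>j p q. (j, p, q) \<in> ?Z \<and> (if c j then e = (p, q) else e = (q, p)))" for e
    unfolding A_def oarr_def orient1_def by (force simp: prod.swap_def split: if_splits)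
  note inj = all_arcs_bij[of u t]
  have i1: "(j, p, q) = (j', p, q')" if "(j, p, q) \<in> ?Z" "(j', p, q') \<in> ?Z" for j p q j' q'
    using inj_onD[OF inj(1), of "(j, p, q)" "(j', p, q')"] that by simp
  have i2: "(j, p, q) = (j', p', q)" if "(j, p, q) \<in> ?Z" "(j', p', q) \<in> ?Z" for j p q j' p'
    using inj_onD[OF inj(2), of "(j, p, q)" "(j', p', q)"] that by simp
  have dj: "p \<noteq> q'" if "(j, p, q) \<in> ?Z" "(j', p', q') \<in> ?Z" for j p q j' p' q'
  proof
    assume "p = q'"
    then have "p \<in> (fst \<circ> snd) ` ?Z \<inter> (snd \<circ> snd) ` ?Z" using that by force
    then show False using all_arcs_disjoint_ends by blast
  qed
  show "inj_on fst A"
  proof (rule inj_onI)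
    fix e f assume "e \<in> A" "f \<in> A" "fst e = fst f"
    then show "e = f" unfolding A using i1 i2 dj by (auto split: if_splits) (metis prod.inject)+
  qed
  show "inj_on snd A"
  proof (rule inj_onI)
    fix e f assume "e \<in> A" "f \<in> A" "snd e = snd f"
    then show "e = f" unfolding A using i1 i2 dj by (auto split: if_splits) (metis prod.inject)+
  qed
  have v: "v \<in> half_verts u t \<longleftrightarrow> (\<exists>j p q. (j, p, q) \<in> ?Z \<and> (v = p \<or> v = q))" for v
    unfolding all_arcs_ends[symmetric] by force
  show "fst ` A = {v \<in> half_verts u t. arc_out c v}"
  proof (intro equalityI subsetI)
    fix w assume "w \<in> fst ` A"
    then obtain j p q where "(j, p, q) \<in> ?Z" "if c j then w = p else w = q" unfolding image_iff Bex_def A by (auto split: if_splits)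
    then show "w \<in> {v \<in> half_verts u t. arc_out c v}" using arc_label_ends[of j p q u t c] v by (auto split: if_splits)
  next
    fix w assume w: "w \<in> {v \<in> half_verts u t. arc_out c v}"
    then obtain j p q where z: "(j, p, q) \<in> ?Z" "w = p \<or> w = q" using v by blast
    then have "if c j then w = p else w = q" using arc_label_ends[OF z(1), of c] w by auto
    then have "(if c j then (p, q) else (q, p)) \<in> A \<and> w = fst (if c j then (p, q) else (q, p))" using z(1) unfolding A by auto
    then show "w \<in> fst ` A" by blast
  qed
  show "snd ` A = {v \<in> half_verts u t. \<not> arc_out c v}"
  proof (intro equalityI subsetI)
    fix w assume "w \<in> snd ` A"
    then obtain j p q where "(j, p, q) \<in> ?Z" "if c j then w = q else w = p" unfolding image_iff Bex_def A by (auto split: if_splits)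
    then show "w \<in> {v \<in> half_verts u t. \<not> arc_out c v}" using arc_label_ends[of j p q u t c] v by (auto split: if_splits)
  next
    fix w assume w: "w \<in> {v \<in> half_verts u t. \<not> arc_out c v}"
    then obtain j p q where z: "(j, p, q) \<in> ?Z" "w = p \<or> w = q" using v by blast
    then have "if c j then w = q else w = p" using arc_label_ends[OF z(1), of c] w by auto
    then have "(if c j then (p, q) else (q, p)) \<in> A \<and> w = snd (if c j then (p, q) else (q, p))" using z(1) unfolding A by auto
    then show "w \<in> snd ` A" by blast
  qed
qed

definition corner_verts :: "bool \<Rightarrow> btree \<Rightarrow> vert set" where
  "corner_verts u t = {Cor u i j a b | i j a b. (a, b) \<in> half_graph 0 t}"

text \<open>Properness of the colouring enters here: as the ends of an edge have different colours,
  both strands start in corners where an arc arrives and end in corners where an arc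
  departs.\<close>

lemma oarr_strands:
  fixes c u t
  defines "G \<equiv> half_graph 0 t"
  defines "A \<equiv> oarr c (pstr u G \<union> nstr u G)"
  assumes c: "\<And>a b. (a, b) \<in> G \<Longrightarrow> c a \<noteq> c b"
  shows "inj_on fst A" "inj_on snd A" "fst ` A = {v \<in> corner_verts u t. \<not> arc_out c v}" "snd ` A = {v \<in> corner_verts u t. arc_out c v}"
proof -
  have A: "A = (\<lambda>(a, b). if c a then (LL u a b, UR u a b) else (UR u a b, LL u a b)) ` G \<union>
     (\<lambda>(a, b). if c a then (LR u a b, UL u a b) else (UL u a b, LR u a b)) ` G"
    unfolding A_def oarr_def pstr_def nstr_def image_Un image_image
    by (intro arg_cong2[of _ _ _ _ "(\<union>)"] image_cong refl) (auto simp: orient1_def)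
  show "inj_on fst A" "inj_on snd A" unfolding A inj_on_def by (auto split: if_splits)
  show "fst ` A = {v \<in> corner_verts u t. \<not> arc_out c v}"
  proof (intro equalityI subsetI)
    fix v assume "v \<in> fst ` A"
    then show "v \<in> {v \<in> corner_verts u t. \<not> arc_out c v}" using c unfolding A corner_verts_def G_def by (auto split: if_splits)
  next
    fix v assume "v \<in> {v \<in> corner_verts u t. \<not> arc_out c v}"
    then obtain i j a b where "v = Cor u i j a b" "(a, b) \<in> G" "\<not> arc_out c v" unfolding corner_verts_def G_def by blast
    then show "v \<in> fst ` A" using c[of a b] unfolding A by (cases i; cases j; cases "c a") (force simp: image_Un)+
  qed
  show "snd ` A = {v \<in> corner_verts u t. arc_out c v}"
  proof (intro equalityI subsetI)
    fix v assume "v \<in> snd ` A"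
    then show "v \<in> {v \<in> corner_verts u t. arc_out c v}" using c unfolding A corner_verts_def G_def by (auto split: if_splits)
  next
    fix v assume "v \<in> {v \<in> corner_verts u t. arc_out c v}"
    then obtain i j a b where "v = Cor u i j a b" "(a, b) \<in> G" "arc_out c v" unfolding corner_verts_def G_def by blast
    then show "v \<in> snd ` A" using c[of a b] unfolding A by (cases i; cases j; cases "c a") (force simp: image_Un)+
  qed
qed

definition half_arrows :: "(nat \<Rightarrow> bool) \<Rightarrow> bool \<Rightarrow> btree \<Rightarrow> (vert \<times> vert) set" where
  "half_arrows c u t = oarr c (all_arcs u t \<union> pstr u (half_graph 0 t) \<union> nstr u (half_graph 0 t))"

text \<open>A corner is both entered and left within one half; a point of the axis is a loose end,
  whose direction depends on the colour. The other half, with colours exchanged, supplies the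
  missing arrow.\<close>

lemma half_arrows_ends:
  assumes c: "\<And>a b. (a, b) \<in> half_graph 0 t \<Longrightarrow> c a \<noteq> c b"
  shows "inj_on fst (half_arrows c u t)" "inj_on snd (half_arrows c u t)"
    "fst ` half_arrows c u t = corner_verts u t \<union> {AxR j | j. j < leaves t \<and> c j} \<union> {AxL j | j. j < leaves t \<and> \<not> c j}"
    "snd ` half_arrows c u t = corner_verts u t \<union> {AxR j | j. j < leaves t \<and> \<not> c j} \<union> {AxL j | j. j < leaves t \<and> c j}"
proof -
  have E: "half_arrows c u t = oarr c (all_arcs u t) \<union> oarr c (pstr u (half_graph 0 t) \<union> nstr u (half_graph 0 t))"
    by (simp add: half_arrows_def oarr_def image_Un Un_assoc)
  let ?S = "oarr c (pstr u (half_graph 0 t) \<union> nstr u (half_graph 0 t))"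
  note a = oarr_arcs[of c u t]
  have s: "inj_on fst ?S" "inj_on snd ?S" "fst ` ?S = {v \<in> corner_verts u t. \<not> arc_out c v}" "snd ` ?S = {v \<in> corner_verts u t. arc_out c v}"
    by (rule oarr_strands, erule c)+
  have hv: "half_verts u t = corner_verts u t \<union> {AxR j | j. j < leaves t} \<union> {AxL j | j. j < leaves t}"
    by (simp add: half_verts_def corner_verts_def)
  show "inj_on fst (half_arrows c u t)"
    unfolding E by (rule inj_on_Un_disjoint[OF a(1) s(1)]) (unfold a(3) s(3), auto)
  show "inj_on snd (half_arrows c u t)"
    unfolding E by (rule inj_on_Un_disjoint[OF a(2) s(2)]) (unfold a(4) s(4), auto)
  show "fst ` half_arrows c u t = corner_verts u t \<union> {AxR j | j. j < leaves t \<and> c j} \<union> {AxL j | j. j < leaves t \<and> \<not> c j}"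
    unfolding E image_Un a(3) s(3) hv by auto
  show "snd ` half_arrows c u t = corner_verts u t \<union> {AxR j | j. j < leaves t \<and> \<not> c j} \<union> {AxL j | j. j < leaves t \<and> c j}"
    unfolding E image_Un a(4) s(4) hv by auto
qed

lemma arrows_ends:
  assumes cT: "\<And>a b. (a, b) \<in> half_graph 0 T \<Longrightarrow> c a \<noteq> c b" and cB: "\<And>a b. (a, b) \<in> half_graph 0 B \<Longrightarrow> c a \<noteq> c b"
    and n: "leaves T = leaves B"
  defines "E \<equiv> half_arrows c True T \<union> half_arrows (\<lambda>j. \<not> c j) False B"
  shows "inj_on fst E" "inj_on snd E" "fst ` E = snd ` E"
proof -
  let ?hT = "half_arrows c True T" and ?hB = "half_arrows (\<lambda>j. \<not> c j) False B"
  have T: "inj_on fst ?hT" "inj_on snd ?hT"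
    "fst ` ?hT = corner_verts True T \<union> {AxR j | j. j < leaves T \<and> c j} \<union> {AxL j | j. j < leaves T \<and> \<not> c j}"
    "snd ` ?hT = corner_verts True T \<union> {AxR j | j. j < leaves T \<and> \<not> c j} \<union> {AxL j | j. j < leaves T \<and> c j}"
    by (rule half_arrows_ends, erule cT)+
  have cB': "(\<not> c a) \<noteq> (\<not> c b)" if "(a, b) \<in> half_graph 0 B" for a b using cB[OF that] by blast
  have B: "inj_on fst ?hB" "inj_on snd ?hB"
    "fst ` ?hB = corner_verts False B \<union> {AxR j | j. j < leaves B \<and> \<not> c j} \<union> {AxL j | j. j < leaves B \<and> \<not> \<not> c j}"
    "snd ` ?hB = corner_verts False B \<union> {AxR j | j. j < leaves B \<and> \<not> \<not> c j} \<union> {AxL j | j. j < leaves B \<and> \<not> c j}"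
    by (rule half_arrows_ends, erule cB')+
  have cv: "Cor True i j a b \<notin> corner_verts False t" "Cor False i j a b \<notin> corner_verts True t"
    "AxR k \<notin> corner_verts u t" "AxL k \<notin> corner_verts u t" for i j a b k u t by (auto simp: corner_verts_def)
  have d: "corner_verts True T \<inter> corner_verts False B = {}" by (auto simp: corner_verts_def)
  show "inj_on fst E" unfolding E_def by (rule inj_on_Un_disjoint[OF T(1) B(1)]) (unfold T(3) B(3), use cv d in auto)
  show "inj_on snd E" unfolding E_def by (rule inj_on_Un_disjoint[OF T(2) B(2)]) (unfold T(4) B(4), use cv d in auto)
  show "fst ` E = snd ` E" unfolding E_def image_Un T(3,4) B(3,4) n by auto
qed

section \<open>Positions of the vertices, and the two half planes\<close>

fun valid :: "vert \<Rightarrow> bool" where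
  "valid (Cor u i j a b) \<longleftrightarrow> a < b"
| "valid (VP a b) \<longleftrightarrow> a < b"
| "valid (VQ a b) \<longleftrightarrow> a < b"
| "valid (Apx u) \<longleftrightarrow> False"
| "valid _ \<longleftrightarrow> True"

fun axv :: "vert \<Rightarrow> bool" where
  "axv (AxR j) \<longleftrightarrow> True"
| "axv (AxL j) \<longleftrightarrow> True"
| "axv (VP a b) \<longleftrightarrow> a < b"
| "axv _ \<longleftrightarrow> False"

lemma offset_inj:
  assumes "a < b" "a' < b'" and eq: "real a + 1 / (16 * (real b - real a)) = real a' + 1 / (16 * (real b' - real a'))"
  shows "a = a' \<and> b = b'"
proof -
  note 1 = vp_bounds[OF assms(1)] and 2 = vp_bounds[OF assms(2)]
  have "real a < real a' + 1" "real a' < real a + 1" using 1(1,2) 2(1,2) eq by linarith+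
  then have a: "a = a'" by linarith
  then have "1 / (16 * (real b - real a)) = 1 / (16 * (real b' - real a))" using eq by simp
  then have "b = b'" using assms a by (simp add: field_simps)
  then show ?thesis using a by blast
qed

text \<open>The fractional parts keep the three kinds apart: \<open>1/4\<close> for
  \<open>AxR\<close>, \<open>3/4\<close> for \<open>AxL\<close>, and a value in
  \<open>(0, 1/16]\<close> for \<open>VP\<close>.\<close>

lemma axis_inj:
  assumes "axv v" "axv w" "vx v = vx w"
  shows "v = w"
proof -
  have q: "real j + 1/4 \<noteq> real k - 1/4" for j k
  proof
    assume "real j + 1/4 = real k - 1/4"
    then have "real (2 * j + 1) = real (2 * k)" by simp
    then show False unfolding of_nat_eq_iff by presburger
  qed
  have r: "real a + 1 / (16 * (real b - real a)) \<noteq> real j + 1/4" "real a + 1 / (16 * (real b - real a)) \<noteq> real j - 1/4"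
    if "a < b" for a b j
  proof -
    note 1 = vp_bounds(1,2)[OF that]
    show "real a + 1 / (16 * (real b - real a)) \<noteq> real j + 1/4"
    proof
      assume "real a + 1 / (16 * (real b - real a)) = real j + 1/4"
      then have "j < a" "a < j + 1" using 1 by linarith+
      then show False by linarith
    qed
    show "real a + 1 / (16 * (real b - real a)) \<noteq> real j - 1/4"
    proof
      assume "real a + 1 / (16 * (real b - real a)) = real j - 1/4"
      then have "a < j" "j < a + 1" using 1 by linarith+
      then show False by linarith
    qed
  qed
  show ?thesis
  proof (cases v)
    case (AxR j)
    show ?thesis using assms q[of j] r[of _ _ j] unfolding AxR by (cases w) fastforce+
  next
    case (AxL j)
    show ?thesis using assms q[of _ j] r[of _ _ j] unfolding AxL by (cases w) fastforce+
  next
    case (VP a b)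
    show ?thesis
    proof (cases w)
      case w: (VP a' b')
      show ?thesis using assms offset_inj[of a b a' b'] unfolding VP w by simp
    next
      case (AxR j)
      have "a < b" using assms(1) VP by simp
      then show ?thesis using assms(3) r(1)[of a b j] unfolding VP AxR vx.simps by blast
    next
      case (AxL j)
      have "a < b" using assms(1) VP by simp
      then show ?thesis using assms(3) r(2)[of a b j] unfolding VP AxL vx.simps by blast
    qed (use assms VP in simp_all)
  qed (use assms in simp_all)
qed

text \<open>Different signs would make an odd integer equal to an even one after doubling.\<close>

lemma quarter_inj:
  assumes "real m + (if i then 1/4 else - 1/4) = real n + (if j then 1/4 else - 1/4)"
  shows "i = j \<and> m = n"
proof -
  have "i = j"
  proof (rule ccontr)
    assume "i \<noteq> j"
    then have "real (2 * m + 1) = real (2 * n) \<or> real (2 * m) = real (2 * n + 1)" using assms by (cases i) auto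
    then show False unfolding of_nat_eq_iff by presburger
  qed
  then show ?thesis using assms by simp
qed

lemma cor_coords:
  assumes "a < b"
  shows "2 * vx (Cor u i j a b) = real (a + b) + (if i then 1/4 else - 1/4)"
    "2 * vy (Cor u i j a b) = (if u then 1 else - 1) * (real ((b - a)\<^sup>2) + (if j then 1/4 else - 1/4))"
    "1 \<le> real ((b - a)\<^sup>2)"
proof -
  have "1 \<le> (b - a)\<^sup>2" using assms by simp
  then show "1 \<le> real ((b - a)\<^sup>2)" by linarith
qed (use assms in \<open>auto simp: of_nat_diff\<close>)

text \<open>Twice the coordinates of a corner are, up to the sign of the half plane, integers
  shifted by a quarter. So \<open>a + b\<close>, the square of \<open>b - a\<close> and the two
  offsets can be read off.\<close>

lemma pos_inj:
  assumes "valid v" "valid w" "pos v = pos w"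
  shows "v = w"
proof -
  have e: "vx v = vx w" "vy v = vy w" "vz v = vz w" using assms(3) by (auto simp: pos_def)
  have cy: "vy (Cor u i j a b) \<noteq> 0" "vz (Cor u i j a b) \<ge> 0" if "a < b" for u i j a b
    using cor_coords(2)[OF that, of u i j] cor_coords(3)[OF that] by (auto split: if_splits)
  have qy: "vy (VQ a b) \<noteq> 0" if "a < b" for a b
  proof -
    have "real a + 1 \<le> real b" using that by linarith
    then show ?thesis using vp_bounds(1,2)[OF that] unfolding vy.simps by linarith
  qed
  have ax: "vy x = 0" "vz x = (case x of VP _ _ \<Rightarrow> -1 | _ \<Rightarrow> 0)" if "axv x" for x using that by (cases x; simp)+
  consider "axv v" | "axv w" | "\<not> axv v" "\<not> axv w" by blast
  then show ?thesis
  proof cases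
    case 1
    have "axv w" using assms(2) e ax[OF 1] cy(1) qy by (cases w) (metis valid.simps axv.simps)+
    then show ?thesis using axis_inj 1 e by blast
  next
    case 2
    have "axv v" using assms(1) e ax[OF 2] cy(1) qy by (cases v) (metis valid.simps axv.simps)+
    then show ?thesis using axis_inj 2 e by blast
  next
    case 3
    show ?thesis
    proof (cases v)
      case v: (Cor u i j a b)
      have ab: "a < b" using assms(1) v by simp
      have "vz v \<ge> 0" using cy(2)[OF ab] v by simp
      then obtain u' i' j' a' b' where w: "w = Cor u' i' j' a' b'" using 3 assms(2) e by (cases w) auto
      have ab': "a' < b'" using assms(2) w by simp
      note 1 = cor_coords(1,2)[OF ab, of u i j] cor_coords(3)[OF ab] and 2 = cor_coords(1,2)[OF ab', of u' i' j'] cor_coords(3)[OF ab']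
      have x: "i = i' \<and> a + b = a' + b'" using 1(1) 2(1) e(1) unfolding v w by (intro quarter_inj) linarith
      have sgn: "0 < vy (Cor u i j a b) \<longleftrightarrow> u" if "a < b" for u i j a b
      proof -
        have "vy (Cor False i j a b) = - vy (Cor True i j a b)" by simp
        then show ?thesis using cor_bounds(4)[OF that, of i j] by (cases u) (simp_all del: vy.simps)
      qed
      have u: "u' = u" using sgn[OF ab] sgn[OF ab'] e(2) unfolding v w by metis
      define A where "A = real ((b - a)\<^sup>2) + (if j then 1/4 else - 1/4)"
      define A' where "A' = real ((b' - a')\<^sup>2) + (if j' then 1/4 else - 1/4)"
      have "(if u then 1 else - 1) * A = (if u then 1 else - 1) * A'"
        using 1(2) 2(2) e(2) unfolding v w u A_def A'_def by metis
      then have "A = A'" by (cases u; simp only: if_True if_False mult_1 mult_minus1 neg_equal_iff_equal)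
      then have y: "j = j' \<and> (b - a)\<^sup>2 = (b' - a')\<^sup>2" unfolding A_def A'_def by (rule quarter_inj)
      then have "b - a = b' - a'" by simp
      then show ?thesis using x y u ab ab' unfolding v w by auto
    next
      case v: (VQ a b)
      then obtain a' b' where w: "w = VQ a' b'" using 3 assms(2) e by (cases w) (auto split: if_splits)
      show ?thesis using offset_inj[of a b a' b'] assms e unfolding v w by simp
    qed (use 3 assms in simp_all)
  qed
qed

lemma seg_parrI: "0 \<le> t \<Longrightarrow> t \<le> 1 \<Longrightarrow> (1 - t) *\<^sub>R pos p + t *\<^sub>R pos q \<in> seg (parr (p, q))"
  by (auto simp: seg_def parr_def in_segment)

definition upside :: "vert \<times> vert \<Rightarrow> bool" where
  "upside e \<longleftrightarrow> (case e of (p, q) \<Rightarrow> (0 < vy p \<or> axv p) \<and> (0 < vy q \<or> axv q) \<and> (0 < vy p \<or> 0 < vy q))"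

definition loside :: "vert \<times> vert \<Rightarrow> bool" where
  "loside e \<longleftrightarrow> (case e of (p, q) \<Rightarrow> (vy p < 0 \<or> axv p) \<and> (vy q < 0 \<or> axv q) \<and> (vy p < 0 \<or> vy q < 0))"

lemma axis_point:
  assumes "x \<in> seg (parr (p, q))" "snd (fst x) = 0" "0 \<le> \<sigma> * vy p" "0 \<le> \<sigma> * vy q" "0 < \<sigma> * vy p \<or> 0 < \<sigma> * vy q"
  shows "x = pos p \<and> vy p = 0 \<or> x = pos q \<and> vy q = 0"
proof -
  obtain t where t: "0 \<le> t" "t \<le> 1" "x = (1 - t) *\<^sub>R pos p + t *\<^sub>R pos q" using seg_parr[OF assms(1)] .
  have "(1 - t) * vy p + t * vy q = 0" using assms(2) unfolding t(3) by (simp add: pos_def)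
  then have "\<sigma> * ((1 - t) * vy p + t * vy q) = 0" by simp
  then have "(1 - t) * (\<sigma> * vy p) + t * (\<sigma> * vy q) = 0" by (simp add: algebra_simps)
  moreover have "0 \<le> (1 - t) * (\<sigma> * vy p)" "0 \<le> t * (\<sigma> * vy q)" using t assms by auto
  ultimately have "(1 - t) * (\<sigma> * vy p) = 0" "t * (\<sigma> * vy q) = 0" by linarith+
  then show ?thesis using assms(5) t by auto
qed

text \<open>Segments in opposite half planes can only meet on the axis, in ends of both, and there
  the first coordinate already determines the vertex.\<close>

lemma vsep_upside_loside:
  assumes "upside e" "loside f"
  shows "vsep e f"
proof -
  obtain p q r s where e: "e = (p, q)" and f: "f = (r, s)" by (cases e; cases f)
  have ax0: "vy v = 0" if "axv v" for v using that by (cases v) auto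
  have u: "0 \<le> 1 * vy p" "0 \<le> 1 * vy q" "0 < 1 * vy p \<or> 0 < 1 * vy q" "vy p = 0 \<Longrightarrow> axv p" "vy q = 0 \<Longrightarrow> axv q"
    using assms(1) ax0 unfolding upside_def e by (auto intro: less_imp_le simp: order.strict_implies_order)
  have l: "0 \<le> -1 * vy r" "0 \<le> -1 * vy s" "0 < -1 * vy r \<or> 0 < -1 * vy s" "vy r = 0 \<Longrightarrow> axv r" "vy s = 0 \<Longrightarrow> axv s"
    using assms(2) ax0 unfolding loside_def f by (auto intro: less_imp_le simp: order.strict_implies_order)
  show ?thesis
    unfolding vsep_def psep_def e f
  proof (intro ballI impI)
    fix x y assume x: "x \<in> seg (parr (p, q))" and y: "y \<in> seg (parr (r, s))" and eq: "fst x = fst y"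
    obtain t where t: "0 \<le> t" "t \<le> 1" "x = (1 - t) *\<^sub>R pos p + t *\<^sub>R pos q" using seg_parr[OF x] .
    obtain k where k: "0 \<le> k" "k \<le> 1" "y = (1 - k) *\<^sub>R pos r + k *\<^sub>R pos s" using seg_parr[OF y] .
    have "0 \<le> (1 - t) * vy p + t * vy q" using t(1,2) u(1,2) by simp
    then have "0 \<le> snd (fst x)" unfolding t(3) by (simp add: pos_def)
    moreover have "0 \<le> (1 - k) * (-1 * vy r)" "0 \<le> k * (-1 * vy s)" by (rule mult_nonneg_nonneg; use k(1,2) l(1,2) in linarith)+
    then have "snd (fst y) \<le> 0" unfolding k(3) by (simp add: pos_def)
    ultimately have z: "snd (fst x) = 0" "snd (fst y) = 0" using eq by auto
    obtain v where v: "v = p \<or> v = q" "x = pos v" "axv v" using axis_point[OF x z(1) u(1-3)] u(4,5) by blast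
    obtain w where w: "w = r \<or> w = s" "y = pos w" "axv w" using axis_point[OF y z(2) l(1-3)] l(4,5) by blast
    have "v = w" using axis_inj[OF v(3) w(3)] eq unfolding v(2) w(2) by (simp add: pos_def)
    then show "x = y \<and> x \<in> {fst (parr (p, q)), snd (parr (p, q))} \<and> x \<in> {fst (parr (r, s)), snd (parr (r, s))}"
      using v w by (auto simp: parr_def)
  qed
qed

definition refl_kind :: "vert \<Rightarrow> bool" where
  "refl_kind v \<longleftrightarrow> (\<exists>i j a b. v = Cor True i j a b) \<or> (\<exists>j. v = AxR j \<or> v = AxL j)"

lemma reflect_comb: "reflect ((1 - t) *\<^sub>R x + t *\<^sub>R y) = (1 - t) *\<^sub>R reflect x + t *\<^sub>R reflect y"
  by (simp add: reflect_def case_prod_beta prod_eq_iff algebra_simps)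

lemma vsep_low:
  assumes "vsep (p, q) (r, s)" "refl_kind p" "refl_kind q" "refl_kind r" "refl_kind s"
  shows "vsep (low p, low q) (low r, low s)"
  unfolding vsep_def psep_def
proof (intro ballI impI)
  fix x y assume x: "x \<in> seg (parr (low p, low q))" and y: "y \<in> seg (parr (low r, low s))" and eq: "fst x = fst y"
  have P: "pos (low v) = reflect (pos v)" if "refl_kind v" for v using reflect_pos[of v] that unfolding refl_kind_def by simp
  obtain t where t: "0 \<le> t" "t \<le> 1" "x = (1 - t) *\<^sub>R pos (low p) + t *\<^sub>R pos (low q)" using seg_parr[OF x] .
  obtain k where k: "0 \<le> k" "k \<le> 1" "y = (1 - k) *\<^sub>R pos (low r) + k *\<^sub>R pos (low s)" using seg_parr[OF y] .
  define x0 where "x0 = (1 - t) *\<^sub>R pos p + t *\<^sub>R pos q"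
  define y0 where "y0 = (1 - k) *\<^sub>R pos r + k *\<^sub>R pos s"
  have xr: "x = reflect x0" and yr: "y = reflect y0"
    unfolding t(3) k(3) x0_def y0_def reflect_comb using P assms(2-5) by simp_all
  have m: "x0 \<in> seg (parr (p, q))" "y0 \<in> seg (parr (r, s))"
    unfolding x0_def y0_def using t k by (auto intro: seg_parrI)
  have "fst x0 = fst y0" using eq unfolding xr yr by (simp add: reflect_def case_prod_beta prod_eq_iff)
  then have "x0 = y0 \<and> x0 \<in> {pos p, pos q} \<and> x0 \<in> {pos r, pos s}"
    using assms(1) m unfolding vsep_def psep_def by (simp add: parr_def)
  then show "x = y \<and> x \<in> {fst (parr (low p, low q)), snd (parr (low p, low q))} \<and> x \<in> {fst (parr (low r, low s)), snd (parr (low r, low s))}"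
    unfolding xr yr using P assms(2-5) by (auto simp: parr_def)
qed

section \<open>Segments that stay and segments that are replaced\<close>

text \<open>The upper strands and the arcs that survive all replacements. The counterpart
  \<open>szone\<close> collects the lower strands and the arcs from \<open>LR\<close> to the axis,
  of which the replaced arcs consist.\<close>

definition ozone :: "bool \<Rightarrow> btree \<Rightarrow> (vert \<times> vert) set" where
  "ozone u t = insert (ex u 0 t, AxL 0) (snd ` warc u 0 t) \<union> snd ` pstr u (half_graph 0 t)"

definition szone :: "bool \<Rightarrow> btree \<Rightarrow> (vert \<times> vert) set" where
  "szone u t = snd ` nstr u (half_graph 0 t) \<union> snd ` uarc u (half_graph 0 t)"

lemma warc_up: "(j, e) \<in> warc True s t \<Longrightarrow> e \<in> up s t"
  by (induction t arbitrary: s) (auto simp: Let_def)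

lemma graph_up: "(a, b) \<in> half_graph s t \<Longrightarrow>
  (LL True a b, UR True a b) \<in> up s t \<and> (LR True a b, UL True a b) \<in> up s t \<and> (LR True a b, AxL b) \<in> up s t \<and> (UL True a b, VP a b) \<in> up s t"
  by (induction t arbitrary: s) (auto simp: Let_def)

lemma zone_up: "e \<in> ozone True t \<union> szone True t \<Longrightarrow> e = (ex True 0 t, AxL 0) \<or> e \<in> up 0 t"
  unfolding ozone_def szone_def pstr_def nstr_def uarc_def using warc_up[of _ _ 0 t] graph_up[of _ _ 0 t] by auto

lemma upper_pairwise:
  assumes "e = (ex True 0 t, AxL 0) \<or> e \<in> up 0 t" "f = (ex True 0 t, AxL 0) \<or> f \<in> up 0 t" "e \<noteq> f"
  shows "vsep e f \<or> diag True e f \<or> diag True f e"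
proof -
  have "vsep f (ex True 0 t, AxL 0)" if "f \<in> up 0 t" for f
    by (rule below_exit_vsep[OF below_exit_up[OF that]]) (use gx_AxL ex_vx[of 0 t] in auto)
  then show ?thesis using assms up_pairwise[of e 0 t f] vsep_sym by blast
qed

lemma zone_kind: "(p, q) \<in> ozone True t \<union> szone True t \<Longrightarrow> refl_kind p \<and> refl_kind q"
  unfolding refl_kind_def ozone_def szone_def pstr_def nstr_def uarc_def
  using warc_kind[of _ p q 0 t p] warc_kind[of _ p q 0 t q] ex_kind[of 0 t] by auto

lemma low_zone: "ozone False t = map_prod low low ` ozone True t" "szone False t = map_prod low low ` szone True t"
proof -
  let ?g = "map_prod low low"
  have 1: "snd ` map_prod id ?g ` A = ?g ` snd ` A" for A :: "(nat \<times> vert \<times> vert) set" by (simp add: image_image)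
  have 2: "snd ` pstr False G = ?g ` snd ` pstr True G" "snd ` nstr False G = ?g ` snd ` nstr True G"
    "snd ` uarc False G = ?g ` snd ` uarc True G" for G
    by (simp_all add: pstr_def nstr_def uarc_def image_image case_prod_beta)
  show "ozone False t = ?g ` ozone True t"
    unfolding ozone_def low_warc 1 2 image_Un image_insert map_prod_simp low_ex low.simps ..
  show "szone False t = ?g ` szone True t"
    unfolding szone_def 2 image_Un ..
qed

text \<open>The statement for the lower half plane is the mirror image of that for the upper
  one.\<close>

lemma zone_pairwise:
  assumes "e \<in> ozone u t \<union> szone u t" "f \<in> ozone u t \<union> szone u t" "e \<noteq> f"
  shows "vsep e f \<or> diag u e f \<or> diag u f e"
proof (cases u)
  case True
  show ?thesis
    using upper_pairwise[OF zone_up[of e t] zone_up[of f t] assms(3)] assms(1,2) by (simp add: True)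
next
  case False
  have "e \<in> map_prod low low ` (ozone True t \<union> szone True t)" using assms(1) False unfolding image_Un low_zone[symmetric] by simp
  then obtain z where z: "e = map_prod low low z" "z \<in> ozone True t \<union> szone True t" by (rule imageE)
  have "f \<in> map_prod low low ` (ozone True t \<union> szone True t)" using assms(2) False unfolding image_Un low_zone[symmetric] by simp
  then obtain w where w: "f = map_prod low low w" "w \<in> ozone True t \<union> szone True t" by (rule imageE)
  have "z \<noteq> w" using z(1) w(1) assms(3) by blast
  then have 1: "vsep z w \<or> diag True z w \<or> diag True w z"
    by (rule upper_pairwise[OF zone_up[OF z(2)] zone_up[OF w(2)]])
  obtain p q r s where pq: "z = (p, q)" "w = (r, s)" by (cases z; cases w)
  note k = zone_kind[OF z(2)[unfolded pq]] zone_kind[OF w(2)[unfolded pq]]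
  from 1 show ?thesis
  proof (elim disjE)
    assume "vsep z w"
    then show ?thesis using vsep_low[of p q r s] k unfolding z(1) w(1) pq by simp
  next
    assume "diag True z w"
    then show ?thesis unfolding z(1) w(1) diag_def using False by auto
  next
    assume "diag True w z"
    then show ?thesis unfolding z(1) w(1) diag_def using False by auto
  qed
qed

lemma ex_shape: "ex u s t = AxR s \<or> (\<exists>b. (s, b) \<in> half_graph s t \<and> ex u s t = UL u s b)"
  by (cases t) auto

lemma warc_shape: "(j, p, q) \<in> warc u s t \<Longrightarrow>
   (p = AxR j \<or> (\<exists>b. (j, b) \<in> half_graph s t \<and> p = UL u j b)) \<and>
   ((\<exists>b. (j, b) \<in> half_graph s t \<and> q = LL u j b) \<or> (\<exists>a. (a, j) \<in> half_graph s t \<and> q = UR u a j))"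
proof (induction t arbitrary: s)
  case (Node l r)
  let ?b = "s + leaves l"
  consider "(j, p, q) \<in> warc u s l" | "(j, p, q) \<in> warc u ?b r" | "j = s" "p = ex u s l" "q = LL u s ?b"
    | "j = ?b" "p = ex u ?b r" "q = UR u s ?b"
    using Node.prems by auto
  then show ?case
  proof cases
    case 1 then show ?thesis using Node.IH(1)[of s] by auto
  next
    case 2 then show ?thesis using Node.IH(2)[of ?b] by auto
  next
    case 3 then show ?thesis using ex_shape[of u s l] by auto
  next
    case 4 then show ?thesis using ex_shape[of u ?b r] by auto
  qed
qed simp

text \<open>Around an inner vertex of the vine, one arc runs from the axis to the edge on the right
  and one from this edge to the edge on the left. Around the last vertex the arc from the axis goes
  to the edge on the left directly.\<close>

lemma warc_vine: "right_vine t \<Longrightarrow> (j, p, q) \<in> warc u s t \<Longrightarrow>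
   p = AxR j \<and> q = LL u j (Suc j) \<or>
   (\<exists>i. j = Suc i \<and> q = UR u i j \<and> (Suc j < s + leaves t \<and> p = UL u j (Suc j) \<or> Suc j = s + leaves t \<and> p = AxR j))"
proof (induction t arbitrary: s)
  case (Node l r)
  then have l: "l = Leaf" and r: "right_vine r" by auto
  have x: "r = Leaf \<and> ex u (Suc s) r = AxR (Suc s) \<or> 2 \<le> leaves r \<and> ex u (Suc s) r = UL u (Suc s) (Suc (Suc s))"
    using r leaves_pos by (cases r) (auto simp: Suc_le_eq)
  consider "(j, p, q) \<in> warc u (Suc s) r" | "j = s" "p = AxR s" "q = LL u s (Suc s)"
    | "j = Suc s" "p = ex u (Suc s) r" "q = UR u s (Suc s)"
    using Node.prems unfolding l by auto
  then show ?case
  proof cases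
    case 1 then show ?thesis using Node.IH(2)[OF r, of "Suc s"] by (auto simp: l)
  next
    case 2 then show ?thesis by simp
  next
    case 3 then show ?thesis using x by (auto simp: l)
  qed
qed simp

lemma zone_cases:
  assumes "e \<in> ozone u t \<union> szone u t"
  obtains (fin) "e = (ex u 0 t, AxL 0)" | (wa) j p q where "e = (p, q)" "(j, p, q) \<in> warc u 0 t"
  | (ps) a b where "e = (LL u a b, UR u a b)" "(a, b) \<in> half_graph 0 t" "e \<in> ozone u t"
  | (ns) a b where "e = (LR u a b, UL u a b)" "(a, b) \<in> half_graph 0 t" "e \<in> szone u t"
  | (ua) a b where "e = (LR u a b, AxL b)" "(a, b) \<in> half_graph 0 t" "e \<in> szone u t"
proof -
  have "e = (ex u 0 t, AxL 0) \<or> (\<exists>j. (j, e) \<in> warc u 0 t) \<or> (\<exists>a b. e = (LL u a b, UR u a b) \<and> (a, b) \<in> half_graph 0 t \<and> e \<in> ozone u t)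
    \<or> (\<exists>a b. e = (LR u a b, UL u a b) \<and> (a, b) \<in> half_graph 0 t \<and> e \<in> szone u t) \<or> (\<exists>a b. e = (LR u a b, AxL b) \<and> (a, b) \<in> half_graph 0 t \<and> e \<in> szone u t)"
    using assms unfolding ozone_def szone_def pstr_def nstr_def uarc_def by force
  then show thesis
  proof (elim disjE exE conjE)
    fix j assume "(j, e) \<in> warc u 0 t"
    then show thesis using wa by (cases e) simp
  qed (use fin ps ns ua in blast)+
qed

lemma cor_side:
  assumes "a < b"
  shows "0 < vy (Cor True i j a b)" "vy (Cor False i j a b) < 0"
  using cor_bounds(4)[OF assms, of i j] by auto

lemma zone_side:
  assumes "e \<in> ozone u t \<union> szone u t" "t \<noteq> Leaf"
  shows "if u then upside e else loside e"
  using assms(1)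
proof (cases rule: zone_cases)
  case fin
  obtain l r where t: "t = Node l r" using assms(2) by (cases t) auto
  have "0 < leaves l" using leaves_pos[of l] by simp
  then show ?thesis unfolding fin t upside_def loside_def using cor_side[of 0 "leaves l"] by (auto simp del: vy.simps(3))
next
  case (wa j p q)
  have r: "a < b" if "(a, b) \<in> half_graph 0 t" for a b using half_graph_range[OF that] by simp
  show ?thesis using warc_shape[OF wa(2)] unfolding wa(1) upside_def loside_def using cor_side r
    by (auto simp del: vy.simps(3))
next
  case (ps a b)
  then show ?thesis unfolding ps(1) upside_def loside_def using cor_side[of a b] half_graph_range[OF ps(2)] by (auto simp del: vy.simps(3))
next
  case (ns a b)
  then show ?thesis unfolding ns(1) upside_def loside_def using cor_side[of a b] half_graph_range[OF ns(2)] by (auto simp del: vy.simps(3))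
next
  case (ua a b)
  then show ?thesis unfolding ua(1) upside_def loside_def using cor_side[of a b] half_graph_range[OF ua(2)] by (auto simp del: vy.simps(3))
qed

section \<open>The lowered arcs\<close>

text \<open>Makes integrality available to linear arithmetic over the reals.\<close>

lemma nat_gap: "real j + 1 \<le> real a \<or> real a \<le> real j"
proof (cases "a \<le> j")
  case False
  then have "real (Suc j) \<le> real a" by (simp only: of_nat_le_iff)
  then show ?thesis by simp
qed simp

lemma low_coords:
  "vx (Cor False i j k (Suc k)) = real k + 1/2 + (if i then 1/8 else - 1/8)"
  "vy (Cor False i j k (Suc k)) = - 1/2 - (if j then 1/8 else - 1/8)"
  by (auto simp: field_simps)

lemma vp_coords:
  assumes "a < b"
  shows "real a < vx (VP a b)" "vx (VP a b) \<le> real a + 1/16" "vx (VQ a b) = vx (VP a b)" "vy (VP a b) = 0" "vy (VQ a b) = vx (VP a b) - real b"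
  using vp_bounds(1,2)[OF assms] by auto

lemmas coords = low_coords vx.simps(1,2) vy.simps(1,2)

text \<open>In the plane the descent is parallel to the second axis, and it stays in the strip
  between \<open>a\<close> and \<open>a + 1/16\<close>.\<close>

lemma pq_vsep:
  assumes "a < b" "vx p \<le> real a \<and> vx q \<le> real a \<or> real a + 1/16 < vx p \<and> real a + 1/16 < vx q"
  shows "vsep (p, q) (VP a b, VQ a b)"
proof -
  note v = vp_coords[OF assms(1)]
  from assms(2) show ?thesis
  proof
    assume "vx p \<le> real a \<and> vx q \<le> real a"
    then show ?thesis using v(1) by (intro vsep_lt[where A = 1 and B = 0 and k = "vx (VP a b)"]) (use v(3) in linarith)+
  next
    assume "real a + 1/16 < vx p \<and> real a + 1/16 < vx q"
    then show ?thesis using v(2) by (intro vsep_sym[OF vsep_lt[where A = 1 and B = 0 and k = "min (vx p) (vx q)"]]) (use v(3) in linarith)+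
  qed
qed

text \<open>The arc on the lower boundary of the disc of \<open>a\<close>, before it is oriented.
  The vertex \<open>0\<close> has no edge to the left, so there the arc ends on the axis.\<close>

definition bottom :: "nat \<Rightarrow> vert \<times> vert" where
  "bottom a = (UL False a (Suc a), if a = 0 then AxL 0 else UR False (a - 1) a)"

lemma vine_graphD: "right_vine t \<Longrightarrow> (a, b) \<in> half_graph 0 t \<Longrightarrow> b = Suc a"
  using half_graph_vine[of t 0] by auto

lemma vine_ex: "right_vine t \<Longrightarrow> t \<noteq> Leaf \<Longrightarrow> ex u 0 t = UL u 0 (Suc 0)"
  by (cases t) auto

text \<open>Both ends of a segment of the lower half are on the same side of the strip that contains
  the descent, unless the segment is the arc joining the two edges at \<open>a\<close>, or the edge
  at \<open>0\<close> with the axis.\<close>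

lemma lower_pq:
  assumes e: "e \<in> ozone False B \<union> szone False B" and B: "right_vine B" "B \<noteq> Leaf" and ab: "a < b" "b < leaves B"
  shows "vsep e (VP a b, VQ a b) \<or> e = bottom a"
  using e
proof (cases rule: zone_cases)
  case fin
  then have e: "e = (UL False 0 (Suc 0), AxL 0)" using vine_ex[OF B] by simp
  show ?thesis
  proof (cases "a = 0")
    case False
    then have "1 \<le> real a" by linarith
    then show ?thesis unfolding e by (intro disjI1[OF pq_vsep[OF ab(1)]]) (simp add: coords del: vx.simps(3))
  qed (simp add: bottom_def e)
next
  case (wa j p q)
  from warc_vine[OF B(1) wa(2)] show ?thesis
  proof (elim disjE conjE exE)
    assume pq: "p = AxR j" "q = LL False j (Suc j)"
    have "real j + 1 \<le> real a \<or> real a \<le> real j" by (rule nat_gap)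
    then show ?thesis unfolding wa(1) pq by (intro disjI1[OF pq_vsep[OF ab(1)]]) (simp only: coords if_True if_False of_nat_Suc; linarith)
  next
    fix i assume pq: "j = Suc i" "q = UR False i j" "p = UL False j (Suc j)"
    consider "a = j" | "real j + 1 \<le> real a" | "real a + 1 \<le> real j" using nat_gap[of j a] nat_gap[of a j] by linarith
    then show ?thesis
    proof cases
      case 1 then show ?thesis unfolding wa(1) pq by (simp add: bottom_def)
    next
      case 2 then show ?thesis unfolding wa(1) pq by (intro disjI1[OF pq_vsep[OF ab(1)]]) (simp only: coords if_True if_False of_nat_Suc; linarith)
    next
      case 3 then show ?thesis unfolding wa(1) pq by (intro disjI1[OF pq_vsep[OF ab(1)]]) (simp only: coords if_True if_False of_nat_Suc; linarith)
    qed
  next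
    fix i assume pq: "j = Suc i" "q = UR False i j" "Suc j = 0 + leaves B" "p = AxR j"
    have "real a + 1 \<le> real j" using ab pq(3) by linarith
    then show ?thesis unfolding wa(1) pq(4,2) pq(1) by (intro disjI1[OF pq_vsep[OF ab(1)]]) (simp only: coords if_True if_False of_nat_Suc; linarith)
  qed
next
  case (ps j k)
  have k: "k = Suc j" using vine_graphD[OF B(1) ps(2)] .
  have "real j + 1 \<le> real a \<or> real a \<le> real j" by (rule nat_gap)
  then show ?thesis unfolding ps(1) k by (intro disjI1[OF pq_vsep[OF ab(1)]]) (simp only: coords if_True if_False of_nat_Suc; linarith)
next
  case (ns j k)
  have k: "k = Suc j" using vine_graphD[OF B(1) ns(2)] .
  have "real j + 1 \<le> real a \<or> real a \<le> real j" by (rule nat_gap)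
  then show ?thesis unfolding ns(1) k by (intro disjI1[OF pq_vsep[OF ab(1)]]) (simp only: coords if_True if_False of_nat_Suc; linarith)
next
  case (ua j k)
  have k: "k = Suc j" using vine_graphD[OF B(1) ua(2)] .
  have "real j + 1 \<le> real a \<or> real a \<le> real j" by (rule nat_gap)
  then show ?thesis unfolding ua(1) k by (intro disjI1[OF pq_vsep[OF ab(1)]]) (simp only: coords if_True if_False of_nat_Suc; linarith)
qed

context
  fixes a b k :: nat and T :: vert
  assumes ab: "a < b" and b: "b = Suc k" and T: "T = UL False (b - 1) b"
begin

lemma t_coords: "vx T = real k + 3/8" "vy T = - 5/8"
  unfolding T b using low_coords[of False True k] by simp_all

lemma vq_coords: "vx (VQ a b) \<le> real k + 1/16" "vx (VQ a b) - vy (VQ a b) = real b"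
proof -
  have "real a \<le> real k" using ab b by simp
  then show "vx (VQ a b) \<le> real k + 1/16" using vp_coords(2,3)[OF ab] by linarith
  show "vx (VQ a b) - vy (VQ a b) = real b" using vp_coords(3,5)[OF ab] by linarith
qed

text \<open>The last piece of the lowered arc lies on the line \<open>x - y = b\<close>.\<close>

lemma qt_vsep:
  assumes "vx p - vy p < real b \<and> vx q - vy q < real b \<or> real b < vx p - vy p \<and> real b < vx q - vy q"
  shows "vsep (p, q) (VQ a b, T)"
  using assms
proof
  assume "vx p - vy p < real b \<and> vx q - vy q < real b"
  then show ?thesis using vq_coords(2) t_coords b by (intro vsep_lt[where A = 1 and B = "-1" and k = "real b"]) linarith+
next
  assume "real b < vx p - vy p \<and> real b < vx q - vy q"
  then show ?thesis using vq_coords(2) t_coords b by (intro vsep_lt[where A = "-1" and B = 1 and k = "- real b"]) linarith+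
qed

lemma qt_share:
  assumes "vx p - vy p < real b"
  shows "vsep (p, T) (VQ a b, T)"
  by (rule vsep_swap2, rule vsep_share[where A = 1 and B = "-1"]) (use assms vq_coords t_coords b in linarith)+

text \<open>This strand lies on the same line \<open>x - y = b\<close> and continues the piece
  beyond \<open>T\<close>.\<close>

lemma qt_nstr: "vsep (LR False k b, T) (VQ a b, T)"
  by (rule vsep_swap2, rule vsep_share[where A = "-1" and B = 0])
    (use vq_coords t_coords low_coords[of True False k] b in \<open>simp_all del: vx.simps(3-) vy.simps(3-)\<close>)

text \<open>This strand does cross the line \<open>x - y = b\<close>, but beyond \<open>T\<close>.
  It lies on the line \<open>x + y = k\<close>, which has the piece on one side.\<close>

lemma qt_pstr: "vsep (LL False k b, UR False k b) (VQ a b, T)"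
  by (rule vsep_sym, rule vsep_lt[where A = 1 and B = 1 and k = "real k"])
    (use vq_coords t_coords low_coords[of False False k] low_coords[of True True k] b in \<open>simp_all del: vx.simps(3-) vy.simps(3-)\<close>)

lemma qt_uarc: "vsep (LR False k b, AxL b) (VQ a b, T)"
  by (rule vsep_sym, rule vsep_lt[where A = 1 and B = 0 and k = "real k + 5/8"])
    (use vq_coords t_coords low_coords[of True False k] b in \<open>simp_all del: vx.simps(3-) vy.simps(3-)\<close>)

lemma lower_qt:
  assumes e: "e \<in> ozone False B \<union> szone False B" and B: "right_vine B" "B \<noteq> Leaf" and bB: "b < leaves B"
  shows "vsep e (VQ a b, T)"
  using e
proof (cases rule: zone_cases)
  case fin
  then have e: "e = (UL False 0 (Suc 0), AxL 0)" using vine_ex[OF B] by simp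
  show ?thesis
  proof (cases "k = 0")
    case True
    have "UL False 0 (Suc 0) = T" using True by (simp add: T b)
    moreover have "vsep (T, AxL 0) (VQ a b, T)" by (rule vsep_swap1, rule qt_share) simp
    ultimately show ?thesis unfolding e by simp
  next
    case False
    then have "2 \<le> real b" using b by simp
    then show ?thesis unfolding e by (intro qt_vsep) (simp add: coords del: vx.simps(3-) vy.simps(3-))
  qed
next
  case (wa j p q)
  from warc_vine[OF B(1) wa(2)] show ?thesis
  proof (elim disjE conjE exE)
    assume pq: "p = AxR j" "q = LL False j (Suc j)"
    have "real j + 1 \<le> real b \<or> real b \<le> real j" by (rule nat_gap)
    then show ?thesis unfolding wa(1) pq by (intro qt_vsep) (simp only: coords if_True if_False of_nat_Suc; linarith)
  next
    fix i assume pq: "j = Suc i" "q = UR False i j" "p = UL False j (Suc j)"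
    consider "b = Suc j" | "real j + 2 \<le> real b" | "real b \<le> real j" using nat_gap[of j b] nat_gap[of "Suc j" b] by (cases "b = Suc j") (simp, linarith)
    then show ?thesis
    proof cases
      case 1
      then have "p = T" by (simp add: pq T)
      moreover have "vx q - vy q < real b" using 1 unfolding pq(2) pq(1) by (simp add: coords del: vx.simps(3-) vy.simps(3-))
      ultimately show ?thesis unfolding wa(1) using vsep_swap1 qt_share by blast
    next
      case 2 then show ?thesis unfolding wa(1) pq by (intro qt_vsep) (simp only: coords if_True if_False of_nat_Suc; linarith)
    next
      case 3 then show ?thesis unfolding wa(1) pq by (intro qt_vsep) (simp only: coords if_True if_False of_nat_Suc; linarith)
    qed
  next
    fix i assume pq: "j = Suc i" "q = UR False i j" "Suc j = 0 + leaves B" "p = AxR j"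
    have "real b \<le> real j" using bB pq(3) by linarith
    then show ?thesis unfolding wa(1) pq(4,2) pq(1) by (intro qt_vsep) (simp only: coords if_True if_False of_nat_Suc; linarith)
  qed
next
  case (ps j l)
  have l: "l = Suc j" using vine_graphD[OF B(1) ps(2)] .
  consider "k = j" | "real j + 2 \<le> real b" | "real b \<le> real j" using b nat_gap[of j k] nat_gap[of k j] by linarith
  then show ?thesis
  proof cases
    case 1 then show ?thesis using qt_pstr unfolding ps(1) l b by simp
  next
    case 2 then show ?thesis unfolding ps(1) l by (intro qt_vsep) (simp only: coords if_True if_False of_nat_Suc; linarith)
  next
    case 3 then show ?thesis unfolding ps(1) l by (intro qt_vsep) (simp only: coords if_True if_False of_nat_Suc; linarith)
  qed
next
  case (ns j l)
  have l: "l = Suc j" using vine_graphD[OF B(1) ns(2)] .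
  consider "k = j" | "real j + 2 \<le> real b" | "real b \<le> real j" using b nat_gap[of j k] nat_gap[of k j] by linarith
  then show ?thesis
  proof cases
    case 1 then show ?thesis using qt_nstr unfolding ns(1) l b T by simp
  next
    case 2 then show ?thesis unfolding ns(1) l by (intro qt_vsep) (simp only: coords if_True if_False of_nat_Suc; linarith)
  next
    case 3 then show ?thesis unfolding ns(1) l by (intro qt_vsep) (simp only: coords if_True if_False of_nat_Suc; linarith)
  qed
next
  case (ua j l)
  have l: "l = Suc j" using vine_graphD[OF B(1) ua(2)] .
  consider "k = j" | "real j + 2 \<le> real b" | "real b \<le> real j" using b nat_gap[of j k] nat_gap[of k j] by linarith
  then show ?thesis
  proof cases
    case 1 then show ?thesis using qt_uarc unfolding ua(1) l b by simp
  next
    case 2 then show ?thesis unfolding ua(1) l by (intro qt_vsep) (simp only: coords if_True if_False of_nat_Suc; linarith)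
  next
    case 3 then show ?thesis unfolding ua(1) l by (intro qt_vsep) (simp only: coords if_True if_False of_nat_Suc; linarith)
  qed
qed

lemma pq_qt_own: "vsep (VP a b, VQ a b) (VQ a b, T)"
  by (rule vsep_share[where A = 1 and B = "-1"]) (use vp_coords[OF ab] vq_coords t_coords b ab in linarith)+

end

lemma pq_pq:
  assumes "a < b" "a' < b'" "(a, b) \<noteq> (a', b')"
  shows "vsep (VP a b, VQ a b) (VP a' b', VQ a' b')"
proof -
  note v = vp_coords(3)[OF assms(1)] vp_coords(3)[OF assms(2)]
  have "vx (VP a b) \<noteq> vx (VP a' b')" using offset_inj[OF assms(1,2)] assms(3) by auto
  then consider "vx (VP a b) < vx (VP a' b')" | "vx (VP a' b') < vx (VP a b)" by linarith
  then show ?thesis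
  proof cases
    case 1
    then show ?thesis by (intro vsep_lt[where A = 1 and B = 0 and k = "vx (VP a' b')"]) (use v in linarith)+
  next
    case 2
    then show ?thesis by (intro vsep_sym[OF vsep_lt[where A = 1 and B = 0 and k = "vx (VP a b)"]]) (use v in linarith)+
  qed
qed

lemma qt_qt:
  assumes "a < b" "a' < b'" "b \<noteq> b'"
  shows "vsep (VQ a b, UL False (b - 1) b) (VQ a' b', UL False (b' - 1) b')"
proof -
  obtain k where k1: "b = Suc k" using assms(1) by (cases b) auto
  obtain k' where k2: "b' = Suc k'" using assms(2) by (cases b') auto
  note k = k1 k2
  have "real b < real b' \<or> real b' < real b" using assms(3) by linarith
  then show ?thesis
    using vq_coords(2)[OF assms(1) k(1) refl] t_coords[OF assms(1) k(1) refl] k by (intro qt_vsep[OF assms(2) k(2) refl]) linarith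
qed

text \<open>For \<open>b < b'\<close> the line \<open>x - y = b'\<close> separates, and for
  \<open>b' \<le> a\<close> a line parallel to the second axis. Otherwise \<open>b' < b\<close> and
  \<open>a < b'\<close>, and as edges of a tree do not cross, \<open>a \<le> a'\<close>. Then the
  descent of \<open>(a, b)\<close> is to the left of the other piece; for \<open>a = a'\<close> this
  holds because the offset decreases with the length of the edge.\<close>

lemma pq_qt:
  assumes G: "(a, b) \<in> half_graph 0 t" "(a', b') \<in> half_graph 0 t" and "(a, b) \<noteq> (a', b')"
  shows "vsep (VP a b, VQ a b) (VQ a' b', UL False (b' - 1) b')"
proof -
  have ab: "a < b" "a' < b'" using half_graph_range[OF G(1)] half_graph_range[OF G(2)] by auto
  obtain k where k: "b' = Suc k" using ab(2) by (cases b') auto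
  note v = vp_coords[OF ab(1)] and v' = vp_coords[OF ab(2)] and q = vq_coords[OF ab(2) k refl] and t = t_coords[OF ab(2) k refl]
  have "b \<noteq> b'" using half_graph_parent_unique[of a b 0 t a'] G assms(3) by auto
  then consider "b < b'" | "b' \<le> a" | "b' < b" "a < b'" by linarith
  then show ?thesis
  proof cases
    case 1
    then have "real b < real b'" "real a + 1 \<le> real b" using ab by linarith+
    then show ?thesis using v by (intro qt_vsep[OF ab(2) k refl]) linarith
  next
    case 2
    then have "real k + 1 \<le> real a" using k by linarith
    then have "vx (VQ a' b') < vx (VP a b)" "vx (UL False (b' - 1) b') < vx (VP a b)" using q t v by linarith+
    then show ?thesis
      by (intro vsep_sym[OF vsep_lt[where A = 1 and B = 0 and k = "vx (VP a b)"]]) (use v(3) in linarith)+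
  next
    case 3
    have "a \<le> a'" using half_graph_noncrossing[OF G] 3 by linarith
    then have "vx (VP a b) < vx (VP a' b')"
    proof (cases "a = a'")
      case True
      have "1 / (16 * (real b - real a)) < 1 / (16 * (real b' - real a))" using 3 ab True by (intro divide_strict_left_mono) auto
      then show ?thesis using True by simp
    next
      case False
      with \<open>a \<le> a'\<close> have "real a + 1 \<le> real a'" by linarith
      then show ?thesis using v v' by linarith
    qed
    moreover have "vx (VP a' b') \<le> vx (UL False (b' - 1) b')" using q t v' by linarith
    ultimately show ?thesis
      by (intro vsep_lt[where A = 1 and B = 0 and k = "vx (VP a' b')"]) (use v(3) v'(3) in linarith)+
  qed
qed

section \<open>From symbolic separation and heights to flat arcs below a link\<close>

definition above :: "vert \<times> vert \<Rightarrow> vert \<times> vert \<Rightarrow> bool" where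
  "above e f \<longleftrightarrow> (\<forall>v \<in> {fst e, snd e}. \<forall>w \<in> {fst f, snd f}. vz w < vz v)"

lemma diag_above: "diag u e f \<Longrightarrow> above e f"
  by (auto simp: diag_def above_def)

lemma above_seg:
  assumes "above e f" "x \<in> seg (parr e)" "y \<in> seg (parr f)"
  shows "snd y < snd x"
proof -
  obtain p q r s where e: "e = (p, q)" and f: "f = (r, s)" by (cases e; cases f)
  obtain t where t: "0 \<le> t" "t \<le> 1" "x = (1 - t) *\<^sub>R pos p + t *\<^sub>R pos q" using seg_parr[OF assms(2)[unfolded e]] .
  obtain k where k: "0 \<le> k" "k \<le> 1" "y = (1 - k) *\<^sub>R pos r + k *\<^sub>R pos s" using seg_parr[OF assms(3)[unfolded f]] .
  have y: "snd y = (1 - k) * vz r + k * vz s" and x: "snd x = (1 - t) * vz p + t * vz q"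
    unfolding k(3) t(3) by (simp_all add: pos_def)
  have "vz r < vz p" "vz s < vz p" "vz r < vz q" "vz s < vz q" using assms(1) unfolding above_def e f by auto
  then have "snd y < vz p" "snd y < vz q" unfolding y using k by (auto intro!: convex_bound_lt)
  then have "(1 - t) * (- vz p) + t * (- vz q) < - snd y" using t by (intro convex_bound_lt) auto
  then show ?thesis unfolding x by simp
qed

lemma vsep_orient1: "vsep (orient1 s e) (orient1 r f) \<longleftrightarrow> vsep e f"
proof -
  have 1: "vsep (orient1 s e) f \<longleftrightarrow> vsep e f" for s e f
  proof -
    obtain p q where e: "e = (p, q)" by (cases e)
    show ?thesis unfolding e orient1_def using vsep_swap1[of q p f] vsep_swap1[of p q f] by auto
  qed
  then show ?thesis using vsep_sym by blast
qed

lemma above_orient1: "above (orient1 s e) (orient1 r f) \<longleftrightarrow> above e f"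
  by (auto simp: above_def orient1_def)

definition planar :: "vert \<times> vert \<Rightarrow> bool" where
  "planar e \<longleftrightarrow> vx (fst e) \<noteq> vx (snd e) \<or> vy (fst e) \<noteq> vy (snd e)"

lemma planar_orient1: "planar (orient1 s e) \<longleftrightarrow> planar e"
  by (auto simp: planar_def orient1_def)

lemma edges_map: "edges (map f vs) = map_prod f f ` edges vs"
  by (induction vs rule: induct_list012) auto

lemma parr_edges: "edges (map pos vs) = parr ` edges vs"
  unfolding edges_map by (intro image_cong refl) (simp add: parr_def map_prod_def case_prod_beta)

lemma flat_vsep:
  assumes "distinct vs" "\<forall>e \<in> edges vs. \<forall>f \<in> edges vs. e \<noteq> f \<longrightarrow> vsep e f" "\<forall>v \<in> set vs. valid v" "\<forall>e \<in> edges vs. planar e"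
  shows "flat (map pos vs)"
  using assms
proof (induction vs rule: induct_list012)
  case (3 x y zs)
  have "flat (map pos (y # zs))" using 3 by (intro 3(2)) auto
  moreover have "fst (pos x) \<noteq> fst (pos y)" using 3(6) by (simp add: planar_def pos_def)
  moreover have "a = pos y \<and> b = pos y" if f: "f \<in> edges (map pos (y # zs))" and a: "a \<in> closed_segment (pos x) (pos y)" and b: "b \<in> seg f" and eq: "fst a = fst b" for f a b
  proof -
    obtain g where g: "g \<in> edges (y # zs)" "f = parr g" using f unfolding parr_edges by auto
    have gin: "fst g \<in> set (y # zs)" "snd g \<in> set (y # zs)" using edges_in[OF g(1)] by auto
    then have "(x, y) \<noteq> g" using 3(3) by auto
    then have "vsep (x, y) g" using 3(4) g(1) by auto
    moreover have "a \<in> seg (parr (x, y))" using a by (simp add: seg_def parr_def)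
    ultimately have *: "a = b" "a \<in> {pos x, pos y}" "a \<in> {pos (fst g), pos (snd g)}"
      using b eq unfolding vsep_def psep_def g(2) by (auto simp: parr_def)
    have "a \<noteq> pos x"
    proof
      assume "a = pos x"
      then have "x = fst g \<or> x = snd g" using *(3) gin 3(5) pos_inj[of x "fst g"] pos_inj[of x "snd g"] by auto
      then show False using gin 3(3) by auto
    qed
    then show ?thesis using * by auto
  qed
  ultimately show ?case by simp
qed auto

text \<open>Positions determine vertices, so a common point of the arc and the rest is a common
  vertex, which by hypothesis is an end of the arc.\<close>

lemma under_vsep:
  assumes "\<And>e f. e \<in> R \<Longrightarrow> f \<in> edges vs \<Longrightarrow> vsep e f \<or> above e f"
    and "\<And>e v. e \<in> R \<Longrightarrow> v = fst e \<or> v = snd e \<Longrightarrow> valid v \<and> (v \<in> set vs \<longrightarrow> v = hd vs \<or> v = last vs)"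
    and "\<forall>v \<in> set vs. valid v" "vs \<noteq> []"
  shows "under (parr ` R) (map pos vs)"
  unfolding under_def parr_edges
proof (intro ballI impI)
  fix e' f' x y assume "e' \<in> parr ` R" "f' \<in> parr ` edges vs" and x: "x \<in> seg e'" and y: "y \<in> seg f'" and eq: "fst x = fst y"
  then obtain e f where e: "e \<in> R" "e' = parr e" and f: "f \<in> edges vs" "f' = parr f" by auto
  from assms(1)[OF e(1) f(1)] show "snd y < snd x \<or> x = y \<and> x \<in> {fst e', snd e'} \<and> x \<in> {hd (map pos vs), last (map pos vs)}"
  proof
    assume "above e f"
    then show ?thesis using above_seg x y unfolding e f by blast
  next
    assume "vsep e f"
    then have *: "x = y" "x \<in> {fst e', snd e'}" "x \<in> {fst f', snd f'}" using x y eq unfolding vsep_def psep_def e f by auto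
    have "x = pos (fst e) \<or> x = pos (snd e)" "x = pos (fst f) \<or> x = pos (snd f)"
      using *(2,3) unfolding e f by (simp_all add: parr_def)
    then obtain v w where v: "v = fst e \<or> v = snd e" "x = pos v" and w: "w = fst f \<or> w = snd f" "x = pos w"
      by metis
    have ws: "w \<in> set vs" using edges_in[OF f(1)] w by auto
    then have "v = w" using pos_inj assms(2)[OF e(1) v(1)] assms(3) v(2) w(2) by metis
    then have "v = hd vs \<or> v = last vs" using assms(2)[OF e(1) v(1)] ws by blast
    then show ?thesis using * v(2) assms(4) by (auto simp: hd_map last_map)
  qed
qed

section \<open>The old and the new arc of an edge\<close>

definition xv :: "nat \<Rightarrow> nat \<Rightarrow> vert list" where
  "xv a b = [UL True a b, LR True a b, AxL b, LR False (b - 1) b, UL False (b - 1) b]"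

definition yv :: "nat \<Rightarrow> nat \<Rightarrow> vert list" where
  "yv a b = [UL True a b, VP a b, VQ a b, UL False (b - 1) b]"

text \<open>\<open>y\<close> selects the new arc. \<open>r\<close> reverses the list and will be the
  colour of \<open>a\<close>: for the colour \<open>+\<close> the arc runs towards
  \<open>UL True a b\<close>.\<close>

definition kl :: "bool \<Rightarrow> bool \<Rightarrow> nat \<Rightarrow> nat \<Rightarrow> vert list" where
  "kl r y a b = (if r then rev else id) (if y then yv a b else xv a b)"

definition kx :: "bool \<Rightarrow> nat \<Rightarrow> nat \<Rightarrow> (vert \<times> vert) set" where
  "kx y a b = (if y then {(UL True a b, VP a b), (VP a b, VQ a b), (VQ a b, UL False (b - 1) b)}
     else {(LR True a b, UL True a b), (LR True a b, AxL b), (LR False (b - 1) b, AxL b), (LR False (b - 1) b, UL False (b - 1) b)})"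

lemma kl_edges:
  assumes "e \<in> edges (kl r y a b)"
  shows "\<exists>s. \<exists>g \<in> kx y a b. e = orient1 s g"
proof -
  have "edges (kl r y a b) \<subseteq> kx y a b \<union> prod.swap ` kx y a b"
    unfolding kl_def kx_def xv_def yv_def by (cases r; cases y) simp_all
  then consider "e \<in> kx y a b" | g where "g \<in> kx y a b" "e = prod.swap g" using assms by blast
  then show ?thesis
  proof cases
    case 1
    then show ?thesis by (intro exI[of _ True] bexI[of _ e]) (simp_all add: orient1_def)
  next
    case (2 g)
    then show ?thesis by (intro exI[of _ False] bexI[of _ g]) (simp_all add: orient1_def)
  qed
qed

lemma kl_props:
  assumes "a < b"
  shows "distinct (kl r y a b)" "3 \<le> length (kl r y a b)" "\<forall>v \<in> set (kl r y a b). valid v" "kl r y a b \<noteq> []"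
    "hd (kl r y a b) = (if r then UL False (b - 1) b else UL True a b)" "last (kl r y a b) = (if r then UL True a b else UL False (b - 1) b)"
    "(e1, e2) \<in> edges (kl r y a b) \<Longrightarrow> (e2, e1) \<notin> edges (kl r y a b)"
  using assms unfolding kl_def xv_def yv_def by (cases r; cases y; auto)+

lemma kl_disjoint: "b \<noteq> b' \<Longrightarrow> v \<in> set (kl r y a b) \<Longrightarrow> v \<notin> set (kl r' y' a' b')"
  unfolding kl_def xv_def yv_def by (cases r; cases y; cases r'; cases y') auto

lemma kx_disjoint: "b \<noteq> b' \<Longrightarrow> g \<in> kx y a b \<Longrightarrow> g \<notin> kx y' a' b'"
  unfolding kx_def by (cases y; cases y') auto

text \<open>Admits the vertices of the segments that stay. It omits \<open>LR\<close> and
  \<open>AxL j\<close> with \<open>j > 0\<close>, which occur inside the replaced arcs, so a vertex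
  shared by a kept segment and such an arc is an end of the arc.\<close>

fun okv :: "vert \<Rightarrow> bool" where
  "okv (AxR j) \<longleftrightarrow> True"
| "okv (AxL j) \<longleftrightarrow> j = 0"
| "okv (Cor u i j a b) \<longleftrightarrow> a < b \<and> \<not> (i \<and> \<not> j)"
| "okv _ \<longleftrightarrow> False"

lemma okv_valid: "okv v \<Longrightarrow> valid v" by (cases v) auto

lemma okv_kl: "okv v \<Longrightarrow> a < b \<Longrightarrow> v \<in> set (kl r y a b) \<Longrightarrow> v = hd (kl r y a b) \<or> v = last (kl r y a b)"
  unfolding kl_def xv_def yv_def by (cases r; cases y) auto

lemma ozone_cases:
  assumes "e \<in> ozone u t"
  obtains (fin) "e = (ex u 0 t, AxL 0)" | (wa) j p q where "e = (p, q)" "(j, p, q) \<in> warc u 0 t"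
  | (ps) a b where "e = (LL u a b, UR u a b)" "(a, b) \<in> half_graph 0 t"
  using assms unfolding ozone_def pstr_def by fastforce

lemma ozone_verts:
  assumes "e \<in> ozone u t"
  shows "okv (fst e) \<and> okv (snd e)" "\<nexists>v a b. e = (LR v a b, UL v a b)" "\<nexists>v i j b. e = (LR v i j, AxL b)"
proof -
  have r: "a < b" if "(a, b) \<in> half_graph 0 t" for a b using half_graph_range[OF that] by simp
  have "okv (fst e) \<and> okv (snd e) \<and> (\<nexists>v a b. e = (LR v a b, UL v a b)) \<and> (\<nexists>v i j b. e = (LR v i j, AxL b))"
    using assms
  proof (cases rule: ozone_cases)
    case fin then show ?thesis using ex_shape[of u 0 t] r by auto
  next
    case (wa j p q) then show ?thesis using warc_shape[OF wa(2)] r by auto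
  next
    case (ps a b) then show ?thesis using r by auto
  qed
  then show "okv (fst e) \<and> okv (snd e)" "\<nexists>v a b. e = (LR v a b, UL v a b)" "\<nexists>v i j b. e = (LR v i j, AxL b)" by blast+
qed

lemma ozone_planar:
  assumes "e \<in> ozone u t" "t \<noteq> Leaf"
  shows "planar e"
proof -
  have r: "a < b" if "(a, b) \<in> half_graph 0 t" for a b using half_graph_range[OF that] by simp
  have ny: "vy (Cor u i j a b) \<noteq> 0" if "a < b" for i j a b using cor_side[OF that, of i j] by (cases u) auto
  show ?thesis
    using assms(1)
  proof (cases rule: ozone_cases)
    case fin
    then show ?thesis using vine_ex assms(2) ny r by (cases t) (auto simp: planar_def leaves_pos Suc_le_eq simp del: vy.simps(3))
  next
    case (wa j p q)
    have 1: "p = AxR j \<Longrightarrow> planar (p, q)" using warc_shape[OF wa(2)] ny r by (auto simp: planar_def simp del: vy.simps(3))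
    have 2: "planar (UL u j b, LL u j b')" if "j < b" "j < b'" for b b'
      using that by (cases "b = b'") (auto simp: planar_def)
    have 3: "planar (UL u j b, UR u a j)" if "j < b" "a < j" for a b
    proof -
      have "real a + 2 \<le> real b" using that by linarith
      then have "vx (UR u a j) < vx (UL u j b)" by (simp add: field_simps)
      then show ?thesis by (simp add: planar_def del: vx.simps)
    qed
    show ?thesis using warc_shape[OF wa(2)] 1 2 3 r unfolding wa(1) by blast
  qed (auto simp: planar_def)
qed

lemma ozone_pairwise:
  assumes "e \<in> ozone u t" "f \<in> ozone u t" "e \<noteq> f"
  shows "vsep e f"
  using zone_pairwise[of e u t f] assms ozone_verts(2)[OF assms(1)] ozone_verts(2)[OF assms(2)] unfolding diag_def by blast

fun isLL :: "vert \<Rightarrow> bool" where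
  "isLL (Cor u i j a b) \<longleftrightarrow> \<not> i \<and> \<not> j"
| "isLL _ \<longleftrightarrow> False"

text \<open>Recovers the label of a kept segment from its ends, so that its orientation is well
  defined. A segment into \<open>UR\<close> is a strand labelled \<open>a\<close> if it comes from
  \<open>LL\<close>, and otherwise an arc around \<open>b\<close>. The value \<open>0\<close> for
  segments into the axis fits the arc into \<open>AxL 0\<close>, the only kept one of this
  kind.\<close>

fun lab :: "vert \<times> vert \<Rightarrow> nat" where
  "lab (p, Cor u i j a b) = (if i \<and> j \<and> \<not> isLL p then b else a)"
| "lab (p, v) = 0"

definition olab :: "bool \<Rightarrow> btree \<Rightarrow> (nat \<times> vert \<times> vert) set" where
  "olab u t = insert (0, ex u 0 t, AxL 0) (warc u 0 t) \<union> pstr u (half_graph 0 t)"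

lemma olab_lab:
  assumes "(j, e) \<in> olab u t"
  shows "j = lab e \<and> e \<in> ozone u t"
proof -
  have "ozone u t = snd ` olab u t" by (simp add: ozone_def olab_def image_Un)
  then have "e \<in> ozone u t" using assms by force
  moreover obtain p q where e: "e = (p, q)" by (cases e)
  consider "(j, p, q) \<in> warc u 0 t" | "j = 0" "q = AxL 0" | a b where "j = a" "p = LL u a b" "q = UR u a b"
    using assms unfolding olab_def pstr_def e by auto
  then have "j = lab e"
  proof cases
    case 1 then show ?thesis using warc_shape[OF 1] unfolding e by auto
  qed (simp_all add: e)
  ultimately show ?thesis by blast
qed

lemma oarr_olab: "e' \<in> oarr c (olab u t) \<Longrightarrow> \<exists>e \<in> ozone u t. e' = orient1 (c (lab e)) e"
  unfolding oarr_def using olab_lab by fastforce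

lemma finite_warc: "finite (warc u s t)"
  by (induction t arbitrary: s) auto

lemma finite_oarr_olab: "finite (oarr c (olab u t))"
  by (simp add: oarr_def olab_def pstr_def finite_warc finite_half_graph)

lemma half_arrows_split:
  "half_arrows c u t = oarr c (olab u t) \<union> oarr c (nstr u (half_graph 0 t) \<union> uarc u (half_graph 0 t))"
  unfolding half_arrows_def oarr_def image_Un[symmetric] by (rule arg_cong[of _ _ "image _"]) (auto simp: all_arcs_def arcs_def olab_def)

lemma bottom_pq:
  assumes "a < b"
  shows "above (bottom a) (VP a b, VQ a b)" "vx (snd (bottom a)) < vx (fst (bottom a))"
    "x \<in> seg (parr (bottom a)) \<Longrightarrow> w = VP a b \<or> w = VQ a b \<Longrightarrow> fst x \<noteq> fst (pos w)"
    "x \<in> seg (parr (VP a b, VQ a b)) \<Longrightarrow> w = fst (bottom a) \<or> w = snd (bottom a) \<Longrightarrow> fst x \<noteq> fst (pos w)"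
proof -
  note v = vp_coords[OF assms]
  have ab: "real a + 1 \<le> real b" using assms by linarith
  define p q where "p = fst (bottom a)" and "q = snd (bottom a)"
  have e: "bottom a = (p, q)" by (simp add: p_def q_def)
  have p: "vx p = real a + 3/8" "vy p = - 5/8" unfolding p_def bottom_def using low_coords[of False True a] by simp_all
  have q: "vx q \<le> real a - 1/4" "a = 0 \<and> vy q = 0 \<or> vy q = - 5/8"
    unfolding q_def bottom_def using low_coords[of True True "a - 1"] by (cases a; simp del: vx.simps(3-) vy.simps(3-))+
  show "above (bottom a) (VP a b, VQ a b)" by (auto simp: above_def bottom_def)
  show "vx (snd (bottom a)) < vx (fst (bottom a))" using p q unfolding e by simp
  show "fst x \<noteq> fst (pos w)" if x: "x \<in> seg (parr (bottom a))" and w: "w = VP a b \<or> w = VQ a b"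
  proof
    assume eq: "fst x = fst (pos w)"
    obtain t where t: "0 \<le> t" "t \<le> 1" "x = (1 - t) *\<^sub>R pos p + t *\<^sub>R pos q" using seg_parr[OF x[unfolded e]] .
    have X: "vx w = (1 - t) * vx p + t * vx q" "vy w = (1 - t) * vy p + t * vy q"
      using eq unfolding t(3) by (auto simp: pos_def)
    \<comment> \<open>The boundary arc stays at \<open>y \<ge> - 5/8\<close>, and
      \<open>VQ a b\<close> is deeper than that; so only \<open>VP a b\<close> remains to be
      excluded.\<close>
    have "(1 - t) * (- 5/8) + t * (- 5/8) \<le> (1 - t) * vy p + t * vy q" using t p q by (intro add_mono mult_left_mono) auto
    moreover have "(1 - t) * (- 5/8) + t * (- 5/8) = - 5/8" by (simp only: left_diff_distrib; linarith)
    ultimately have "- 5/8 \<le> vy w" unfolding X(2) by linarith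
    moreover have "vy (VQ a b) < - 5/8" using v(2,5) ab by linarith
    ultimately have w': "w = VP a b" using w by (metis not_less)
    then have y0: "(1 - t) * vy p + t * vy q = 0" using X(2) v(4) by simp
    have "t = 1"
      using q(2)
    proof
      assume "vy q = - 5/8"
      then show ?thesis using y0 p(2) by (simp add: algebra_simps)
    qed (use y0 p(2) in simp)
    then show False using X(1) q(1) v(1) w' by simp
  qed
  show "fst x \<noteq> fst (pos w)" if x: "x \<in> seg (parr (VP a b, VQ a b))" and w: "w = fst (bottom a) \<or> w = snd (bottom a)"
  proof
    assume eq: "fst x = fst (pos w)"
    obtain t where t: "0 \<le> t" "t \<le> 1" "x = (1 - t) *\<^sub>R pos (VP a b) + t *\<^sub>R pos (VQ a b)" using seg_parr[OF x] .
    have "vx w = (1 - t) * vx (VP a b) + t * vx (VQ a b)" using eq unfolding t(3) by (auto simp: pos_def)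
    then have 1: "vx w = vx (VP a b)" unfolding v(3) by (simp add: algebra_simps del: vx.simps)
    have "w = p \<or> w = q" using w unfolding p_def q_def .
    then have "vx p = vx (VP a b) \<or> vx q = vx (VP a b)" using 1 by metis
    then show False using p(1) q(1) v(1,2) by linarith
  qed
qed

text \<open>The upper segment comes first.\<close>

definition xing :: "vert \<times> vert \<Rightarrow> vert \<times> vert \<Rightarrow> bool" where
  "xing e f \<longleftrightarrow> (\<exists>a b s. a < b \<and> e = orient1 s (bottom a) \<and> f = orient1 s (VP a b, VQ a b))"

lemma lab_bot: "lab (bottom a) = a"
  by (simp add: bottom_def)

section \<open>The positive diagram\<close>

locale vine_diagram =
  fixes T B :: btree and c :: "nat \<Rightarrow> bool"
  assumes T: "T \<noteq> Leaf" and B: "right_vine B" "B \<noteq> Leaf" and leaves_eq: "leaves T = leaves B"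
    and cT: "\<And>a b. (a, b) \<in> half_graph 0 T \<Longrightarrow> c a \<noteq> c b" and cB: "\<And>a b. (a, b) \<in> half_graph 0 B \<Longrightarrow> c a \<noteq> c b"
begin

abbreviation "G \<equiv> half_graph 0 T"

lemma G_range: "(a, b) \<in> G \<Longrightarrow> a < b \<and> b < leaves B \<and> b = Suc (b - 1) \<and> (b - 1, b) \<in> half_graph 0 B"
  using half_graph_range[of a b 0 T] leaves_eq half_graph_vine[OF B(1), of 0] by auto

text \<open>Sorts the segments of an arc by their origin. The clauses on strands exclude the roles
  in a crossing that such a segment cannot have, and \<open>okv\<close> tells it apart from the kept
  segments.\<close>

lemma kx_cases:
  assumes "(a, b) \<in> G" "g \<in> kx y a b"
  obtains (upper) "g \<in> up 0 T" "upside g" "\<nexists>p q. g = (LL True p q, UR True p q)"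
      "y \<Longrightarrow> \<nexists>p q. g = (LR True p q, UL True p q)" "\<not> (okv (fst g) \<and> okv (snd g))"
  | (lower) "g \<in> szone False B" "loside g" "\<not> y" "\<nexists>p q. g = (LL False p q, UR False p q)" "\<not> (okv (fst g) \<and> okv (snd g))"
  | (pq) "g = (VP a b, VQ a b)" "loside g" "y" | (qt) "g = (VQ a b, UL False (b - 1) b)" "loside g" "y"
proof -
  note r = G_range[OF assms(1)]
  have ab: "a < b" "b - 1 < b" using r by auto
  have q0: "vy (VQ a b) < 0" using vp_coords[OF ab(1)] ab(1) by linarith
  note c1 = cor_side(1)[OF ab(1)] and c2 = cor_side(2)[OF ab(2)]
  consider (1) "g = (LR True a b, UL True a b) \<and> \<not> y \<or> g = (LR True a b, AxL b) \<and> \<not> y \<or> g = (UL True a b, VP a b) \<and> y"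
    | (2) "\<not> y" "g = (LR False (b - 1) b, AxL b) \<or> g = (LR False (b - 1) b, UL False (b - 1) b)"
    | (3) "y" "g = (VP a b, VQ a b)" | (4) "y" "g = (VQ a b, UL False (b - 1) b)"
    using assms(2) unfolding kx_def by (cases y) auto
  then show thesis
  proof cases
    case 1
    have "g \<in> up 0 T" using 1 graph_up[OF assms(1)] by blast
    moreover have "upside g" using 1 c1 ab by (auto simp: upside_def simp del: vy.simps(3-))
    ultimately show thesis using 1 by (intro upper) auto
  next
    case 2
    have "g \<in> szone False B" using 2 r unfolding szone_def nstr_def uarc_def by (force simp: image_iff)
    moreover have "loside g" using 2 c2 by (auto simp: loside_def simp del: vy.simps(3-))
    ultimately show thesis using 2 by (intro lower) auto
  next
    case 3
    have "loside g" unfolding 3 loside_def using q0 ab by (simp del: vy.simps(3-))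
    then show thesis using 3 pq by blast
  next
    case 4
    have "loside g" unfolding 4 loside_def using q0 c2 by (simp del: vy.simps(3-))
    then show thesis using 4 qt by blast
  qed
qed

lemma kx_lower:
  assumes G: "(a, b) \<in> G" and e: "e \<in> ozone False B \<union> szone False B" "e \<notin> range bottom"
  shows "vsep e (VP a b, VQ a b)" "vsep e (VQ a b, UL False (b - 1) b)"
proof -
  note r = G_range[OF G]
  show "vsep e (VP a b, VQ a b)" using lower_pq[OF e(1) B] r e(2) by blast
  show "vsep e (VQ a b, UL False (b - 1) b)" using lower_qt[OF _ _ refl e(1) B] r by blast
qed

lemma szone_not_bot: "e \<in> szone u t \<Longrightarrow> e \<notin> range bottom"
  unfolding szone_def nstr_def uarc_def bottom_def by auto

text \<open>Each of the two arcs may be in its old or its new form, since the arcs are replaced one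
  at a time and both forms coexist.\<close>

lemma kx_pairwise:
  assumes 1: "(a, b) \<in> G" "g \<in> kx y a b" and 2: "(a', b') \<in> G" "g' \<in> kx y' a' b'" and ne: "g \<noteq> g'"
  shows "vsep g g'"
proof -
  have r: "a < b" "a' < b'" using G_range 1 2 by blast+
  have idx: "b = b' \<Longrightarrow> a = a'" using half_graph_parent_unique 1(1) 2(1) by blast
  have own: "vsep (VP a b, VQ a b) (VQ a b, UL False (b - 1) b)" if "(a, b) \<in> G" for a b
    using pq_qt_own[OF _ _ refl] G_range[OF that] by blast
  have pqt: "vsep (VP a b, VQ a b) (VQ a' b', UL False (b' - 1) b')" if "(a, b) \<in> G" "(a', b') \<in> G" for a b a' b'
    using own[OF that(1)] pq_qt[OF that] by (cases "(a, b) = (a', b')") auto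
  have ul: "vsep e f" if "upside e" "loside f" for e f using vsep_upside_loside that .
  show ?thesis
    using 1
  proof (cases rule: kx_cases)
    case upper
    note g = upper
    show ?thesis
      using 2
    proof (cases rule: kx_cases)
      case upper
      then show ?thesis using upper_pairwise[of g T g'] g ne unfolding diag_def by blast
    qed (use g ul in blast)+
  next
    case lower
    note g = lower
    show ?thesis
      using 2
    proof (cases rule: kx_cases)
      case upper
      then show ?thesis using g ul vsep_sym by blast
    next
      case lower
      then show ?thesis using zone_pairwise[of g False B g'] g ne unfolding diag_def by blast
    next
      case pq
      then show ?thesis using kx_lower(1)[OF 2(1), of g] g(1) szone_not_bot by blast
    next
      case qt
      then show ?thesis using kx_lower(2)[OF 2(1), of g] g(1) szone_not_bot by blast
    qed
  next
    case pq
    note g = pq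
    show ?thesis
      using 2
    proof (cases rule: kx_cases)
      case upper
      then show ?thesis using g ul vsep_sym by blast
    next
      case lower
      then show ?thesis using kx_lower(1)[OF 1(1), of g'] g(1) szone_not_bot vsep_sym by blast
    next
      case pq
      then show ?thesis using pq_pq[OF r] ne g by blast
    next
      case qt
      then show ?thesis using pqt[OF 1(1) 2(1)] g by blast
    qed
  next
    case qt
    note g = qt
    show ?thesis
      using 2
    proof (cases rule: kx_cases)
      case upper
      then show ?thesis using g ul vsep_sym by blast
    next
      case lower
      then show ?thesis using kx_lower(2)[OF 1(1), of g'] g(1) szone_not_bot vsep_sym by blast
    next
      case pq
      then show ?thesis using pqt[OF 2(1) 1(1)] g vsep_sym by blast
    next
      case qt
      then have "b \<noteq> b'" using ne g idx by auto
      then show ?thesis using qt_qt[OF r] g qt by blast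
    qed
  qed
qed

text \<open>A kept segment crosses an old arc only as the upper strand at an edge, and a new arc
  only on the lower boundary of the disc of \<open>a\<close>.\<close>

lemma ozone_kx:
  assumes G: "(a, b) \<in> G" "g \<in> kx y a b" and e: "u \<and> e \<in> ozone True T \<or> \<not> u \<and> e \<in> ozone False B"
  shows "vsep e g \<or> \<not> y \<and> diag u e g \<or> y \<and> \<not> u \<and> e = bottom a \<and> g = (VP a b, VQ a b)"
  using e
proof (elim disjE conjE)
  assume u: "u" and e: "e \<in> ozone True T"
  have es: "upside e" using zone_side[of e True T] e T by simp
  from G show ?thesis
  proof (cases rule: kx_cases)
    case upper
    have "e \<noteq> g" using upper(5) ozone_verts(1)[OF e] by blast
    then have "vsep e g \<or> diag True e g \<or> diag True g e" using upper_pairwise[of e T g] zone_up[of e T] e upper(1) by blast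
    then show ?thesis using upper(3,4) u unfolding diag_def by blast
  qed (use es vsep_upside_loside in blast)+
next
  assume u: "\<not> u" and e: "e \<in> ozone False B"
  have es: "loside e" using zone_side[of e False B] e B by simp
  from G show ?thesis
  proof (cases rule: kx_cases)
    case upper
    then show ?thesis using es vsep_upside_loside vsep_sym by blast
  next
    case lower
    have "e \<noteq> g" using lower(5) ozone_verts(1)[OF e] by blast
    then have "vsep e g \<or> diag False e g \<or> diag False g e" using zone_pairwise[of e False B g] e lower(1) by blast
    moreover have "\<not> diag False g e" using lower(4) unfolding diag_def by blast
    ultimately show ?thesis using u lower(3) by auto
  next
    case pq
    then show ?thesis using lower_pq[of e B a b] e B G_range[OF G(1)] u by blast
  next
    case qt
    then show ?thesis using lower_qt[OF _ _ refl, of a b "b - 1" e B] e B G_range[OF G(1)] by blast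
  qed
qed

definition oa :: "(vert \<times> vert) set" where
  "oa = oarr c (olab True T) \<union> oarr (\<lambda>j. \<not> c j) (olab False B)"

lemma oa_cases:
  assumes "e' \<in> oa"
  obtains (up) e where "e \<in> ozone True T" "e' = orient1 (c (lab e)) e"
  | (lo) e where "e \<in> ozone False B" "e' = orient1 (\<not> c (lab e)) e"
  using assms unfolding oa_def using oarr_olab[of e' c True T] oarr_olab[of e' "\<lambda>j. \<not> c j" False B] by blast

lemma oa_pairwise:
  assumes "e \<in> oa" "f \<in> oa" "e \<noteq> f"
  shows "vsep e f"
proof -
  have ul: "vsep e f" if "e \<in> ozone True T" "f \<in> ozone False B" for e f
    using vsep_upside_loside[of e f] zone_side[of e True T] zone_side[of f False B] that T B by auto
  show ?thesis
    using assms(1)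
  proof (cases rule: oa_cases)
    case (up g)
    note g = up
    show ?thesis
      using assms(2)
    proof (cases rule: oa_cases)
      case (up h)
      then have "g \<noteq> h" using g assms(3) by auto
      then show ?thesis using ozone_pairwise[OF g(1) up(1)] unfolding g(2) up(2) vsep_orient1 by blast
    next
      case (lo h)
      show ?thesis using ul[OF g(1) lo(1)] unfolding g(2) lo(2) vsep_orient1 by blast
    qed
  next
    case (lo g)
    note g = lo
    show ?thesis
      using assms(2)
    proof (cases rule: oa_cases)
      case (up h)
      show ?thesis using vsep_sym[OF ul[OF up(1) g(1)]] unfolding g(2) up(2) vsep_orient1 by blast
    next
      case (lo h)
      then have "g \<noteq> h" using g assms(3) by auto
      then show ?thesis using ozone_pairwise[OF g(1) lo(1)] unfolding g(2) lo(2) vsep_orient1 by blast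
    qed
  qed
qed

lemma oa_props:
  assumes "e \<in> oa"
  shows "planar e" "okv (fst e)" "okv (snd e)"
proof -
  have "planar e \<and> okv (fst e) \<and> okv (snd e)"
    using assms
  proof (cases rule: oa_cases)
    case (up g)
    then show ?thesis using ozone_planar[OF up(1) T] ozone_verts(1)[OF up(1)] unfolding up(2) planar_orient1 by (simp add: orient1_def)
  next
    case (lo g)
    then show ?thesis using ozone_planar[OF lo(1) B(2)] ozone_verts(1)[OF lo(1)] unfolding lo(2) planar_orient1 by (simp add: orient1_def)
  qed
  then show "planar e" "okv (fst e)" "okv (snd e)" by blast+
qed

definition ka :: "bool \<Rightarrow> nat \<times> nat \<Rightarrow> (vert \<times> vert) set" where
  "ka y p = edges (kl (c (fst p)) y (fst p) (snd p))"

lemma ka_planar: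
  assumes "(a, b) \<in> G" "e \<in> ka y (a, b)"
  shows "planar e"
proof -
  have ab: "a < b" using G_range assms(1) by blast
  obtain k where k: "b = Suc k" using ab by (cases b) auto
  have q: "vy (VQ a b) < 0" using vp_coords[OF ab] ab by linarith
  have t: "vx (VQ a b) \<noteq> vx (UL False (b - 1) b)" using vq_coords(1)[OF ab k refl] t_coords(1)[OF ab k refl] by linarith
  have ny: "vy (Cor u i j a b) \<noteq> 0" if "a < b" for u i j a b using cor_side[OF that, of i j] by (cases u) auto
  obtain s g where g: "g \<in> kx y a b" "e = orient1 s g" using kl_edges assms(2) unfolding ka_def fst_conv snd_conv by blast
  have cx: "vx (LR u a b) \<noteq> vx (UL u a b)" for u a b by simp
  have lt: "b - 1 < b" using ab by simp
  have ax: "vy (AxL b) = 0" by simp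
  have "planar g"
    using g(1) q t cx[of True a b] cx[of False "b - 1" b] ny[OF ab] ny[OF lt] vp_coords(4)[OF ab] ax
    unfolding kx_def planar_def by (cases y) (auto simp del: vx.simps vy.simps)
  then show ?thesis unfolding g(2) planar_orient1 .
qed

lemma ka_pairwise:
  assumes "p \<in> G" "q \<in> G" "e \<in> ka y p" "f \<in> ka y' q" "e \<noteq> f" "p = q \<Longrightarrow> y = y'"
  shows "vsep e f"
proof -
  obtain a b a' b' where pq: "p = (a, b)" "q = (a', b')" by (cases p; cases q)
  obtain s g where g: "g \<in> kx y a b" "e = orient1 s g" using kl_edges assms(3) unfolding ka_def pq fst_conv snd_conv by blast
  obtain r h where h: "h \<in> kx y' a' b'" "f = orient1 r h" using kl_edges assms(4) unfolding ka_def pq fst_conv snd_conv by blast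
  have "g \<noteq> h"
  proof
    assume gh: "g = h"
    have "b = b'" using kx_disjoint[of b b'] g(1) h(1) gh by blast
    then have "a = a'" using half_graph_parent_unique assms(1,2) pq by blast
    then have *: "p = q" using pq \<open>b = b'\<close> by simp
    \<comment> \<open>Different arrows on the same segment are reverse to each other, but an arc
      never runs through a segment in both directions.\<close>
    have "f = prod.swap e" using assms(5) unfolding g(2) h(2) gh by (auto simp: orient1_def)
    moreover have "a < b" using G_range assms(1) pq by blast
    ultimately show False using kl_props(7)[of a b "fst e" "snd e" "c a" y] assms(3,4,6) * unfolding ka_def pq by (cases e) auto
  qed
  then show ?thesis using kx_pairwise[of a b g y a' b' h y'] g h assms(1,2) pq by (simp add: vsep_orient1)
qed

lemma oa_ka_x:
  assumes "e \<in> oa" "p \<in> G" "f \<in> ka y p"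
  shows "vsep e f \<or> above e f"
proof -
  obtain a b where p: "p = (a, b)" by (cases p)
  have ab: "a < b" using G_range assms(2) p by blast
  obtain r h where h: "h \<in> kx y a b" "f = orient1 r h" using kl_edges assms(3) unfolding ka_def p fst_conv snd_conv by blast
  have "\<exists>u g s. (u \<and> g \<in> ozone True T \<or> \<not> u \<and> g \<in> ozone False B) \<and> e = orient1 s g"
    using assms(1) by (cases rule: oa_cases) blast+
  then obtain u g s where g: "u \<and> g \<in> ozone True T \<or> \<not> u \<and> g \<in> ozone False B" "e = orient1 s g" by blast
  have "vsep g h \<or> above g h"
    using ozone_kx[OF _ h(1) g(1)] assms(2) p diag_above bottom_pq(1)[OF ab] by blast
  then show ?thesis unfolding g(2) h(2) vsep_orient1 above_orient1 .
qed

lemma oa_ka_y: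
  assumes "e \<in> oa" "p \<in> G" "f \<in> ka True p"
  shows "vsep e f \<or> xing e f"
proof -
  obtain a b where p: "p = (a, b)" by (cases p)
  have G: "(a, b) \<in> G" using assms(2) p by blast
  have ab: "a < b" using G_range[OF G] by blast
  obtain r h where h: "h \<in> kx True a b" "f = orient1 r h" using kl_edges assms(3) unfolding ka_def p fst_conv snd_conv by blast
  show ?thesis
    using assms(1)
  proof (cases rule: oa_cases)
    case (up g)
    then have "vsep g h" using ozone_kx[OF G h(1), of True g] by blast
    then show ?thesis unfolding up(2) h(2) vsep_orient1 by blast
  next
    case (lo g)
    have "vsep g h \<or> g = bottom a \<and> h = (VP a b, VQ a b)" using ozone_kx[OF G h(1), of False g] lo(1) by blast
    then show ?thesis
    proof
      assume gh: "g = bottom a \<and> h = (VP a b, VQ a b)"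
      \<comment> \<open>The direction of the descent is read off from the list: downwards exactly if
        \<open>a\<close> has colour \<open>-\<close>.\<close>
      have "r = (\<not> c a)"
        using assms(3) unfolding h(2) conjunct2[OF gh] ka_def p kl_def yv_def orient1_def by (cases "c a"; cases r) auto
      then have "f = orient1 (\<not> c a) (VP a b, VQ a b)" using h(2) gh by simp
      moreover have "e = orient1 (\<not> c a) (bottom a)" using lo(2) gh by (simp add: lab_bot)
      ultimately have "xing e f" unfolding xing_def using ab by blast
      then show ?thesis ..
    qed (unfold lo(2) h(2) vsep_orient1, blast)
  qed
qed

end

section \<open>Criteria for positive diagrams and for links\<close>

text \<open>Distinguishes the partners of a crossing. Each crossing has exactly one of this kind, so
  three segments never cross pairwise and triple points are excluded.\<close>

definition isPQ :: "vert \<times> vert \<Rightarrow> bool" where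
  "isPQ f \<longleftrightarrow> (\<exists>a b. fst f = VP a b \<or> fst f = VQ a b)"

lemma seg_parr_orient1: "seg (parr (orient1 s e)) = seg (parr e)"
  by (cases s) (simp add: orient1_def, simp add: orient1_def parr_def, rule seg_swap)

lemma xingD:
  assumes "xing e f"
  shows "above e f" "x \<in> seg (parr e) \<Longrightarrow> w = fst f \<or> w = snd f \<Longrightarrow> fst x \<noteq> fst (pos w)"
    "x \<in> seg (parr f) \<Longrightarrow> w = fst e \<or> w = snd e \<Longrightarrow> fst x \<noteq> fst (pos w)"
    "0 < cross (direction (parr e)) (direction (parr f))" "isPQ f" "\<not> isPQ e"
proof -
  obtain a b s where ab: "a < b" and e: "e = orient1 s (bottom a)" and f: "f = orient1 s (VP a b, VQ a b)"
    using assms unfolding xing_def by blast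
  note b = bottom_pq[OF ab]
  show "above e f" unfolding e f above_orient1 by (rule b(1))
  show "fst x \<noteq> fst (pos w)" if "x \<in> seg (parr e)" "w = fst f \<or> w = snd f"
    using b(3)[of x w] that unfolding e f seg_parr_orient1 by (auto simp: orient1_def split: if_splits)
  show "fst x \<noteq> fst (pos w)" if "x \<in> seg (parr f)" "w = fst e \<or> w = snd e"
    using b(4)[of x w] that unfolding e f seg_parr_orient1 by (auto simp: orient1_def split: if_splits)
  obtain p q where pq: "bottom a = (p, q)" by (cases "bottom a")
  \<comment> \<open>Since the descent is parallel to the second axis, what remains is the product of
    the horizontal extent of the boundary arc and the depth of \<open>VQ a b\<close>, both negative.
    Reversing both directions does not change it.\<close>
  have "cross (direction (parr e)) (direction (parr f)) =
      (vx q - vx p) * (vy (VQ a b) - vy (VP a b)) - (vy q - vy p) * (vx (VQ a b) - vx (VP a b))"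
    unfolding e f pq by (cases s) (simp_all add: orient1_def direction_def parr_def pos_def cross_def algebra_simps del: vx.simps vy.simps)
  also have "\<dots> = (vx q - vx p) * vy (VQ a b)" unfolding vp_coords(3,4)[OF ab] by simp
  finally show "0 < cross (direction (parr e)) (direction (parr f))"
    using b(2) vp_coords(2,5)[OF ab] ab unfolding pq by (simp del: vx.simps vy.simps add: mult_neg_neg)
  show "isPQ f" "\<not> isPQ e" unfolding e f isPQ_def bottom_def by (auto simp: orient1_def)
qed

lemma positive_parr:
  assumes pl: "\<And>e. e \<in> D \<Longrightarrow> planar e" and pw: "\<And>e f. e \<in> D \<Longrightarrow> f \<in> D \<Longrightarrow> e \<noteq> f \<Longrightarrow> vsep e f \<or> xing e f \<or> xing f e"
  shows "positive_diagram (parr ` D)"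
proof -
  have fp: "fst (fst (parr e)) \<noteq> fst (snd (parr e))" if "e \<in> D" for e
    using pl[OF that] by (auto simp: planar_def parr_def pos_def)
  have op: "x \<in> seg e \<and> x \<notin> {fst e, snd e}" if "x \<in> open_segment (fst e) (snd e)" for x e
    using that by (simp add: open_segment_def seg_def)
  have vertex: "v = fst (parr e) \<or> v = snd (parr e)"
    if e: "e \<in> D" and f: "f \<in> D" and v: "v \<in> {fst (parr f), snd (parr f)}"
      and cs: "fst v \<in> closed_segment (fst (fst (parr e))) (fst (snd (parr e)))" for e f v
  proof (cases "e = f")
    case False
    obtain t where t: "0 \<le> t" "t \<le> 1" "fst v = (1 - t) *\<^sub>R fst (fst (parr e)) + t *\<^sub>R fst (snd (parr e))"
      using cs by (auto simp: in_segment)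
    define y where "y = (1 - t) *\<^sub>R fst (parr e) + t *\<^sub>R snd (parr e)"
    have y: "y \<in> seg (parr e)" "fst y = fst v" using t by (auto simp: y_def seg_def in_segment)
    have vs: "v \<in> seg (parr f)" using v by (auto simp: seg_def)
    obtain w where w: "w = fst f \<or> w = snd f" "v = pos w" using v by (auto simp: parr_def)
    from pw[OF f e] False consider "vsep f e" | "xing f e" | "xing e f" by blast
    then show ?thesis
    proof cases
      case 1
      then show ?thesis using vs y unfolding vsep_def psep_def by auto
    next
      case 2
      then show ?thesis using xingD(3)[OF 2 y(1) w(1)] y(2) w(2) by simp
    next
      case 3
      then show ?thesis using xingD(2)[OF 3 y(1) w(1)] y(2) w(2) by simp
    qed
  qed (use v in simp)
  have touch: "xing e f \<or> xing f e"
    if "e \<in> D" "f \<in> D" "e \<noteq> f" "x \<in> open_segment (fst (parr e)) (snd (parr e))" "y \<in> open_segment (fst (parr f)) (snd (parr f))" "fst x = fst y"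
    for e f x y
  proof -
    have "\<not> vsep e f" using op[OF that(4)] op[OF that(5)] that(6) unfolding vsep_def psep_def by blast
    then show ?thesis using pw[OF that(1-3)] by blast
  qed
  have reg: "regular_projection (parr ` D)"
    unfolding regular_projection_def
  proof (intro conjI)
    show "\<forall>(p, q) \<in> parr ` D. fst p \<noteq> fst q" by (simp add: fp case_prod_beta)
    show "\<forall>v \<in> fst ` parr ` D \<union> snd ` parr ` D. \<forall>(p, q) \<in> parr ` D. fst v \<in> closed_segment (fst p) (fst q) \<longrightarrow> v = p \<or> v = q"
    proof (intro ballI)
      fix v w assume "v \<in> fst ` parr ` D \<union> snd ` parr ` D" and "w \<in> parr ` D"
      then obtain e f where e: "e \<in> D" "w = parr e" and f: "f \<in> D" "v \<in> {fst (parr f), snd (parr f)}" by auto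
      show "case w of (p, q) \<Rightarrow> fst v \<in> closed_segment (fst p) (fst q) \<longrightarrow> v = p \<or> v = q"
        using vertex[OF e(1) f] unfolding e(2) case_prod_beta by blast
    qed
    show "\<forall>e \<in> parr ` D. \<forall>f \<in> parr ` D. \<forall>g \<in> parr ` D. distinct [e, f, g] \<longrightarrow>
        fst ` open_segment (fst e) (snd e) \<inter> fst ` open_segment (fst f) (snd f) \<inter> fst ` open_segment (fst g) (snd g) = {}"
    proof (intro ballI impI, rule ccontr)
      fix e' f' g' assume "e' \<in> parr ` D" "f' \<in> parr ` D" "g' \<in> parr ` D" and d: "distinct [e', f', g']"
        and ne: "fst ` open_segment (fst e') (snd e') \<inter> fst ` open_segment (fst f') (snd f') \<inter> fst ` open_segment (fst g') (snd g') \<noteq> {}"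
      then obtain e f g where e: "e \<in> D" "e' = parr e" and f: "f \<in> D" "f' = parr f" and g: "g \<in> D" "g' = parr g" by blast
      obtain x y z where x: "x \<in> open_segment (fst e') (snd e')" and y: "y \<in> open_segment (fst f') (snd f')"
        and z: "z \<in> open_segment (fst g') (snd g')" and xy: "fst x = fst y" and xz: "fst x = fst z"
        using ne by (auto simp: set_eq_iff image_iff)
      have yz: "fst y = fst z" using xy xz by simp
      have n: "e \<noteq> f" "e \<noteq> g" "f \<noteq> g" using d e f g by auto
      show False
        using touch[OF e(1) f(1) n(1) x[unfolded e(2)] y[unfolded f(2)] xy] touch[OF e(1) g(1) n(2) x[unfolded e(2)] z[unfolded g(2)] xz]
          touch[OF f(1) g(1) n(3) y[unfolded f(2)] z[unfolded g(2)] yz] xingD(5,6) by blast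
    qed
  qed
  have "cross (direction e') (direction f') > 0" if "e' \<in> parr ` D" "f' \<in> parr ` D" "passes_over e' f'" for e' f'
  proof -
    obtain e f where e: "e \<in> D" "e' = parr e" and f: "f \<in> D" "f' = parr f" using \<open>e' \<in> parr ` D\<close> \<open>f' \<in> parr ` D\<close> by blast
    obtain x y where x: "x \<in> open_segment (fst (parr e)) (snd (parr e))" and y: "y \<in> open_segment (fst (parr f)) (snd (parr f))"
      and eq: "fst x = fst y" and gt: "snd y < snd x" using \<open>passes_over e' f'\<close> unfolding passes_over_def e f by blast
    \<comment> \<open>The projection is injective on a single segment, so a segment does not pass
      over itself.\<close>
    have "e \<noteq> f"
    proof
      assume ef: "e = f"
      obtain t where t: "x = (1 - t) *\<^sub>R fst (parr e) + t *\<^sub>R snd (parr e)" using x by (auto simp: in_segment)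
      obtain k where k: "y = (1 - k) *\<^sub>R fst (parr e) + k *\<^sub>R snd (parr e)" using y ef by (auto simp: in_segment)
      have "(t - k) *\<^sub>R (fst (snd (parr e)) - fst (fst (parr e))) = fst x - fst y" unfolding t k by (simp add: algebra_simps)
      then have "t = k" using fp[OF e(1)] eq by simp
      then show False using gt t k by simp
    qed
    then have "xing e f \<or> xing f e" using touch e f x y eq by blast
    moreover have "\<not> xing f e"
    proof
      assume "xing f e"
      then have "snd x < snd y" using above_seg xingD(1) op[OF x] op[OF y] by blast
      then show False using gt by simp
    qed
    ultimately show ?thesis using xingD(4) unfolding e f by blast
  qed
  then show ?thesis using reg unfolding positive_diagram_def by blast
qed

lemma link_parr:
  assumes "finite E" "inj_on fst E" "inj_on snd E" "fst ` E = snd ` E" "inj_on pos (fst ` E)"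
    and pl: "\<And>e. e \<in> E \<Longrightarrow> planar e" and pw: "\<And>e f. e \<in> E \<Longrightarrow> f \<in> E \<Longrightarrow> e \<noteq> f \<Longrightarrow> vsep e f \<or> above e f \<or> above f e"
  shows "link (parr ` E)"
  unfolding link_def
proof (intro conjI)
  have p: "fst (parr e) = pos (fst e)" "snd (parr e) = pos (snd e)" for e by (simp_all add: parr_def)
  show "finite (parr ` E)" using assms(1) by simp
  show "\<forall>(p, q) \<in> parr ` E. p \<noteq> q" using pl by (fastforce simp: planar_def parr_def pos_def)
  have "inj_on (pos \<circ> fst) E" "inj_on (pos \<circ> snd) E" using assms(2-5) by (auto intro: comp_inj_on)
  then show "inj_on fst (parr ` E)" "inj_on snd (parr ` E)" unfolding inj_on_def by (auto simp: p)
  have "fst ` parr ` E = pos ` fst ` E" "snd ` parr ` E = pos ` snd ` E" by (simp_all add: image_image p)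
  then show "fst ` parr ` E = snd ` parr ` E" using assms(4) by simp
  show "\<forall>e \<in> parr ` E. \<forall>f \<in> parr ` E. e \<noteq> f \<longrightarrow> seg e \<inter> seg f \<subseteq> {fst e, snd e} \<inter> {fst f, snd f}"
  proof (intro ballI impI subsetI)
    fix e' f' x assume "e' \<in> parr ` E" "f' \<in> parr ` E" "e' \<noteq> f'" and x: "x \<in> seg e' \<inter> seg f'"
    then obtain e f where e: "e \<in> E" "e' = parr e" and f: "f \<in> E" "f' = parr f" and "e \<noteq> f" by blast
    then consider "vsep e f" | "above e f" | "above f e" using pw[of e f] by blast
    then show "x \<in> {fst e', snd e'} \<inter> {fst f', snd f'}"
    proof cases
      case 1
      then show ?thesis using x unfolding vsep_def psep_def e f by blast
    next
      case 2
      then have "snd x < snd x" using above_seg x e f by blast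
      then show ?thesis by simp
    next
      case 3
      then have "snd x < snd x" using above_seg x e f by blast
      then show ?thesis by simp
    qed
  qed
qed

section \<open>Replacing the arcs one at a time\<close>

context vine_diagram
begin

text \<open>The stage at which the arcs of the edges in \<open>S\<close> have been lowered:
  \<open>H {}\<close> is the given link and \<open>H G\<close> the positive diagram.\<close>

definition H :: "(nat \<times> nat) set \<Rightarrow> (vert \<times> vert) set" where
  "H S = oa \<union> (\<Union>p \<in> G. ka (p \<in> S) p)"

lemma ka_valid: "p \<in> G \<Longrightarrow> e \<in> ka y p \<Longrightarrow> valid (fst e) \<and> valid (snd e)"
  using G_range[of "fst p" "snd p"] kl_props(3)[of "fst p" "snd p" "c (fst p)" y] edges_in unfolding ka_def by fastforce

lemma H_valid: "e \<in> H S \<Longrightarrow> valid (fst e) \<and> valid (snd e)"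
  unfolding H_def using oa_props(2,3) okv_valid ka_valid by blast

lemma H_planar: "e \<in> H S \<Longrightarrow> planar e"
  unfolding H_def using oa_props(1) ka_planar by fastforce

lemma H_pairwise:
  assumes "e \<in> H S" "f \<in> H S" "e \<noteq> f"
  shows "vsep e f \<or> above e f \<or> above f e"
proof -
  consider "e \<in> oa" "f \<in> oa" | p where "e \<in> oa" "p \<in> G" "f \<in> ka (p \<in> S) p" | p where "f \<in> oa" "p \<in> G" "e \<in> ka (p \<in> S) p"
    | p q where "p \<in> G" "q \<in> G" "e \<in> ka (p \<in> S) p" "f \<in> ka (q \<in> S) q"
    using assms(1,2) unfolding H_def by blast
  then show ?thesis
  proof cases
    case 1 then show ?thesis using oa_pairwise assms(3) by blast
  next
    case 2 then show ?thesis using oa_ka_x by blast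
  next
    case 3 then show ?thesis using oa_ka_x vsep_sym by blast
  next
    case (4 p q) then show ?thesis using ka_pairwise[OF 4 assms(3)] by blast
  qed
qed

lemma H_pairwise_G:
  assumes "e \<in> H G" "f \<in> H G" "e \<noteq> f"
  shows "vsep e f \<or> xing e f \<or> xing f e"
proof -
  consider "e \<in> oa" "f \<in> oa" | p where "e \<in> oa" "p \<in> G" "f \<in> ka True p" | p where "f \<in> oa" "p \<in> G" "e \<in> ka True p"
    | p q where "p \<in> G" "q \<in> G" "e \<in> ka True p" "f \<in> ka True q"
    using assms(1,2) unfolding H_def by auto
  then show ?thesis
  proof cases
    case 1 then show ?thesis using oa_pairwise assms(3) by blast
  next
    case 2 then show ?thesis using oa_ka_y by blast
  next
    case 3 then show ?thesis using oa_ka_y vsep_sym by blast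
  next
    case (4 p q) then show ?thesis using ka_pairwise[OF 4 assms(3)] by blast
  qed
qed

text \<open>The arrows that do not stay are regrouped by the edges of the upper tree. Each
  \<open>b > 0\<close> is the right end of exactly one edge in either tree, so every segment is met
  once; and \<open>a\<close> and \<open>b - 1\<close> have the same colour, both being adjacent to
  \<open>b\<close>, so the four segments are directed consistently.\<close>

lemma arrows_eq: "half_arrows c True T \<union> half_arrows (\<lambda>j. \<not> c j) False B = H {}"
proof -
  define f1 where "f1 p = orient1 (c (fst p)) (LR True (fst p) (snd p), UL True (fst p) (snd p))" for p
  define f2 where "f2 p = orient1 (c (snd p)) (LR True (fst p) (snd p), AxL (snd p))" for p
  define f3 where "f3 p = orient1 (\<not> c (snd p - 1)) (LR False (snd p - 1) (snd p), UL False (snd p - 1) (snd p))" for p :: "nat \<times> nat"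
  define f4 where "f4 p = orient1 (\<not> c (snd p)) (LR False (snd p - 1) (snd p), AxL (snd p))" for p :: "nat \<times> nat"
  have k: "ka False p = {f1 p, f2 p, f3 p, f4 p}" if "p \<in> G" for p
  proof -
    obtain a b where p: "p = (a, b)" by (cases p)
    have "c a \<noteq> c b" "c (b - 1) \<noteq> c b" using cT cB G_range that p by blast+
    then have "c b = (\<not> c a)" "c (b - 1) = c a" by blast+
    then show ?thesis
      unfolding ka_def kl_def xv_def f1_def f2_def f3_def f4_def orient1_def p by (cases "c a") auto
  qed
  have GB: "half_graph 0 B = (\<lambda>p. (snd p - 1, snd p)) ` G"
  proof (intro equalityI subsetI)
    fix p assume p: "p \<in> half_graph 0 B"
    obtain j k where jk: "p = (j, k)" by (cases p)
    have "k = Suc j" "k < leaves T" using vine_graphD[OF B(1)] half_graph_range[of j k 0 B] p leaves_eq unfolding jk by auto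
    then obtain a where "(a, k) \<in> G" using half_graph_parent[of 0 k T] by auto
    then show "p \<in> (\<lambda>p. (snd p - 1, snd p)) ` G" using \<open>k = Suc j\<close> unfolding jk by force
  next
    fix p assume "p \<in> (\<lambda>p. (snd p - 1, snd p)) ` G"
    then show "p \<in> half_graph 0 B" using G_range by auto
  qed
  have 1: "oarr c (nstr True G \<union> uarc True G) = f1 ` G \<union> f2 ` G"
    unfolding oarr_def nstr_def uarc_def image_Un image_image f1_def f2_def case_prod_beta fst_conv snd_conv ..
  have 2: "oarr (\<lambda>j. \<not> c j) (nstr False (half_graph 0 B) \<union> uarc False (half_graph 0 B)) = f3 ` G \<union> f4 ` G"
    unfolding GB oarr_def nstr_def uarc_def image_Un image_image f3_def f4_def case_prod_beta fst_conv snd_conv ..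
  have "(\<Union>p \<in> G. ka (p \<in> {}) p) = (\<Union>p \<in> G. {f1 p, f2 p, f3 p, f4 p})" using k by simp
  also have "\<dots> = f1 ` G \<union> f2 ` G \<union> (f3 ` G \<union> f4 ` G)" by blast
  finally show ?thesis unfolding half_arrows_split 1 2 H_def oa_def by (simp only: Un_ac)
qed

lemma link_start: "link (parr ` H {})"
proof (rule link_parr)
  show "inj_on fst (H {})" "inj_on snd (H {})" "fst ` H {} = snd ` H {}"
    unfolding arrows_eq[symmetric] by (rule arrows_ends; (rule leaves_eq | erule cT | erule cB))+
  show "finite (H {})" unfolding H_def oa_def ka_def edges_def using finite_oarr_olab finite_half_graph by simp
  show "inj_on pos (fst ` H {})" using H_valid pos_inj by (intro inj_onI) blast
qed (use H_planar H_pairwise in blast)+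

text \<open>The rest \<open>R\<close> contains the other arcs in their present form, lowered ones
  included. These have the same height as the arc that is moved, but their projections are separated
  from it, so both its positions count as being below \<open>R\<close>.\<close>

lemma link_step:
  assumes p: "p \<in> G" "p \<notin> S" and L: "link (parr ` H S)"
  shows "link (parr ` H (insert p S)) \<and> deforms (parr ` H S) (parr ` H (insert p S))"
proof -
  obtain a b where ab: "p = (a, b)" by (cases p)
  have r: "a < b" using G_range p(1) ab by blast
  define R where "R = oa \<union> (\<Union>q \<in> G - {p}. ka (q \<in> S) q)"
  define l where "l y = kl (c a) y a b" for y
  have l: "ka y p = edges (l y)" for y by (simp add: ka_def l_def ab)
  have U: "(\<Union>q \<in> G. f q) = f p \<union> (\<Union>q \<in> G - {p}. f q)" for f :: "nat \<times> nat \<Rightarrow> (vert \<times> vert) set"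
    using p(1) by blast
  have U': "(\<Union>q \<in> G - {p}. ka (q \<in> insert p S) q) = (\<Union>q \<in> G - {p}. ka (q \<in> S) q)"
    by (intro SUP_cong refl) simp
  have H: "H S = R \<union> edges (l False)" "H (insert p S) = R \<union> edges (l True)"
    unfolding H_def R_def l[symmetric] U[of "\<lambda>q. ka (q \<in> S) q"] U[of "\<lambda>q. ka (q \<in> insert p S) q"] U'
    using p(2) by (simp_all add: Un_ac)
  note kp = kl_props(1-6)[OF r, where r = "c a", folded l_def]
  have ps: "distinct (map pos (l y))" "3 \<le> length (map pos (l y))" "flat (map pos (l y))" "under (parr ` R) (map pos (l y))" for y
  proof -
    have "inj_on pos (set (l y))" using kp(3) pos_inj by (intro inj_onI) blast
    then show "distinct (map pos (l y))" using kp(1) by (simp add: distinct_map)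
    show "3 \<le> length (map pos (l y))" using kp(2) by simp
    have "\<forall>e \<in> edges (l y). \<forall>f \<in> edges (l y). e \<noteq> f \<longrightarrow> vsep e f"
      using ka_pairwise[OF p(1) p(1), of _ y _ y] unfolding l[symmetric] by blast
    moreover have "\<forall>e \<in> edges (l y). planar e"
      using ka_planar[of a b _ y] p(1) unfolding l[symmetric] ab by blast
    ultimately show "flat (map pos (l y))" using kp(1,3) by (intro flat_vsep)
    show "under (parr ` R) (map pos (l y))"
    proof (rule under_vsep[OF _ _ kp(3,4)])
      fix e f assume e: "e \<in> R" and f: "f \<in> edges (l y)"
      show "vsep e f \<or> above e f"
      proof (cases "e \<in> oa")
        case True
        then show ?thesis using oa_ka_x[OF True p(1)] f l by blast
      next
        case False
        then obtain q where q: "q \<in> G" "q \<noteq> p" "e \<in> ka (q \<in> S) q" using e unfolding R_def by blast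
        have "e \<noteq> f"
        proof
          assume "e = f"
          then have "fst e \<in> set (kl (c (fst q)) (q \<in> S) (fst q) (snd q))" "fst e \<in> set (l y)"
            using edges_in f q(3) unfolding ka_def by blast+
          moreover have "snd q \<noteq> b" using half_graph_parent_unique[of "fst q" b 0 T a] q(1,2) p(1) ab by (cases q) auto
          ultimately show False using kl_disjoint unfolding l_def by blast
        qed
        then show ?thesis using ka_pairwise[OF q(1) p(1) q(3), of f y] f q(2) l by blast
      qed
    next
      fix e v assume e: "e \<in> R" and v: "v = fst e \<or> v = snd e"
      show "valid v \<and> (v \<in> set (l y) \<longrightarrow> v = hd (l y) \<or> v = last (l y))"
      proof (cases "e \<in> oa")
        case True
        then have "okv v" using oa_props(2,3) v by blast
        then show ?thesis using okv_valid okv_kl[OF _ r] unfolding l_def by blast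
      next
        case False
        then obtain q where q: "q \<in> G" "q \<noteq> p" "e \<in> ka (q \<in> S) q" using e unfolding R_def by blast
        have "v \<in> set (kl (c (fst q)) (q \<in> S) (fst q) (snd q))" using edges_in[of e] q(3) v unfolding ka_def by blast
        moreover have "snd q \<noteq> b" using half_graph_parent_unique[of "fst q" b 0 T a] q(1,2) p(1) ab by (cases q) auto
        ultimately have "v \<notin> set (l y)" using kl_disjoint unfolding l_def by blast
        then show ?thesis using ka_valid[OF q(1,3)] v by blast
      qed
    qed
  qed
  have E: "parr ` H S = parr ` R \<union> edges (map pos (l False))" "parr ` H (insert p S) = parr ` R \<union> edges (map pos (l True))"
    unfolding H image_Un parr_edges by simp_all
  have "hd (map pos (l False)) = hd (map pos (l True))" "last (map pos (l False)) = last (map pos (l True))"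
    using kp(4)[of True] kp(4)[of False] kp(5,6) by (simp_all add: hd_map last_map)
  then show ?thesis using L unfolding E by (intro underpass ps) 
qed

lemma link_deforms: "finite S \<Longrightarrow> S \<subseteq> G \<Longrightarrow> link (parr ` H S) \<and> deforms (parr ` H {}) (parr ` H S)"
proof (induction S rule: finite_induct)
  case empty
  show ?case using link_start deforms_refl by blast
next
  case (insert p S)
  then show ?case using link_step[of p S] deforms_trans by blast
qed

lemma positive_isotopic: "\<exists>D. isotopic (thompson_link c (T, B)) D \<and> positive_diagram D"
proof -
  have E: "thompson_link c (T, B) = parr ` H {}"
    unfolding thompson_link_def fst_conv snd_conv half_link_oarr[OF T] reflected_half_link[OF B(2)] arrows_eq[symmetric] half_arrows_def image_Un ..
  obtain Ps where "plink Ps" "arrows Ps = parr ` H {}" using link_imp_plink[OF link_start] .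
  then have "isotopic (parr ` H {}) (parr ` H G)"
    using link_deforms[OF finite_half_graph subset_refl] deforms_imp_isotopic by blast
  moreover have "positive_diagram (parr ` H G)" using H_planar H_pairwise_G by (intro positive_parr) blast+
  ultimately show ?thesis unfolding E by blast
qed

end

section \<open>The diagram with one leaf\<close>

text \<open>The link is a quadrilateral without crossings and thus its own positive diagram. The
  general coordinates do not apply, because the single disc meets no edge and gets additional points
  off the axis.\<close>

lemma one_leaf:
  assumes "c 0"
  shows "\<exists>D. isotopic (thompson_link c (Leaf, Leaf)) D \<and> positive_diagram D"
proof -
  let ?A = "AxR 0" and ?P = "Apx True" and ?L = "AxL 0" and ?Q = "Apx False"
  define E where "E = {(?A, ?P), (?P, ?L), (?L, ?Q), (?Q, ?A)}"
  have M: "medial_arcs {} 0 = {parr (?A, ?P), parr (?P, ?L)}"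
    by (simp add: medial_arcs_def corners_around_def parr_def pos_def Let_def)
  have hl: "half_link d Leaf = orient (d 0) {parr (?A, ?P), parr (?P, ?L)}" for d
    unfolding M[symmetric] by (simp add: half_link_def lessThan_Suc)
  have r: "reflect (pos ?P) = pos ?Q" "reflect (pos ?A) = pos ?A" "reflect (pos ?L) = pos ?L"
    by (simp_all add: reflect_def pos_def)
  have "map_prod reflect reflect ` half_link (\<lambda>j. \<not> c j) Leaf = {parr (?Q, ?A), parr (?L, ?Q)}"
    unfolding hl using assms by (simp add: orient_def parr_def r)
  moreover have "half_link c Leaf = {parr (?A, ?P), parr (?P, ?L)}"
    unfolding hl using assms by (simp add: orient_def)
  ultimately have "thompson_link c (Leaf, Leaf) = {parr (?A, ?P), parr (?P, ?L)} \<union> {parr (?Q, ?A), parr (?L, ?Q)}"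
    unfolding thompson_link_def fst_conv snd_conv by simp
  then have E: "thompson_link c (Leaf, Leaf) = parr ` E"
    unfolding E_def image_insert image_empty by (simp only: Un_insert_left Un_empty_left insert_commute)
  have s: "vsep (?A, ?P) (?P, ?L)" "vsep (?P, ?L) (?L, ?Q)" "vsep (?L, ?Q) (?Q, ?A)" "vsep (?Q, ?A) (?A, ?P)"
    "vsep (?L, ?Q) (?A, ?P)" "vsep (?Q, ?A) (?P, ?L)"
    using vsep_share[where A = "-1" and B = 0, of ?A ?P ?L] vsep_share[where A = 0 and B = "-1", of ?P ?L ?Q]
      vsep_share[where A = 1 and B = 0, of ?L ?Q ?A] vsep_share[where A = 0 and B = 1, of ?Q ?A ?P]
      vsep_lt[where A = 1 and B = 1 and k = 0, of ?L ?Q ?A ?P] vsep_lt[where A = "-1" and B = 1 and k = 0, of ?Q ?A ?P ?L]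
    by simp_all
  have pw: "vsep e f" if "e \<in> E" "f \<in> E" "e \<noteq> f" for e f
    using that unfolding E_def by (elim insertE emptyE) (simp_all add: s s[THEN vsep_sym])
  have pl: "planar e" if "e \<in> E" for e using that unfolding E_def by (auto simp: planar_def)
  have "link (parr ` E)"
  proof (rule link_parr)
    show "inj_on fst E" "inj_on snd E" "fst ` E = snd ` E" "finite E" by (auto simp: E_def)
    show "inj_on pos (fst ` E)" by (auto simp: E_def inj_on_def pos_def)
  qed (use pl pw in blast)+
  then obtain Ps where "plink Ps" "arrows Ps = parr ` E" using link_imp_plink by blast
  then have "isotopic (parr ` E) (parr ` E)" using deforms_imp_isotopic deforms_refl by blast
  moreover have "positive_diagram (parr ` E)" using pl pw by (intro positive_parr) blast+
  ultimately show ?thesis unfolding E by blast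
qed

theorem theorem1:
  fixes g :: "diagram set" and T B :: btree and c :: "nat \<Rightarrow> bool"
  assumes "g \<in> oriented_F \<inter> F_plus"
    and "(T, B) \<in> g" and "right_vine B"
    and "proper_colouring c (T, B)" and "c 0"
  shows "\<exists>D. isotopic (thompson_link c (T, B)) D \<and> positive_diagram D"
proof -
  have "g \<in> tree_diagrams // diagram_equiv" using assms(1) by (simp add: oriented_F_def thompson_F_def)
  then obtain d where "g = diagram_equiv `` {d}" by (rule quotientE)
  then have "(d, (T, B)) \<in> diagram_equiv" using assms(2) by simp
  then have n: "leaves T = leaves B" by (simp add: diagram_equiv_def tree_diagrams_def)
  have leaf: "t = Leaf" if "leaves t = 1" for t
  proof (cases t)
    case (Node l r)
    then show ?thesis using that leaves_pos[of l] leaves_pos[of r] by simp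
  qed simp
  show ?thesis
  proof (cases "B = Leaf")
    case True
    then have "T = Leaf" using n leaf[of T] by simp
    then show ?thesis using one_leaf[of c] assms(5) True by simp
  next
    case False
    then have "T \<noteq> Leaf" using n leaf[of B] by auto
    then interpret vine_diagram T B c
      using False assms(3,4) n by unfold_locales (auto simp: proper_colouring_def)
    show ?thesis by (rule positive_isotopic)
  qed
qed

end
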